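(* Let $V$ be a simple vertex operator algebra of strong CFT type which is isomorphic to its contragredient module $V'$. Let $N\ge 1$ and let $g\ge 1$ be integers, with $g\ge 2$ if $N\ge 2$. Let $u\in V$ be quasiprimary of weight $N$, inserted at $x$, and let $v_1,\ldots,v_n\in V$ be inserted at $y_1,\ldots,y_n$. Then the genus $g$ formal correlation differential form satisfies $$\mathcal{F}_V(u,x;\boldsymbol{v},\boldsymbol{y})=\sum_{a=1}^{g}\ \sum_{\ell=0}^{2N-2}\Theta_{N,a}^{\ell}(x)\,\mathrm{Res}_a^{\ell}\mathcal{F}_V(u;\boldsymbol{v},\boldsymbol{y})+\sum_{k=1}^{n}\sum_{j\ge 0}\Psi_N^{(0,j)}(x,y_k)\,\mathcal{F}_V(\ldots;u(j)v_k,y_k;\ldots)\,dy_k^{\,j},$$ where in the last sum $v_k$ is replaced by $u(j)v_k$ and $u$ is no longer inserted at $x$.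
   Context: **VOA.** $V=(V,Y,\mathbf{1},\omega)$ is a vertex operator algebra over $\mathbb{C}$, $V=\bigoplus_{n\ge0}V_n$, $\dim V_n<\infty$, $Y(u,z)=\sum_{n}u(n)z^{-n-1}$, $Y(\omega,z)=\sum_n L(n)z^{-n-2}$. Strong CFT type means $V_0=\mathbb{C}\mathbf{1}$ and $L(1)V_1=0$. A vector $u$ is quasiprimary of weight $N$ if $u\in V_N$ and $L(1)u=0$. $\langle\cdot,\cdot\rangle$ is the unique (symmetric, non-degenerate) invariant bilinear form on $V$ with $\langle\mathbf 1,\mathbf 1\rangle=1$: $\langle Y(u,z)v,w\rangle=\langle v,Y(e^{zL(1)}(-z^{-2})^{L(0)}u,z^{-1})w\rangle$. **Genus zero.** $Z^{(0)}(v_1,y_1;\ldots;v_n,y_n)=\langle\mathbf 1,Y(v_1,y_1)\cdots Y(v_n,y_n)\mathbf 1\rangle$, regarded as its extension to a rational function of the $y_k$. **Genus $g$.** Let $\mathcal I=\{\pm1,\ldots,\pm g\}$, let $w_a$ ($a\in\mathcal I$) and $\rho_a$ ($1\le a\le g$) be formal variables, $\rho_{-a}:=\rho_a$. For each $a=1,\ldots,g$ let $\{b_a\}$ be a homogeneous basis of $V$ with $\langle\cdot,\cdot\rangle$-dual basis $\{\overline{b}_a\}$, and $b_{-a}:=\rho_a^{\mathrm{wt}(b_a)}\overline{b}_a$. Define $$Z_V(\boldsymbol v,\boldsymbol y)=\sum_{b_1,\ldots,b_g}Z^{(0)}(v_1,y_1;\ldots;v_n,y_n;b_1,w_1;b_{-1},w_{-1};\ldots;b_g,w_g;b_{-g},w_{-g}),$$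 summed over the bases, and $\mathcal F_V(\boldsymbol v,\boldsymbol y)=Z_V(\boldsymbol v,\boldsymbol y)\prod_k dy_k^{\mathrm{wt}(v_k)}$ (extended linearly to inhomogeneous vectors). These are formal series in the $\rho_a$. For $u$ inserted at $x$ and $0\le\ell\le2N-2$, $a\in\mathcal I$, $$\mathrm{Res}_a^\ell\mathcal F_V(u;\boldsymbol v,\boldsymbol y):=\mathrm{Res}_{x-w_a}(x-w_a)^\ell\mathcal F_V(u,x;\boldsymbol v,\boldsymbol y)=\sum_{b_1,\ldots,b_g}Z^{(0)}(\ldots;u(\ell)b_a,w_a;\ldots)\prod_k dy_k^{\mathrm{wt}(v_k)}.$$ **Schottky group and $\Psi_N,\Theta_{N,a}^\ell$.** For Schottky parameters satisfying $|w_a-w_b|>|\rho_a|^{1/2}+|\rho_b|^{1/2}$ for all $a\ne b$ in $\mathcal I$, $\Gamma$ is the free (Schottky) group generated by the Möbius maps $\gamma_a z=w_{-a}+\rho_a/(z-w_a)$, $a=1,\ldots,g$, with limit set $\Lambda(\Gamma)$ and $\Omega_0=\widehat{\mathbb C}\setminus\Lambda(\Gamma)$; $\Omega_0/\Gamma$ is a genus $g$ Riemann surface. With $\mathcal L=\{0,\ldots,2N-2\}$, $\Psi_N(x,y)=\sum_{\gamma\in\Gamma}\Pi_N(\gamma x,y)$, $$\Pi_N(x,y)=\pi_N(x,y)dx^Ndy^{1-N},\qquad \pi_N(x,y)=\frac1{x-y}\prod_{\ell\in\mathcal L}\frac{y-A_\ell}{x-A_\ell},$$ where for $N\ge2$ the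 $A_\ell$ are distinct points of $\Lambda(\Gamma)$ and for $N=1$, $A_0\in\Omega_0$. The holomorphic $N$-forms $\Theta_{N,a}^\ell(x)$ ($1\le a\le g$, $\ell\in\mathcal L$) are defined by $\Psi_N(x,\gamma_ay)-\Psi_N(x,y)=-\sum_{\ell\in\mathcal L}\Theta_{N,a}^\ell(x)(y-w_a)^\ell dy^{1-N}$. For functions, $f^{(i)}=\frac1{i!}\partial^if$ and $h^{(i,j)}(x,y)=\frac1{i!j!}\partial_x^i\partial_y^jh$; on $\Psi_N$ these derivatives act on the coefficient of $dx^Ndy^{1-N}$. **Expansions in $\rho$.** The identity is formal, $\Psi_N$ and $\Theta_{N,a}^\ell$ being represented by the following expansions in the $\rho_a$. Write $\pi_N(x,y)=\frac1{x-y}+\sum_{\ell\in\mathcal L}f_\ell(x)y^\ell$, where $f_\ell(x)=-\sum_{i\in\mathcal L}\frac1{x-A_i}Q_i^{(\ell)}(0)$, $Q_i(y)=\prod_{j\ne i}\frac{y-A_j}{A_i-A_j}$. For $a,b\in\mathcal I$, $m,n\ge0$ let $L_b^n(x)=\rho_b^{n/2}\pi_N^{(0,n)}(x,w_b)dx^N$, $R_a^m(y)=(-1)^N\rho_a^{(m+1)/2}\pi_N^{(m,0)}(w_{-a},y)dy^{1-N}$, $A_{ab}^{mn}=(-1)^N\rho_a^{(m+1)/2}\rho_b^{n/2}\pi_N^{(m,n)}(w_{-a},w_b)$ if $a\ne-b$, $A_{a,-a}^{mn}=(-1)^N\rho_a^{(m+n+1)/2}\sum_{\ell\in\mathcal L}\binom{\ell}{n}f_\ell^{(m)}(w_{-a})w_{-a}^{\ell-n}$,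 $\Delta_{ab}^{mn}=\delta_{m,n+2N-1}\delta_{ab}$, $\widetilde L=L\Delta$, $\widetilde A=A\Delta$, $(I-\widetilde A)^{-1}=\sum_{k\ge0}\widetilde A^k$. Then $\Psi_N(x,y)=\Pi_N(x,y)+\widetilde L(x)(I-\widetilde A)^{-1}R(y)$ and $\Theta_{N,a}^\ell(x)=T_a^\ell(x)+(-1)^N\rho_a^{N-1-\ell}T_{-a}^{2N-2-\ell}(x)$ with $T_a^\ell(x)=\rho_a^{-\ell/2}\big(L(x)+\widetilde L(x)(I-\widetilde A)^{-1}A\big)_a^\ell$. *)

theory Defs
  imports "HOL-Complex_Analysis.Complex_Analysis" "HOL-Library.Groups_Big_Fun" "HOL-Library.FuncSet"
begin

section \<open>Vertex operator algebras\<close>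

text \<open>
  The underlying space of \<open>V\<close> is the whole type \<open>'v\<close>; \<open>vmode V u n v\<close> is \<open>u(n)v\<close>, where
  \<open>Y(u,z) = \<Sum>\<^sub>n u(n) z^(-n-1)\<close>.  All sums \<open>Sum_any\<close> below have only finitely many nonzero terms.
\<close>

record 'v voa =
  vscale :: "complex \<Rightarrow> 'v \<Rightarrow> 'v"
  vmode :: "'v \<Rightarrow> int \<Rightarrow> 'v \<Rightarrow> 'v"
  vac :: 'v
  conf :: 'v

definition Vir :: "'v voa \<Rightarrow> int \<Rightarrow> 'v \<Rightarrow> 'v" where
  "Vir V n = vmode V (conf V) (n + 1)"

text \<open>
  The homogeneous spaces are the eigenspaces of \<open>L(0)\<close>.  Eigenspaces for distinct eigenvalues are
  independent, so that their spanning everything (required in \<open>is_voa\<close>) says that \<open>V\<close> is their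
  direct sum.
\<close>

definition wtspace :: "'v voa \<Rightarrow> nat \<Rightarrow> 'v set" where
  "wtspace V n = {v. Vir V 0 v = vscale V (of_nat n) v}"

text \<open>
  The identity quantified over \<open>l m n\<close> is the Borcherds identity, that is, the Jacobi identity
  written in modes.
\<close>

definition is_voa :: "('v::ab_group_add) voa \<Rightarrow> bool" where
  "is_voa V \<longleftrightarrow>
     vector_space (vscale V) \<and>
     (\<forall>u u' n v. vmode V (u + u') n v = vmode V u n v + vmode V u' n v) \<and>
     (\<forall>c u n v. vmode V (vscale V c u) n v = vscale V c (vmode V u n v)) \<and>
     (\<forall>u n v v'. vmode V u n (v + v') = vmode V u n v + vmode V u n v') \<and>
     (\<forall>c u n v. vmode V u n (vscale V c v) = vscale V c (vmode V u n v)) \<and>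
     (\<forall>u v. \<exists>K. \<forall>n\<ge>K. vmode V u n v = 0) \<and>
     (\<forall>n v. vmode V (vac V) n v = (if n = -1 then v else 0)) \<and>
     (\<forall>u. vmode V u (-1) (vac V) = u) \<and>
     (\<forall>u n. n \<ge> 0 \<longrightarrow> vmode V u n (vac V) = 0) \<and>
     (\<forall>u v t l m n.
        Sum_any (\<lambda>i::nat. vscale V ((-1) ^ i * (of_int l gchoose i))
            (vmode V u (m + l - int i) (vmode V v (n + int i) t)
              - vscale V ((-1) powi l) (vmode V v (n + l - int i) (vmode V u (m + int i) t))))
        = Sum_any (\<lambda>i::nat. vscale V (of_int m gchoose i)
            (vmode V (vmode V u (l + int i) v) (m + n - int i) t))) \<and>
     (\<exists>c. \<forall>m n v.
        Vir V m (Vir V n v) - Vir V n (Vir V m v)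
        = vscale V (of_int (m - n)) (Vir V (m + n) v)
          + (if m + n = 0 then vscale V (of_int (m ^ 3 - m) / 12 * c) v else 0)) \<and>
     (\<forall>u n v. vmode V (Vir V (-1) u) n v = vscale V (- of_int n) (vmode V u (n - 1) v)) \<and>
     module.span (vscale V) (\<Union>n. wtspace V n) = UNIV \<and>
     (\<forall>n. \<exists>S. finite S \<and> wtspace V n \<subseteq> module.span (vscale V) S)"

definition strong_cft_type :: "('v::ab_group_add) voa \<Rightarrow> bool" where
  "strong_cft_type V \<longleftrightarrow>
     wtspace V 0 = module.span (vscale V) {vac V} \<and> (\<forall>v\<in>wtspace V 1. Vir V 1 v = 0)"

definition simple_voa :: "('v::ab_group_add) voa \<Rightarrow> bool" where
  "simple_voa V \<longleftrightarrow>
     (UNIV :: 'v set) \<noteq> {0} \<and>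
     (\<forall>I. module.subspace (vscale V) I \<and> (\<forall>u n. \<forall>v\<in>I. vmode V u n v \<in> I)
          \<longrightarrow> I = {0} \<or> I = UNIV)"

definition quasiprimary :: "('v::ab_group_add) voa \<Rightarrow> nat \<Rightarrow> 'v \<Rightarrow> bool" where
  "quasiprimary V N u \<longleftrightarrow> u \<in> wtspace V N \<and> Vir V 1 u = 0"

definition wt :: "'v voa \<Rightarrow> 'v \<Rightarrow> nat" where
  "wt V v = (THE n. v \<in> wtspace V n)"

definition hcomp :: "('v::ab_group_add) voa \<Rightarrow> 'v \<Rightarrow> nat \<Rightarrow> 'v" where
  "hcomp V v = (THE c. (\<forall>n. c n \<in> wtspace V n) \<and> finite {n. c n \<noteq> 0} \<and> Sum_any c = v)"

text \<open>
  \<open>adj_mode V u n\<close> is the coefficient of \<open>z^(-n-1)\<close> in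
  \<open>Y(e^(z L(1)) (- z^(-2))^L(0) u, z^(-1))\<close>.  For \<open>u\<close> of weight \<open>k\<close> this series equals
  \<open>(-1)^k \<Sum>\<^sub>i \<Sum>\<^sub>m (1/i!) (L(1)^i u)(m) z^(m + 1 + i - 2k)\<close>, and \<open>L(1)^i u = 0\<close> for \<open>i > k\<close>.
\<close>

definition adj_mode :: "('v::ab_group_add) voa \<Rightarrow> 'v \<Rightarrow> int \<Rightarrow> 'v \<Rightarrow> 'v" where
  "adj_mode V u n t = Sum_any (\<lambda>k::nat. vscale V ((-1) ^ k)
     (\<Sum>i\<le>k. vscale V (1 / fact i)
        (vmode V ((Vir V 1 ^^ i) (hcomp V u k)) (2 * int k - n - int i - 2) t)))"

text \<open>The space \<open>V' = \<Oplus>\<^sub>n V\<^sub>n\<^sup>*\<close>, as a set of linear functionals on \<open>V\<close>.\<close>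

definition restricted_dual :: "('v::ab_group_add) voa \<Rightarrow> ('v \<Rightarrow> complex) set" where
  "restricted_dual V =
     {f. Vector_Spaces.linear (vscale V) (*) f \<and> finite {n. \<exists>v\<in>wtspace V n. f v \<noteq> 0}}"

definition self_contragredient :: "('v::ab_group_add) voa \<Rightarrow> bool" where
  "self_contragredient V \<longleftrightarrow>
     (\<exists>\<phi>. bij_betw \<phi> UNIV (restricted_dual V) \<and>
          (\<forall>v v' t. \<phi> (v + v') t = \<phi> v t + \<phi> v' t) \<and>
          (\<forall>c v t. \<phi> (vscale V c v) t = c * \<phi> v t) \<and>
          (\<forall>u n v t. \<phi> (vmode V u n v) t = \<phi> v (adj_mode V u n t)))"

definition normalized_invariant_form ::
  "('v::ab_group_add) voa \<Rightarrow> ('v \<Rightarrow> 'v \<Rightarrow> complex) \<Rightarrow> bool" where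
  "normalized_invariant_form V B \<longleftrightarrow>
     (\<forall>v. Vector_Spaces.linear (vscale V) (*) (B v)) \<and>
     (\<forall>v t. B v t = B t v) \<and>
     (\<forall>v. (\<forall>t. B v t = 0) \<longrightarrow> v = 0) \<and>
     (\<forall>u n v t. B (vmode V u n v) t = B v (adj_mode V u n t)) \<and>
     B (vac V) (vac V) = 1"

definition homogeneous_basis :: "('v::ab_group_add) voa \<Rightarrow> 'v set \<Rightarrow> bool" where
  "homogeneous_basis V S \<longleftrightarrow>
     \<not> module.dependent (vscale V) S \<and> module.span (vscale V) S = UNIV \<and>
     S \<subseteq> (\<Union>n. wtspace V n)"

definition dual_vec :: "('v \<Rightarrow> 'v \<Rightarrow> complex) \<Rightarrow> 'v set \<Rightarrow> 'v \<Rightarrow> 'v" where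
  "dual_vec B S b = (THE d. \<forall>b'\<in>S. B b' d = (if b' = b then 1 else 0))"


section \<open>Genus zero correlation functions\<close>

definition poly_fun :: "nat \<Rightarrow> (complex list \<Rightarrow> complex) \<Rightarrow> bool" where
  "poly_fun n p \<longleftrightarrow>
     (\<exists>(S :: (nat \<Rightarrow> nat) set) c. finite S \<and>
        (\<forall>ys. length ys = n \<longrightarrow> p ys = (\<Sum>e\<in>S. c e * (\<Prod>k<n. ys ! k ^ e k))))"

definition vac_expectation ::
  "'v voa \<Rightarrow> ('v \<Rightarrow> 'v \<Rightarrow> complex) \<Rightarrow> 'v list \<Rightarrow> int list \<Rightarrow> complex" where
  "vac_expectation V B vs ms =
     B (vac V) (foldr (\<lambda>(v, m) t. vmode V v m t) (zip vs ms) (vac V))"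

text \<open>
  \<open>f\<close> is a rational function without poles at points with pairwise distinct coordinates, and its
  expansion in the region \<open>|y\<^sub>1| > \<dots> > |y\<^sub>n| > 0\<close> is \<open>\<langle>1, Y(v\<^sub>1,y\<^sub>1) \<dots> Y(v\<^sub>n,y\<^sub>n) 1\<rangle>\<close>.
\<close>

definition rational_extension ::
  "'v voa \<Rightarrow> ('v \<Rightarrow> 'v \<Rightarrow> complex) \<Rightarrow> 'v list \<Rightarrow> (complex list \<Rightarrow> complex) \<Rightarrow> bool" where
  "rational_extension V B vs f \<longleftrightarrow>
     (\<exists>p q. poly_fun (length vs) p \<and> poly_fun (length vs) q \<and>
        (\<forall>ys. length ys = length vs \<and> distinct ys \<longrightarrow> q ys \<noteq> 0 \<and> f ys = p ys / q ys)) \<and>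
     (\<forall>ys. length ys = length vs \<and> sorted_wrt (\<lambda>y y'. norm y > norm y') ys \<and> 0 \<notin> set ys \<longrightarrow>
        ((\<lambda>ms. vac_expectation V B vs ms * (\<Prod>k<length vs. ys ! k powi (- (ms ! k) - 1)))
          has_sum f ys) {ms. length ms = length vs})"

definition Z0 ::
  "'v voa \<Rightarrow> ('v \<Rightarrow> 'v \<Rightarrow> complex) \<Rightarrow> 'v list \<Rightarrow> complex list \<Rightarrow> complex" where
  "Z0 V B vs ys = (THE z. \<exists>f. rational_extension V B vs f \<and> f ys = z)"


section \<open>Formal series in the half-integral powers of the \<open>\<rho>\<^sub>a\<close>\<close>

text \<open>
  \<open>f \<kappa>\<close> is the coefficient of \<open>\<Prod>\<^sub>a \<rho>\<^sub>a^(\<kappa> a / 2)\<close>.  For the series and families of series used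
  below, the sums defining \<open>rs_mult\<close> and \<open>rs_sum\<close> are finite for each coefficient.
\<close>

type_synonym rho_series = "(nat \<Rightarrow> int) \<Rightarrow> complex"

definition rs_mono :: "complex \<Rightarrow> (nat \<Rightarrow> int) \<Rightarrow> rho_series" where
  "rs_mono c \<mu> = (\<lambda>\<kappa>. if \<kappa> = \<mu> then c else 0)"

definition rs_const :: "complex \<Rightarrow> rho_series" where
  "rs_const c = rs_mono c (\<lambda>_. 0)"

definition rs_add :: "rho_series \<Rightarrow> rho_series \<Rightarrow> rho_series" where
  "rs_add f h = (\<lambda>\<kappa>. f \<kappa> + h \<kappa>)"

definition rs_mult :: "rho_series \<Rightarrow> rho_series \<Rightarrow> rho_series" where
  "rs_mult f h = (\<lambda>\<kappa>. Sum_any (\<lambda>\<mu>. f \<mu> * h (\<lambda>i. \<kappa> i - \<mu> i)))"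

definition rs_sum :: "'i set \<Rightarrow> ('i \<Rightarrow> rho_series) \<Rightarrow> rho_series" where
  "rs_sum I F = (\<lambda>\<kappa>. \<Sum>i\<in>{i\<in>I. F i \<kappa> \<noteq> 0}. F i \<kappa>)"

text \<open>\<open>rho_half a k\<close> is \<open>\<rho>\<^sub>a^(k/2)\<close>, where \<open>\<rho>\<^sub>-\<^sub>a = \<rho>\<^sub>a\<close>.\<close>

definition rho_half :: "int \<Rightarrow> int \<Rightarrow> rho_series" where
  "rho_half a k = rs_mono 1 (\<lambda>i. if i = nat \<bar>a\<bar> then k else 0)"


section \<open>Genus \<open>g\<close> correlation functions\<close>

definition handles :: "nat \<Rightarrow> int set" where
  "handles g = {- int g..int g} - {0}"

text \<open>
  \<open>bas a\<close> is the basis chosen for the handle \<open>a \<in> {1..g}\<close>.  The factor \<open>\<rho>\<^sub>a^wt(b\<^sub>a)\<close> of \<open>b\<^sub>-\<^sub>a\<close> is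
  taken out of \<open>Z0\<close>.  Each coefficient is a rational function of \<open>ys\<close> and the \<open>w a\<close> whose poles lie
  on the diagonals; it is given by its values at pairwise distinct points.
\<close>

definition ZV ::
  "('v::ab_group_add) voa \<Rightarrow> ('v \<Rightarrow> 'v \<Rightarrow> complex) \<Rightarrow> nat \<Rightarrow> (int \<Rightarrow> complex) \<Rightarrow> (nat \<Rightarrow> 'v set)
    \<Rightarrow> 'v list \<Rightarrow> complex list \<Rightarrow> rho_series" where
  "ZV V B g w bas vs ys =
     rs_sum (\<Pi>\<^sub>E a\<in>{1..g}. bas a) (\<lambda>b.
       rs_mono
         (Z0 V B (vs @ concat (map (\<lambda>a. [b a, dual_vec B (bas a) (b a)]) [1..<Suc g]))
                 (ys @ concat (map (\<lambda>a. [w (int a), w (- int a)]) [1..<Suc g])))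
         (\<lambda>a. if a \<in> {1..g} then 2 * int (wt V (b a)) else 0))"

text \<open>
  Differential forms are represented by their values on tangent vectors: \<open>dx\<close> and \<open>dy\<^sub>k\<close> are complex
  numbers, nonzero where negative powers occur.  \<open>form_weight V d\<close> is the linear map with
  \<open>v \<mapsto> d^wt(v) v\<close> for homogeneous \<open>v\<close>, which gives the linear extension of \<open>\<F>\<^sub>V\<close> to inhomogeneous
  vectors.
\<close>

definition form_weight :: "('v::ab_group_add) voa \<Rightarrow> complex \<Rightarrow> 'v \<Rightarrow> 'v" where
  "form_weight V d v = Sum_any (\<lambda>n. vscale V (d ^ n) (hcomp V v n))"

definition FV ::
  "('v::ab_group_add) voa \<Rightarrow> ('v \<Rightarrow> 'v \<Rightarrow> complex) \<Rightarrow> nat \<Rightarrow> (int \<Rightarrow> complex) \<Rightarrow> (nat \<Rightarrow> 'v set)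
    \<Rightarrow> 'v list \<Rightarrow> complex list \<Rightarrow> complex list \<Rightarrow> rho_series" where
  "FV V B g w bas vs ys dys = ZV V B g w bas (map2 (form_weight V) dys vs) ys"

text \<open>The residue is that of the coefficient of \<open>dx^N\<close>, obtained by setting \<open>dx = 1\<close>.\<close>

definition Res_FV ::
  "('v::ab_group_add) voa \<Rightarrow> ('v \<Rightarrow> 'v \<Rightarrow> complex) \<Rightarrow> nat \<Rightarrow> (int \<Rightarrow> complex) \<Rightarrow> (nat \<Rightarrow> 'v set)
    \<Rightarrow> int \<Rightarrow> nat \<Rightarrow> 'v \<Rightarrow> 'v list \<Rightarrow> complex list \<Rightarrow> complex list \<Rightarrow> rho_series" where
  "Res_FV V B g w bas a l u vs ys dys =
     (\<lambda>\<kappa>. residue (\<lambda>x. (x - w a) ^ l * FV V B g w bas (u # vs) (x # ys) (1 # dys) \<kappa>) (w a))"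


section \<open>The expansions of \<open>\<Psi>\<^sub>N\<close> and \<open>\<Theta>\<^sub>N\<^sub>,\<^sub>a\<^sup>l\<close>\<close>

text \<open>
  The points \<open>A 0, \<dots>, A (2N-2)\<close> enter the expansions as parameters not depending on \<open>\<rho>\<close>; the
  expansions make sense for all pairwise distinct \<open>A l\<close> different from \<open>x\<close> and from the \<open>w a\<close>, in
  particular for limit points of the Schottky group (or, if \<open>N = 1\<close>, other points).
\<close>

definition sderiv :: "nat \<Rightarrow> (complex \<Rightarrow> complex) \<Rightarrow> complex \<Rightarrow> complex" where
  "sderiv i f x = (deriv ^^ i) f x / fact i"

definition sderiv2 ::
  "nat \<Rightarrow> nat \<Rightarrow> (complex \<Rightarrow> complex \<Rightarrow> complex) \<Rightarrow> complex \<Rightarrow> complex \<Rightarrow> complex" where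
  "sderiv2 i j h x y = sderiv i (\<lambda>x'. sderiv j (\<lambda>y'. h x' y') y) x"

definition piN :: "nat \<Rightarrow> (nat \<Rightarrow> complex) \<Rightarrow> complex \<Rightarrow> complex \<Rightarrow> complex" where
  "piN N A x y = 1 / (x - y) * (\<Prod>l\<le>2 * N - 2. (y - A l) / (x - A l))"

definition lagrangeQ :: "nat \<Rightarrow> (nat \<Rightarrow> complex) \<Rightarrow> nat \<Rightarrow> complex \<Rightarrow> complex" where
  "lagrangeQ N A i y = (\<Prod>j\<in>{..2 * N - 2} - {i}. (y - A j) / (A i - A j))"

definition fN :: "nat \<Rightarrow> (nat \<Rightarrow> complex) \<Rightarrow> nat \<Rightarrow> complex \<Rightarrow> complex" where
  "fN N A l x = - (\<Sum>i\<le>2 * N - 2. 1 / (x - A i) * sderiv l (lagrangeQ N A i) 0)"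

text \<open>Vectors and matrices have entries indexed by pairs \<open>(a, m)\<close> with \<open>a \<in> handles g\<close>.\<close>

type_synonym rho_vec = "int \<times> nat \<Rightarrow> rho_series"
type_synonym rho_mat = "int \<times> nat \<Rightarrow> int \<times> nat \<Rightarrow> rho_series"

definition vec_mat :: "nat \<Rightarrow> rho_vec \<Rightarrow> rho_mat \<Rightarrow> rho_vec" where
  "vec_mat g X M = (\<lambda>q. rs_sum (handles g \<times> UNIV) (\<lambda>r. rs_mult (X r) (M r q)))"

definition vec_dot :: "nat \<Rightarrow> rho_vec \<Rightarrow> rho_vec \<Rightarrow> rho_series" where
  "vec_dot g X Y = rs_sum (handles g \<times> UNIV) (\<lambda>r. rs_mult (X r) (Y r))"

definition mat_mult :: "nat \<Rightarrow> rho_mat \<Rightarrow> rho_mat \<Rightarrow> rho_mat" where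
  "mat_mult g M M' = (\<lambda>p. vec_mat g (M p) M')"

definition mat_one :: rho_mat where
  "mat_one = (\<lambda>p q. rs_const (if p = q then 1 else 0))"

definition geometric_inverse :: "nat \<Rightarrow> rho_mat \<Rightarrow> rho_mat" where
  "geometric_inverse g M = (\<lambda>p q. rs_sum UNIV (\<lambda>k::nat. (mat_mult g M ^^ k) mat_one p q))"

definition Lvec :: "nat \<Rightarrow> (int \<Rightarrow> complex) \<Rightarrow> (nat \<Rightarrow> complex) \<Rightarrow> complex \<Rightarrow> rho_vec" where
  "Lvec N w A x = (\<lambda>(b, n).
     rs_mult (rho_half b (int n)) (rs_const (sderiv2 0 n (piN N A) x (w b))))"

definition Rvec :: "nat \<Rightarrow> (int \<Rightarrow> complex) \<Rightarrow> (nat \<Rightarrow> complex) \<Rightarrow> complex \<Rightarrow> rho_vec" where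
  "Rvec N w A y = (\<lambda>(a, m).
     rs_mult (rho_half a (int m + 1)) (rs_const ((-1) ^ N * sderiv2 m 0 (piN N A) (w (- a)) y)))"

definition Amat :: "nat \<Rightarrow> (int \<Rightarrow> complex) \<Rightarrow> (nat \<Rightarrow> complex) \<Rightarrow> rho_mat" where
  "Amat N w A = (\<lambda>(a, m) (b, n).
     rs_mult (rs_mult (rho_half a (int m + 1)) (rho_half b (int n)))
       (rs_const ((-1) ^ N *
         (if a \<noteq> - b then sderiv2 m n (piN N A) (w (- a)) (w b)
          else (\<Sum>l\<le>2 * N - 2. of_nat (l choose n) * sderiv m (fN N A l) (w (- a))
                               * w (- a) ^ (l - n))))))"

definition Delta :: "nat \<Rightarrow> rho_mat" where
  "Delta N = (\<lambda>(a, m) (b, n). rs_const (if a = b \<and> m = n + 2 * N - 1 then 1 else 0))"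

definition Ltilde :: "nat \<Rightarrow> nat \<Rightarrow> (int \<Rightarrow> complex) \<Rightarrow> (nat \<Rightarrow> complex) \<Rightarrow> complex \<Rightarrow> rho_vec" where
  "Ltilde N g w A x = vec_mat g (Lvec N w A x) (Delta N)"

definition Atilde :: "nat \<Rightarrow> nat \<Rightarrow> (int \<Rightarrow> complex) \<Rightarrow> (nat \<Rightarrow> complex) \<Rightarrow> rho_mat" where
  "Atilde N g w A = mat_mult g (Amat N w A) (Delta N)"

definition LtildeInv :: "nat \<Rightarrow> nat \<Rightarrow> (int \<Rightarrow> complex) \<Rightarrow> (nat \<Rightarrow> complex) \<Rightarrow> complex \<Rightarrow> rho_vec" where
  "LtildeInv N g w A x = vec_mat g (Ltilde N g w A x) (geometric_inverse g (Atilde N g w A))"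

text \<open>\<open>psi\<close>, \<open>Tcoeff\<close> and \<open>theta\<close> are the coefficients of the powers of \<open>dx\<close> and \<open>dy\<close>.\<close>

definition psi ::
  "nat \<Rightarrow> nat \<Rightarrow> (int \<Rightarrow> complex) \<Rightarrow> (nat \<Rightarrow> complex) \<Rightarrow> complex \<Rightarrow> complex \<Rightarrow> rho_series" where
  "psi N g w A x y =
     rs_add (rs_const (piN N A x y)) (vec_dot g (LtildeInv N g w A x) (Rvec N w A y))"

definition Tcoeff ::
  "nat \<Rightarrow> nat \<Rightarrow> (int \<Rightarrow> complex) \<Rightarrow> (nat \<Rightarrow> complex) \<Rightarrow> int \<Rightarrow> nat \<Rightarrow> complex \<Rightarrow> rho_series" where
  "Tcoeff N g w A a l x =
     rs_mult (rho_half a (- int l))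
       (rs_add (Lvec N w A x (a, l)) (vec_mat g (LtildeInv N g w A x) (Amat N w A) (a, l)))"

definition theta ::
  "nat \<Rightarrow> nat \<Rightarrow> (int \<Rightarrow> complex) \<Rightarrow> (nat \<Rightarrow> complex) \<Rightarrow> int \<Rightarrow> nat \<Rightarrow> complex \<Rightarrow> rho_series" where
  "theta N g w A a l x =
     rs_add (Tcoeff N g w A a l x)
       (rs_mult (rs_const ((-1) ^ N))
         (rs_mult (rho_half a (2 * (int N - 1 - int l))) (Tcoeff N g w A (- a) (2 * N - 2 - l) x)))"

definition Theta_form ::
  "nat \<Rightarrow> nat \<Rightarrow> (int \<Rightarrow> complex) \<Rightarrow> (nat \<Rightarrow> complex) \<Rightarrow> int \<Rightarrow> nat \<Rightarrow> complex \<Rightarrow> complex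
    \<Rightarrow> rho_series" where
  "Theta_form N g w A a l x dx = rs_mult (rs_const (dx ^ N)) (theta N g w A a l x)"

definition Psi_form_deriv ::
  "nat \<Rightarrow> nat \<Rightarrow> (int \<Rightarrow> complex) \<Rightarrow> (nat \<Rightarrow> complex) \<Rightarrow> nat \<Rightarrow> complex \<Rightarrow> complex \<Rightarrow> complex
    \<Rightarrow> complex \<Rightarrow> rho_series" where
  "Psi_form_deriv N g w A j x dx y dy =
     rs_mult (rs_const (dx ^ N * dy powi (1 - int N)))
       (\<lambda>\<kappa>. sderiv j (\<lambda>y'. psi N g w A x y' \<kappa>) y)"

end

theory Submission
  imports Defs
begin
text \<open>
  The proof consists of a genus zero part and of a formal part.

  Genus zero.  In \<open>\<langle>1, Y(u,x) Y(v\<^sub>1,y\<^sub>1) \<dots> Y(v\<^sub>n,y\<^sub>n) 1\<rangle>\<close> the modes \<open>u(m)\<close> with \<open>m < 0\<close> do not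
  contribute, and those with \<open>m \<ge> 0\<close> can be commuted to the right until they annihilate the vacuum.
  The commutators add up to \<open>\<Sum>\<^sub>k \<Sum>\<^sub>j (x - y\<^sub>k)^(-j-1) \<langle>\<dots> u(j)v\<^sub>k \<dots>\<rangle>\<close> (\<open>Z0_Cons\<close>), and by induction on
  the number of vectors this also shows that correlation functions are rational.  The normal ordering
  formula gives in the same way an expansion of \<open>\<langle>\<dots> u(-1-m)v\<^sub>k \<dots>\<rangle>\<close>, whose coefficients are the
  Taylor coefficients of order \<open>m\<close> of the same poles at \<open>x = y\<^sub>k\<close> (\<open>Z0_creation_mode\<close>).  As \<open>u\<close> is
  quasiprimary of weight \<open>N\<close>, its modes \<open>u(m)\<close> with \<open>0 \<le> m \<le> 2N - 2\<close> annihilate the vacuum on both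
  sides, which yields \<open>2N - 1\<close> linear relations between the functions \<open>\<langle>\<dots> u(j)v\<^sub>k \<dots>\<rangle>\<close>
  (\<open>Z0_null_relation\<close>).  Since \<open>\<pi>\<^sub>N(x,y) - 1/(x-y)\<close> is a polynomial of degree at most \<open>2N - 2\<close> in
  \<open>y\<close>, these relations allow to replace \<open>1/(x-y)\<close> by \<open>\<pi>\<^sub>N(x,y)\<close> in both formulas
  (\<open>Z0_Cons_piN\<close>, \<open>Z0_creation_mode_piN\<close>).

  Genus \<open>g\<close>.  Summing the first formula over the dual bases expresses \<open>\<F>\<^sub>V(u,x; v,y)\<close> by the series
  with \<open>u(j)v\<^sub>k\<close> at \<open>y\<^sub>k\<close> and the series \<open>X\<^sub>c\<^sup>j\<close> with \<open>u(j)b\<^sub>c\<close> at \<open>w\<^sub>c\<close>, where \<open>j \<ge> 0\<close>.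
  Invariance of the bilinear form moves \<open>u\<close> from \<open>b\<^sub>c\<close> to its dual vector \<open>b\<^sub>-\<^sub>c\<close> and gives
  \<open>X\<^sub>c\<^sup>j = (-1)^N \<rho>\<^sub>c^(j+1-N) X\<^sub>-\<^sub>c^(2N-2-j)\<close> (\<open>handle_flip\<close>).  For \<open>j = n + 2N - 1\<close> the right-hand side
  has the mode \<open>u(-1-n)\<close>, to which the second formula applies.  After normalization by
  \<open>\<rho>\<^sub>c^(-j/2)\<close> the series \<open>X\<^sub>c\<^sup>j\<close> with \<open>j \<ge> 2N - 1\<close> therefore form a vector \<open>Y\<close> satisfying a linear
  system \<open>Y = H + \<tilde>A Y\<close>, where \<open>H\<close> only involves the insertions \<open>u(j)v\<^sub>k\<close> and the \<open>X\<^sub>c\<^sup>l\<close> with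
  \<open>l \<le> 2N - 2\<close> (\<open>handle_unknown_system\<close>).  The entries of \<open>\<tilde>A\<close> have positive degree in \<open>\<rho>\<close>, growing
  with the indices, so that the geometric series makes sense coefficientwise and solves the system
  (\<open>formal_solution\<close>).

  In the solution the insertions \<open>u(j)v\<^sub>k\<close> are multiplied by \<open>\<Psi>\<^sub>N^(0,j)(x,y\<^sub>k)\<close>, and \<open>X\<^sub>c\<^sup>l\<close> by \<open>T\<^sub>c\<^sup>l(x)\<close>.
  Another use of the flip identifies \<open>X\<^sub>-\<^sub>a^(2N-2-l)\<close> with a multiple of \<open>X\<^sub>a\<^sup>l\<close> and so combines \<open>T\<^sub>a\<^sup>l\<close> and
  \<open>T\<^sub>-\<^sub>a^(2N-2-l)\<close> to \<open>\<Theta>\<^sub>N\<^sub>,\<^sub>a\<^sup>l\<close> (\<open>ZV_recursion\<close>).  Finally \<open>X\<^sub>a\<^sup>l\<close> is the residue in the theorem, because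
  \<open>(x - w\<^sub>a)^(-l-1)\<close> is multiplied by \<open>X\<^sub>a\<^sup>l\<close> in the expansion of the first formula
  (\<open>handle_residue\<close>).
\<close>

section \<open>Modes of a vertex operator algebra\<close>

locale vertex_operator_algebra =
  fixes V :: "('v::ab_group_add) voa"
  assumes voa: "is_voa V"
begin

abbreviation sc :: "complex \<Rightarrow> 'v \<Rightarrow> 'v" (infixr "\<odot>" 75) where "c \<odot> v \<equiv> vscale V c v"

sublocale VS: vector_space "vscale V"
  using voa by (simp add: is_voa_def)

lemmas voa_axioms = voa[unfolded is_voa_def]

lemmas mode_add_left = voa_axioms[THEN conjunct2, THEN conjunct1, rule_format]
lemmas mode_scale_left = voa_axioms[THEN conjunct2, THEN conjunct2, THEN conjunct1, rule_format]
lemmas mode_add_right = voa_axioms[THEN conjunct2, THEN conjunct2, THEN conjunct2, THEN conjunct1, rule_format]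
lemmas mode_scale_right = voa_axioms[THEN conjunct2, THEN conjunct2, THEN conjunct2, THEN conjunct2, THEN conjunct1, rule_format]
lemmas voa_axioms_from_trunc = voa_axioms[THEN conjunct2, THEN conjunct2, THEN conjunct2, THEN conjunct2, THEN conjunct2]
lemmas mode_trunc = voa_axioms_from_trunc[THEN conjunct1, rule_format]
lemmas mode_vac = voa_axioms_from_trunc[THEN conjunct2, THEN conjunct1, rule_format]
lemmas mode_creation = voa_axioms_from_trunc[THEN conjunct2, THEN conjunct2, THEN conjunct1, rule_format]
lemmas mode_annihilates_vac = voa_axioms_from_trunc[THEN conjunct2, THEN conjunct2, THEN conjunct2, THEN conjunct1, rule_format]
lemmas voa_axioms_from_borcherds = voa_axioms_from_trunc[THEN conjunct2, THEN conjunct2, THEN conjunct2, THEN conjunct2]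
lemmas borcherds = voa_axioms_from_borcherds[THEN conjunct1, rule_format]
lemmas virasoro = voa_axioms_from_borcherds[THEN conjunct2, THEN conjunct1, rule_format]
lemmas mode_translation = voa_axioms_from_borcherds[THEN conjunct2, THEN conjunct2, THEN conjunct1, rule_format]
lemmas voa_axioms_from_span = voa_axioms_from_borcherds[THEN conjunct2, THEN conjunct2, THEN conjunct2]
lemmas span_wtspace = voa_axioms_from_span[THEN conjunct1, rule_format]
lemmas wtspace_finite_dim = voa_axioms_from_span[THEN conjunct2, rule_format]

lemma mode_zero_left [simp]: "vmode V 0 n v = 0"
  using mode_scale_left[of 0 0 n v] by simp

lemma mode_zero_right [simp]: "vmode V u n 0 = 0"
  using mode_scale_right[of u n 0 0] by simp

lemma mode_sum_right: "vmode V u n (\<Sum>i\<in>I. f i) = (\<Sum>i\<in>I. vmode V u n (f i))"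
  by (induction I rule: infinite_finite_induct) (auto simp: mode_add_right)

lemma mode_trunc_nat: "\<exists>K::nat. \<forall>j\<ge>K. vmode V u (n + int j) v = 0"
proof -
  obtain K where "\<forall>n\<ge>K. vmode V u n v = 0" using mode_trunc by blast
  then have "\<forall>j\<ge>nat (K - n). vmode V u (n + int j) v = 0" by auto
  then show ?thesis by blast
qed

lemma mode_trunc_list: "\<exists>J::nat. \<forall>v\<in>set vs. \<forall>j\<ge>J. vmode V u (int j) v = 0"
proof (induction vs)
  case (Cons v vs)
  then obtain J where J: "\<forall>v\<in>set vs. \<forall>j\<ge>J. vmode V u (int j) v = 0" by blast
  obtain K where K: "\<forall>j\<ge>K. vmode V u (0 + int j) v = 0" using mode_trunc_nat by blast
  have "\<forall>v'\<in>set (v # vs). \<forall>j\<ge>max J K. vmode V u (int j) v' = 0" using J K by auto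
  then show ?case by blast
qed simp

text \<open>
  The commutator formula is the case \<open>l = 0\<close> of the Borcherds identity, where only the first term
  of the left-hand side survives.
\<close>

lemma commutator:
  assumes J: "\<And>j. j \<ge> J \<Longrightarrow> vmode V u (int j) v = 0"
  shows "vmode V u m (vmode V v n t) = vmode V v n (vmode V u m t)
     + (\<Sum>j<J. (of_int m gchoose j) \<odot> vmode V (vmode V u (int j) v) (m + n - int j) t)"
proof -
  have L: "Sum_any (\<lambda>i::nat. ((-1) ^ i * (of_int 0 gchoose i)) \<odot>
            (vmode V u (m + 0 - int i) (vmode V v (n + int i) t)
              - ((-1) powi 0) \<odot> (vmode V v (n + 0 - int i) (vmode V u (m + int i) t))))
     = vmode V u m (vmode V v n t) - vmode V v n (vmode V u m t)"
    (is "Sum_any ?f = _")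
  proof -
    have "Sum_any ?f = (\<Sum>i\<in>{0}. ?f i)"
    proof (rule Sum_any.expand_superset)
      show "{a. ?f a \<noteq> 0} \<subseteq> {0}"
        by (auto simp: gbinomial_0_left split: if_splits)
    qed simp
    then show ?thesis by simp
  qed
  have R: "Sum_any (\<lambda>i::nat. (of_int m gchoose i) \<odot>
            (vmode V (vmode V u (0 + int i) v) (m + n - int i) t))
     = (\<Sum>j<J. (of_int m gchoose j) \<odot> vmode V (vmode V u (int j) v) (m + n - int j) t)"
    (is "Sum_any ?g = _")
  proof -
    have "Sum_any ?g = (\<Sum>i<J. ?g i)"
    proof (rule Sum_any.expand_superset)
      show "{a. ?g a \<noteq> 0} \<subseteq> {..<J}"
        by (rule subsetI, rule ccontr) (auto simp: J)
    qed simp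
    then show ?thesis by simp
  qed
  show ?thesis using borcherds[of 0 u m v n t] L R by (simp add: algebra_simps)
qed

text \<open>
  The case \<open>l = -1\<close>, \<open>m = 0\<close> of the Borcherds identity expresses the modes of the normally ordered
  product \<open>u(-1)v\<close>; truncation makes the sum finite.
\<close>

lemma normal_ordered_modes:
  obtains I :: nat where
    "\<And>i. i \<ge> I \<Longrightarrow> vmode V v (n + int i) t = 0"
    "\<And>i. i \<ge> I \<Longrightarrow> vmode V u (int i) t = 0"
    "vmode V (vmode V u (-1) v) n t =
       (\<Sum>i<I. vmode V u (-1 - int i) (vmode V v (n + int i) t)
             + vmode V v (n - 1 - int i) (vmode V u (int i) t))"
proof -
  obtain I1 where I1: "\<forall>i\<ge>I1. vmode V v (n + int i) t = 0" using mode_trunc_nat by blast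
  obtain I2 where I2: "\<forall>i\<ge>I2. vmode V u (0 + int i) t = 0" using mode_trunc_nat by blast
  define I where "I = max I1 I2"
  have v0: "\<And>i. i \<ge> I \<Longrightarrow> vmode V v (n + int i) t = 0" using I1 by (auto simp: I_def)
  have u0: "\<And>i. i \<ge> I \<Longrightarrow> vmode V u (int i) t = 0" using I2 by (auto simp: I_def)
  let ?f = "\<lambda>i::nat. ((-1) ^ i * (of_int (-1) gchoose i)) \<odot>
            (vmode V u (0 + (-1) - int i) (vmode V v (n + int i) t)
              - ((-1) powi (-1)) \<odot> (vmode V v (n + (-1) - int i) (vmode V u (0 + int i) t)))"
  let ?g = "\<lambda>i::nat. (of_int 0 gchoose i) \<odot>
            (vmode V (vmode V u (-1 + int i) v) (0 + n - int i) t)"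
  have gb: "((-1::complex) ^ i * (of_int (-1) gchoose i)) = 1" for i
    using binomial_gbinomial[of i i, where 'a = complex]
    by (simp add: gbinomial_minus flip: power_mult_distrib)
  have "Sum_any ?f = (\<Sum>i<I. ?f i)"
    proof (rule Sum_any.expand_superset)
    show "{i. ?f i \<noteq> 0} \<subseteq> {..<I}" by (rule subsetI, rule ccontr) (auto simp: u0 v0)
  qed simp
  moreover have "Sum_any ?g = (\<Sum>i\<in>{0}. ?g i)"
    by (rule Sum_any.expand_superset) (auto simp: gbinomial_0_left split: if_splits)
  ultimately have "(\<Sum>i\<in>{0}. ?g i) = (\<Sum>i<I. ?f i)"
    using borcherds[of "-1" u 0 v n t] by simp
  also have "\<dots> = (\<Sum>i<I. vmode V u (-1 - int i) (vmode V v (n + int i) t)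
             + vmode V v (n - 1 - int i) (vmode V u (int i) t))"
    unfolding gb by (intro sum.cong) (auto simp: algebra_simps)
  finally have "vmode V (vmode V u (-1) v) n t = \<dots>" by simp
  then show ?thesis using that v0 u0 by blast
qed


section \<open>The grading\<close>

definition eigen0 :: "complex \<Rightarrow> 'v set" where
  "eigen0 c = {v. Vir V 0 v = c \<odot> v}"

lemma wtspace_eigen0: "wtspace V n = eigen0 (of_nat n)"
  by (simp add: wtspace_def eigen0_def)

lemma Vir_add: "Vir V n (v + v') = Vir V n v + Vir V n v'"
  and Vir_scale: "Vir V n (c \<odot> v) = c \<odot> Vir V n v"
  and Vir_zero [simp]: "Vir V n 0 = 0"
  and Vir_sum: "Vir V n (\<Sum>i\<in>I. f i) = (\<Sum>i\<in>I. Vir V n (f i))"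
  by (simp_all add: Vir_def mode_add_right mode_scale_right mode_sum_right)

lemma subspace_eigen0: "VS.subspace (eigen0 c)"
  by (rule VS.subspaceI) (auto simp: eigen0_def Vir_add Vir_scale VS.scale_right_distrib mult.commute)

lemma subspace_wtspace: "VS.subspace (wtspace V n)"
  by (simp add: wtspace_eigen0 subspace_eigen0)

text \<open>
  Applying \<open>L(0) - k\<close> to a linear relation removes the term with eigenvalue \<open>k\<close>.
\<close>

lemma eigen0_independent:
  assumes "finite I" "\<And>i. i \<in> I \<Longrightarrow> c i \<in> eigen0 i" "(\<Sum>i\<in>I. c i) = 0"
  shows "\<forall>i\<in>I. c i = 0"
  using assms
proof (induction I arbitrary: c)
  case (insert k I)
  have L: "Vir V 0 (c i) = i \<odot> c i" if "i \<in> insert k I" for i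
    using insert.prems(1)[OF that] by (simp add: eigen0_def)
  have "(\<Sum>i\<in>insert k I. Vir V 0 (c i) - k \<odot> c i) = 0"
    by (simp only: sum_subtractf Vir_sum[symmetric] VS.scale_sum_right[symmetric] insert.prems(2)
        Vir_zero VS.scale_zero_right diff_self)
  then have 1: "(\<Sum>i\<in>I. (i - k) \<odot> c i) = 0"
    using insert.hyps by (simp add: L VS.scale_left_diff_distrib)
  have 2: "(i - k) \<odot> c i \<in> eigen0 i" if "i \<in> I" for i
    using insert.prems(1) that by (intro VS.subspace_scale[OF subspace_eigen0]) simp
  have "\<forall>i\<in>I. (i - k) \<odot> c i = 0" by (rule insert.IH[OF 2 1])
  then have *: "\<forall>i\<in>I. c i = 0" using insert.hyps by auto
  then have "c k = 0" using insert.prems(2) insert.hyps by simp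
  with * show ?case by simp
qed simp

lemma homogeneous_decomposition:
  "\<exists>M c. (\<forall>n. c n \<in> wtspace V n) \<and> (\<forall>n\<ge>M. c n = 0) \<and> v = (\<Sum>n<M. c n)"
proof -
  have "v \<in> VS.span (\<Union>n. wtspace V n)" by (simp add: span_wtspace)
  then show ?thesis
  proof (induction rule: VS.span_induct_alt)
    case base
    show ?case by (rule exI[of _ 0], rule exI[of _ "\<lambda>_. 0"]) (simp add: wtspace_def)
  next
    case (step a x y)
    then obtain k M c where k: "x \<in> wtspace V k"
      and c: "\<forall>n. c n \<in> wtspace V n" "\<forall>n\<ge>M. c n = 0" "y = (\<Sum>n<M. c n)" by blast
    define d where "d n = c n + (if n = k then a \<odot> x else 0)" for n
    define M' where "M' = max M (Suc k)"
    have "(\<Sum>n<M'. d n) = (\<Sum>n<M'. c n) + a \<odot> x"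
      by (simp add: d_def sum.distrib M'_def less_max_iff_disj)
    also have "(\<Sum>n<M'. c n) = (\<Sum>n<M. c n)"
      by (rule sum.mono_neutral_right) (use c(2) in \<open>auto simp: M'_def\<close>)
    finally have "a \<odot> x + y = (\<Sum>n<M'. d n)" using c by simp
    moreover have "d n \<in> wtspace V n" for n
      using VS.subspace_add[OF subspace_wtspace] VS.subspace_scale[OF subspace_wtspace] c(1) k
      by (auto simp: d_def)
    moreover have "\<forall>n\<ge>M'. d n = 0" using c(2) by (auto simp: d_def M'_def)
    ultimately show ?case by blast
  qed
qed

lemma homogeneous_induct [case_names add homogeneous]:
  assumes "\<And>v v'. P v \<Longrightarrow> P v' \<Longrightarrow> P (v + v')" "\<And>n v. v \<in> wtspace V n \<Longrightarrow> P v"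
  shows "P v"
proof -
  obtain M c where c: "\<forall>n. c n \<in> wtspace V n" "v = (\<Sum>n<M. c n)"
    using homogeneous_decomposition by blast
  have "P (\<Sum>n<m. c n)" for m
  proof (induction m)
    case 0
    have "(0::'v) \<in> wtspace V 0" by (simp add: wtspace_def)
    then show ?case using assms(2) by simp
  next
    case (Suc m)
    then show ?case using assms(1)[OF Suc assms(2)[of "c m" m]] c(1) by simp
  qed
  then show ?thesis using c(2) by simp
qed

lemma wtspace_components_unique:
  assumes "\<And>n. c n \<in> wtspace V n" "\<And>n. d n \<in> wtspace V n" "finite {n. c n \<noteq> 0}" "finite {n. d n \<noteq> 0}"
    "Sum_any c = Sum_any d"
  shows "c = d"
proof -
  define I where "I = {n. c n \<noteq> 0} \<union> {n. d n \<noteq> 0}"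
  have fin: "finite I" using assms by (simp add: I_def)
  have "Sum_any c = (\<Sum>n\<in>I. c n)" "Sum_any d = (\<Sum>n\<in>I. d n)"
    using fin by (auto intro!: Sum_any.expand_superset simp: I_def)
  then have "(\<Sum>n\<in>I. c n - d n) = 0" using assms(5) by (simp add: sum_subtractf)
  then have 1: "(\<Sum>z\<in>of_nat ` I. c (nat \<lfloor>Re z\<rfloor>) - d (nat \<lfloor>Re z\<rfloor>)) = 0"
    by (subst sum.reindex) (auto simp: inj_on_def)
  have 2: "c (nat \<lfloor>Re z\<rfloor>) - d (nat \<lfloor>Re z\<rfloor>) \<in> eigen0 z" if "z \<in> of_nat ` I" for z
  proof -
    obtain n where "z = of_nat n" using \<open>z \<in> of_nat ` I\<close> by blast
    then show ?thesis
      using assms(1)[of n] assms(2)[of n] by (simp add: wtspace_eigen0 VS.subspace_diff[OF subspace_eigen0])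
  qed
  have "\<forall>z\<in>of_nat ` I. c (nat \<lfloor>Re z\<rfloor>) - d (nat \<lfloor>Re z\<rfloor>) = 0"
    by (rule eigen0_independent[OF _ 2 1]) (simp add: fin)
  then have I: "\<forall>n\<in>I. c n = d n" by simp
  show ?thesis
  proof
    fix n show "c n = d n"
    proof (cases "n \<in> I")
      case True
      with I show ?thesis by blast
    next
      case False
      then have "c n = 0 \<and> d n = 0" by (simp add: I_def)
      then show ?thesis by metis
    qed
  qed
qed

lemma hcomp_eqI:
  assumes "\<And>n. c n \<in> wtspace V n" "finite {n. c n \<noteq> 0}" "Sum_any c = v"
  shows "hcomp V v = c"
  unfolding hcomp_def
  by (rule the_equality) (use assms wtspace_components_unique in auto)

lemma hcomp_props:
  shows "hcomp V v n \<in> wtspace V n" "finite {n. hcomp V v n \<noteq> 0}" "Sum_any (hcomp V v) = v"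
proof -
  obtain M c where c: "\<forall>n. c n \<in> wtspace V n" "\<forall>n\<ge>M. c n = 0" "v = (\<Sum>n<M. c n)"
    using homogeneous_decomposition by blast
  have sub: "{n. c n \<noteq> 0} \<subseteq> {..<M}" by (rule subsetI, rule ccontr) (auto simp: c(2))
  then have fin: "finite {n. c n \<noteq> 0}" using finite_subset by blast
  have "Sum_any c = v"
    using sub by (subst Sum_any.expand_superset[of "{..<M}"]) (auto simp: c(3))
  then have "hcomp V v = c" using hcomp_eqI c(1) fin by blast
  then show "hcomp V v n \<in> wtspace V n" "finite {n. hcomp V v n \<noteq> 0}" "Sum_any (hcomp V v) = v"
    using c(1) fin \<open>Sum_any c = v\<close> by auto
qed

lemma hcomp_homogeneous:
  assumes "v \<in> wtspace V n"
  shows "hcomp V v = (\<lambda>k. if k = n then v else 0)"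
  by (rule hcomp_eqI) (use assms in \<open>auto simp: VS.subspace_0[OF subspace_wtspace]\<close>)

lemma hcomp_add: "hcomp V (v + v') = (\<lambda>n. hcomp V v n + hcomp V v' n)"
proof (rule hcomp_eqI)
  show "hcomp V v n + hcomp V v' n \<in> wtspace V n" for n
    by (intro VS.subspace_add[OF subspace_wtspace] hcomp_props(1))
  show "finite {n. hcomp V v n + hcomp V v' n \<noteq> 0}"
    by (rule finite_subset[OF _ finite_UnI[OF hcomp_props(2)[of v] hcomp_props(2)[of v']]]) auto
  show "Sum_any (\<lambda>n. hcomp V v n + hcomp V v' n) = v + v'"
    by (simp add: Sum_any.distrib hcomp_props)
qed

lemma wt_eq:
  assumes "v \<in> wtspace V n" "v \<noteq> 0"
  shows "wt V v = n"
  unfolding wt_def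
proof (rule the_equality)
  fix m assume "v \<in> wtspace V m"
  then have "hcomp V v m = v" by (simp add: hcomp_homogeneous)
  then show "m = n" using assms by (simp add: hcomp_homogeneous split: if_splits)
qed fact

text \<open>
  An eigenvector for another eigenvalue would be linearly independent of its own homogeneous
  components.
\<close>

lemma eigen0_nontrivial:
  assumes "v \<in> eigen0 c" "v \<noteq> 0"
  shows "\<exists>n. c = of_nat n"
proof (rule ccontr)
  assume c: "\<nexists>n. c = of_nat n"
  define I :: "complex set" where "I = of_nat ` {n. hcomp V v n \<noteq> 0}"
  define d where "d z = (if z = c then - v else hcomp V v (nat \<lfloor>Re z\<rfloor>))" for z
  have fin: "finite I" using hcomp_props(2) by (simp add: I_def)
  have cI: "c \<notin> I" using c by (auto simp: I_def)
  have "(\<Sum>z\<in>I. d z) = (\<Sum>n | hcomp V v n \<noteq> 0. hcomp V v n)"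
    unfolding I_def by (subst sum.reindex) (use c in \<open>auto simp: inj_on_def d_def intro!: sum.cong\<close>)
  also have "\<dots> = v" using hcomp_props(3)[of v] by (simp add: Sum_any.expand_set)
  finally have 1: "(\<Sum>z\<in>insert c I. d z) = 0" using fin cI by (simp add: d_def)
  have 2: "d z \<in> eigen0 z" if zI: "z \<in> insert c I" for z
  proof (cases "z = c")
    case False
    then obtain n where "z = of_nat n" using zI by (auto simp: I_def)
    then show ?thesis using False hcomp_props(1)[of v n] by (simp add: d_def wtspace_eigen0)
  qed (simp add: d_def assms(1) VS.subspace_neg[OF subspace_eigen0])
  have "\<forall>z\<in>insert c I. d z = 0" by (rule eigen0_independent[OF _ 2 1]) (simp add: fin)
  then have "d c = 0" by blast
  then show False using assms by (simp add: d_def)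
qed

lemma Vir_vac: "n \<ge> -1 \<Longrightarrow> Vir V n (vac V) = 0"
  by (simp add: Vir_def mode_annihilates_vac)

lemma conf_eq: "conf V = Vir V (-2) (vac V)"
  by (simp add: Vir_def mode_creation)

lemma conf_wtspace: "conf V \<in> wtspace V 2"
proof -
  obtain c where c: "\<And>m n v. Vir V m (Vir V n v) - Vir V n (Vir V m v)
        = of_int (m - n) \<odot> Vir V (m + n) v
          + (if m + n = 0 then (of_int (m ^ 3 - m) / 12 * c) \<odot> v else 0)"
    using virasoro by blast
  have "Vir V 0 (conf V) = 2 \<odot> conf V"
    using c[of 0 "-2" "vac V"] by (simp add: conf_eq Vir_vac)
  then show ?thesis by (simp add: wtspace_def)
qed

lemma Vir1_conf: "Vir V 1 (conf V) = 0"
proof -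
  obtain c where c: "\<And>m n v. Vir V m (Vir V n v) - Vir V n (Vir V m v)
        = of_int (m - n) \<odot> Vir V (m + n) v
          + (if m + n = 0 then (of_int (m ^ 3 - m) / 12 * c) \<odot> v else 0)"
    using virasoro by blast
  show ?thesis using c[of 1 "-2" "vac V"] by (simp add: conf_eq Vir_vac)
qed

text \<open>
  The commutator formula for \<open>\<omega>(1) = L(0)\<close>, where the term with \<open>\<omega>(0)u = L(-1)u\<close> is evaluated by the
  translation property.
\<close>

lemma commutator_L0:
  "Vir V 0 (vmode V u n v) =
     vmode V u n (Vir V 0 v) + vmode V (Vir V 0 u) n v - of_int (n + 1) \<odot> vmode V u n v"
proof -
  obtain J where J: "\<forall>j\<ge>J. vmode V (conf V) (0 + int j) u = 0" using mode_trunc_nat by blast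
  define J' where "J' = max J 2"
  have J': "vmode V (conf V) (int j) u = 0" if "j \<ge> J'" for j using J that by (auto simp: J'_def)
  have "(\<Sum>j<J'. (of_int 1 gchoose j) \<odot> vmode V (vmode V (conf V) (int j) u) (1 + n - int j) v)
    = (\<Sum>j\<in>{0,1}. (of_int 1 gchoose j) \<odot> vmode V (vmode V (conf V) (int j) u) (1 + n - int j) v)"
  proof (rule sum.mono_neutral_right)
    have "(1::complex) gchoose j = 0" if "j \<noteq> 0" "j \<noteq> 1" for j
      using binomial_gbinomial[of 1 j, where 'a = complex] that by (simp add: binomial_eq_0)
    then show "\<forall>i\<in>{..<J'} - {0, 1}. (of_int 1 gchoose i) \<odot>
        vmode V (vmode V (conf V) (int i) u) (1 + n - int i) v = 0" by auto
  qed (auto simp: J'_def)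
  also have "\<dots> = vmode V (Vir V (-1) u) (n + 1) v + vmode V (Vir V 0 u) n v"
    by (simp add: Vir_def add.commute)
  also have "vmode V (Vir V (-1) u) (n + 1) v = - (of_int (n + 1) \<odot> vmode V u n v)"
    by (simp only: mode_translation add_diff_cancel_right' VS.scale_minus_left)
  finally show ?thesis
    using commutator[of J' "conf V" u 1 n v] J' by (simp add: Vir_def)
qed

lemma mode_eigen0:
  assumes "u \<in> wtspace V k" "v \<in> wtspace V m"
  shows "vmode V u n v \<in> eigen0 (of_int (int k + int m - n - 1))"
proof -
  have "Vir V 0 (vmode V u n v) =
     of_nat m \<odot> vmode V u n v + of_nat k \<odot> vmode V u n v - of_int (n + 1) \<odot> vmode V u n v"
    using assms by (simp add: commutator_L0 wtspace_def mode_scale_left mode_scale_right)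
  then show ?thesis
    by (simp add: eigen0_def algebra_simps)
qed

lemma mode_wtspace:
  assumes "u \<in> wtspace V k" "v \<in> wtspace V m" "int k + int m - n - 1 = int l"
  shows "vmode V u n v \<in> wtspace V l"
  using mode_eigen0[OF assms(1,2), of n] unfolding assms(3) by (simp add: wtspace_eigen0)

text \<open>
  There are no vectors of negative weight.
\<close>

lemma mode_eq_0:
  assumes "u \<in> wtspace V k" "v \<in> wtspace V m" "int k + int m - n - 1 < 0"
  shows "vmode V u n v = 0"
proof (rule ccontr)
  assume "vmode V u n v \<noteq> 0"
  then obtain l :: nat where "of_int (int k + int m - n - 1) = (of_nat l :: complex)"
    using eigen0_nontrivial[OF mode_eigen0[OF assms(1,2)]] by blast
  then have "int k + int m - n - 1 = int l" by (metis of_int_eq_iff of_int_of_nat_eq)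
  then show False using assms(3) by simp
qed

lemma Vir_minus1_wtspace:
  assumes "u \<in> wtspace V k"
  shows "Vir V (-1) u \<in> wtspace V (Suc k)"
  using mode_wtspace[OF conf_wtspace assms, of 0 "Suc k"] by (simp add: Vir_def)

end

section \<open>Rational functions of several points\<close>

definition rat_fun :: "nat \<Rightarrow> (complex list \<Rightarrow> complex) \<Rightarrow> bool" where
  "rat_fun n f \<longleftrightarrow> (\<exists>p q. poly_fun n p \<and> poly_fun n q \<and>
     (\<forall>ys. length ys = n \<and> distinct ys \<longrightarrow> q ys \<noteq> 0 \<and> f ys = p ys / q ys))"

text \<open>
  The region \<open>|y\<^sub>1| > \<dots> > |y\<^sub>n| > 0\<close>, where the products of vertex operators converge.
\<close>

definition ordered_region :: "complex list \<Rightarrow> bool" where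
  "ordered_region ys \<longleftrightarrow> sorted_wrt (\<lambda>y y'. norm y > norm y') ys \<and> 0 \<notin> set ys"

lemma ordered_region_nth:
  assumes "ordered_region ys" "i < j" "j < length ys"
  shows "norm (ys ! j) < norm (ys ! i)"
  using assms by (auto simp: ordered_region_def sorted_wrt_iff_nth_less)

lemma ordered_region_nonzero: "ordered_region ys \<Longrightarrow> k < length ys \<Longrightarrow> ys ! k \<noteq> 0"
  by (auto simp: ordered_region_def dest: nth_mem)

lemma ordered_region_Cons: "ordered_region (x # ys) \<Longrightarrow> ordered_region ys"
  by (simp add: ordered_region_def)

lemma ordered_region_distinct:
  assumes "ordered_region ys"
  shows "distinct ys"
proof (subst distinct_conv_nth, intro allI impI)
  fix i j assume ij: "i < length ys" "j < length ys" "i \<noteq> j"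
  then consider "i < j" | "j < i" by linarith
  then show "ys ! i \<noteq> ys ! j"
  proof cases
    case 1
    with ordered_region_nth[OF assms, of i j] ij show ?thesis by auto
  next
    case 2
    with ordered_region_nth[OF assms, of j i] ij show ?thesis by auto
  qed
qed

lemma poly_funI:
  assumes "finite I" "\<And>ys. length ys = n \<Longrightarrow> p ys = (\<Sum>i\<in>I. C i * (\<Prod>k<n. ys ! k ^ E i k))"
  shows "poly_fun n p"
  unfolding poly_fun_def
proof (intro exI conjI allI impI)
  show "finite (E ` I)" using assms(1) by simp
  fix ys :: "complex list" assume "length ys = n"
  then have "p ys = (\<Sum>i\<in>I. C i * (\<Prod>k<n. ys ! k ^ E i k))" by (rule assms(2))
  also have "\<dots> = (\<Sum>e\<in>E ` I. \<Sum>i | i \<in> I \<and> E i = e. C i * (\<Prod>k<n. ys ! k ^ E i k))"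
    by (rule sum.image_gen[OF assms(1)])
  also have "\<dots> = (\<Sum>e\<in>E ` I. (\<Sum>i | i \<in> I \<and> E i = e. C i) * (\<Prod>k<n. ys ! k ^ e k))"
    by (intro sum.cong refl) (simp add: sum_distrib_right)
  finally show "p ys = (\<Sum>e\<in>E ` I. (\<lambda>e. \<Sum>i | i \<in> I \<and> E i = e. C i) e * (\<Prod>k<n. ys ! k ^ e k))" .
qed

lemma poly_funE:
  assumes "poly_fun n p"
  obtains S c where "finite S" "\<And>ys. length ys = n \<Longrightarrow> p ys = (\<Sum>e\<in>S. c e * (\<Prod>k<n. ys ! k ^ e k))"
  using assms unfolding poly_fun_def by metis

lemma poly_fun_const: "poly_fun n (\<lambda>_. c)"
  by (rule poly_funI[of "{()}" _ _ "\<lambda>_. c" "\<lambda>_ _. 0"]) auto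

lemma poly_fun_nth:
  assumes "i < n"
  shows "poly_fun n (\<lambda>ys. ys ! i)"
proof (rule poly_funI[of "{()}" _ _ "\<lambda>_. 1" "\<lambda>_ k. if k = i then 1 else 0"])
  fix ys :: "complex list"
  have "(\<Prod>k<n. ys ! k ^ (if k = i then 1 else 0)) = (\<Prod>k<n. if k = i then ys ! k else 1)"
    by (intro prod.cong) auto
  then show "ys ! i = (\<Sum>u\<in>{()}. 1 * (\<Prod>k<n. ys ! k ^ (if k = i then 1 else 0)))"
    using assms by simp
qed simp

lemma poly_fun_add:
  assumes "poly_fun n p" "poly_fun n q"
  shows "poly_fun n (\<lambda>ys. p ys + q ys)"
proof -
  obtain S c where S: "finite S" "\<And>ys. length ys = n \<Longrightarrow> p ys = (\<Sum>e\<in>S. c e * (\<Prod>k<n. ys ! k ^ e k))"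
    using poly_funE[OF assms(1)] by metis
  obtain T d where T: "finite T" "\<And>ys. length ys = n \<Longrightarrow> q ys = (\<Sum>e\<in>T. d e * (\<Prod>k<n. ys ! k ^ e k))"
    using poly_funE[OF assms(2)] by metis
  show ?thesis
    by (rule poly_funI[of "S <+> T" _ _ "case_sum c d" "case_sum id id"])
      (simp_all add: sum.Plus S T)
qed

lemma poly_fun_mult:
  assumes "poly_fun n p" "poly_fun n q"
  shows "poly_fun n (\<lambda>ys. p ys * q ys)"
proof -
  obtain S c where S: "finite S" "\<And>ys. length ys = n \<Longrightarrow> p ys = (\<Sum>e\<in>S. c e * (\<Prod>k<n. ys ! k ^ e k))"
    using poly_funE[OF assms(1)] by metis
  obtain T d where T: "finite T" "\<And>ys. length ys = n \<Longrightarrow> q ys = (\<Sum>e\<in>T. d e * (\<Prod>k<n. ys ! k ^ e k))"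
    using poly_funE[OF assms(2)] by metis
  show ?thesis
  proof (rule poly_funI[of "S \<times> T" _ _ "\<lambda>(e, e'). c e * d e'" "\<lambda>(e, e') k. e k + e' k"])
    fix ys :: "complex list" assume "length ys = n"
    then have "p ys * q ys = (\<Sum>e\<in>S. \<Sum>e'\<in>T. (c e * (\<Prod>k<n. ys ! k ^ e k)) * (d e' * (\<Prod>k<n. ys ! k ^ e' k)))"
      by (simp add: S(2) T(2) sum_product)
    also have "\<dots> = (\<Sum>(e, e')\<in>S \<times> T. c e * d e' * (\<Prod>k<n. ys ! k ^ (e k + e' k)))"
      by (subst sum.cartesian_product) (auto intro!: sum.cong simp: power_add prod.distrib)
    finally show "p ys * q ys = (\<Sum>i\<in>S \<times> T. (case i of (e, e') \<Rightarrow> c e * d e') *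
        (\<Prod>k<n. ys ! k ^ (case i of (e, e') \<Rightarrow> \<lambda>k. e k + e' k) k))"
      by (simp add: case_prod_unfold)
  qed (simp add: S(1) T(1))
qed

lemma poly_fun_power: "poly_fun n p \<Longrightarrow> poly_fun n (\<lambda>ys. p ys ^ k)"
  by (induction k) (auto intro: poly_fun_const poly_fun_mult)

lemma poly_fun_diff:
  assumes "poly_fun n p" "poly_fun n q"
  shows "poly_fun n (\<lambda>ys. p ys - q ys)"
  using poly_fun_add[OF assms(1) poly_fun_mult[OF poly_fun_const[of n "-1"] assms(2)]] by simp

lemma poly_fun_tl:
  assumes "poly_fun n p"
  shows "poly_fun (Suc n) (\<lambda>ys. p (tl ys))"
proof -
  obtain S c where S: "finite S" "\<And>ys. length ys = n \<Longrightarrow> p ys = (\<Sum>e\<in>S. c e * (\<Prod>k<n. ys ! k ^ e k))"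
    using poly_funE[OF assms] by metis
  show ?thesis
  proof (rule poly_funI[of S _ _ c "\<lambda>e k. case k of 0 \<Rightarrow> 0 | Suc k \<Rightarrow> e k"])
    fix ys :: "complex list" assume "length ys = Suc n"
    then obtain y zs where ys: "ys = y # zs" "length zs = n" by (cases ys) auto
    show "p (tl ys) = (\<Sum>e\<in>S. c e * (\<Prod>k<Suc n. ys ! k ^ (case k of 0 \<Rightarrow> 0 | Suc k \<Rightarrow> e k)))"
      by (simp only: prod.lessThan_Suc_shift ys(1) list.sel S(2)[OF ys(2)] nat.case nth_Cons_0
          nth_Cons_Suc power_0 mult_1)
  qed (rule S(1))
qed

lemma rat_funI:
  assumes "poly_fun n p" "poly_fun n q"
    "\<And>ys. length ys = n \<Longrightarrow> distinct ys \<Longrightarrow> q ys \<noteq> 0 \<and> f ys = p ys / q ys"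
  shows "rat_fun n f"
  using assms unfolding rat_fun_def by blast

lemma rat_fun_poly: "poly_fun n p \<Longrightarrow> rat_fun n p"
  by (rule rat_funI[of n p "\<lambda>_. 1"]) (auto intro: poly_fun_const)

lemma rat_fun_add:
  assumes "rat_fun n f" "rat_fun n h"
  shows "rat_fun n (\<lambda>ys. f ys + h ys)"
proof -
  obtain p q where f: "poly_fun n p" "poly_fun n q"
    "\<And>ys. length ys = n \<Longrightarrow> distinct ys \<Longrightarrow> q ys \<noteq> 0 \<and> f ys = p ys / q ys"
    using assms(1) unfolding rat_fun_def by blast
  obtain r s where h: "poly_fun n r" "poly_fun n s"
    "\<And>ys. length ys = n \<Longrightarrow> distinct ys \<Longrightarrow> s ys \<noteq> 0 \<and> h ys = r ys / s ys"
    using assms(2) unfolding rat_fun_def by blast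
  show ?thesis
  proof (rule rat_funI)
    show "poly_fun n (\<lambda>ys. p ys * s ys + r ys * q ys)" "poly_fun n (\<lambda>ys. q ys * s ys)"
      by (intro poly_fun_add poly_fun_mult f(1,2) h(1,2))+
    show "q ys * s ys \<noteq> 0 \<and> f ys + h ys = (p ys * s ys + r ys * q ys) / (q ys * s ys)"
      if "length ys = n" "distinct ys" for ys
      using f(3)[OF that] h(3)[OF that] by (simp add: add_frac_eq)
  qed
qed

lemma rat_fun_mult:
  assumes "rat_fun n f" "rat_fun n h"
  shows "rat_fun n (\<lambda>ys. f ys * h ys)"
proof -
  obtain p q where f: "poly_fun n p" "poly_fun n q"
    "\<And>ys. length ys = n \<Longrightarrow> distinct ys \<Longrightarrow> q ys \<noteq> 0 \<and> f ys = p ys / q ys"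
    using assms(1) unfolding rat_fun_def by blast
  obtain r s where h: "poly_fun n r" "poly_fun n s"
    "\<And>ys. length ys = n \<Longrightarrow> distinct ys \<Longrightarrow> s ys \<noteq> 0 \<and> h ys = r ys / s ys"
    using assms(2) unfolding rat_fun_def by blast
  show ?thesis
  proof (rule rat_funI)
    show "poly_fun n (\<lambda>ys. p ys * r ys)" "poly_fun n (\<lambda>ys. q ys * s ys)"
      by (intro poly_fun_mult f(1,2) h(1,2))+
    show "q ys * s ys \<noteq> 0 \<and> f ys * h ys = (p ys * r ys) / (q ys * s ys)"
      if "length ys = n" "distinct ys" for ys
      using f(3)[OF that] h(3)[OF that] by simp
  qed
qed

lemma rat_fun_sum: "(\<And>i. i \<in> I \<Longrightarrow> rat_fun n (f i)) \<Longrightarrow> rat_fun n (\<lambda>ys. \<Sum>i\<in>I. f i ys)"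
proof (induction I rule: infinite_finite_induct)
  case (insert i I)
  then show ?case by (simp add: rat_fun_add)
qed (simp_all add: rat_fun_poly poly_fun_const)

lemma rat_fun_tl:
  assumes "rat_fun n f"
  shows "rat_fun (Suc n) (\<lambda>ys. f (tl ys))"
proof -
  obtain p q where f: "poly_fun n p" "poly_fun n q"
    "\<And>ys. length ys = n \<Longrightarrow> distinct ys \<Longrightarrow> q ys \<noteq> 0 \<and> f ys = p ys / q ys"
    using assms(1) unfolding rat_fun_def by blast
  show ?thesis
  proof (rule rat_funI)
    show "poly_fun (Suc n) (\<lambda>ys. p (tl ys))" "poly_fun (Suc n) (\<lambda>ys. q (tl ys))"
      using f by (simp_all add: poly_fun_tl)
    show "q (tl ys) \<noteq> 0 \<and> f (tl ys) = p (tl ys) / q (tl ys)" if "length ys = Suc n" "distinct ys" for ys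
      by (rule f(3)) (use that in \<open>simp_all add: distinct_tl\<close>)
  qed
qed

lemma rat_fun_inverse_diff_power:
  assumes "i < n" "j < n" "i \<noteq> j"
  shows "rat_fun n (\<lambda>ys. 1 / (ys ! i - ys ! j) ^ k)"
proof (rule rat_funI)
  show "poly_fun n (\<lambda>ys. 1)" by (rule poly_fun_const)
  show "poly_fun n (\<lambda>ys. (ys ! i - ys ! j) ^ k)"
    by (intro poly_fun_power poly_fun_diff poly_fun_nth assms)
  show "(ys ! i - ys ! j) ^ k \<noteq> 0 \<and> 1 / (ys ! i - ys ! j) ^ k = 1 / (ys ! i - ys ! j) ^ k"
    if "length ys = n" "distinct ys" for ys :: "complex list"
    using that assms nth_eq_iff_index_eq[of ys i j] by simp
qed

lemma poly_fun_on_line: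
  assumes "poly_fun n p"
  shows "\<exists>P. \<forall>t. p (map (\<lambda>k. a k + t * d k) [0..<n]) = poly P t"
proof -
  obtain S c where S: "finite S" "\<And>ys. length ys = n \<Longrightarrow> p ys = (\<Sum>e\<in>S. c e * (\<Prod>k<n. ys ! k ^ e k))"
    using poly_funE[OF assms] by metis
  have "p (map (\<lambda>k. a k + t * d k) [0..<n])
      = poly (\<Sum>e\<in>S. smult (c e) (\<Prod>k<n. [:a k, d k:] ^ e k)) t" for t
    by (subst S(2)) (simp_all add: poly_sum poly_prod)
  then show ?thesis by blast
qed

lemma poly_eq_0_if_eventually_0:
  fixes P :: "complex poly"
  assumes "eventually (\<lambda>t. poly P t = 0) (at 0)"
  shows "P = 0"
proof (rule ccontr)
  assume "P \<noteq> 0"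
  then have "finite {t. poly P t = 0}" by (rule poly_roots_finite)
  then have "eventually (\<lambda>t. t \<notin> {t. poly P t = 0}) (at 0)"
    using islimpt_finite islimpt_iff_eventually by blast
  with assms have "eventually (\<lambda>_. False) (at (0::complex))" by eventually_elim simp
  then show False by simp
qed

text \<open>
  On the line from a point of the region \<open>|y\<^sub>1| > \<dots> > |y\<^sub>n| > 0\<close> to any given point, the
  cross-multiplied difference is a polynomial in one variable that vanishes near \<open>0\<close>.
\<close>

lemma rat_fun_eqI:
  assumes f: "rat_fun n f" and h: "rat_fun n h"
    and eq: "\<And>ys. length ys = n \<Longrightarrow> ordered_region ys \<Longrightarrow> f ys = h ys"
    and zs: "length zs = n" "distinct zs"
  shows "f zs = h zs"
proof -
  obtain p q where f: "poly_fun n p" "poly_fun n q"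
    "\<And>ys. length ys = n \<Longrightarrow> distinct ys \<Longrightarrow> q ys \<noteq> 0 \<and> f ys = p ys / q ys"
    using f unfolding rat_fun_def by blast
  obtain r s where h: "poly_fun n r" "poly_fun n s"
    "\<And>ys. length ys = n \<Longrightarrow> distinct ys \<Longrightarrow> s ys \<noteq> 0 \<and> h ys = r ys / s ys"
    using h unfolding rat_fun_def by blast
  \<comment> \<open>The point \<open>(n, n - 1, \<dots>, 1)\<close> of the region.\<close>
  define a where "a k = complex_of_real (real (n - k))" for k
  have norm_a: "norm (a k) = real (n - k)" for k
    unfolding a_def norm_of_real by simp
  define d where "d k = zs ! k - a k" for k
  define L where "L t = map (\<lambda>k. a k + t * d k) [0..<n]" for t
  have polyD: "poly_fun n (\<lambda>ys. p ys * s ys - r ys * q ys)"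
    by (intro poly_fun_diff poly_fun_mult f h)
  obtain P where P: "\<And>t. p (L t) * s (L t) - r (L t) * q (L t) = poly P t"
    using poly_fun_on_line[OF polyD, of a d] unfolding L_def by blast
  have ev1: "eventually (\<lambda>t. a k + t * d k \<noteq> 0) (at 0)" if "k < n" for k
  proof -
    have "((\<lambda>t. a k + t * d k) \<longlongrightarrow> a k + 0 * d k) (at 0)" by (intro tendsto_intros)
    moreover have "a k + 0 * d k \<noteq> 0" using that by (simp add: a_def)
    ultimately show ?thesis by (rule tendsto_imp_eventually_ne)
  qed
  have ev2: "eventually (\<lambda>t. norm (a j + t * d j) < norm (a i + t * d i)) (at 0)" if "i < j" "j < n" for i j
  proof -
    have "((\<lambda>t. norm (a i + t * d i) - norm (a j + t * d j)) \<longlongrightarrow> norm (a i + 0 * d i) - norm (a j + 0 * d j)) (at 0)"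
      by (intro tendsto_intros)
    moreover have "norm (a i + 0 * d i) - norm (a j + 0 * d j) > 0"
      using that by (simp add: norm_a)
    ultimately have "eventually (\<lambda>t. norm (a i + t * d i) - norm (a j + t * d j) > 0) (at 0)"
      by (rule order_tendstoD)
    then show ?thesis by eventually_elim simp
  qed
  have "eventually (\<lambda>t. (\<forall>k\<in>{..<n}. a k + t * d k \<noteq> 0) \<and>
      (\<forall>(i, j)\<in>{(i, j). i < j \<and> j < n}. norm (a j + t * d j) < norm (a i + t * d i))) (at 0)"
  proof (intro eventually_conj eventually_ball_finite)
    show "finite {(i, j). i < j \<and> j < n}"
      by (rule finite_subset[of _ "{..<n} \<times> {..<n}"]) auto
  qed (use ev1 ev2 in auto)
  then have "eventually (\<lambda>t. poly P t = 0) (at 0)"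
  proof eventually_elim
    case (elim t)
    have len: "length (L t) = n" by (simp add: L_def)
    have reg: "ordered_region (L t)"
      using elim by (auto simp: ordered_region_def L_def sorted_wrt_iff_nth_less)
    have dist: "distinct (L t)" by (rule ordered_region_distinct[OF reg])
    have "p (L t) / q (L t) = r (L t) / s (L t)"
      using eq[OF len reg] f(3)[OF len dist] h(3)[OF len dist] by simp
    then show ?case
      using f(3)[OF len dist] h(3)[OF len dist] P[of t] by (simp add: frac_eq_eq)
  qed
  then have "P = 0" by (rule poly_eq_0_if_eventually_0)
  moreover have "L 1 = zs"
    using zs by (auto simp: L_def d_def intro: nth_equalityI)
  ultimately have "p zs * s zs = r zs * q zs" using P[of 1] by simp
  then show ?thesis using f(3)[OF zs] h(3)[OF zs] by (simp add: frac_eq_eq)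
qed


section \<open>Binomial expansions\<close>

lemma neg_binomial_has_sum:
  fixes r :: complex
  assumes "norm r < 1"
  shows "((\<lambda>i. of_nat ((i + j) choose j) * r ^ i) has_sum 1 / (1 - r) ^ (j + 1)) UNIV"
proof -
  have coeff: "(- of_nat (j + 1) gchoose i) * (- s) ^ i = of_nat ((i + j) choose j) * s ^ i" for s :: complex and i
  proof -
    have "(- of_nat (j + 1) gchoose i :: complex) = (-1) ^ i * (of_nat (i + j) gchoose i)"
      using gbinomial_minus[of "of_nat (j + 1) :: complex" i] by (simp add: add_ac)
    also have "(of_nat (i + j) gchoose i :: complex) = of_nat ((i + j) choose j)"
      using binomial_symmetric[of i "i + j"] by (simp only: binomial_gbinomial[symmetric]) simp
    moreover have "(-1) ^ i * (-1) ^ i = (1::complex)" by (simp flip: power_mult_distrib)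
    moreover have "(- s) ^ i = (-1) ^ i * s ^ i" by (rule power_minus)
    ultimately show ?thesis by simp
  qed
  have sums: "(\<lambda>i. of_nat ((i + j) choose j) * s ^ i) sums (1 / (1 - s) ^ (j + 1))"
    if "norm s < 1" for s :: complex
  proof -
    have "1 - s \<noteq> 0" using that by auto
    then have "(1 + (- s)) powr (- of_nat (j + 1)) = 1 / (1 - s) ^ (j + 1)"
      by (simp add: powr_minus powr_nat' divide_inverse del: of_nat_Suc of_nat_add)
    then show ?thesis
      using gen_binomial_complex[of "- s" "- of_nat (j + 1)"] that unfolding coeff by simp
  qed
  have "summable (\<lambda>i. complex_of_real (norm (of_nat ((i + j) choose j) * r ^ i)))"
    using sums[of "complex_of_real (norm r)"] assms
    by (simp add: norm_mult norm_power sums_iff)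
  then have "summable (\<lambda>i. norm (of_nat ((i + j) choose j) * r ^ i))"
    by (simp only: summable_complex_of_real)
  then show ?thesis
    using sums[OF assms] by (rule norm_summable_imp_has_sum)
qed

text \<open>
  The expansion of the pole at \<open>z = w\<close> in the region \<open>|z| > |w|\<close>; the coefficients are those of the
  commutator formula for the modes \<open>u(m)\<close> with \<open>m \<ge> 0\<close>.
\<close>

lemma has_sum_binomial_right:
  fixes z w :: complex
  assumes "norm w < norm z" "w \<noteq> 0"
  shows "((\<lambda>m::nat. (of_nat m gchoose j) * z powi (- 1 - int m) * w powi (int m - int j))
           has_sum 1 / (z - w) ^ (j + 1)) UNIV"
proof -
  have z: "z \<noteq> 0" using assms by auto
  have "norm (w / z) < 1" using assms z by (simp add: norm_divide divide_simps)
  then have "((\<lambda>i. z powi (- int j - 1) * (of_nat ((i + j) choose j) * (w / z) ^ i))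
      has_sum z powi (- int j - 1) * (1 / (1 - w / z) ^ (j + 1))) UNIV"
    by (intro has_sum_cmult_right neg_binomial_has_sum)
  also have "z powi (- int j - 1) * (1 / (1 - w / z) ^ (j + 1)) = 1 / (z - w) ^ (j + 1)"
  proof -
    have "z powi (- int j - 1) = 1 / z ^ (j + 1)"
    proof -
      have "z powi (- int j - 1) = z powi (- int (j + 1))" by (rule arg_cong[of _ _ "power_int z"]) simp
      then show ?thesis by (simp only: power_int_minus power_int_of_nat divide_inverse mult_1)
    qed
    moreover have "(z - w) = z * (1 - w / z)" using z by (simp add: field_simps)
    ultimately show ?thesis by (simp add: power_mult_distrib)
  qed
  also have "(\<lambda>i. z powi (- int j - 1) * (of_nat ((i + j) choose j) * (w / z) ^ i))
     = (\<lambda>i. (of_nat (i + j) gchoose j) * z powi (- 1 - int (i + j)) * w powi (int (i + j) - int j))"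
  proof
    fix i
    have "- 1 - int (i + j) = (- int j - 1) + (- int i)" by simp
    then have "z powi (- 1 - int (i + j)) = z powi (- int j - 1) * z powi (- int i)"
      using z power_int_add[of z "- int j - 1" "- int i"] by metis
    moreover have "(w / z) ^ i = w powi (int i) * z powi (- int i)"
      by (simp add: power_mult_distrib power_int_minus divide_inverse power_inverse)
    ultimately show "z powi (- int j - 1) * (of_nat ((i + j) choose j) * (w / z) ^ i)
        = (of_nat (i + j) gchoose j) * z powi (- 1 - int (i + j)) * w powi (int (i + j) - int j)"
      by (simp add: binomial_gbinomial)
  qed
  finally have "((\<lambda>i. (of_nat (i + j) gchoose j) * z powi (- 1 - int (i + j)) * w powi (int (i + j) - int j))
      has_sum 1 / (z - w) ^ (j + 1)) UNIV" .
  moreover have "bij_betw (\<lambda>i. i + j) UNIV {j..}"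
    by (rule bij_betw_byWitness[of _ "\<lambda>m. m - j"]) auto
  ultimately have "((\<lambda>m. (of_nat m gchoose j) * z powi (- 1 - int m) * w powi (int m - int j))
      has_sum 1 / (z - w) ^ (j + 1)) {j..}"
    by (subst has_sum_reindex_bij_betw[symmetric]) auto
  then show ?thesis
    by (subst has_sum_cong_neutral[where T = "{j..}"]) (auto simp: binomial_eq_0 simp flip: binomial_gbinomial)
qed

text \<open>
  The expansion of the same pole in the opposite region.  Here the coefficients are those of the
  commutator formula for the modes \<open>u(-1-i)\<close>.
\<close>

lemma has_sum_binomial_left:
  fixes z w :: complex
  assumes "norm w < norm z"
  shows "((\<lambda>i::nat. (of_int (- 1 - int i) gchoose j) * z powi (- 1 - int i - int j) * w powi int i)
           has_sum - (1 / (w - z) ^ (j + 1))) UNIV"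
proof -
  have z: "z \<noteq> 0" using assms by auto
  have "norm (w / z) < 1" using assms z by (simp add: norm_divide divide_simps)
  then have "((\<lambda>i. ((-1) ^ j * z powi (- int j - 1)) * (of_nat ((i + j) choose j) * (w / z) ^ i))
      has_sum ((-1) ^ j * z powi (- int j - 1)) * (1 / (1 - w / z) ^ (j + 1))) UNIV"
    by (intro has_sum_cmult_right neg_binomial_has_sum)
  also have "((-1) ^ j * z powi (- int j - 1)) * (1 / (1 - w / z) ^ (j + 1)) = - (1 / (w - z) ^ (j + 1))"
  proof -
    have "z powi (- int j - 1) = 1 / z ^ (j + 1)"
    proof -
      have "z powi (- int j - 1) = z powi (- int (j + 1))" by (rule arg_cong[of _ _ "power_int z"]) simp
      then show ?thesis by (simp only: power_int_minus power_int_of_nat divide_inverse mult_1)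
    qed
    moreover have "(w - z) ^ (j + 1) = (-1) ^ (j + 1) * (z ^ (j + 1) * (1 - w / z) ^ (j + 1))"
    proof -
      have "w - z = (-1) * (z * (1 - w / z))" using z by (simp add: field_simps)
      then show ?thesis by (metis power_mult_distrib)
    qed
    ultimately show ?thesis by (cases "even j") simp_all
  qed
  also have "(\<lambda>i. ((-1) ^ j * z powi (- int j - 1)) * (of_nat ((i + j) choose j) * (w / z) ^ i))
     = (\<lambda>i. (of_int (- 1 - int i) gchoose j) * z powi (- 1 - int i - int j) * w powi int i)"
  proof
    fix i
    have "- 1 - int i - int j = (- int j - 1) + (- int i)" by simp
    then have "z powi (- 1 - int i - int j) = z powi (- int j - 1) * z powi (- int i)"
      using z power_int_add[of z "- int j - 1" "- int i"] by metis
    moreover have "(w / z) ^ i = w powi (int i) * z powi (- int i)"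
      by (simp add: power_mult_distrib power_int_minus divide_inverse power_inverse)
    moreover have "(of_int (- 1 - int i) gchoose j :: complex) = (-1) ^ j * of_nat ((i + j) choose j)"
    proof -
      have "(of_int (- 1 - int i) :: complex) = - of_nat (i + 1)" by simp
      then have "(of_int (- 1 - int i) gchoose j :: complex)
          = (-1) ^ j * ((of_nat (i + 1) + of_nat j - 1) gchoose j)"
        by (simp only: gbinomial_minus)
      also have "(of_nat (i + 1) + of_nat j - 1 :: complex) = of_nat (i + j)" by simp
      finally show ?thesis by (simp only: binomial_gbinomial)
    qed
    ultimately show "((-1) ^ j * z powi (- int j - 1)) * (of_nat ((i + j) choose j) * (w / z) ^ i)
        = (of_int (- 1 - int i) gchoose j) * z powi (- 1 - int i - int j) * w powi int i"
      by simp
  qed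
  finally show ?thesis .
qed

lemma has_sum_product:
  fixes f :: "'a \<Rightarrow> complex" and h :: "'b \<Rightarrow> complex"
  assumes f: "(f has_sum a) I" and h: "(h has_sum b) J"
  shows "((\<lambda>(i, j). f i * h j) has_sum (a * b)) (I \<times> J)"
proof (rule has_sum_SigmaI)
  show "((\<lambda>y. case (x, y) of (i, j) \<Rightarrow> f i * h j) has_sum f x * b) J" for x
    using has_sum_cmult_right[OF h] by simp
  show "((\<lambda>x. f x * b) has_sum a * b) I" using has_sum_cmult_left[OF f] by simp
  have absf: "(\<lambda>i. norm (f i)) summable_on I" and absh: "(\<lambda>j. norm (h j)) summable_on J"
    using f h by (auto simp flip: summable_on_iff_abs_summable_on_complex simp: summable_on_def)
  have "(\<lambda>x. norm (case x of (i, j) \<Rightarrow> f i * h j)) summable_on I \<times> J"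
    unfolding Infinite_Sum.abs_summable_on_Sigma_iff
  proof (intro conjI ballI)
    show "(\<lambda>y. norm (case (x, y) of (i, j) \<Rightarrow> f i * h j)) summable_on J" for x
      using summable_on_cmult_right[OF absh, of "norm (f x)"] by (simp add: norm_mult)
    have "(\<lambda>x. norm (f x) * (\<Sum>\<^sub>\<infinity>y\<in>J. norm (h y))) summable_on I"
      by (rule summable_on_cmult_left[OF absf])
    then show "(\<lambda>x. norm (\<Sum>\<^sub>\<infinity>y\<in>J. norm (case (x, y) of (i, j) \<Rightarrow> f i * h j))) summable_on I"
      by (simp add: norm_mult infsum_cmult_right' abs_mult infsum_nonneg)
  qed
  then show "(\<lambda>(i, j). f i * h j) summable_on I \<times> J"
    by (rule iffD2[OF summable_on_iff_abs_summable_on_complex])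
qed

section \<open>Strings of modes\<close>

definition mode_string :: "'v voa \<Rightarrow> 'v list \<Rightarrow> int list \<Rightarrow> 'v \<Rightarrow> 'v" where
  "mode_string V vs ms t = foldr (\<lambda>(v, m) t. vmode V v m t) (zip vs ms) t"

definition shift_modes :: "(nat \<Rightarrow> int) \<Rightarrow> int list \<Rightarrow> int list" where
  "shift_modes \<delta> ms = map (\<lambda>k. ms ! k + \<delta> k) [0..<length ms]"

lemma length_shift_modes [simp]: "length (shift_modes \<delta> ms) = length ms"
  by (simp add: shift_modes_def)

lemma nth_shift_modes [simp]: "k < length ms \<Longrightarrow> shift_modes \<delta> ms ! k = ms ! k + \<delta> k"
  by (simp add: shift_modes_def)

lemma mode_string_Nil [simp]: "mode_string V [] ms t = t"
  by (simp add: mode_string_def)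

lemma mode_string_Cons [simp]:
  "mode_string V (v # vs) (m # ms) t = vmode V v m (mode_string V vs ms t)"
  by (simp add: mode_string_def)

lemma mode_string_append:
  "length vs = length ms \<Longrightarrow>
     mode_string V (vs @ vs') (ms @ ms') t = mode_string V vs ms (mode_string V vs' ms' t)"
  by (simp add: mode_string_def)

lemma vac_expectation_mode_string:
  "vac_expectation V B vs ms = B (vac V) (mode_string V vs ms (vac V))"
  by (simp add: vac_expectation_def mode_string_def)

lemma has_sum_finite_sum:
  fixes f :: "'i \<Rightarrow> 'a \<Rightarrow> complex"
  assumes "\<And>i. i \<in> I \<Longrightarrow> (f i has_sum s i) A"
  shows "((\<lambda>x. \<Sum>i\<in>I. f i x) has_sum (\<Sum>i\<in>I. s i)) A"
  using assms
proof (induction I rule: infinite_finite_induct)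
  case (insert i I)
  then show ?case by (simp add: has_sum_add)
qed simp_all

lemma prod_two_powi:
  fixes y :: "nat \<Rightarrow> complex"
  assumes "p < n" "k < n" "p \<noteq> k"
  shows "(\<Prod>i<n. y i powi (if i = p then a else if i = k then b else 0)) = y p powi a * y k powi b"
proof -
  have "(\<Prod>i<n. y i powi (if i = p then a else if i = k then b else 0))
      = (\<Prod>i\<in>{p, k}. y i powi (if i = p then a else if i = k then b else 0))"
    by (rule prod.mono_neutral_right) (use assms in auto)
  then show ?thesis using assms by simp
qed

text \<open>
  Multiplying the expansion of a correlation function by a series in monomials
  \<open>\<Prod>\<^sub>k y\<^sub>k^(\<delta>\<^sub>i(k))\<close> shifts the mode numbers by \<open>\<delta>\<^sub>i\<close>.
\<close>

lemma has_sum_shifted_modes: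
  fixes ys :: "complex list" and g :: "int list \<Rightarrow> complex" and \<delta> :: "'i \<Rightarrow> nat \<Rightarrow> int"
  assumes "((\<lambda>ms. g ms * (\<Prod>k<n. ys ! k powi (- (ms ! k) - 1))) has_sum S) {ms. length ms = n}"
    and nz: "\<And>k. k < n \<Longrightarrow> ys ! k \<noteq> 0"
    and a: "((\<lambda>i. c i * (\<Prod>k<n. ys ! k powi (\<delta> i k))) has_sum C) I"
  shows "((\<lambda>(i, ms). c i * g (shift_modes (\<delta> i) ms) * (\<Prod>k<n. ys ! k powi (- (ms ! k) - 1)))
           has_sum C * S) (I \<times> {ms. length ms = n})"
proof -
  let ?L = "{ms :: int list. length ms = n}"
  let ?F = "\<lambda>(i, ms). (c i * (\<Prod>k<n. ys ! k powi (\<delta> i k))) *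
                 (g ms * (\<Prod>k<n. ys ! k powi (- (ms ! k) - 1)))"
  have "(?F has_sum C * S) (I \<times> ?L)"
    by (rule has_sum_product[OF a assms(1)])
  moreover have bij: "bij_betw (\<lambda>(i, ms). (i, shift_modes (\<delta> i) ms)) (I \<times> ?L) (I \<times> ?L)"
    by (rule bij_betw_byWitness[of _ "\<lambda>(i, ms). (i, shift_modes (\<lambda>k. - \<delta> i k) ms)"])
      (auto intro!: nth_equalityI)
  ultimately have "((\<lambda>x. ?F ((\<lambda>(i, ms). (i, shift_modes (\<delta> i) ms)) x)) has_sum C * S) (I \<times> ?L)"
    by (subst has_sum_reindex_bij_betw[OF bij])
  then show ?thesis
  proof (rule iffD1[OF has_sum_cong, rotated])
    fix x assume x: "x \<in> I \<times> ?L"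
    obtain i ms where x': "x = (i, ms)" "length ms = n" using x by auto
    have "(\<Prod>k<n. ys ! k powi (\<delta> i k)) * (\<Prod>k<n. ys ! k powi (- (shift_modes (\<delta> i) ms ! k) - 1))
        = (\<Prod>k<n. ys ! k powi (- (ms ! k) - 1))"
      unfolding prod.distrib[symmetric]
    proof (rule prod.cong[OF refl])
      fix k assume "k \<in> {..<n}"
      then have k: "k < n" by simp
      have e: "\<delta> i k + (- (shift_modes (\<delta> i) ms ! k) - 1) = - (ms ! k) - 1" using k x' by simp
      have "ys ! k powi (\<delta> i k) * ys ! k powi (- (shift_modes (\<delta> i) ms ! k) - 1)
          = ys ! k powi (\<delta> i k + (- (shift_modes (\<delta> i) ms ! k) - 1))"
        using nz[OF k] by (intro power_int_add[symmetric]) simp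
      then show "ys ! k powi (\<delta> i k) * ys ! k powi (- (shift_modes (\<delta> i) ms ! k) - 1) = ys ! k powi (- (ms ! k) - 1)"
        by (simp only: e)
    qed
    then show "?F ((\<lambda>(i, ms). (i, shift_modes (\<delta> i) ms)) x)
        = (case x of (i, ms) \<Rightarrow> c i * g (shift_modes (\<delta> i) ms) * (\<Prod>k<n. ys ! k powi (- (ms ! k) - 1)))"
      by (simp add: x' mult_ac)
  qed
qed

context vertex_operator_algebra
begin

lemma mode_string_add: "mode_string V vs ms (t + t') = mode_string V vs ms t + mode_string V vs ms t'"
proof (induction vs arbitrary: ms)
  case (Cons v vs)
  show ?case
  proof (cases ms)
    case Nil then show ?thesis by (simp add: mode_string_def)
  next
    case (Cons m ms') then show ?thesis by (simp add: Cons.IH mode_add_right)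
  qed
qed simp

lemma mode_string_scale: "mode_string V vs ms (c \<odot> t) = c \<odot> mode_string V vs ms t"
proof (induction vs arbitrary: ms)
  case (Cons v vs)
  show ?case
  proof (cases ms)
    case Nil then show ?thesis by (simp add: mode_string_def)
  next
    case (Cons m ms') then show ?thesis by (simp add: Cons.IH mode_scale_right)
  qed
qed simp

lemma mode_string_zero [simp]: "mode_string V vs ms 0 = 0"
  using mode_string_scale[of vs ms 0 0] by simp

lemma mode_string_sum: "mode_string V vs ms (\<Sum>i\<in>I. f i) = (\<Sum>i\<in>I. mode_string V vs ms (f i))"
  by (induction I rule: infinite_finite_induct) (simp_all add: mode_string_add)

lemma mode_string_slot_add:
  assumes "p < length vs" "length ms = length vs"
  shows "mode_string V (vs[p := a + b]) ms t = mode_string V (vs[p := a]) ms t + mode_string V (vs[p := b]) ms t"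
  using assms
proof (induction vs arbitrary: ms p)
  case (Cons v vs)
  then obtain m ms' where ms: "ms = m # ms'" "length ms' = length vs" by (cases ms) auto
  show ?case
  proof (cases p)
    case 0 then show ?thesis by (simp add: ms mode_add_left)
  next
    case (Suc q) then show ?thesis using Cons.IH[of q ms'] Cons.prems ms by (simp add: mode_add_right)
  qed
qed simp

lemma mode_string_slot_scale:
  assumes "p < length vs" "length ms = length vs"
  shows "mode_string V (vs[p := c \<odot> a]) ms t = c \<odot> mode_string V (vs[p := a]) ms t"
  using assms
proof (induction vs arbitrary: ms p)
  case (Cons v vs)
  then obtain m ms' where ms: "ms = m # ms'" "length ms' = length vs" by (cases ms) auto
  show ?case
  proof (cases p)
    case 0 then show ?thesis by (simp add: ms mode_scale_left)
  next
    case (Suc q) then show ?thesis using Cons.IH[of q ms'] Cons.prems ms by (simp add: mode_scale_right)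
  qed
qed simp

text \<open>
  The commutator formula, applied successively to each factor of the string.
\<close>

lemma mode_string_commute:
  assumes "length ms = length vs" "\<And>p j. p < length vs \<Longrightarrow> j \<ge> J \<Longrightarrow> vmode V u (int j) (vs ! p) = 0"
  shows "vmode V u m (mode_string V vs ms t) = mode_string V vs ms (vmode V u m t)
     + (\<Sum>p<length vs. \<Sum>j<J. (of_int m gchoose j) \<odot>
          mode_string V (vs[p := vmode V u (int j) (vs ! p)]) (ms[p := m + ms ! p - int j]) t)"
  using assms
proof (induction vs arbitrary: ms)
  case (Cons v vs)
  then obtain k ms' where ms: "ms = k # ms'" "length ms' = length vs" by (cases ms) auto
  have J: "vmode V u (int j) v = 0" if "j \<ge> J" for j
    using Cons.prems(2)[of 0 j] that by simp
  have J': "vmode V u (int j) (vs ! p) = 0" if "p < length vs" "j \<ge> J" for p j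
    using Cons.prems(2)[of "Suc p" j] that by simp
  define T where "T = mode_string V vs ms' t"
  have "vmode V u m (mode_string V (v # vs) ms t) = vmode V v k (vmode V u m T)
     + (\<Sum>j<J. (of_int m gchoose j) \<odot> vmode V (vmode V u (int j) v) (m + k - int j) T)"
    using commutator[of J u v m k T] J by (simp add: ms T_def)
  also have "vmode V v k (vmode V u m T) = vmode V v k (mode_string V vs ms' (vmode V u m t))
     + (\<Sum>p<length vs. \<Sum>j<J. (of_int m gchoose j) \<odot>
          vmode V v k (mode_string V (vs[p := vmode V u (int j) (vs ! p)]) (ms'[p := m + ms' ! p - int j]) t))"
    unfolding T_def
    by (subst Cons.IH[OF ms(2) J']) (simp_all add: mode_add_right mode_sum_right mode_scale_right)
  finally show ?case
    by (simp add: ms T_def sum.lessThan_Suc_shift add_ac del: sum.lessThan_Suc)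
qed simp

end

section \<open>The invariant form and the vacuum\<close>

locale voa_invariant_form = vertex_operator_algebra V for V :: "('v::ab_group_add) voa" +
  fixes B :: "'v \<Rightarrow> 'v \<Rightarrow> complex"
  assumes form: "normalized_invariant_form V B"
    and cft: "strong_cft_type V"
begin

lemmas form_axioms = form[unfolded normalized_invariant_form_def]

lemmas B_linear = form_axioms[THEN conjunct1, rule_format]
lemmas B_sym = form_axioms[THEN conjunct2, THEN conjunct1, rule_format]
lemmas B_nondegenerate = form_axioms[THEN conjunct2, THEN conjunct2, THEN conjunct1, rule_format]
lemmas B_invariant = form_axioms[THEN conjunct2, THEN conjunct2, THEN conjunct2, THEN conjunct1, rule_format]
lemmas B_vac = form_axioms[THEN conjunct2, THEN conjunct2, THEN conjunct2, THEN conjunct2]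

lemma B_add_right: "B v (s + t) = B v s + B v t"
  and B_scale_right: "B v (c \<odot> t) = c * B v t"
proof -
  interpret L: Vector_Spaces.linear "vscale V" "(*)" "B v" by (rule B_linear)
  show "B v (s + t) = B v s + B v t" "B v (c \<odot> t) = c * B v t" by (rule L.add L.scale)+
qed

lemma B_zero_right [simp]: "B v 0 = 0"
  using B_scale_right[of v 0 0] by simp

lemma B_sum_right: "B v (\<Sum>i\<in>I. f i) = (\<Sum>i\<in>I. B v (f i))"
  by (induction I rule: infinite_finite_induct) (simp_all add: B_add_right)

lemma B_add_left: "B (s + t) v = B s v + B t v"
  and B_scale_left: "B (c \<odot> t) v = c * B t v"
  and B_zero_left [simp]: "B 0 v = 0"
  and B_sum_left: "B (\<Sum>i\<in>I. f i) v = (\<Sum>i\<in>I. B (f i) v)"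
  using B_sym[of _ v] by (simp_all add: B_add_right B_scale_right B_sum_right)

lemma adj_mode_homogeneous:
  assumes "u \<in> wtspace V K"
  shows "adj_mode V u n t = ((-1) ^ K) \<odot> (\<Sum>i\<le>K. (1 / fact i) \<odot>
           vmode V ((Vir V 1 ^^ i) u) (2 * int K - n - int i - 2) t)"
proof -
  have z: "(Vir V 1 ^^ i) 0 = 0" for i by (induction i) simp_all
  let ?f = "\<lambda>k::nat. ((-1) ^ k) \<odot>
     (\<Sum>i\<le>k. (1 / fact i) \<odot>
        (vmode V ((Vir V 1 ^^ i) (hcomp V u k)) (2 * int k - n - int i - 2) t))"
  have "adj_mode V u n t = Sum_any ?f" by (simp add: adj_mode_def)
  also have "\<dots> = (\<Sum>k\<in>{K}. ?f k)"
    by (rule Sum_any.expand_superset)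
      (auto simp: hcomp_homogeneous[OF assms] z split: if_splits)
  finally show ?thesis by (simp add: hcomp_homogeneous[OF assms])
qed

text \<open>
  The terms with \<open>L(1)^i u\<close>, \<open>i > 0\<close>, of the adjoint mode vanish.
\<close>

lemma adj_mode_quasiprimary:
  assumes "quasiprimary V N u"
  shows "adj_mode V u n t = ((-1) ^ N) \<odot> vmode V u (2 * int N - 2 - n) t"
proof -
  have u: "u \<in> wtspace V N" "Vir V 1 u = 0" using assms by (auto simp: quasiprimary_def)
  have z: "(Vir V 1 ^^ i) u = (if i = 0 then u else 0)" for i
    by (induction i) (simp_all add: u)
  have "(\<Sum>i\<le>N. (1 / fact i) \<odot> vmode V ((Vir V 1 ^^ i) u) (2 * int N - n - int i - 2) t)
      = (\<Sum>i\<in>{0}. (1 / fact i) \<odot> vmode V ((Vir V 1 ^^ i) u) (2 * int N - n - int i - 2) t)"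
    by (rule sum.mono_neutral_right) (auto simp: z)
  then show ?thesis by (simp add: adj_mode_homogeneous[OF u(1)] algebra_simps)
qed

lemma B_quasiprimary:
  assumes "quasiprimary V N u"
  shows "B (vmode V u n s) t = (-1) ^ N * B s (vmode V u (2 * int N - 2 - n) t)"
  by (simp add: B_invariant adj_mode_quasiprimary[OF assms] B_scale_right)

text \<open>
  The adjoint of \<open>u(m)\<close> is a sum of modes \<open>(L(1)^i u)(2K - m - i - 2)\<close> with \<open>i \<le> K\<close>; these mode
  numbers are nonnegative, so that the vacuum is annihilated.
\<close>

lemma vac_creation_mode:
  assumes "u \<in> wtspace V K" "K \<ge> 1" "m < 0"
  shows "B (vac V) (vmode V u m t) = 0"
proof -
  have "adj_mode V u m (vac V) = 0"
    unfolding adj_mode_homogeneous[OF assms(1)]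
    using assms(2,3) by (intro trans[OF arg_cong[of _ _ "vscale V _", OF sum.neutral]])
      (auto simp: mode_annihilates_vac)
  then show ?thesis using B_sym B_invariant[of u m t "vac V"] by simp
qed

text \<open>
  The adjoint of \<open>u(m)\<close> is up to a sign the single mode \<open>u(2N - 2 - m)\<close>, which annihilates the
  vacuum also for \<open>0 \<le> m \<le> 2N - 2\<close>.
\<close>

lemma vac_quasiprimary_mode:
  assumes "quasiprimary V N u" "m \<le> 2 * int N - 2"
  shows "B (vac V) (vmode V u m t) = 0"
  using B_sym[of "vac V"] B_quasiprimary[OF assms(1), of m t "vac V"] assms(2)
  by (simp add: mode_annihilates_vac)

lemma L0_self_adjoint: "B (Vir V 0 s) t = B s (Vir V 0 t)"
proof -
  have "quasiprimary V 2 (conf V)" by (simp add: quasiprimary_def conf_wtspace Vir1_conf)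
  from B_quasiprimary[OF this, of 1 s t] show ?thesis by (simp add: Vir_def)
qed

text \<open>
  \<open>L(0)\<close> is self-adjoint, because the conformal vector is quasiprimary of weight \<open>2\<close>.
\<close>

lemma B_wtspace_orthogonal:
  assumes "s \<in> wtspace V m" "t \<in> wtspace V n" "m \<noteq> n"
  shows "B s t = 0"
proof -
  have "of_nat m * B s t = of_nat n * B s t"
    using L0_self_adjoint[of s t] assms(1,2) by (simp add: wtspace_def B_scale_left B_scale_right)
  then show ?thesis using assms(3) by simp
qed

end

section \<open>Rationality of the genus zero correlation functions\<close>

lemma prod_one_powi:
  fixes y :: "nat \<Rightarrow> complex"
  assumes "p < n"
  shows "(\<Prod>i<n. y i powi (if i = p then a else 0)) = y p powi a"
proof -
  have "(\<Prod>i<n. y i powi (if i = p then a else 0)) = (\<Prod>i\<in>{p}. y i powi (if i = p then a else 0))"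
    by (rule prod.mono_neutral_right) (use assms in auto)
  then show ?thesis by simp
qed

lemma shift_modes_one:
  "p < length ms \<Longrightarrow> shift_modes (\<lambda>k. if k = p then d else 0) ms = ms[p := ms ! p + d]"
  by (auto intro!: nth_equalityI simp: nth_list_update)

lemma shift_modes_two:
  "p < length ms \<Longrightarrow> k < length ms \<Longrightarrow> p \<noteq> k \<Longrightarrow>
     shift_modes (\<lambda>i. if i = p then d else if i = k then e else 0) ms = ms[p := ms ! p + d, k := ms ! k + e]"
  by (auto intro!: nth_equalityI simp: nth_list_update)

lemma has_sum_superset:
  fixes f :: "'a \<Rightarrow> complex"
  assumes "(f has_sum s) A" "A \<subseteq> B" "\<And>x. x \<in> B \<Longrightarrow> x \<notin> A \<Longrightarrow> f x = 0"
  shows "(f has_sum s) B"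
  by (rule iffD1[OF has_sum_cong_neutral assms(1)]) (use assms(2,3) in auto)

context voa_invariant_form
begin

lemma rational_extension_iff:
  "rational_extension V B vs f \<longleftrightarrow> rat_fun (length vs) f \<and>
     (\<forall>ys. length ys = length vs \<and> ordered_region ys \<longrightarrow>
        ((\<lambda>ms. vac_expectation V B vs ms * (\<Prod>k<length vs. ys ! k powi (- (ms ! k) - 1)))
          has_sum f ys) {ms. length ms = length vs})"
  by (simp add: rational_extension_def rat_fun_def ordered_region_def)

lemma rational_extension_rat_fun: "rational_extension V B vs f \<Longrightarrow> rat_fun (length vs) f"
  by (simp add: rational_extension_iff)

lemma rational_extension_has_sum:
  assumes "rational_extension V B vs f" "length vs = n" "length ys = n" "ordered_region ys"
  shows "((\<lambda>ms. vac_expectation V B vs ms * (\<Prod>k<n. ys ! k powi (- (ms ! k) - 1)))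
          has_sum f ys) {ms. length ms = n}"
  using assms unfolding rational_extension_iff by blast

lemma rational_extension_unique:
  assumes f: "rational_extension V B vs f" and h: "rational_extension V B vs h"
    and ys: "length ys = length vs" "distinct ys"
  shows "f ys = h ys"
proof (rule rat_fun_eqI[OF rational_extension_rat_fun[OF f] rational_extension_rat_fun[OF h] _ ys])
  fix ys :: "complex list" assume "length ys = length vs" "ordered_region ys"
  then show "f ys = h ys"
    using has_sum_unique rational_extension_has_sum[OF f refl] rational_extension_has_sum[OF h refl] by blast
qed

lemma vac_expectation_slot_add:
  "p < length vs \<Longrightarrow> length ms = length vs \<Longrightarrow>
     vac_expectation V B (vs[p := a + b]) ms = vac_expectation V B (vs[p := a]) ms + vac_expectation V B (vs[p := b]) ms"
  by (simp add: vac_expectation_mode_string mode_string_slot_add B_add_right)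

lemma vac_expectation_slot_scale:
  "p < length vs \<Longrightarrow> length ms = length vs \<Longrightarrow>
     vac_expectation V B (vs[p := c \<odot> a]) ms = c * vac_expectation V B (vs[p := a]) ms"
  by (simp add: vac_expectation_mode_string mode_string_slot_scale B_scale_right)

lemma rational_extension_slot_add:
  assumes p: "p < length vs"
    and f: "rational_extension V B (vs[p := a]) f" and h: "rational_extension V B (vs[p := b]) h"
  shows "rational_extension V B (vs[p := a + b]) (\<lambda>ys. f ys + h ys)"
  unfolding rational_extension_iff length_list_update
proof (intro conjI allI impI)
  show "rat_fun (length vs) (\<lambda>ys. f ys + h ys)"
    using rational_extension_rat_fun[OF f] rational_extension_rat_fun[OF h] by (simp add: rat_fun_add)
  fix ys :: "complex list" assume ys: "length ys = length vs \<and> ordered_region ys"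
  have "((\<lambda>ms. vac_expectation V B (vs[p := a]) ms * (\<Prod>k<length vs. ys ! k powi (- (ms ! k) - 1))
           + vac_expectation V B (vs[p := b]) ms * (\<Prod>k<length vs. ys ! k powi (- (ms ! k) - 1)))
          has_sum f ys + h ys) {ms. length ms = length vs}"
    by (intro has_sum_add rational_extension_has_sum[OF f] rational_extension_has_sum[OF h])
      (use ys in simp_all)
  then show "((\<lambda>ms. vac_expectation V B (vs[p := a + b]) ms * (\<Prod>k<length vs. ys ! k powi (- (ms ! k) - 1)))
          has_sum f ys + h ys) {ms. length ms = length vs}"
    by (rule iffD1[OF has_sum_cong, rotated]) (simp add: vac_expectation_slot_add p ring_distribs)
qed

lemma rational_extension_slot_scale:
  assumes p: "p < length vs" and f: "rational_extension V B (vs[p := a]) f"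
  shows "rational_extension V B (vs[p := c \<odot> a]) (\<lambda>ys. c * f ys)"
  unfolding rational_extension_iff length_list_update
proof (intro conjI allI impI)
  show "rat_fun (length vs) (\<lambda>ys. c * f ys)"
    using rational_extension_rat_fun[OF f]
    by (simp add: rat_fun_mult[OF rat_fun_poly[OF poly_fun_const]])
  fix ys :: "complex list" assume ys: "length ys = length vs \<and> ordered_region ys"
  have "((\<lambda>ms. c * (vac_expectation V B (vs[p := a]) ms * (\<Prod>k<length vs. ys ! k powi (- (ms ! k) - 1))))
          has_sum c * f ys) {ms. length ms = length vs}"
    by (intro has_sum_cmult_right rational_extension_has_sum[OF f]) (use ys in simp_all)
  then show "((\<lambda>ms. vac_expectation V B (vs[p := c \<odot> a]) ms * (\<Prod>k<length vs. ys ! k powi (- (ms ! k) - 1)))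
          has_sum c * f ys) {ms. length ms = length vs}"
    by (rule iffD1[OF has_sum_cong, rotated]) (simp add: vac_expectation_slot_scale p)
qed

lemma rational_extension_Nil: "rational_extension V B [] (\<lambda>_. 1)"
  unfolding rational_extension_iff
  by (auto intro!: has_sum_finiteI simp: rat_fun_poly poly_fun_const vac_expectation_mode_string B_vac)

lemma rational_extension_vac:
  assumes f: "rational_extension V B vs f"
  shows "rational_extension V B (vac V # vs) (\<lambda>zs. f (tl zs))"
  unfolding rational_extension_iff
proof (intro conjI allI impI)
  show "rat_fun (length (vac V # vs)) (\<lambda>zs. f (tl zs))"
    using rat_fun_tl[OF rational_extension_rat_fun[OF f]] by simp
  fix zs :: "complex list" assume zs: "length zs = length (vac V # vs) \<and> ordered_region zs"
  then obtain x ys where zs': "zs = x # ys" "length ys = length vs" by (cases zs) auto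
  let ?n = "length vs"
  let ?T = "\<lambda>ms. vac_expectation V B (vac V # vs) ms * (\<Prod>k<length (vac V # vs). zs ! k powi (- (ms ! k) - 1))"
  have inj: "inj_on (\<lambda>ms. (- 1 :: int) # ms) {ms. length ms = ?n}" by (auto simp: inj_on_def)
  have "((?T \<circ> (\<lambda>ms. - 1 # ms)) has_sum f ys) {ms. length ms = ?n}"
  proof (rule iffD1[OF has_sum_cong rational_extension_has_sum[OF f refl zs'(2)]])
    show "ordered_region ys" using zs zs' ordered_region_Cons by blast
    show "vac_expectation V B vs ms * (\<Prod>k<?n. ys ! k powi (- (ms ! k) - 1)) = (?T \<circ> (\<lambda>ms. - 1 # ms)) ms" for ms
      by (simp add: zs' prod.lessThan_Suc_shift vac_expectation_mode_string mode_vac del: prod.lessThan_Suc)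
  qed
  then have "(?T has_sum f ys) ((\<lambda>ms. - 1 # ms) ` {ms. length ms = ?n})"
    by (rule iffD2[OF has_sum_reindex[OF inj]])
  then show "(?T has_sum f (tl zs)) {ms. length ms = length (vac V # vs)}"
    unfolding zs' list.sel
  proof (rule has_sum_superset)
    fix ms :: "int list"
    assume "ms \<in> {ms. length ms = length (vac V # vs)}" "ms \<notin> (\<lambda>ms. - 1 # ms) ` {ms. length ms = ?n}"
    then obtain m ms' where "ms = m # ms'" "m \<noteq> - 1" by (cases ms) auto
    then show "vac_expectation V B (vac V # vs) ms * (\<Prod>k<length (vac V # vs). (x # ys) ! k powi (- (ms ! k) - 1)) = 0"
      by (simp add: vac_expectation_mode_string mode_vac)
  qed auto
qed

lemma vac_expectation_Cons_nonneg:
  assumes ms: "length ms = length vs"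
    and J: "\<And>p j. p < length vs \<Longrightarrow> j \<ge> J \<Longrightarrow> vmode V u (int j) (vs ! p) = 0"
  shows "vac_expectation V B (u # vs) (int m # ms) =
     (\<Sum>p<length vs. \<Sum>j<J. (of_nat m gchoose j) *
        vac_expectation V B (vs[p := vmode V u (int j) (vs ! p)]) (ms[p := int m + ms ! p - int j]))"
  using mode_string_commute[OF ms J, where m = "int m" and t = "vac V"]
  by (simp add: vac_expectation_mode_string mode_annihilates_vac B_sum_right B_scale_right)

text \<open>
  \<open>\<langle>1, u(m) \<dots>\<rangle>\<close> vanishes for \<open>m < 0\<close>, and for \<open>m \<ge> 0\<close> the mode \<open>u(m)\<close> is commuted to the
  right until it annihilates the vacuum.  The sum over \<open>m\<close> is then a binomial series.
\<close>

lemma rational_extension_Cons: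
  assumes u: "u \<in> wtspace V K" "K \<ge> 1"
    and J: "\<And>p j. p < length vs \<Longrightarrow> j \<ge> J \<Longrightarrow> vmode V u (int j) (vs ! p) = 0"
    and F: "\<And>p j. p < length vs \<Longrightarrow> rational_extension V B (vs[p := vmode V u (int j) (vs ! p)]) (F p j)"
  shows "rational_extension V B (u # vs)
     (\<lambda>zs. \<Sum>p<length vs. \<Sum>j<J. 1 / (zs ! 0 - zs ! Suc p) ^ (j + 1) * F p j (tl zs))"
  unfolding rational_extension_iff
proof (intro conjI allI impI)
  let ?n = "length vs"
  show "rat_fun (length (u # vs)) (\<lambda>zs. \<Sum>p<?n. \<Sum>j<J. 1 / (zs ! 0 - zs ! Suc p) ^ (j + 1) * F p j (tl zs))"
  proof (intro rat_fun_sum rat_fun_mult)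
    fix p j assume p: "p \<in> {..<?n}"
    then show "rat_fun (length (u # vs)) (\<lambda>zs. 1 / (zs ! 0 - zs ! Suc p) ^ (j + 1))"
      by (intro rat_fun_inverse_diff_power) auto
    show "rat_fun (length (u # vs)) (\<lambda>zs. F p j (tl zs))"
      using rat_fun_tl[OF rational_extension_rat_fun[OF F]] p by simp
  qed
  fix zs :: "complex list" assume zs: "length zs = length (u # vs) \<and> ordered_region zs"
  then obtain x ys where zs': "zs = x # ys" "length ys = ?n" by (cases zs) auto
  have reg: "ordered_region ys" using zs zs' ordered_region_Cons by blast
  let ?P = "\<lambda>ms. \<Prod>k<?n. ys ! k powi (- (ms ! k) - 1)"
  let ?T = "\<lambda>ms. vac_expectation V B (u # vs) ms * (\<Prod>k<length (u # vs). zs ! k powi (- (ms ! k) - 1))"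
  let ?L = "{ms :: int list. length ms = ?n}"
  have nz: "ys ! k \<noteq> 0" if "k < ?n" for k
    using ordered_region_nonzero[OF reg] that zs' by simp
  have summand: "((\<lambda>(m, ms). ((of_nat m gchoose j) * x powi (- 1 - int m)) *
        vac_expectation V B (vs[p := vmode V u (int j) (vs ! p)])
          (shift_modes (\<lambda>k. if k = p then int m - int j else 0) ms) * ?P ms)
      has_sum 1 / (x - ys ! p) ^ (j + 1) * F p j ys) (UNIV \<times> ?L)" if p: "p < ?n" for p j
  proof (rule has_sum_shifted_modes[OF rational_extension_has_sum[OF F[OF p]] nz])
    have "norm (ys ! p) < norm x"
      using ordered_region_nth[of zs 0 "Suc p"] zs zs' p by simp
    from has_sum_binomial_right[OF this nz[OF p], of j]
    show "((\<lambda>m::nat. (of_nat m gchoose j) * x powi (- 1 - int m) *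
          (\<Prod>k<?n. ys ! k powi (if k = p then int m - int j else 0)))
        has_sum 1 / (x - ys ! p) ^ (j + 1)) UNIV"
      by (simp only: prod_one_powi[OF p, of "(!) ys"])
  qed (use zs' reg in simp_all)
  have inj: "inj_on (\<lambda>(m, ms). int m # ms) (UNIV \<times> ?L)" by (auto simp: inj_on_def)
  have "((?T \<circ> (\<lambda>(m, ms). int m # ms)) has_sum
      (\<Sum>p<?n. \<Sum>j<J. 1 / (x - ys ! p) ^ (j + 1) * F p j ys)) (UNIV \<times> ?L)"
  proof (rule iffD1[OF has_sum_cong has_sum_finite_sum[OF has_sum_finite_sum[OF summand]]])
    fix z assume z: "z \<in> (UNIV::nat set) \<times> ?L"
    obtain m ms where z': "z = (m, ms)" "length ms = ?n" using z by auto
    have xm: "x powi (- int m - 1) = x powi (- 1 - int m)" by (rule arg_cong[of _ _ "power_int x"]) simp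
    have "(?T \<circ> (\<lambda>(m, ms). int m # ms)) z = vac_expectation V B (u # vs) (int m # ms) * (x powi (- 1 - int m) * ?P ms)"
      by (simp add: z' zs' prod.lessThan_Suc_shift xm del: prod.lessThan_Suc)
    also have "\<dots> = (\<Sum>p<?n. \<Sum>j<J. ((of_nat m gchoose j) * x powi (- 1 - int m)) *
        vac_expectation V B (vs[p := vmode V u (int j) (vs ! p)])
          (shift_modes (\<lambda>k. if k = p then int m - int j else 0) ms) * ?P ms)"
    proof -
      have "vac_expectation V B (u # vs) (int m # ms) =
         (\<Sum>p<?n. \<Sum>j<J. (of_nat m gchoose j) *
            vac_expectation V B (vs[p := vmode V u (int j) (vs ! p)]) (ms[p := int m + ms ! p - int j]))"
        by (rule vac_expectation_Cons_nonneg) (use z' J in auto)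
      then show ?thesis
        by (simp only: sum_distrib_right) (intro sum.cong refl, simp add: shift_modes_one z' algebra_simps)
    qed
    finally show "(\<Sum>p<?n. \<Sum>j<J. case z of (m, ms) \<Rightarrow> ((of_nat m gchoose j) * x powi (- 1 - int m)) *
        vac_expectation V B (vs[p := vmode V u (int j) (vs ! p)])
          (shift_modes (\<lambda>k. if k = p then int m - int j else 0) ms) * ?P ms) = (?T \<circ> (\<lambda>(m, ms). int m # ms)) z"
      by (simp add: z')
  qed auto
  then have "(?T has_sum (\<Sum>p<?n. \<Sum>j<J. 1 / (x - ys ! p) ^ (j + 1) * F p j ys))
      ((\<lambda>(m, ms). int m # ms) ` (UNIV \<times> ?L))"
    by (rule iffD2[OF has_sum_reindex[OF inj]])
  then have "(?T has_sum (\<Sum>p<?n. \<Sum>j<J. 1 / (x - ys ! p) ^ (j + 1) * F p j ys)) {ms. length ms = length (u # vs)}"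
  proof (rule has_sum_superset)
    fix ms :: "int list"
    assume ms: "ms \<in> {ms. length ms = length (u # vs)}" "ms \<notin> (\<lambda>(m, ms). int m # ms) ` (UNIV \<times> ?L)"
    then obtain m ms' where ms': "ms = m # ms'" "length ms' = ?n" by (cases ms) auto
    have "m < 0"
    proof (rule ccontr)
      assume "\<not> m < 0"
      then have "ms = (\<lambda>(m, ms). int m # ms) (nat m, ms')" using ms' by simp
      then show False using ms ms' by blast
    qed
    then show "?T ms = 0"
      using vac_creation_mode[OF u] by (simp add: ms' vac_expectation_mode_string)
  qed auto
  then show "(?T has_sum (\<Sum>p<?n. \<Sum>j<J. 1 / (zs ! 0 - zs ! Suc p) ^ (j + 1) * F p j (tl zs))) {ms. length ms = length (u # vs)}"
    by (simp add: zs')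
qed

text \<open>
  Induction on the number of vectors: for homogeneous \<open>v\<close> of positive weight the formula of
  \<open>rational_extension_Cons\<close> removes the first vector, and in weight \<open>0\<close> there is only the vacuum.
\<close>

theorem rational_extension_exists: "\<exists>f. rational_extension V B vs f"
proof (induction "length vs" arbitrary: vs)
  case 0
  then show ?case using rational_extension_Nil by auto
next
  case (Suc n)
  then obtain v vs' where vs: "vs = v # vs'" "length vs' = n" by (cases vs) auto
  have IH: "\<exists>f. rational_extension V B ws f" if "length ws = n" for ws
    using Suc.hyps(1) that by blast
  have "\<exists>f. rational_extension V B (v # vs') f"
  proof (induction v rule: homogeneous_induct)
    case (add v v')
    then obtain f h where "rational_extension V B (v # vs') f" "rational_extension V B (v' # vs') h"
      by blast
    then show ?case using rational_extension_slot_add[of 0 "v # vs'" v f v' h] by auto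
  next
    case (homogeneous k v)
    show ?case
    proof (cases "k = 0")
      case True
      then have "v \<in> VS.span {vac V}" using homogeneous cft by (simp add: strong_cft_type_def)
      then obtain c where v: "v = c \<odot> vac V" by (auto simp: VS.span_singleton)
      obtain f where "rational_extension V B vs' f" using IH vs by blast
      then have "rational_extension V B (vac V # vs') (\<lambda>zs. f (tl zs))" by (rule rational_extension_vac)
      then show ?thesis using rational_extension_slot_scale[of 0 "vac V # vs'" "vac V" _ c] v by auto
    next
      case False
      obtain J where J: "\<forall>w\<in>set vs'. \<forall>j\<ge>J. vmode V v (int j) w = 0" using mode_trunc_list by blast
      define F where "F p j = (SOME f. rational_extension V B (vs'[p := vmode V v (int j) (vs' ! p)]) f)" for p j
      have "rational_extension V B (vs'[p := vmode V v (int j) (vs' ! p)]) (F p j)" for p j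
      proof -
        have "\<exists>f. rational_extension V B (vs'[p := vmode V v (int j) (vs' ! p)]) f"
          by (rule IH) (simp add: vs)
        then show ?thesis unfolding F_def by (rule someI_ex)
      qed
      then show ?thesis
        using rational_extension_Cons[OF homogeneous, of vs' J F] False J by auto
    qed
  qed
  then show ?case by (simp add: vs)
qed

lemma Z0_eq:
  assumes f: "rational_extension V B vs f" and ys: "length ys = length vs" "distinct ys"
  shows "Z0 V B vs ys = f ys"
  unfolding Z0_def
  by (rule the_equality) (use f rational_extension_unique[OF _ f ys] in blast)+

lemma Z0_rational_extension: "rational_extension V B vs (Z0 V B vs)"
proof -
  obtain f where f: "rational_extension V B vs f" using rational_extension_exists by blast
  obtain p q where pq: "poly_fun (length vs) p" "poly_fun (length vs) q"
    "\<And>ys. length ys = length vs \<Longrightarrow> distinct ys \<Longrightarrow> q ys \<noteq> 0 \<and> f ys = p ys / q ys"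
    using rational_extension_rat_fun[OF f] unfolding rat_fun_def by blast
  show ?thesis
    unfolding rational_extension_iff
  proof (intro conjI allI impI)
    show "rat_fun (length vs) (Z0 V B vs)"
      by (rule rat_funI[OF pq(1,2)]) (simp add: Z0_eq[OF f] pq(3))
    fix ys assume "length ys = length vs \<and> ordered_region ys"
    then show "((\<lambda>ms. vac_expectation V B vs ms * (\<Prod>k<length vs. ys ! k powi (- (ms ! k) - 1)))
          has_sum Z0 V B vs ys) {ms. length ms = length vs}"
      using rational_extension_has_sum[OF f refl, of ys] Z0_eq[OF f, of ys] ordered_region_distinct[of ys] by simp
  qed
qed

lemma Z0_slot_add:
  "p < length vs \<Longrightarrow> length ys = length vs \<Longrightarrow> distinct ys \<Longrightarrow>
     Z0 V B (vs[p := a + b]) ys = Z0 V B (vs[p := a]) ys + Z0 V B (vs[p := b]) ys"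
  by (rule Z0_eq[OF rational_extension_slot_add[OF _ Z0_rational_extension Z0_rational_extension]]) simp_all

lemma Z0_slot_scale:
  "p < length vs \<Longrightarrow> length ys = length vs \<Longrightarrow> distinct ys \<Longrightarrow>
     Z0 V B (vs[p := c \<odot> a]) ys = c * Z0 V B (vs[p := a]) ys"
  by (rule Z0_eq[OF rational_extension_slot_scale[OF _ Z0_rational_extension]]) simp_all

theorem Z0_Cons:
  assumes u: "u \<in> wtspace V K" "K \<ge> 1"
    and J: "\<And>p j. p < length vs \<Longrightarrow> j \<ge> J \<Longrightarrow> vmode V u (int j) (vs ! p) = 0"
    and ys: "length ys = length vs" "distinct (x # ys)"
  shows "Z0 V B (u # vs) (x # ys) =
     (\<Sum>p<length vs. \<Sum>j<J. 1 / (x - ys ! p) ^ (j + 1) * Z0 V B (vs[p := vmode V u (int j) (vs ! p)]) ys)"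
  using Z0_eq[OF rational_extension_Cons[OF u J Z0_rational_extension], where ys = "x # ys"] ys by simp

end

section \<open>Creation modes and null relations in genus zero\<close>

context voa_invariant_form
begin

lemma Z0_slot_zero:
  "p < length vs \<Longrightarrow> length ys = length vs \<Longrightarrow> distinct ys \<Longrightarrow> Z0 V B (vs[p := 0]) ys = 0"
  using Z0_slot_scale[of p vs ys 0 0] by simp

lemma Z0_slot_sum:
  assumes "p < length vs" "length ys = length vs" "distinct ys"
  shows "Z0 V B (vs[p := \<Sum>i\<in>I. f i]) ys = (\<Sum>i\<in>I. Z0 V B (vs[p := f i]) ys)"
  by (induction I rule: infinite_finite_induct) (simp_all add: Z0_slot_zero Z0_slot_add assms)

lemma vac_mode_string_creation:
  assumes "u \<in> wtspace V K" "K \<ge> 1" "m < 0" "length ms = length vs"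
    "\<And>p j. p < length vs \<Longrightarrow> j \<ge> J \<Longrightarrow> vmode V u (int j) (vs ! p) = 0"
  shows "B (vac V) (mode_string V vs ms (vmode V u m t)) =
     (\<Sum>p<length vs. \<Sum>j<J. - (of_int m gchoose j) *
        B (vac V) (mode_string V (vs[p := vmode V u (int j) (vs ! p)]) (ms[p := m + ms ! p - int j]) t))"
  using arg_cong[OF mode_string_commute[OF assms(4,5), where m = m and t = t], where f = "B (vac V)"]
    vac_creation_mode[OF assms(1-3), of "mode_string V vs ms t"]
  by (simp add: B_add_right B_sum_right B_scale_right sum_negf eq_neg_iff_add_eq_0)

text \<open>
  In \<open>\<langle>1, \<dots> (u(-1)v)(m) \<dots> 1\<rangle>\<close> the modes \<open>u(-1-i)\<close> are commuted to the left and the modes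
  \<open>u(i)\<close> to the right.
\<close>

lemma vac_expectation_normal_ordered:
  fixes pre post :: "'v list" and v :: 'v and mk :: int
  assumes u: "u \<in> wtspace V K" "K \<ge> 1"
    and Jpre: "\<And>p j. p < length pre \<Longrightarrow> j \<ge> J \<Longrightarrow> vmode V u (int j) (pre ! p) = 0"
    and Jpost: "\<And>p j. p < length post \<Longrightarrow> j \<ge> J \<Longrightarrow> vmode V u (int j) (post ! p) = 0"
    and mpre: "length mpre = length pre" and mpost: "length mpost = length post"
  defines "G \<equiv> \<lambda>i::nat.
      (\<Sum>p<length pre. \<Sum>j<J. - (of_int (- 1 - int i) gchoose j) *
         vac_expectation V B (pre[p := vmode V u (int j) (pre ! p)] @ v # post)
           (mpre[p := - 1 - int i + mpre ! p - int j] @ (mk + int i) # mpost))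
    + (\<Sum>q<length post. \<Sum>j<J. (of_nat i gchoose j) *
         vac_expectation V B (pre @ v # post[q := vmode V u (int j) (post ! q)])
           (mpre @ (mk - 1 - int i) # mpost[q := int i + mpost ! q - int j]))"
  shows "\<exists>I. (\<forall>i\<ge>I. G i = 0) \<and>
     vac_expectation V B (pre @ vmode V u (-1) v # post) (mpre @ mk # mpost) = (\<Sum>i<I. G i)"
proof -
  define T where "T = mode_string V post mpost (vac V)"
  define S1 where "S1 i = B (vac V) (mode_string V pre mpre (vmode V u (- 1 - int i) (vmode V v (mk + int i) T)))" for i
  define S2 where "S2 i = B (vac V) (mode_string V pre mpre (vmode V v (mk - 1 - int i) (vmode V u (int i) T)))" for i
  have G: "G i = S1 i + S2 i" for i
  proof -
    have "S1 i = (\<Sum>p<length pre. \<Sum>j<J. - (of_int (- 1 - int i) gchoose j) *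
         vac_expectation V B (pre[p := vmode V u (int j) (pre ! p)] @ v # post)
           (mpre[p := - 1 - int i + mpre ! p - int j] @ (mk + int i) # mpost))"
      unfolding S1_def
      by (subst vac_mode_string_creation[OF u _ mpre Jpre])
        (simp_all add: vac_expectation_mode_string mode_string_append mpre T_def)
    moreover have "S2 i = (\<Sum>q<length post. \<Sum>j<J. (of_nat i gchoose j) *
         vac_expectation V B (pre @ v # post[q := vmode V u (int j) (post ! q)])
           (mpre @ (mk - 1 - int i) # mpost[q := int i + mpost ! q - int j]))"
    proof -
      have "vmode V u (int i) T = (\<Sum>q<length post. \<Sum>j<J. (of_nat i gchoose j) \<odot>
          mode_string V (post[q := vmode V u (int j) (post ! q)]) (mpost[q := int i + mpost ! q - int j]) (vac V))"
        unfolding T_def using mode_string_commute[OF mpost Jpost, where m = "int i" and t = "vac V"]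
        by (simp add: mode_annihilates_vac)
      then show ?thesis
        by (simp add: S2_def mode_sum_right mode_scale_right mode_string_sum mode_string_scale
            B_sum_right B_scale_right vac_expectation_mode_string mode_string_append mpre)
    qed
    ultimately show ?thesis by (simp add: G_def)
  qed
  obtain I where I: "\<And>i. i \<ge> I \<Longrightarrow> vmode V v (mk + int i) T = 0"
      "\<And>i. i \<ge> I \<Longrightarrow> vmode V u (int i) T = 0"
      "vmode V (vmode V u (-1) v) mk T =
       (\<Sum>i<I. vmode V u (-1 - int i) (vmode V v (mk + int i) T)
             + vmode V v (mk - 1 - int i) (vmode V u (int i) T))"
    by (rule normal_ordered_modes[of v mk T u], rule that)
  have "vac_expectation V B (pre @ vmode V u (-1) v # post) (mpre @ mk # mpost) = (\<Sum>i<I. S1 i + S2 i)"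
    by (simp add: vac_expectation_mode_string mode_string_append mpre T_def[symmetric] I(3)
        mode_string_sum mode_string_add B_sum_right B_add_right S1_def S2_def)
  moreover have "\<forall>i\<ge>I. G i = 0" using I(1,2) by (simp add: G S1_def S2_def)
  ultimately show ?thesis using G by auto
qed

text \<open>
  The inserted vector \<open>u(-1)v\<close> stands between \<open>pre\<close> and \<open>post\<close>.  On the region of convergence the pole at
  \<open>y\<^sub>k = y\<^sub>p\<close> is expanded in \<open>y\<^sub>k / y\<^sub>p\<close> if \<open>p\<close> stands before \<open>k\<close>, and in \<open>y\<^sub>p / y\<^sub>k\<close> otherwise.  The two
  expansions match the two kinds of modes of the normally ordered product, and the resulting identity
  between rational functions no longer depends on the order of the points.
\<close>

lemma Z0_normal_ordered_split:
  fixes pre post :: "'v list" and v :: 'v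
  assumes u: "u \<in> wtspace V K" "K \<ge> 1"
    and Jpre: "\<And>p j. p < length pre \<Longrightarrow> j \<ge> J \<Longrightarrow> vmode V u (int j) (pre ! p) = 0"
    and Jpost: "\<And>p j. p < length post \<Longrightarrow> j \<ge> J \<Longrightarrow> vmode V u (int j) (post ! p) = 0"
    and k: "k = length pre" and n: "n = length (pre @ v # post)"
    and ys: "length ys = n" "distinct ys"
  shows "Z0 V B (pre @ vmode V u (-1) v # post) ys =
      (\<Sum>p<length pre. \<Sum>j<J. 1 / (ys ! k - ys ! p) ^ (j + 1) *
          Z0 V B (pre[p := vmode V u (int j) (pre ! p)] @ v # post) ys)
    + (\<Sum>q<length post. \<Sum>j<J. 1 / (ys ! k - ys ! (Suc (k + q))) ^ (j + 1) *
          Z0 V B (pre @ v # post[q := vmode V u (int j) (post ! q)]) ys)"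
proof (rule rat_fun_eqI[OF _ _ _ ys])
  show "rat_fun n (Z0 V B (pre @ vmode V u (-1) v # post))"
    using rational_extension_rat_fun[OF Z0_rational_extension] n by (metis length_append length_Cons)
  have rf: "rat_fun n (Z0 V B ws)" if "length ws = n" for ws
    using rational_extension_rat_fun[OF Z0_rational_extension, of ws] that by simp
  show "rat_fun n (\<lambda>ys. (\<Sum>p<length pre. \<Sum>j<J. 1 / (ys ! k - ys ! p) ^ (j + 1) *
          Z0 V B (pre[p := vmode V u (int j) (pre ! p)] @ v # post) ys)
    + (\<Sum>q<length post. \<Sum>j<J. 1 / (ys ! k - ys ! (Suc (k + q))) ^ (j + 1) *
          Z0 V B (pre @ v # post[q := vmode V u (int j) (post ! q)]) ys))"
    by (intro rat_fun_add rat_fun_sum rat_fun_mult rat_fun_inverse_diff_power rf)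
      (use k n in auto)
  fix ys :: "complex list" assume ys: "length ys = n" "ordered_region ys"
  let ?L = "{ms :: int list. length ms = n}"
  let ?P = "\<lambda>ms. \<Prod>k<n. ys ! k powi (- (ms ! k) - 1)"
  have nz: "ys ! i \<noteq> 0" if "i < n" for i using ordered_region_nonzero[OF ys(2)] that ys by simp
  have kn: "k < n" by (simp add: k n)
  \<comment> \<open>The shifts of the mode numbers by the monomials in the expansions of the two kinds of poles.\<close>
  define d1 where "d1 p j i = (\<lambda>q. if q = p then - 1 - int i - int j else if q = k then int i else 0)"
    for p j i :: nat
  define d2 where "d2 p j i = (\<lambda>q. if q = p then int i - int j else if q = k then - 1 - int i else 0)"
    for p j i :: nat
  define E1 where "E1 p j = (\<lambda>(i, ms). - (of_int (- 1 - int i) gchoose j) *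
     vac_expectation V B (pre[p := vmode V u (int j) (pre ! p)] @ v # post) (shift_modes (d1 p j i) ms) * ?P ms)" for p j
  define E2 where "E2 q j = (\<lambda>(i, ms). (of_nat i gchoose j) *
     vac_expectation V B (pre @ v # post[q := vmode V u (int j) (post ! q)]) (shift_modes (d2 (Suc (k + q)) j i) ms) * ?P ms)" for q j
  have s1: "(E1 p j has_sum 1 / (ys ! k - ys ! p) ^ (j + 1) *
       Z0 V B (pre[p := vmode V u (int j) (pre ! p)] @ v # post) ys) (UNIV \<times> ?L)" if p: "p < length pre" for p j
    unfolding E1_def
  proof (rule has_sum_shifted_modes[OF rational_extension_has_sum[OF Z0_rational_extension] nz])
    have pk: "p < n" "p \<noteq> k" using p k n by auto
    have "norm (ys ! k) < norm (ys ! p)" using ordered_region_nth[OF ys(2), of p k] p k ys n by simp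
    from has_sum_uminusI[OF has_sum_binomial_left[OF this, of j]]
    show "((\<lambda>i. - (of_int (- 1 - int i) gchoose j) * (\<Prod>q<n. ys ! q powi (d1 p j i q)))
       has_sum 1 / (ys ! k - ys ! p) ^ (j + 1)) UNIV"
      unfolding d1_def prod_two_powi[OF pk(1) kn pk(2), of "(!) ys"] by (simp add: mult.assoc)
  qed (use n ys in auto)
  have s2: "(E2 q j has_sum 1 / (ys ! k - ys ! (Suc (k + q))) ^ (j + 1) *
       Z0 V B (pre @ v # post[q := vmode V u (int j) (post ! q)]) ys) (UNIV \<times> ?L)" if q: "q < length post" for q j
    unfolding E2_def
  proof (rule has_sum_shifted_modes[OF rational_extension_has_sum[OF Z0_rational_extension] nz])
    have pk: "Suc (k + q) < n" "Suc (k + q) \<noteq> k" using q k n by auto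
    have "norm (ys ! (Suc (k + q))) < norm (ys ! k)"
      using ordered_region_nth[OF ys(2), of k "Suc (k + q)"] pk ys by simp
    from has_sum_binomial_right[OF this nz[OF pk(1)], of j]
    show "((\<lambda>i. (of_nat i gchoose j) * (\<Prod>p<n. ys ! p powi (d2 (Suc (k + q)) j i p)))
       has_sum 1 / (ys ! k - ys ! (Suc (k + q))) ^ (j + 1)) UNIV"
      unfolding d2_def prod_two_powi[OF pk(1) kn pk(2), of "(!) ys"] by (simp add: mult_ac)
  qed (use n ys in auto)
  let ?S = "(\<Sum>p<length pre. \<Sum>j<J. 1 / (ys ! k - ys ! p) ^ (j + 1) *
          Z0 V B (pre[p := vmode V u (int j) (pre ! p)] @ v # post) ys)
    + (\<Sum>q<length post. \<Sum>j<J. 1 / (ys ! k - ys ! (Suc (k + q))) ^ (j + 1) *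
          Z0 V B (pre @ v # post[q := vmode V u (int j) (post ! q)]) ys)"
  define E where "E z = (\<Sum>p<length pre. \<Sum>j<J. E1 p j z) + (\<Sum>q<length post. \<Sum>j<J. E2 q j z)" for z
  have "(E has_sum ?S) (UNIV \<times> ?L)"
    unfolding E_def by (intro has_sum_add has_sum_finite_sum s1 s2) auto
  then have sw: "((\<lambda>(ms, i). E (i, ms)) has_sum ?S) (?L \<times> UNIV)"
    by (subst (asm) has_sum_swap)
  have "((\<lambda>ms. vac_expectation V B (pre @ vmode V u (-1) v # post) ms * ?P ms) has_sum ?S) ?L"
  proof (rule has_sum_SigmaD[OF sw])
    fix ms :: "int list" assume "ms \<in> ?L"
    then have ms: "length ms = n" by simp
    define mpre mk mpost where "mpre = take k ms" and "mk = ms ! k" and "mpost = drop (Suc k) ms"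
    have ms_eq: "ms = mpre @ mk # mpost"
      using id_take_nth_drop[of k ms] kn ms by (simp add: mpre_def mk_def mpost_def)
    have lens: "length mpre = length pre" "length mpost = length post"
      using ms kn by (auto simp: mpre_def mpost_def k n)
    define G where "G i = (\<Sum>p<length pre. \<Sum>j<J. - (of_int (- 1 - int i) gchoose j) *
         vac_expectation V B (pre[p := vmode V u (int j) (pre ! p)] @ v # post)
           (mpre[p := - 1 - int i + mpre ! p - int j] @ (mk + int i) # mpost))
    + (\<Sum>q<length post. \<Sum>j<J. (of_nat i gchoose j) *
         vac_expectation V B (pre @ v # post[q := vmode V u (int j) (post ! q)])
           (mpre @ (mk - 1 - int i) # mpost[q := int i + mpost ! q - int j]))" for i :: nat
    obtain I where I: "\<forall>i\<ge>I. G i = 0"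
      "vac_expectation V B (pre @ vmode V u (-1) v # post) ms = (\<Sum>i<I. G i)"
      using vac_expectation_normal_ordered[OF u Jpre Jpost lens, where v = v and mk = mk and J = J] unfolding ms_eq G_def by blast
    have shift1: "shift_modes (d1 p j i) ms = mpre[p := - 1 - int i + mpre ! p - int j] @ (mk + int i) # mpost"
      if "p < length pre" for p j i
    proof -
      have "shift_modes (d1 p j i) ms = ms[p := ms ! p + (- 1 - int i - int j), k := ms ! k + int i]"
        unfolding d1_def by (rule shift_modes_two) (use that ms kn k n in auto)
      then show ?thesis
        using that lens k by (simp add: ms_eq list_update_append nth_append algebra_simps)
    qed
    have shift2: "shift_modes (d2 (Suc (k + q)) j i) ms = mpre @ (mk - 1 - int i) # mpost[q := int i + mpost ! q - int j]"
      if "q < length post" for q j i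
    proof -
      have "shift_modes (d2 (Suc (k + q)) j i) ms
          = ms[Suc (k + q) := ms ! (Suc (k + q)) + (int i - int j), k := ms ! k + (- 1 - int i)]"
        unfolding d2_def by (rule shift_modes_two) (use that ms kn k n in auto)
      then show ?thesis
        using that lens k by (simp add: ms_eq list_update_append nth_append algebra_simps)
    qed
    have EG: "E (i, ms) = G i * ?P ms" for i
      unfolding E_def E1_def E2_def G_def distrib_right sum_distrib_right
      by (intro arg_cong2[where f = "(+)"] sum.cong refl) (simp_all add: shift1 shift2)
    show "((\<lambda>i. case (ms, i) of (ms, i) \<Rightarrow> E (i, ms)) has_sum
        vac_expectation V B (pre @ vmode V u (-1) v # post) ms * ?P ms) UNIV"
      by (rule has_sum_finite_neutralI[of "{..<I}"])
        (use I in \<open>simp_all add: EG sum_distrib_right\<close>)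
  qed
  moreover have "((\<lambda>ms. vac_expectation V B (pre @ vmode V u (-1) v # post) ms * ?P ms) has_sum
      Z0 V B (pre @ vmode V u (-1) v # post) ys) ?L"
    by (rule rational_extension_has_sum[OF Z0_rational_extension]) (use n ys in auto)
  ultimately show "Z0 V B (pre @ vmode V u (-1) v # post) ys = ?S"
    by (rule has_sum_unique[rotated])
qed

lemma Z0_normal_ordered:
  assumes u: "u \<in> wtspace V K" "K \<ge> 1"
    and J: "\<And>p j. p < length vs \<Longrightarrow> j \<ge> J \<Longrightarrow> vmode V u (int j) (vs ! p) = 0"
    and k: "k < length vs"
    and ys: "length ys = length vs" "distinct ys"
  shows "Z0 V B (vs[k := vmode V u (-1) (vs ! k)]) ys =
      (\<Sum>p\<in>{..<length vs} - {k}. \<Sum>j<J. 1 / (ys ! k - ys ! p) ^ (j + 1) *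
          Z0 V B (vs[p := vmode V u (int j) (vs ! p)]) ys)"
proof -
  define pre v post where "pre = take k vs" and "v = vs ! k" and "post = drop (Suc k) vs"
  have vs: "vs = pre @ v # post"
    using id_take_nth_drop[OF k] by (simp add: pre_def v_def post_def)
  have lens: "length pre = k" "length post = length vs - Suc k" using k by (auto simp: pre_def post_def)
  have Jpre: "vmode V u (int j) (pre ! p) = 0" if "p < length pre" "j \<ge> J" for p j
    using J[of p j] that lens k by (simp add: pre_def)
  have Jpost: "vmode V u (int j) (post ! p) = 0" if "p < length post" "j \<ge> J" for p j
    using J[of "Suc k + p" j] that lens k by (simp add: post_def)
  let ?f = "\<lambda>p. \<Sum>j<J. 1 / (ys ! k - ys ! p) ^ (j + 1) * Z0 V B (vs[p := vmode V u (int j) (vs ! p)]) ys"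
  have split: "{..<length vs} - {k} = {..<k} \<union> {k + 1..<length vs}" using k by auto
  have "(\<Sum>p\<in>{..<length vs} - {k}. ?f p) = (\<Sum>p<k. ?f p) + (\<Sum>p\<in>{k + 1..<length vs}. ?f p)"
    unfolding split by (rule sum.union_disjoint) auto
  also have "(\<Sum>p\<in>{k + 1..<length vs}. ?f p) = (\<Sum>q<length post. ?f (Suc (k + q)))"
    by (rule sum.reindex_bij_witness[of _ "\<lambda>q. Suc (k + q)" "\<lambda>p. p - (k + 1)"]) (use k lens in auto)
  also have "(\<Sum>p<k. ?f p) = (\<Sum>p<length pre. \<Sum>j<J. 1 / (ys ! k - ys ! p) ^ (j + 1) *
          Z0 V B (pre[p := vmode V u (int j) (pre ! p)] @ v # post) ys)"
    unfolding lens by (intro sum.cong refl) (use lens(1) in \<open>simp add: vs list_update_append nth_append\<close>)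
  also have "(\<Sum>q<length post. ?f (Suc (k + q))) =
      (\<Sum>q<length post. \<Sum>j<J. 1 / (ys ! k - ys ! (Suc (k + q))) ^ (j + 1) *
          Z0 V B (pre @ v # post[q := vmode V u (int j) (post ! q)]) ys)"
    by (intro sum.cong refl) (use lens(1) in \<open>simp add: vs list_update_append nth_append\<close>)
  finally have sum_eq: "(\<Sum>p\<in>{..<length vs} - {k}. ?f p) =
      (\<Sum>p<length pre. \<Sum>j<J. 1 / (ys ! k - ys ! p) ^ (j + 1) *
          Z0 V B (pre[p := vmode V u (int j) (pre ! p)] @ v # post) ys)
    + (\<Sum>q<length post. \<Sum>j<J. 1 / (ys ! k - ys ! (Suc (k + q))) ^ (j + 1) *
          Z0 V B (pre @ v # post[q := vmode V u (int j) (post ! q)]) ys)" .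
  have vk: "vs[k := vmode V u (-1) (vs ! k)] = pre @ vmode V u (-1) v # post"
    unfolding v_def[symmetric] by (subst vs) (simp add: list_update_append lens(1))
  show ?thesis
    unfolding vk sum_eq
    by (rule Z0_normal_ordered_split[OF u Jpre Jpost]) (use ys lens(1) vs in auto)
qed

text \<open>
  \<open>(L(-1)u)(-1-m) = (m + 1) u(-2-m)\<close> and \<open>(L(-1)u)(j) = - j u(j-1)\<close>, so that the formula for \<open>L(-1)u\<close>
  and \<open>m\<close> is the one for \<open>u\<close> and \<open>m + 1\<close>.
\<close>

theorem Z0_creation_mode:
  assumes "u \<in> wtspace V K" "K \<ge> 1"
    and "\<And>p j. p < length vs \<Longrightarrow> j \<ge> J \<Longrightarrow> vmode V u (int j) (vs ! p) = 0"
    and k: "k < length vs"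
    and ys: "length ys = length vs" "distinct ys"
  shows "Z0 V B (vs[k := vmode V u (- 1 - int m) (vs ! k)]) ys =
      (\<Sum>p\<in>{..<length vs} - {k}. \<Sum>j<J.
          (-1) ^ m * of_nat ((m + j) choose m) / (ys ! k - ys ! p) ^ (m + j + 1) *
          Z0 V B (vs[p := vmode V u (int j) (vs ! p)]) ys)"
  using assms(1-3)
proof (induction m arbitrary: u K J)
  case 0
  show ?case using Z0_normal_ordered[OF 0 k ys] by simp
next
  case (Suc m)
  let ?u = "Vir V (-1) u"
  have J: "vmode V ?u (int j) (vs ! p) = 0" if "p < length vs" "j \<ge> Suc J" for p j
    using Suc.prems(3)[of p "j - 1"] that by (simp add: mode_translation of_nat_diff)
  have "of_nat (Suc m) * Z0 V B (vs[k := vmode V u (- 1 - int (Suc m)) (vs ! k)]) ys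
      = Z0 V B (vs[k := vmode V ?u (- 1 - int m) (vs ! k)]) ys"
  proof -
    have "vmode V ?u (- 1 - int m) (vs ! k) = of_nat (Suc m) \<odot> vmode V u (- 1 - int (Suc m)) (vs ! k)"
      by (simp add: mode_translation algebra_simps)
    then show ?thesis using k ys by (simp only: Z0_slot_scale)
  qed
  also have "\<dots> = (\<Sum>p\<in>{..<length vs} - {k}. \<Sum>j<Suc J.
          (-1) ^ m * of_nat ((m + j) choose m) / (ys ! k - ys ! p) ^ (m + j + 1) *
          Z0 V B (vs[p := vmode V ?u (int j) (vs ! p)]) ys)"
    by (rule Suc.IH[OF Vir_minus1_wtspace[OF Suc.prems(1)] _ J]) simp_all
  also have "\<dots> = (\<Sum>p\<in>{..<length vs} - {k}. \<Sum>j<J. of_nat (Suc m) *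
          ((-1) ^ Suc m * of_nat ((Suc m + j) choose Suc m) / (ys ! k - ys ! p) ^ (Suc m + j + 1) *
          Z0 V B (vs[p := vmode V u (int j) (vs ! p)]) ys))"
  proof (rule sum.cong[OF refl])
    fix p assume "p \<in> {..<length vs} - {k}"
    then have p: "p < length vs" by simp
    have tr: "Z0 V B (vs[p := vmode V ?u (int j) (vs ! p)]) ys
        = - of_nat j * Z0 V B (vs[p := vmode V u (int j - 1) (vs ! p)]) ys" for j
      using p ys by (simp only: mode_translation Z0_slot_scale) simp
    have bin: "complex_of_nat (Suc m) * of_nat ((Suc m + j) choose Suc m) = of_nat (Suc j) * of_nat ((m + Suc j) choose m)" for j
    proof -
      have "Suc m * ((Suc m + j) choose Suc m) = Suc j * ((m + Suc j) choose m)"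
        using choose_mult_lemma[of m j 1] Suc_times_binomial_add[of m j] binomial_symmetric[of m "m + Suc j"]
        by (simp add: mult.commute)
      then show ?thesis by (metis of_nat_mult)
    qed
    show "(\<Sum>j<Suc J. (-1) ^ m * of_nat ((m + j) choose m) / (ys ! k - ys ! p) ^ (m + j + 1) *
          Z0 V B (vs[p := vmode V ?u (int j) (vs ! p)]) ys)
       = (\<Sum>j<J. of_nat (Suc m) *
          ((-1) ^ Suc m * of_nat ((Suc m + j) choose Suc m) / (ys ! k - ys ! p) ^ (Suc m + j + 1) *
          Z0 V B (vs[p := vmode V u (int j) (vs ! p)]) ys))"
      unfolding tr sum.lessThan_Suc_shift
    proof (subst of_nat_0, subst minus_zero, subst mult_zero_left, subst mult_zero_right, subst add_0, intro sum.cong refl)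
      fix j
      let ?z = "Z0 V B (vs[p := vmode V u (int j) (vs ! p)]) ys"
      let ?d = "ys ! k - ys ! p"
      have "of_nat (Suc m) * ((-1) ^ Suc m * of_nat ((Suc m + j) choose Suc m) / ?d ^ (Suc m + j + 1) * ?z)
          = (-1) ^ Suc m * (of_nat (Suc m) * of_nat ((Suc m + j) choose Suc m)) / ?d ^ (Suc m + j + 1) * ?z"
        by simp
      also have "\<dots> = (-1) ^ m * of_nat ((m + Suc j) choose m) / ?d ^ (m + Suc j + 1) * (- of_nat (Suc j) * ?z)"
        unfolding bin by (simp add: mult_ac del: of_nat_Suc)
      finally have e: "of_nat (Suc m) * ((-1) ^ Suc m * of_nat ((Suc m + j) choose Suc m) / ?d ^ (Suc m + j + 1) * ?z)
          = (-1) ^ m * of_nat ((m + Suc j) choose m) / ?d ^ (m + Suc j + 1) * (- of_nat (Suc j) * ?z)" .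
      have W: "Z0 V B (vs[p := vmode V u (int (Suc j) - 1) (vs ! p)]) ys = ?z" by simp
      show "(-1) ^ m * of_nat ((m + Suc j) choose m) / ?d ^ (m + Suc j + 1) *
          (- of_nat (Suc j) * Z0 V B (vs[p := vmode V u (int (Suc j) - 1) (vs ! p)]) ys)
        = of_nat (Suc m) * ((-1) ^ Suc m * of_nat ((Suc m + j) choose Suc m) / ?d ^ (Suc m + j + 1) * ?z)"
        by (simp only: W e)
    qed
  qed
  also have "\<dots> = of_nat (Suc m) * (\<Sum>p\<in>{..<length vs} - {k}. \<Sum>j<J.
          (-1) ^ Suc m * of_nat ((Suc m + j) choose Suc m) / (ys ! k - ys ! p) ^ (Suc m + j + 1) *
          Z0 V B (vs[p := vmode V u (int j) (vs ! p)]) ys)"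
    by (simp only: sum_distrib_left)
  finally show ?case by (simp only: mult_cancel_left of_nat_eq_0_iff) simp
qed

text \<open>
  For \<open>0 \<le> m \<le> 2N - 2\<close> the mode \<open>u(m)\<close> annihilates the vacuum on both sides, so that the commutators
  of \<open>u(m)\<close> with all the factors add up to zero.
\<close>

theorem Z0_null_relation:
  assumes u: "quasiprimary V N u" and m: "m \<le> 2 * N - 2"  "N \<ge> 1"
    and J: "\<And>p j. p < length vs \<Longrightarrow> j \<ge> J \<Longrightarrow> vmode V u (int j) (vs ! p) = 0"
    and ys: "length ys = length vs" "distinct ys"
  shows "(\<Sum>p<length vs. \<Sum>j<J. of_nat (m choose j) * ys ! p ^ (m - j) *
          Z0 V B (vs[p := vmode V u (int j) (vs ! p)]) ys) = 0"
proof (rule rat_fun_eqI[OF _ _ _ ys, of _ "\<lambda>_. 0"])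
  let ?n = "length vs"
  have rf: "rat_fun ?n (Z0 V B ws)" if "length ws = ?n" for ws
    using rational_extension_rat_fun[OF Z0_rational_extension, of ws] that by simp
  show "rat_fun ?n (\<lambda>ys. \<Sum>p<?n. \<Sum>j<J. of_nat (m choose j) * ys ! p ^ (m - j) *
          Z0 V B (vs[p := vmode V u (int j) (vs ! p)]) ys)"
    by (intro rat_fun_sum rat_fun_mult rf rat_fun_poly poly_fun_const poly_fun_power poly_fun_nth) auto
  show "rat_fun ?n (\<lambda>_. 0)" by (intro rat_fun_poly poly_fun_const)
  fix ys :: "complex list" assume ys: "length ys = ?n" "ordered_region ys"
  let ?L = "{ms :: int list. length ms = ?n}"
  let ?P = "\<lambda>ms. \<Prod>k<?n. ys ! k powi (- (ms ! k) - 1)"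
  have nz: "ys ! i \<noteq> 0" if "i < ?n" for i using ordered_region_nonzero[OF ys(2)] that ys by simp
  have s: "((\<lambda>(i, ms). of_nat (m choose j) *
        vac_expectation V B (vs[p := vmode V u (int j) (vs ! p)])
          (shift_modes (\<lambda>k. if k = p then int m - int j else 0) ms) * ?P ms)
      has_sum of_nat (m choose j) * ys ! p ^ (m - j) * Z0 V B (vs[p := vmode V u (int j) (vs ! p)]) ys) ({()} \<times> ?L)"
    if p: "p < ?n" for p j
  proof (rule has_sum_shifted_modes[OF rational_extension_has_sum[OF Z0_rational_extension] nz])
    have "of_nat (m choose j) * ys ! p ^ (m - j) = of_nat (m choose j) * ys ! p powi (int m - int j)"
    proof (cases "j \<le> m")
      case True
      then have "int m - int j = int (m - j)" by simp
      then show ?thesis by (simp only: power_int_of_nat)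
    qed (simp add: binomial_eq_0)
    then show "((\<lambda>i. of_nat (m choose j) * (\<Prod>k<?n. ys ! k powi (if k = p then int m - int j else 0)))
        has_sum of_nat (m choose j) * ys ! p ^ (m - j)) {()}"
      by (intro has_sum_finiteI) (simp_all add: prod_one_powi[OF p, of "(!) ys"])
  qed (use ys in auto)
  have "((\<lambda>z. \<Sum>p<?n. \<Sum>j<J. case z of (i, ms) \<Rightarrow> of_nat (m choose j) *
        vac_expectation V B (vs[p := vmode V u (int j) (vs ! p)])
          (shift_modes (\<lambda>k. if k = p then int m - int j else 0) ms) * ?P ms)
      has_sum (\<Sum>p<?n. \<Sum>j<J. of_nat (m choose j) * ys ! p ^ (m - j) *
          Z0 V B (vs[p := vmode V u (int j) (vs ! p)]) ys)) ({()} \<times> ?L)"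
    by (intro has_sum_finite_sum s) auto
  moreover have "((\<lambda>z. \<Sum>p<?n. \<Sum>j<J. case z of (i, ms) \<Rightarrow> of_nat (m choose j) *
        vac_expectation V B (vs[p := vmode V u (int j) (vs ! p)])
          (shift_modes (\<lambda>k. if k = p then int m - int j else 0) ms) * ?P ms) has_sum 0) ({()} \<times> ?L)"
  proof (rule has_sum_0)
    fix z assume "z \<in> {()} \<times> ?L"
    then obtain ms where z: "z = ((), ms)" "length ms = ?n" by auto
    have "(\<Sum>p<?n. \<Sum>j<J. of_nat (m choose j) *
        vac_expectation V B (vs[p := vmode V u (int j) (vs ! p)]) (ms[p := int m + ms ! p - int j]))
       = B (vac V) (vmode V u (int m) (mode_string V vs ms (vac V)))"
      using arg_cong[OF mode_string_commute[OF z(2) J, where m = "int m" and t = "vac V"], where f = "B (vac V)"]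
      by (simp add: mode_annihilates_vac B_sum_right B_scale_right vac_expectation_mode_string binomial_gbinomial)
    also have "\<dots> = 0" using m by (intro vac_quasiprimary_mode[OF u]) (simp add: of_nat_diff)
    finally have 0: "(\<Sum>p<?n. \<Sum>j<J. of_nat (m choose j) *
        vac_expectation V B (vs[p := vmode V u (int j) (vs ! p)]) (ms[p := int m + ms ! p - int j])) = 0" .
    have "(\<Sum>p<?n. \<Sum>j<J. case z of (i, ms) \<Rightarrow> of_nat (m choose j) *
        vac_expectation V B (vs[p := vmode V u (int j) (vs ! p)])
          (shift_modes (\<lambda>k. if k = p then int m - int j else 0) ms) * ?P ms)
      = (\<Sum>p<?n. \<Sum>j<J. of_nat (m choose j) *
        vac_expectation V B (vs[p := vmode V u (int j) (vs ! p)]) (ms[p := int m + ms ! p - int j])) * ?P ms"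
      unfolding sum_distrib_right z
      by (intro sum.cong refl) (simp add: shift_modes_one z algebra_simps)
    then show "(\<Sum>p<?n. \<Sum>j<J. case z of (i, ms) \<Rightarrow> of_nat (m choose j) *
        vac_expectation V B (vs[p := vmode V u (int j) (vs ! p)])
          (shift_modes (\<lambda>k. if k = p then int m - int j else 0) ms) * ?P ms) = 0"
      unfolding 0 by simp
  qed
  ultimately show "(\<Sum>p<?n. \<Sum>j<J. of_nat (m choose j) * ys ! p ^ (m - j) *
          Z0 V B (vs[p := vmode V u (int j) (vs ! p)]) ys) = 0"
    by (rule has_sum_unique)
qed

end

section \<open>The kernel \<open>\<pi>\<^sub>N\<close> and its derivatives\<close>

text \<open>
  Higher derivatives are computed by exhibiting the whole sequence of Taylor coefficients.
\<close>

lemma sderiv_family: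
  fixes G :: "nat \<Rightarrow> complex \<Rightarrow> complex"
  assumes S: "open S"
    and G: "\<And>m x. x \<in> S \<Longrightarrow> (G m has_field_derivative of_nat (Suc m) * G (Suc m) x) (at x)"
    and f: "\<And>x. x \<in> S \<Longrightarrow> f x = G 0 x" and x: "x \<in> S"
  shows "sderiv m f x = G m x"
proof -
  have "(deriv ^^ m) f x = fact m * G m x" if "x \<in> S" for x
    using that
  proof (induction m arbitrary: x)
    case 0
    then show ?case by (simp add: f)
  next
    case (Suc m)
    have "eventually (\<lambda>y. y \<in> S) (nhds x)" using S Suc.prems by (rule eventually_nhds_in_open)
    then have ev: "eventually (\<lambda>y. (deriv ^^ m) f y = fact m * G m y) (nhds x)"
      by eventually_elim (rule Suc.IH)
    have "(deriv ^^ Suc m) f x = deriv (\<lambda>y. fact m * G m y) x"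
      using deriv_cong_ev[OF ev refl] by simp
    also have "\<dots> = fact m * (of_nat (Suc m) * G (Suc m) x)"
      by (intro DERIV_imp_deriv DERIV_cmult G Suc.prems)
    finally show ?case by (simp add: algebra_simps)
  qed
  from this[OF x] show ?thesis by (simp add: sderiv_def)
qed

lemma sderiv_poly_0: "sderiv l (poly q) 0 = coeff q l" for q :: "complex poly"
proof -
  have "sderiv l (poly q) 0 = (\<lambda>m x. poly ((pderiv ^^ m) q) x / fact m) l 0"
  proof (rule sderiv_family[of UNIV])
    show "((\<lambda>x. poly ((pderiv ^^ m) q) x / fact m) has_field_derivative
        of_nat (Suc m) * (poly ((pderiv ^^ Suc m) q) x / fact (Suc m))) (at x)" for m x
    proof -
      have "of_nat (Suc m) * (poly ((pderiv ^^ Suc m) q) x / fact (Suc m)) = poly (pderiv ((pderiv ^^ m) q)) x / fact m"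
        by (simp add: fact_Suc del: of_nat_Suc)
      then show ?thesis using DERIV_cdivide[OF poly_DERIV[of "(pderiv ^^ m) q" x], of "fact m"] by (simp only:)
    qed
  qed auto
  also have "\<dots> = coeff q l"
    by (simp add: poly_0_coeff_0 coeff_higher_pderiv pochhammer_fact flip: pochhammer_fact)
  finally show ?thesis .
qed

text \<open>
  \<open>lagrangeQ\<close> as a polynomial, whose degree and coefficients can be computed with.
\<close>

definition lagrange_poly :: "nat \<Rightarrow> (nat \<Rightarrow> complex) \<Rightarrow> nat \<Rightarrow> complex poly" where
  "lagrange_poly N A i = (\<Prod>j\<in>{..2 * N - 2} - {i}. smult (1 / (A i - A j)) [:- A j, 1:])"

lemma poly_lagrange_poly: "poly (lagrange_poly N A i) = lagrangeQ N A i"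
  unfolding lagrange_poly_def lagrangeQ_def poly_prod
  by (intro ext prod.cong refl) (simp add: divide_inverse algebra_simps)

lemma degree_lagrange_poly: "i \<le> 2 * N - 2 \<Longrightarrow> degree (lagrange_poly N A i) \<le> 2 * N - 2"
proof -
  assume i: "i \<le> 2 * N - 2"
  have "degree (lagrange_poly N A i) \<le> (\<Sum>j\<in>{..2 * N - 2} - {i}. degree (smult (1 / (A i - A j)) [:- A j, 1:]))"
    unfolding lagrange_poly_def by (rule degree_prod_sum_le[unfolded o_def]) simp
  also have "\<dots> \<le> (\<Sum>j\<in>{..2 * N - 2} - {i}. 1)"
    by (rule sum_mono) (rule order_trans[OF degree_smult_le], simp)
  also have "\<dots> = 2 * N - 2" using i by simp
  finally show ?thesis .
qed

lemma lagrangeQ_expand: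
  assumes "i \<le> 2 * N - 2"
  shows "lagrangeQ N A i y = (\<Sum>l\<le>2 * N - 2. sderiv l (lagrangeQ N A i) 0 * y ^ l)"
proof -
  have "lagrangeQ N A i y = (\<Sum>l\<le>2 * N - 2. coeff (lagrange_poly N A i) l * y ^ l)"
    unfolding poly_lagrange_poly[symmetric]
    unfolding poly_altdef
    by (rule sum.mono_neutral_left) (use degree_lagrange_poly[OF assms] in \<open>auto simp: coeff_eq_0\<close>)
  then show ?thesis by (simp flip: poly_lagrange_poly add: sderiv_poly_0)
qed

lemma lagrangeQ_node:
  assumes "inj_on A {..2 * N - 2}" "i \<le> 2 * N - 2" "k \<le> 2 * N - 2"
  shows "lagrangeQ N A i (A k) = (if i = k then 1 else 0)"
proof (cases "i = k")
  case True
  have "(A k - A j) / (A i - A j) = 1" if "j \<in> {..2 * N - 2} - {i}" for j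
    using that True assms(1,2) by (auto simp: inj_on_def)
  then show ?thesis using True by (simp add: lagrangeQ_def)
next
  case False
  then show ?thesis using assms(3) by (auto simp: lagrangeQ_def intro!: prod_zero)
qed

text \<open>
  As polynomials in \<open>y\<close> of degree less than \<open>2N\<close>, both sides agree at \<open>y = x\<close> and at the
  \<open>2N - 1\<close> nodes.
\<close>

lemma node_product_eq:
  assumes N: "N \<ge> 1" and A: "inj_on A {..2 * N - 2}" and x: "x \<notin> A ` {..2 * N - 2}"
  shows "(\<Prod>l\<le>2 * N - 2. (y - A l) / (x - A l)) = 1 + (x - y) * (\<Sum>l\<le>2 * N - 2. fN N A l x * y ^ l)"
proof -
  define p where "p = (\<Prod>l\<le>2 * N - 2. smult (1 / (x - A l)) [:- A l, 1:])"
  define s where "s = (\<Sum>i\<le>2 * N - 2. smult (- 1 / (x - A i)) (lagrange_poly N A i))"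
  define q where "q = 1 + [:x, -1:] * s"
  have fs: "(\<Sum>l\<le>2 * N - 2. fN N A l x * y ^ l) = poly s y" for y
  proof -
    have "(\<Sum>l\<le>2 * N - 2. fN N A l x * y ^ l)
        = (\<Sum>l\<le>2 * N - 2. \<Sum>i\<le>2 * N - 2. - (1 / (x - A i)) * (sderiv l (lagrangeQ N A i) 0 * y ^ l))"
      by (simp add: fN_def sum_distrib_right sum_negf)
    also have "\<dots> = (\<Sum>i\<le>2 * N - 2. - (1 / (x - A i)) * (\<Sum>l\<le>2 * N - 2. sderiv l (lagrangeQ N A i) 0 * y ^ l))"
      by (subst sum.swap) (simp add: sum_distrib_left)
    also have "\<dots> = poly s y"
      by (simp add: s_def poly_sum poly_lagrange_poly lagrangeQ_expand[symmetric])
    finally show ?thesis .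
  qed
  have "p = q"
  proof (rule poly_eqI_degree)
    let ?X = "insert x (A ` {..2 * N - 2})"
    have "card (A ` {..2 * N - 2}) = 2 * N - 1" using card_image[OF A] N by simp
    moreover have "x \<notin> A ` {..2 * N - 2}" using x by auto
    ultimately have card: "card ?X = 2 * N" using N by simp
    have "degree p \<le> (\<Sum>l\<le>2 * N - 2. degree (smult (1 / (x - A l)) [:- A l, 1:]))"
      unfolding p_def by (rule degree_prod_sum_le[unfolded o_def]) simp
    also have "\<dots> \<le> (\<Sum>l\<le>2 * N - 2. 1)"
      by (rule sum_mono) (rule order_trans[OF degree_smult_le], simp)
    finally show "card ?X > degree p" using N unfolding card by simp
    have "degree s \<le> 2 * N - 2"
      unfolding s_def
      by (intro degree_sum_le order_trans[OF degree_smult_le] degree_lagrange_poly) auto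
    then have "degree ([:x, -1:] * s) \<le> 2 * N - 1"
      using degree_mult_le[of "[:x, -1:]" s] N by simp
    then have "degree q \<le> 2 * N - 1" unfolding q_def by (intro degree_add_le) auto
    then show "card ?X > degree q" using N unfolding card by simp
    fix y assume "y \<in> ?X"
    then consider "y = x" | k where "k \<le> 2 * N - 2" "y = A k" by auto
    then show "poly p y = poly q y"
    proof cases
      case 1
      have "poly p x = 1"
        unfolding p_def poly_prod using x by (intro prod.neutral) (auto simp: divide_simps)
      then show ?thesis using 1 by (simp add: q_def)
    next
      case 2
      have "poly p y = 0" using 2 by (auto simp: p_def poly_prod intro!: prod_zero)
      have "poly s y = (\<Sum>i\<le>2 * N - 2. if i = k then - 1 / (x - A k) else 0)"
        unfolding s_def poly_sum
        by (intro sum.cong refl) (use 2 A in \<open>auto simp: poly_lagrange_poly lagrangeQ_node\<close>)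
      then have "poly s y = - 1 / (x - A k)" using 2 by simp
      moreover have "poly q y = 1 + (x - y) * poly s y" by (simp add: q_def algebra_simps)
      moreover have "x \<noteq> A k" using 2(1) x by auto
      ultimately have "poly q y = 0" using 2(2) by simp
      with \<open>poly p y = 0\<close> show ?thesis by simp
    qed
  qed
  moreover have "poly p y = (\<Prod>l\<le>2 * N - 2. (y - A l) / (x - A l))"
    unfolding p_def poly_prod by (intro prod.cong refl) (simp add: divide_inverse algebra_simps)
  moreover have "poly q y = 1 + (x - y) * poly s y" by (simp add: q_def algebra_simps)
  ultimately show ?thesis by (simp add: fs)
qed

lemma piN_expand:
  assumes "N \<ge> 1" "inj_on A {..2 * N - 2}" "x \<notin> A ` {..2 * N - 2}" "x \<noteq> y"
  shows "piN N A x y = 1 / (x - y) + (\<Sum>l\<le>2 * N - 2. fN N A l x * y ^ l)"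
  unfolding piN_def node_product_eq[OF assms(1-3)] using assms(4) by (simp add: distrib_left)

lemma inverse_power_has_derivative:
  fixes x a :: complex
  assumes "x \<noteq> a"
  shows "((\<lambda>x. 1 / (x - a) ^ (k + 1)) has_field_derivative - of_nat (k + 1) / (x - a) ^ (k + 2)) (at x)"
proof -
  have e: "(x - a) powi (- int k) = 1 / (x - a) ^ k" for x and k :: nat
    by (simp add: power_int_minus divide_inverse)
  have "((\<lambda>x. (x - a) powi (- int (k + 1))) has_field_derivative
      of_int (- int (k + 1)) * (x - a) powi (- int (k + 1) - 1) * (1 - 0)) (at x)"
    using assms by (intro DERIV_power_int DERIV_diff DERIV_ident DERIV_const) auto
  moreover have "- int (k + 1) - 1 = - int (k + 2)" by simp
  ultimately show ?thesis unfolding e by (simp only: e) simp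
qed

lemma inverse_power_has_derivative':
  fixes x y :: complex
  assumes "x \<noteq> y"
  shows "((\<lambda>y. 1 / (x - y) ^ (k + 1)) has_field_derivative of_nat (k + 1) / (x - y) ^ (k + 2)) (at y)"
proof -
  have "((\<lambda>y. x - y) has_field_derivative 0 - 1) (at y)" by (intro DERIV_diff DERIV_ident DERIV_const)
  from DERIV_chain2[OF inverse_power_has_derivative[of "x - y" 0 k, unfolded diff_0_right] this]
  show ?thesis using assms by (simp del: of_nat_add of_nat_Suc)
qed

lemma fN_has_family_derivative:
  fixes A c :: "nat \<Rightarrow> complex" and x :: complex
  assumes "x \<notin> A ` {..2 * N - 2}"
  shows "((\<lambda>x. - (\<Sum>i\<le>2 * N - 2. (-1) ^ m / (x - A i) ^ (m + 1) * c i)) has_field_derivative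
     of_nat (Suc m) * - (\<Sum>i\<le>2 * N - 2. (-1) ^ Suc m / (x - A i) ^ (Suc m + 1) * c i)) (at x)"
proof -
  have "((\<lambda>x. (-1) ^ m / (x - A i) ^ (m + 1) * c i) has_field_derivative
      of_nat (Suc m) * ((-1) ^ Suc m / (x - A i) ^ (Suc m + 1) * c i)) (at x)" if "i \<le> 2 * N - 2" for i
  proof -
    have "x \<noteq> A i" using assms that by auto
    from DERIV_cmult[OF inverse_power_has_derivative[OF this, of m], of "(-1) ^ m * c i"]
    show ?thesis by (simp add: mult_ac del: of_nat_add of_nat_Suc)
  qed
  then have "((\<lambda>x. \<Sum>i\<le>2 * N - 2. (-1) ^ m / (x - A i) ^ (m + 1) * c i) has_field_derivative
     (\<Sum>i\<le>2 * N - 2. of_nat (Suc m) * ((-1) ^ Suc m / (x - A i) ^ (Suc m + 1) * c i))) (at x)"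
    by (intro DERIV_sum) auto
  from DERIV_minus[OF this] show ?thesis by (simp only: sum_distrib_left mult_minus_right)
qed

lemma open_avoiding_nodes: "open (- (A ` {..2 * N - 2 :: nat}) :: complex set)"
  by (simp add: finite_imp_closed open_Compl)

lemma sderiv_fN:
  assumes "x \<notin> A ` {..2 * N - 2}"
  shows "sderiv m (fN N A l) x = - (\<Sum>i\<le>2 * N - 2. (-1) ^ m / (x - A i) ^ (m + 1) * sderiv l (lagrangeQ N A i) 0)"
  by (rule sderiv_family[OF open_avoiding_nodes[of A N],
        where G = "\<lambda>m x. - (\<Sum>i\<le>2 * N - 2. (-1) ^ m / (x - A i) ^ (m + 1) * sderiv l (lagrangeQ N A i) 0)"])
    (use assms fN_has_family_derivative in \<open>auto simp: fN_def\<close>)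

lemma sderiv_fN_has_derivative:
  assumes "x \<notin> A ` {..2 * N - 2}"
  shows "((\<lambda>x. sderiv m (fN N A l) x) has_field_derivative of_nat (Suc m) * sderiv (Suc m) (fN N A l) x) (at x)"
proof (rule has_field_derivative_transform_within_open[OF _ open_avoiding_nodes[of A N]])
  show "((\<lambda>x. - (\<Sum>i\<le>2 * N - 2. (-1) ^ m / (x - A i) ^ (m + 1) * sderiv l (lagrangeQ N A i) 0))
      has_field_derivative of_nat (Suc m) * sderiv (Suc m) (fN N A l) x) (at x)"
    unfolding sderiv_fN[OF assms, of "Suc m"] by (rule fN_has_family_derivative[OF assms])
qed (use assms sderiv_fN in auto)

text \<open>An explicit formula for \<open>\<pi>\<^sub>N^(m,n)(x,y)\<close>, see \<open>sderiv2_piN\<close>.\<close>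

definition piN_deriv :: "nat \<Rightarrow> (nat \<Rightarrow> complex) \<Rightarrow> nat \<Rightarrow> nat \<Rightarrow> complex \<Rightarrow> complex \<Rightarrow> complex" where
  "piN_deriv N A m n x y = (-1) ^ m * of_nat ((m + n) choose m) / (x - y) ^ (m + n + 1)
     + (\<Sum>l\<le>2 * N - 2. of_nat (l choose n) * sderiv m (fN N A l) x * y ^ (l - n))"

lemma piN_deriv_has_derivative_y:
  assumes "x \<noteq> y"
  shows "((\<lambda>y. piN_deriv N A m n x y) has_field_derivative of_nat (Suc n) * piN_deriv N A m (Suc n) x y) (at y)"
proof -
  have bin: "of_nat (m + n + 1) * of_nat ((m + n) choose m) = (of_nat (Suc n) * of_nat ((m + Suc n) choose m) :: complex)"
  proof -
    have "(m + n + 1) * ((m + n) choose m) = Suc n * ((m + Suc n) choose m)"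
      using Suc_times_binomial_eq[of "m + n" m] Suc_times_binomial_add[of m n]
      by (simp add: mult.commute del: binomial_Suc_Suc mult_Suc mult_Suc_right)
    then show ?thesis by (metis of_nat_mult)
  qed
  have 1: "((\<lambda>y. (-1) ^ m * of_nat ((m + n) choose m) / (x - y) ^ (m + n + 1)) has_field_derivative
      of_nat (Suc n) * ((-1) ^ m * of_nat ((m + Suc n) choose m) / (x - y) ^ (m + Suc n + 1))) (at y)"
  proof -
    have "((\<lambda>y. (-1) ^ m * of_nat ((m + n) choose m) / (x - y) ^ (m + n + 1)) has_field_derivative
      (-1) ^ m * (of_nat (m + n + 1) * of_nat ((m + n) choose m)) / (x - y) ^ (m + Suc n + 1)) (at y)"
      using DERIV_cmult[OF inverse_power_has_derivative'[OF assms, of "m + n"], of "(-1) ^ m * of_nat ((m + n) choose m)"]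
      by (simp add: mult_ac)
    then show ?thesis unfolding bin by (simp add: mult_ac)
  qed
  have 2: "((\<lambda>y. of_nat (l choose n) * sderiv m (fN N A l) x * y ^ (l - n)) has_field_derivative
      of_nat (Suc n) * (of_nat (l choose Suc n) * sderiv m (fN N A l) x * y ^ (l - Suc n))) (at y)" for l
  proof -
    have "((\<lambda>y. of_nat (l choose n) * sderiv m (fN N A l) x * y ^ (l - n)) has_field_derivative
      of_nat (l choose n) * sderiv m (fN N A l) x * (of_nat (l - n) * y ^ (l - n - Suc 0))) (at y)"
      by (intro DERIV_cmult) (auto intro!: derivative_eq_intros)
    moreover have bin': "of_nat (l choose n) * of_nat (l - n) = (of_nat (Suc n) * of_nat (l choose Suc n) :: complex)"
    proof -
      have "(l choose n) * (l - n) = Suc n * (l choose Suc n)"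
        using binomial_absorb_comp[of l n] binomial_absorption[of n l] by (metis mult.commute)
      then show ?thesis by (metis of_nat_mult)
    qed
    moreover have "of_nat (l choose n) * sderiv m (fN N A l) x * (of_nat (l - n) * y ^ (l - n - Suc 0))
        = (of_nat (l choose n) * of_nat (l - n)) * (sderiv m (fN N A l) x * y ^ (l - Suc n))"
      by (simp add: mult_ac)
    moreover have "(of_nat (Suc n) * of_nat (l choose Suc n)) * (sderiv m (fN N A l) x * y ^ (l - Suc n))
        = of_nat (Suc n) * (of_nat (l choose Suc n) * sderiv m (fN N A l) x * y ^ (l - Suc n))"
      by (simp only: mult.assoc)
    ultimately show ?thesis by (simp only: bin')
  qed
  show ?thesis
    unfolding piN_deriv_def distrib_left sum_distrib_left
    by (intro DERIV_add DERIV_sum 1 2)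
qed

lemma piN_deriv_has_derivative_x:
  assumes "x \<noteq> y" "x \<notin> A ` {..2 * N - 2}"
  shows "((\<lambda>x. piN_deriv N A m n x y) has_field_derivative of_nat (Suc m) * piN_deriv N A (Suc m) n x y) (at x)"
proof -
  have bin: "of_nat (m + n + 1) * of_nat ((m + n) choose m) = (of_nat (Suc m) * of_nat ((Suc m + n) choose Suc m) :: complex)"
  proof -
    have "(m + n + 1) * ((m + n) choose m) = Suc m * ((Suc m + n) choose Suc m)"
      using Suc_times_binomial_eq[of "m + n" m]
      by (simp add: mult.commute del: binomial_Suc_Suc mult_Suc mult_Suc_right)
    then show ?thesis by (metis of_nat_mult)
  qed
  have 1: "((\<lambda>x. (-1) ^ m * of_nat ((m + n) choose m) / (x - y) ^ (m + n + 1)) has_field_derivative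
      of_nat (Suc m) * ((-1) ^ Suc m * of_nat ((Suc m + n) choose Suc m) / (x - y) ^ (Suc m + n + 1))) (at x)"
  proof -
    have "((\<lambda>x. (-1) ^ m * of_nat ((m + n) choose m) / (x - y) ^ (m + n + 1)) has_field_derivative
      (-1) ^ Suc m * (of_nat (m + n + 1) * of_nat ((m + n) choose m)) / (x - y) ^ (Suc m + n + 1)) (at x)"
      using DERIV_cmult[OF inverse_power_has_derivative[OF assms(1), of "m + n"], of "(-1) ^ m * of_nat ((m + n) choose m)"]
      by (simp add: mult_ac del: of_nat_add of_nat_Suc)
    then show ?thesis unfolding bin by (simp add: mult_ac)
  qed
  have 2: "((\<lambda>x. of_nat (l choose n) * sderiv m (fN N A l) x * y ^ (l - n)) has_field_derivative
      of_nat (Suc m) * (of_nat (l choose n) * sderiv (Suc m) (fN N A l) x * y ^ (l - n))) (at x)" for l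
    using DERIV_cmult_right[OF DERIV_cmult[OF sderiv_fN_has_derivative[OF assms(2), of m l],
        of "of_nat (l choose n)"], of "y ^ (l - n)"]
    by (simp add: mult_ac)
  show ?thesis
    unfolding piN_deriv_def distrib_left sum_distrib_left
    by (intro DERIV_add DERIV_sum 1 2)
qed

lemma sderiv_piN_y:
  assumes "N \<ge> 1" "inj_on A {..2 * N - 2}" "x \<notin> A ` {..2 * N - 2}" "x \<noteq> y"
  shows "sderiv n (\<lambda>y'. piN N A x y') y = piN_deriv N A 0 n x y"
proof (rule sderiv_family[of "- {x}"])
  show "open (- {x})" by (intro open_Compl finite_imp_closed) auto
  fix y assume "y \<in> - {x}"
  then show "piN N A x y = piN_deriv N A 0 0 x y"
    using piN_expand[OF assms(1-3), of y] by (auto simp: piN_deriv_def sderiv_def)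
qed (use piN_deriv_has_derivative_y assms(4) in auto)

lemma sderiv2_piN:
  assumes "N \<ge> 1" "inj_on A {..2 * N - 2}" "x \<notin> A ` {..2 * N - 2}" "x \<noteq> y"
  shows "sderiv2 m n (piN N A) x y = piN_deriv N A m n x y"
  unfolding sderiv2_def
proof (rule sderiv_family[of "- (A ` {..2 * N - 2}) \<inter> - {y}" "\<lambda>m x. piN_deriv N A m n x y"])
  show "open (- (A ` {..2 * N - 2}) \<inter> - {y})"
    by (intro open_Int open_avoiding_nodes open_Compl finite_imp_closed) auto
qed (use assms sderiv_piN_y piN_deriv_has_derivative_x in auto)

section \<open>Genus zero recursion with the kernel \<open>\<pi>\<^sub>N\<close>\<close>

context voa_invariant_form
begin

lemma null_relation_combination:
  fixes c :: "nat \<Rightarrow> complex"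
  assumes u: "quasiprimary V N u" and N: "N \<ge> 1"
    and J: "\<And>p j. p < length vs \<Longrightarrow> j \<ge> J \<Longrightarrow> vmode V u (int j) (vs ! p) = 0"
    and ys: "length ys = length vs" "distinct ys"
  shows "(\<Sum>p<length vs. \<Sum>j<J. (\<Sum>l\<le>2 * N - 2. of_nat (l choose j) * c l * ys ! p ^ (l - j)) *
          Z0 V B (vs[p := vmode V u (int j) (vs ! p)]) ys) = 0"
proof -
  have "(\<Sum>p<length vs. \<Sum>j<J. (\<Sum>l\<le>2 * N - 2. of_nat (l choose j) * c l * ys ! p ^ (l - j)) *
          Z0 V B (vs[p := vmode V u (int j) (vs ! p)]) ys)
      = (\<Sum>p<length vs. \<Sum>l\<le>2 * N - 2. \<Sum>j<J. c l * (of_nat (l choose j) * ys ! p ^ (l - j) *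
          Z0 V B (vs[p := vmode V u (int j) (vs ! p)]) ys))"
    by (rule sum.cong[OF refl], subst sum.swap) (simp add: sum_distrib_right sum_distrib_left mult_ac)
  also have "\<dots> = (\<Sum>l\<le>2 * N - 2. c l * (\<Sum>p<length vs. \<Sum>j<J. of_nat (l choose j) * ys ! p ^ (l - j) *
          Z0 V B (vs[p := vmode V u (int j) (vs ! p)]) ys))"
    by (subst sum.swap) (simp add: sum_distrib_left)
  also have "\<dots> = 0"
    using Z0_null_relation[OF u _ N J ys] by simp
  finally show ?thesis .
qed

text \<open>
  By \<open>piN_expand\<close> the difference to the kernel \<open>1/(x-y)\<close> is a polynomial of degree at most \<open>2N - 2\<close> in
  \<open>y\<close>, whose contribution vanishes by the null relations.
\<close>

theorem Z0_Cons_piN: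
  assumes u: "quasiprimary V N u" and N: "N \<ge> 1"
    and J: "\<And>p j. p < length vs \<Longrightarrow> j \<ge> J \<Longrightarrow> vmode V u (int j) (vs ! p) = 0"
    and ys: "length ys = length vs" "distinct (x # ys)"
    and A: "inj_on A {..2 * N - 2}" "x \<notin> A ` {..2 * N - 2}"
  shows "Z0 V B (u # vs) (x # ys) =
     (\<Sum>p<length vs. \<Sum>j<J. sderiv2 0 j (piN N A) x (ys ! p) * Z0 V B (vs[p := vmode V u (int j) (vs ! p)]) ys)"
proof -
  let ?Z = "\<lambda>p j. Z0 V B (vs[p := vmode V u (int j) (vs ! p)]) ys"
  have uw: "u \<in> wtspace V N" using u by (simp add: quasiprimary_def)
  have "(\<Sum>p<length vs. \<Sum>j<J. sderiv2 0 j (piN N A) x (ys ! p) * ?Z p j)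
      = (\<Sum>p<length vs. \<Sum>j<J. 1 / (x - ys ! p) ^ (j + 1) * ?Z p j
          + (\<Sum>l\<le>2 * N - 2. of_nat (l choose j) * sderiv 0 (fN N A l) x * ys ! p ^ (l - j)) * ?Z p j)"
  proof (intro sum.cong refl)
    fix p j assume "p \<in> {..<length vs}"
    then have "x \<noteq> ys ! p" using ys by auto
    then show "sderiv2 0 j (piN N A) x (ys ! p) * ?Z p j = 1 / (x - ys ! p) ^ (j + 1) * ?Z p j
          + (\<Sum>l\<le>2 * N - 2. of_nat (l choose j) * sderiv 0 (fN N A l) x * ys ! p ^ (l - j)) * ?Z p j"
      by (subst sderiv2_piN[OF N A]) (simp_all add: piN_deriv_def distrib_right)
  qed
  also have "\<dots> = Z0 V B (u # vs) (x # ys)"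
    unfolding sum.distrib
    using Z0_Cons[OF uw N J ys] null_relation_combination[OF u N J, where J = J and ys = ys] ys by simp
  finally show ?thesis by simp
qed

text \<open>
  At \<open>p = k\<close> there is no pole, and only the polynomial part of \<open>\<pi>\<^sub>N\<close> remains.  This is the reason for
  the separate definition of the entries \<open>A\<^sub>a\<^sub>b\<close> with \<open>b = -a\<close> of the moment matrix.
\<close>

theorem Z0_creation_mode_piN:
  assumes u: "quasiprimary V N u" and N: "N \<ge> 1"
    and J: "\<And>p j. p < length vs \<Longrightarrow> j \<ge> J \<Longrightarrow> vmode V u (int j) (vs ! p) = 0"
    and k: "k < length vs"
    and ys: "length ys = length vs" "distinct ys"
    and A: "inj_on A {..2 * N - 2}" "ys ! k \<notin> A ` {..2 * N - 2}"
  shows "Z0 V B (vs[k := vmode V u (- 1 - int m) (vs ! k)]) ys =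
     (\<Sum>p<length vs. \<Sum>j<J. (if p = k
          then \<Sum>l\<le>2 * N - 2. of_nat (l choose j) * sderiv m (fN N A l) (ys ! k) * (ys ! k) ^ (l - j)
          else sderiv2 m j (piN N A) (ys ! k) (ys ! p)) *
        Z0 V B (vs[p := vmode V u (int j) (vs ! p)]) ys)"
proof -
  let ?Z = "\<lambda>p j. Z0 V B (vs[p := vmode V u (int j) (vs ! p)]) ys"
  let ?c = "\<lambda>p j. if p = k then 0 else (-1) ^ m * of_nat ((m + j) choose m) / (ys ! k - ys ! p) ^ (m + j + 1)"
  have uw: "u \<in> wtspace V N" using u by (simp add: quasiprimary_def)
  have "(\<Sum>p<length vs. \<Sum>j<J. (if p = k
          then \<Sum>l\<le>2 * N - 2. of_nat (l choose j) * sderiv m (fN N A l) (ys ! k) * (ys ! k) ^ (l - j)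
          else sderiv2 m j (piN N A) (ys ! k) (ys ! p)) * ?Z p j)
      = (\<Sum>p<length vs. \<Sum>j<J. ?c p j * ?Z p j
          + (\<Sum>l\<le>2 * N - 2. of_nat (l choose j) * sderiv m (fN N A l) (ys ! k) * ys ! p ^ (l - j)) * ?Z p j)"
  proof (intro sum.cong refl)
    fix p j assume p: "p \<in> {..<length vs}"
    show "(if p = k
          then \<Sum>l\<le>2 * N - 2. of_nat (l choose j) * sderiv m (fN N A l) (ys ! k) * (ys ! k) ^ (l - j)
          else sderiv2 m j (piN N A) (ys ! k) (ys ! p)) * ?Z p j = ?c p j * ?Z p j
          + (\<Sum>l\<le>2 * N - 2. of_nat (l choose j) * sderiv m (fN N A l) (ys ! k) * ys ! p ^ (l - j)) * ?Z p j"
    proof (cases "p = k")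
      case False
      then have "ys ! k \<noteq> ys ! p" using ys p k by (simp add: nth_eq_iff_index_eq)
      then show ?thesis using False
        by (subst sderiv2_piN[OF N A]) (simp_all add: piN_deriv_def distrib_right)
    qed simp
  qed
  also have "\<dots> = (\<Sum>p<length vs. \<Sum>j<J. ?c p j * ?Z p j)"
    unfolding sum.distrib
    using null_relation_combination[OF u N J, where J = J and ys = ys] ys by simp
  also have "\<dots> = (\<Sum>p\<in>{..<length vs} - {k}. \<Sum>j<J. ?c p j * ?Z p j)"
    by (rule sum.mono_neutral_right) auto
  also have "\<dots> = Z0 V B (vs[k := vmode V u (- 1 - int m) (vs ! k)]) ys"
    unfolding Z0_creation_mode[OF uw N J k ys, where J = J]
    by (subst Z0_creation_mode[OF uw N _ k ys, where J = J]) (auto simp: J intro!: sum.cong)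
  finally show ?thesis by simp
qed


section \<open>Dual bases\<close>

lemma B_minus_right [simp]: "B v (- t) = - B v t"
  using B_scale_right[of v "-1" t] by simp

lemma B_minus_left [simp]: "B (- t) v = - B t v"
  using B_scale_left[of "-1" t v] by simp

lemma B_diff_right: "B v (s - t) = B v s - B v t"
  using B_add_right[of v s "- t"] by simp

text \<open>
  Induction on the number of vectors, as in the Gram--Schmidt process, with the nondegenerate form in
  place of a scalar product.
\<close>

lemma dual_system_exists:
  assumes "finite S" "VS.independent S"
  shows "\<exists>d. \<forall>b\<in>S. \<forall>b'\<in>S. B b' (d b) = (if b' = b then 1 else 0)"
  using assms
proof (induction S)
  case (insert b0 S)
  then obtain d where d: "\<And>b b'. b \<in> S \<Longrightarrow> b' \<in> S \<Longrightarrow> B b' (d b) = (if b' = b then 1 else 0)"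
    using VS.independent_mono[of "insert b0 S" S] by blast
  have b0: "b0 \<notin> VS.span S" using insert.prems insert.hyps by (simp add: VS.independent_insert)
  \<comment> \<open>\<open>w\<close> is orthogonal to the vectors \<open>d b\<close>, so that \<open>t\<close> can be corrected by them below.\<close>
  define w where "w = b0 - (\<Sum>b\<in>S. B b0 (d b) \<odot> b)"
  have "w \<noteq> 0"
  proof
    assume "w = 0"
    then have "b0 = (\<Sum>b\<in>S. B b0 (d b) \<odot> b)" by (simp add: w_def)
    moreover have "(\<Sum>b\<in>S. B b0 (d b) \<odot> b) \<in> VS.span S"
      by (intro VS.span_sum VS.span_scale VS.span_base)
    ultimately show False using b0 by metis
  qed
  then obtain t where t: "B w t \<noteq> 0" using B_nondegenerate by blast
  define t' where "t' = t + (\<Sum>b\<in>S. (- B b t) \<odot> d b)"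
  have t'0: "B b' t' = 0" if "b' \<in> S" for b'
  proof -
    have "(\<Sum>b\<in>S. - B b t * B b' (d b)) = (\<Sum>b\<in>S. if b = b' then - B b t else 0)"
      by (intro sum.cong refl) (use d that in auto)
    then show ?thesis using that insert.hyps by (simp add: t'_def B_add_right B_sum_right B_scale_right)
  qed
  have "w = b0 + (\<Sum>b\<in>S. (- B b0 (d b)) \<odot> b)" by (simp add: w_def sum_negf)
  then have "B w t = B b0 t'"
    by (simp add: t'_def B_add_right B_add_left B_sum_right B_sum_left B_scale_right B_scale_left mult.commute)
  then have nz: "B b0 t' \<noteq> 0" using t by simp
  define d0 where "d0 = (1 / B b0 t') \<odot> t'"
  define d' where "d' b = (if b = b0 then d0 else d b + (- B b0 (d b)) \<odot> d0)" for b
  have "B b' (d' b) = (if b' = b then 1 else 0)" if "b \<in> insert b0 S" "b' \<in> insert b0 S" for b b'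
  proof -
    have d0: "B b0 d0 = 1" "\<And>b'. b' \<in> S \<Longrightarrow> B b' d0 = 0"
      using nz t'0 by (simp_all add: d0_def B_scale_right)
    show ?thesis
      using that insert.hyps d d0 by (auto simp: d'_def B_diff_right B_scale_right)
  qed
  then show ?case by blast
qed simp

lemma B_hcomp:
  assumes "s \<in> wtspace V n"
  shows "B s v = B s (hcomp V v n)"
proof -
  have "B s v = B s (\<Sum>k | hcomp V v k \<noteq> 0. hcomp V v k)"
    using hcomp_props(3)[of v] by (simp add: Sum_any.expand_set)
  also have "\<dots> = (\<Sum>k | hcomp V v k \<noteq> 0. B s (hcomp V v k))" by (rule B_sum_right)
  also have "\<dots> = (\<Sum>k | hcomp V v k \<noteq> 0. if k = n then B s (hcomp V v k) else 0)"
    by (intro sum.cong refl) (use B_wtspace_orthogonal[OF assms hcomp_props(1)] in auto)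
  also have "\<dots> = B s (hcomp V v n)" using hcomp_props(2)[of v] by auto
  finally show ?thesis .
qed

context
  fixes S :: "'v set"
  assumes S: "homogeneous_basis V S"
begin

lemma basis_independent: "VS.independent S"
  and basis_span: "VS.span S = UNIV"
  using S by (simp_all add: homogeneous_basis_def)

lemma basis_wtspace: "b \<in> S \<Longrightarrow> b \<in> wtspace V (wt V b)"
proof -
  assume b: "b \<in> S"
  then obtain n where n: "b \<in> wtspace V n" using S by (auto simp: homogeneous_basis_def)
  have "b \<noteq> 0" using b basis_independent VS.dependent_zero by blast
  then show ?thesis using n wt_eq by blast
qed

lemma finite_basis_of_weight: "finite {b \<in> S. int (wt V b) = k}"
proof (cases "k \<ge> 0")
  case True
  obtain T where T: "finite T" "wtspace V (nat k) \<subseteq> VS.span T" using wtspace_finite_dim by blast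
  have "{b \<in> S. int (wt V b) = k} \<subseteq> VS.span T" using T(2) basis_wtspace True by fastforce
  moreover have "VS.independent {b \<in> S. int (wt V b) = k}"
    by (rule VS.independent_mono[OF basis_independent]) auto
  ultimately show ?thesis using VS.independent_span_bound[OF T(1)] by blast
qed simp

lemma B_basis_ext:
  assumes "\<And>b. b \<in> S \<Longrightarrow> B b t = B b t'"
  shows "t = t'"
proof -
  have "B v (t - t') = 0" for v
  proof -
    have "v \<in> VS.span S" by (simp add: basis_span)
    then show ?thesis
    proof (induction rule: VS.span_induct_alt)
      case (step c b v)
      have "B b (t - t') = 0"
        using assms[OF step(1)] B_add_right[of b "t - t'" t'] by simp
      then show ?case using step by (simp add: B_add_left B_scale_left)
    qed simp
  qed
  then have "t - t' = 0" using B_nondegenerate[of "t - t'"] B_sym[of "t - t'"] by simp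
  then show ?thesis by simp
qed

text \<open>
  There are finitely many basis vectors of each weight.  The vectors of the finite dual system in that
  weight become orthogonal to all other basis vectors when they are projected to that weight.
\<close>

lemma dual_vec_exists:
  assumes b: "b \<in> S"
  shows "\<exists>d. d \<in> wtspace V (wt V b) \<and> (\<forall>b'\<in>S. B b' d = (if b' = b then 1 else 0))"
proof -
  define T where "T = {b' \<in> S. int (wt V b') = int (wt V b)}"
  have "finite T" unfolding T_def by (rule finite_basis_of_weight)
  moreover have "VS.independent T"
    by (rule VS.independent_mono[OF basis_independent]) (auto simp: T_def)
  ultimately have "\<exists>d. \<forall>b\<in>T. \<forall>b'\<in>T. B b' (d b) = (if b' = b then 1 else 0)"
    by (rule dual_system_exists)
  then obtain d where d: "\<And>b b'. b \<in> T \<Longrightarrow> b' \<in> T \<Longrightarrow> B b' (d b) = (if b' = b then 1 else 0)"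
    by blast
  define t where "t = hcomp V (d b) (wt V b)"
  have tw: "t \<in> wtspace V (wt V b)" unfolding t_def by (rule hcomp_props)
  have "B b' t = (if b' = b then 1 else 0)" if "b' \<in> S" for b'
  proof (cases "wt V b' = wt V b")
    case True
    then have "b' \<in> T" "b \<in> T" using that b by (auto simp: T_def)
    then show ?thesis using d[of b b'] B_hcomp[of b' "wt V b" "d b"] basis_wtspace[OF that] True
      by (simp add: t_def)
  next
    case False
    then show ?thesis using B_wtspace_orthogonal[OF basis_wtspace[OF that] tw] by auto
  qed
  with tw show ?thesis by blast
qed

lemma dual_vec_props:
  assumes b: "b \<in> S"
  shows "dual_vec B S b \<in> wtspace V (wt V b)"
    and "b' \<in> S \<Longrightarrow> B b' (dual_vec B S b) = (if b' = b then 1 else 0)"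
proof -
  obtain d where d: "d \<in> wtspace V (wt V b)" "\<forall>b'\<in>S. B b' d = (if b' = b then 1 else 0)"
    using dual_vec_exists[OF b] by blast
  have "dual_vec B S b = d"
    unfolding dual_vec_def
  proof (rule the_equality)
    show "\<forall>b'\<in>S. B b' d = (if b' = b then 1 else 0)" by (rule d)
    show "d' = d" if "\<forall>b'\<in>S. B b' d' = (if b' = b then 1 else 0)" for d'
      by (rule B_basis_ext) (use that d(2) in auto)
  qed
  then show "dual_vec B S b \<in> wtspace V (wt V b)"
    "b' \<in> S \<Longrightarrow> B b' (dual_vec B S b) = (if b' = b then 1 else 0)" using d by auto
qed

lemma dual_basis_expansion:
  assumes t: "t \<in> wtspace V n"
  shows "t = (\<Sum>b | b \<in> S \<and> int (wt V b) = int n. B b t \<odot> dual_vec B S b)" (is "t = ?s")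
proof (rule B_basis_ext)
  let ?T = "{b. b \<in> S \<and> int (wt V b) = int n}"
  have fin: "finite ?T" by (rule finite_basis_of_weight)
  fix b assume b: "b \<in> S"
  have "B b ?s = (\<Sum>b'\<in>?T. if b' = b then B b' t else 0)"
    unfolding B_sum_right B_scale_right
    by (intro sum.cong refl) (use dual_vec_props(2) b in auto)
  also have "\<dots> = (if b \<in> ?T then B b t else 0)" using fin by simp
  also have "\<dots> = B b t"
    using B_wtspace_orthogonal[OF basis_wtspace[OF b] t] b by auto
  finally show "B b t = B b ?s" by simp
qed

lemma basis_expansion:
  assumes t: "t \<in> wtspace V n"
  shows "t = (\<Sum>b | b \<in> S \<and> int (wt V b) = int n. B (dual_vec B S b) t \<odot> b)"
proof -
  let ?T = "{b. b \<in> S \<and> int (wt V b) = int n}"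
  have fin: "finite ?T" by (rule finite_basis_of_weight)
  have "t \<in> VS.span S" by (simp add: basis_span)
  then obtain R c where R: "finite R" "R \<subseteq> S" "t = (\<Sum>b\<in>R. c b \<odot> b)"
    unfolding VS.span_explicit by blast
  have coeff: "B (dual_vec B S b) t = (if b \<in> R then c b else 0)" if b: "b \<in> S" for b
  proof -
    have "B (dual_vec B S b) t = (\<Sum>b'\<in>R. if b' = b then c b' else 0)"
      unfolding R(3) B_sum_right B_scale_right
      by (intro sum.cong refl) (use B_sym[of "dual_vec B S b"] dual_vec_props(2)[OF b] R(2) in auto)
    then show ?thesis using R(1) by simp
  qed
  have zero: "B (dual_vec B S b) t = 0" if "b \<in> S" "b \<notin> ?T" for b
    using B_wtspace_orthogonal[OF dual_vec_props(1)[OF that(1)] t] that by auto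
  have "t = (\<Sum>b\<in>R. B (dual_vec B S b) t \<odot> b)"
    using R(2) coeff by (subst R(3)) (auto intro!: sum.cong)
  also have "\<dots> = (\<Sum>b\<in>R \<union> ?T. B (dual_vec B S b) t \<odot> b)"
    by (rule sum.mono_neutral_left) (use R fin coeff in auto)
  also have "\<dots> = (\<Sum>b\<in>?T. B (dual_vec B S b) t \<odot> b)"
    by (rule sum.mono_neutral_right) (use R fin zero in auto)
  finally show ?thesis .
qed

text \<open>
  The tensor \<open>\<Sum>\<^sub>b b \<otimes> \<bar>b\<close> intertwines \<open>u(j)\<close> in the first factor with its adjoint
  \<open>(-1)^N u(2N-2-j)\<close> in the second.
\<close>

lemma dual_basis_adjoint:
  fixes \<beta> :: "'v \<Rightarrow> 'v \<Rightarrow> complex"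
  assumes u: "quasiprimary V N u"
    and lin1: "\<And>(I::'v set) c f t. \<beta> (\<Sum>i\<in>I. c i \<odot> f i) t = (\<Sum>i\<in>I. c i * \<beta> (f i) t)"
    and lin2: "\<And>(I::'v set) c f s. \<beta> s (\<Sum>i\<in>I. c i \<odot> f i) = (\<Sum>i\<in>I. c i * \<beta> s (f i))"
  shows "(\<Sum>b | b \<in> S \<and> int (wt V b) = k. \<beta> (vmode V u j b) (dual_vec B S b))
       = (-1) ^ N * (\<Sum>b | b \<in> S \<and> int (wt V b) = k + int N - 1 - j.
            \<beta> b (vmode V u (2 * int N - 2 - j) (dual_vec B S b)))"
proof -
  let ?T = "\<lambda>k. {b. b \<in> S \<and> int (wt V b) = k}"
  let ?k = "k + int N - 1 - j"
  have uw: "u \<in> wtspace V N" using u by (simp add: quasiprimary_def)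
  have z1: "\<beta> 0 t = 0" and z2: "\<beta> t 0 = 0" for t
    using lin1[of "\<lambda>_. 0" "\<lambda>_. 0" "{}" t] lin2[of t "\<lambda>_. 0" "\<lambda>_. 0" "{}"] by simp_all
  consider "k < 0" | "?k < 0" | n n' where "k = int n" "?k = int n'"
    by (metis nonneg_int_cases not_less)
  then show ?thesis
  proof cases
    \<comment> \<open>If one of the weights is negative, one sum is empty and the terms of the other one vanish.\<close>
    case 1
    have "vmode V u (2 * int N - 2 - j) (dual_vec B S b) = 0" if "b \<in> ?T ?k" for b
      using that 1 by (intro mode_eq_0[OF uw dual_vec_props(1)]) auto
    then have "(\<Sum>b\<in>?T ?k. \<beta> b (vmode V u (2 * int N - 2 - j) (dual_vec B S b))) = 0"
      by (intro sum.neutral) (simp add: z2)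
    moreover have "(\<Sum>b\<in>?T k. \<beta> (vmode V u j b) (dual_vec B S b)) = 0"
      by (rule sum.neutral) (use 1 in auto)
    ultimately show ?thesis by simp
  next
    case 2
    have "vmode V u j b = 0" if "b \<in> ?T k" for b
      using that 2 by (intro mode_eq_0[OF uw basis_wtspace]) auto
    then have "(\<Sum>b\<in>?T k. \<beta> (vmode V u j b) (dual_vec B S b)) = 0"
      by (intro sum.neutral) (simp add: z1)
    moreover have "(\<Sum>b\<in>?T ?k. \<beta> b (vmode V u (2 * int N - 2 - j) (dual_vec B S b))) = 0"
      by (rule sum.neutral) (use 2 in auto)
    ultimately show ?thesis by simp
  next
    case 3
    have "(\<Sum>b\<in>?T k. \<beta> (vmode V u j b) (dual_vec B S b))
        = (\<Sum>b\<in>?T k. \<Sum>b'\<in>?T ?k. B (dual_vec B S b') (vmode V u j b) * \<beta> b' (dual_vec B S b))"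
    proof (rule sum.cong[OF refl])
      fix b assume b: "b \<in> ?T k"
      then have "b \<in> wtspace V n" using basis_wtspace[of b] 3 by auto
      then have "vmode V u j b \<in> wtspace V n'" using 3 by (intro mode_wtspace[OF uw]) auto
      from basis_expansion[OF this, folded 3(2)]
      have "vmode V u j b = (\<Sum>b'\<in>?T ?k. B (dual_vec B S b') (vmode V u j b) \<odot> b')" .
      then have "\<beta> (vmode V u j b) (dual_vec B S b)
          = \<beta> (\<Sum>b'\<in>?T ?k. B (dual_vec B S b') (vmode V u j b) \<odot> b') (dual_vec B S b)" by simp
      then show "\<beta> (vmode V u j b) (dual_vec B S b)
          = (\<Sum>b'\<in>?T ?k. B (dual_vec B S b') (vmode V u j b) * \<beta> b' (dual_vec B S b))"
        by (simp only: lin1)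
    qed
    also have "\<dots> = (\<Sum>b'\<in>?T ?k. \<Sum>b\<in>?T k. (-1) ^ N * (B b (vmode V u (2 * int N - 2 - j) (dual_vec B S b')) * \<beta> b' (dual_vec B S b)))"
      by (subst sum.swap) (simp add: B_sym[of "dual_vec B S _"] B_quasiprimary[OF u] mult.assoc)
    also have "\<dots> = (\<Sum>b'\<in>?T ?k. (-1) ^ N * \<beta> b' (vmode V u (2 * int N - 2 - j) (dual_vec B S b')))"
    proof (rule sum.cong[OF refl])
      fix b' assume b': "b' \<in> ?T ?k"
      then have "dual_vec B S b' \<in> wtspace V n'" using dual_vec_props(1)[of b'] 3 by auto
      then have "vmode V u (2 * int N - 2 - j) (dual_vec B S b') \<in> wtspace V n"
        using 3 by (intro mode_wtspace[OF uw]) auto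
      from dual_basis_expansion[OF this, folded 3(1)]
      have "vmode V u (2 * int N - 2 - j) (dual_vec B S b')
          = (\<Sum>b\<in>?T k. B b (vmode V u (2 * int N - 2 - j) (dual_vec B S b')) \<odot> dual_vec B S b)" .
      then have "\<beta> b' (vmode V u (2 * int N - 2 - j) (dual_vec B S b'))
          = \<beta> b' (\<Sum>b\<in>?T k. B b (vmode V u (2 * int N - 2 - j) (dual_vec B S b')) \<odot> dual_vec B S b)" by simp
      then show "(\<Sum>b\<in>?T k. (-1) ^ N * (B b (vmode V u (2 * int N - 2 - j) (dual_vec B S b')) * \<beta> b' (dual_vec B S b)))
          = (-1) ^ N * \<beta> b' (vmode V u (2 * int N - 2 - j) (dual_vec B S b'))"
        by (simp only: lin2 sum_distrib_left)
    qed
    finally show ?thesis by (simp only: sum_distrib_left)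
  qed
qed

end

end

section \<open>Powers of the differentials\<close>

context vertex_operator_algebra
begin

lemma form_weight_homogeneous:
  assumes "v \<in> wtspace V n"
  shows "form_weight V d v = (d ^ n) \<odot> v"
proof -
  have "form_weight V d v = (\<Sum>k\<in>{n}. (d ^ k) \<odot> (if k = n then v else 0))"
    unfolding form_weight_def hcomp_homogeneous[OF assms]
    by (rule Sum_any.expand_superset) auto
  then show ?thesis by simp
qed

lemma form_weight_add: "form_weight V d (v + v') = form_weight V d v + form_weight V d v'"
proof -
  have fin: "finite {n. (d ^ n) \<odot> hcomp V v n \<noteq> 0}" for v
    by (rule finite_subset[OF _ hcomp_props(2)[of v]]) auto
  show ?thesis
    unfolding form_weight_def hcomp_add VS.scale_right_distrib
    by (rule Sum_any.distrib[OF fin fin])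
qed

lemma form_weight_one: "form_weight V 1 v = v"
  by (simp add: form_weight_def hcomp_props)

text \<open>
  \<open>u(j)\<close> changes the weight by \<open>N - j - 1\<close>.  Hence \<open>dy^j\<close> and the factor \<open>dy^(1-N)\<close> of \<open>\<Psi>\<^sub>N\<close> restore the power of \<open>dy\<close>
  belonging to \<open>v\<^sub>k\<close>.
\<close>

lemma form_weight_mode:
  assumes u: "u \<in> wtspace V N" and d: "d \<noteq> 0"
  shows "form_weight V d (vmode V u j v) = d powi (int N - j - 1) \<odot> vmode V u j (form_weight V d v)"
proof (induction v rule: homogeneous_induct)
  case (add v v')
  then show ?case by (simp add: mode_add_right form_weight_add VS.scale_right_distrib)
next
  case (homogeneous m v)
  show ?case
  proof (cases "int N + int m - j - 1 \<ge> 0")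
    case True
    then obtain l where l: "int N + int m - j - 1 = int l" using nonneg_int_cases by blast
    have "vmode V u j v \<in> wtspace V l" by (rule mode_wtspace[OF u homogeneous l])
    moreover have "d ^ l = d powi (int N - j - 1) * d ^ m"
    proof -
      have e: "int l = (int N - j - 1) + int m" using l by simp
      have "d ^ l = d powi (int l)" by simp
      also have "\<dots> = d powi (int N - j - 1) * d powi (int m)"
        unfolding e using d by (intro power_int_add) simp
      finally show ?thesis by simp
    qed
    ultimately show ?thesis
      by (simp add: form_weight_homogeneous form_weight_homogeneous[OF homogeneous] mode_scale_right)
  next
    case False
    have 0: "vmode V u j v = 0" by (rule mode_eq_0[OF u homogeneous]) (use False in simp)
    show ?thesis
      using form_weight_homogeneous[OF VS.subspace_0[OF subspace_wtspace], of d 0]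
      by (simp add: 0 form_weight_homogeneous[OF homogeneous] mode_scale_right)
  qed
qed

end

section \<open>Series in the variables \<open>\<rho>\<^sub>a\<close>\<close>

lemma rs_mult_mono_left: "rs_mult (rs_mono c \<mu>) f = (\<lambda>\<kappa>. c * f (\<lambda>i. \<kappa> i - \<mu> i))"
proof
  fix \<kappa>
  have "rs_mult (rs_mono c \<mu>) f \<kappa> = (\<Sum>\<nu>\<in>{\<mu>}. rs_mono c \<mu> \<nu> * f (\<lambda>i. \<kappa> i - \<nu> i))"
    unfolding rs_mult_def by (rule Sum_any.expand_superset) (auto simp: rs_mono_def split: if_splits)
  then show "rs_mult (rs_mono c \<mu>) f \<kappa> = c * f (\<lambda>i. \<kappa> i - \<mu> i)" by (simp add: rs_mono_def)
qed

lemma rs_mult_commute: "rs_mult f h = rs_mult h f"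
proof
  fix \<kappa> :: "nat \<Rightarrow> int"
  have "bij (\<lambda>(\<mu> :: nat \<Rightarrow> int) i. \<kappa> i - \<mu> i)"
    by (rule bij_betw_byWitness[of _ "\<lambda>\<mu> i. \<kappa> i - \<mu> i"]) auto
  then show "rs_mult f h \<kappa> = rs_mult h f \<kappa>"
    unfolding rs_mult_def
    by (intro Sum_any.reindex_cong[of "\<lambda>\<mu> i. \<kappa> i - \<mu> i"]) (auto simp: bij_def mult.commute)
qed

lemma rs_mult_mono_right: "rs_mult f (rs_mono c \<mu>) = (\<lambda>\<kappa>. c * f (\<lambda>i. \<kappa> i - \<mu> i))"
  by (subst rs_mult_commute) (rule rs_mult_mono_left)

lemma rs_mult_const_left: "rs_mult (rs_const c) f = (\<lambda>\<kappa>. c * f \<kappa>)"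
  by (simp add: rs_const_def rs_mult_mono_left)

lemma rs_mult_const_right: "rs_mult f (rs_const c) = (\<lambda>\<kappa>. c * f \<kappa>)"
  by (simp add: rs_const_def rs_mult_mono_right)

lemma rs_mult_zero_left [simp]: "rs_mult (\<lambda>_. 0) f = (\<lambda>_. 0)"
  by (simp add: rs_mult_def fun_eq_iff)

lemma rs_mult_zero_right [simp]: "rs_mult f (\<lambda>_. 0) = (\<lambda>_. 0)"
  by (simp add: rs_mult_def fun_eq_iff)

text \<open>
  Associativity fails for general series, as a coefficient of a product with infinitely many terms is
  set to zero.  It holds as soon as one of the factors is a monomial, and this suffices below because
  the entries of \<open>L\<close>, \<open>R\<close> and \<open>A\<close> are monomials.
\<close>

lemma rs_mono_mult_assoc: "rs_mult (rs_mono c \<mu>) (rs_mult f h) = rs_mult (rs_mult (rs_mono c \<mu>) f) h"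
proof
  fix \<kappa> :: "nat \<Rightarrow> int"
  have b: "bij (\<lambda>(\<nu> :: nat \<Rightarrow> int) i. \<nu> i + \<mu> i)"
    by (rule bij_betw_byWitness[of _ "\<lambda>\<nu> i. \<nu> i - \<mu> i"]) auto
  have "Sum_any (\<lambda>\<nu>. f \<nu> * h (\<lambda>i. \<kappa> i - \<mu> i - \<nu> i))
      = Sum_any (\<lambda>\<nu>. f (\<lambda>i. \<nu> i - \<mu> i) * h (\<lambda>i. \<kappa> i - \<nu> i))"
    by (rule Sum_any.reindex_cong[of "\<lambda>\<nu> i. \<nu> i + \<mu> i", symmetric])
      (use b in \<open>auto simp: bij_def algebra_simps\<close>)
  then have *: "rs_mult f h (\<lambda>i. \<kappa> i - \<mu> i) = rs_mult (\<lambda>\<kappa>. f (\<lambda>i. \<kappa> i - \<mu> i)) h \<kappa>"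
    by (simp add: rs_mult_def)
  have scale: "rs_mult (\<lambda>\<kappa>. c * k \<kappa>) h \<kappa> = c * rs_mult k h \<kappa>" for k
  proof (cases "c = 0")
    case False
    have "Sum_any (\<lambda>\<nu>. c * (k \<nu> * h (\<lambda>i. \<kappa> i - \<nu> i))) = c * Sum_any (\<lambda>\<nu>. k \<nu> * h (\<lambda>i. \<kappa> i - \<nu> i))"
      unfolding Sum_any.expand_set using False by (simp add: sum_distrib_left)
    then show ?thesis by (simp add: rs_mult_def mult.assoc)
  qed simp
  show "rs_mult (rs_mono c \<mu>) (rs_mult f h) \<kappa> = rs_mult (rs_mult (rs_mono c \<mu>) f) h \<kappa>"
    unfolding rs_mult_mono_left scale * ..
qed

lemma rs_mult_mono_assoc: "rs_mult (rs_mult f (rs_mono c \<mu>)) h = rs_mult f (rs_mult (rs_mono c \<mu>) h)"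
proof -
  have "rs_mult (rs_mult f (rs_mono c \<mu>)) h = rs_mult (rs_mono c \<mu>) (rs_mult f h)"
    unfolding rs_mult_commute[of f "rs_mono c \<mu>"] by (rule rs_mono_mult_assoc[symmetric])
  also have "\<dots> = rs_mult (rs_mono c \<mu>) (rs_mult h f)" by (simp only: rs_mult_commute[of f h])
  also have "\<dots> = rs_mult (rs_mult (rs_mono c \<mu>) h) f" by (rule rs_mono_mult_assoc)
  also have "\<dots> = rs_mult f (rs_mult (rs_mono c \<mu>) h)" by (rule rs_mult_commute)
  finally show ?thesis .
qed

section \<open>Locally finite sums\<close>

definition locally_finite :: "'i set \<Rightarrow> ('i \<Rightarrow> rho_series) \<Rightarrow> bool" where
  "locally_finite I F \<longleftrightarrow> (\<forall>\<kappa>. finite {i \<in> I. F i \<kappa> \<noteq> 0})"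

lemma rs_sum_eq:
  assumes "finite J" "J \<subseteq> I" "\<And>i. i \<in> I \<Longrightarrow> i \<notin> J \<Longrightarrow> F i \<kappa> = 0"
  shows "rs_sum I F \<kappa> = (\<Sum>i\<in>J. F i \<kappa>)"
  unfolding rs_sum_def by (rule sum.mono_neutral_left) (use assms in auto)

lemma rs_sum_cong: "(\<And>i. i \<in> I \<Longrightarrow> F i = G i) \<Longrightarrow> rs_sum I F = rs_sum I G"
  unfolding rs_sum_def by (intro ext sum.cong) auto

lemma rs_sum_finite: "finite I \<Longrightarrow> rs_sum I F = (\<lambda>\<kappa>. \<Sum>i\<in>I. F i \<kappa>)"
  by (intro ext rs_sum_eq) auto

lemma rs_sum_nonzeroD:
  assumes "rs_sum I F \<kappa> \<noteq> 0"
  obtains i where "i \<in> I" "F i \<kappa> \<noteq> 0"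
proof -
  have "\<exists>i\<in>{i \<in> I. F i \<kappa> \<noteq> 0}. F i \<kappa> \<noteq> 0"
    by (rule ccontr) (use assms in \<open>simp add: rs_sum_def sum.neutral\<close>)
  then show thesis using that by blast
qed

lemma rs_mult_nonzeroD:
  assumes "rs_mult f h \<kappa> \<noteq> 0"
  obtains \<mu> where "f \<mu> \<noteq> 0" "h (\<lambda>i. \<kappa> i - \<mu> i) \<noteq> 0"
proof -
  obtain \<mu> where "f \<mu> * h (\<lambda>i. \<kappa> i - \<mu> i) \<noteq> 0"
    using Sum_any.not_neutral_obtains_not_neutral[OF assms[unfolded rs_mult_def]] .
  then show thesis using that[of \<mu>] by simp
qed

lemma rs_sum_mono_mult: "rs_mult (rs_mono c \<mu>) (rs_sum I F) = rs_sum I (\<lambda>i. rs_mult (rs_mono c \<mu>) (F i))"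
proof (cases "c = 0")
  case False
  then show ?thesis by (simp add: rs_mult_mono_left rs_sum_def sum_distrib_left)
qed (simp add: rs_mult_mono_left rs_sum_def)

lemma rs_sum_mult_mono: "rs_mult (rs_sum I F) (rs_mono c \<mu>) = rs_sum I (\<lambda>i. rs_mult (F i) (rs_mono c \<mu>))"
  using rs_sum_mono_mult[of c \<mu> I F] by (simp add: rs_mult_commute[of _ "rs_mono c \<mu>"])

lemma rs_sum_swap:
  assumes "\<And>\<kappa>. finite {(i, j). i \<in> I \<and> j \<in> J \<and> F i j \<kappa> \<noteq> 0}"
  shows "rs_sum I (\<lambda>i. rs_sum J (F i)) = rs_sum J (\<lambda>j. rs_sum I (\<lambda>i. F i j))"
proof
  fix \<kappa>
  define P where "P = {(i, j). i \<in> I \<and> j \<in> J \<and> F i j \<kappa> \<noteq> 0}"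
  have fin: "finite (fst ` P)" "finite (snd ` P)" using assms[of \<kappa>] by (simp_all add: P_def)
  have sub: "fst ` P \<subseteq> I" "snd ` P \<subseteq> J" by (auto simp: P_def)
  have i0: "i \<in> fst ` P" and j0: "j \<in> snd ` P" if "i \<in> I" "j \<in> J" "F i j \<kappa> \<noteq> 0" for i j
    using that by (force simp: P_def)+
  have inner1: "rs_sum J (F i) \<kappa> = (\<Sum>j\<in>snd ` P. F i j \<kappa>)" if "i \<in> I" for i
    by (rule rs_sum_eq[OF fin(2) sub(2)]) (use j0 that in blast)
  have inner2: "rs_sum I (\<lambda>i. F i j) \<kappa> = (\<Sum>i\<in>fst ` P. F i j \<kappa>)" if "j \<in> J" for j
    by (rule rs_sum_eq[OF fin(1) sub(1)]) (use i0 that in blast)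
  have "rs_sum I (\<lambda>i. rs_sum J (F i)) \<kappa> = (\<Sum>i\<in>fst ` P. rs_sum J (F i) \<kappa>)"
  proof (rule rs_sum_eq[OF fin(1) sub(1)], rule ccontr)
    fix i assume i: "i \<in> I" "i \<notin> fst ` P" "rs_sum J (F i) \<kappa> \<noteq> 0"
    obtain j where "j \<in> J" "F i j \<kappa> \<noteq> 0" using i(3) by (rule rs_sum_nonzeroD)
    then show False using i i0 by blast
  qed
  also have "\<dots> = (\<Sum>i\<in>fst ` P. \<Sum>j\<in>snd ` P. F i j \<kappa>)"
    by (rule sum.cong[OF refl], rule inner1) (use sub in blast)
  also have "\<dots> = (\<Sum>j\<in>snd ` P. \<Sum>i\<in>fst ` P. F i j \<kappa>)" by (rule sum.swap)
  also have "\<dots> = (\<Sum>j\<in>snd ` P. rs_sum I (\<lambda>i. F i j) \<kappa>)"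
    by (rule sum.cong[OF refl], rule inner2[symmetric]) (use sub in blast)
  also have "\<dots> = rs_sum J (\<lambda>j. rs_sum I (\<lambda>i. F i j)) \<kappa>"
  proof (rule rs_sum_eq[OF fin(2) sub(2), symmetric], rule ccontr)
    fix j assume j: "j \<in> J" "j \<notin> snd ` P" "rs_sum I (\<lambda>i. F i j) \<kappa> \<noteq> 0"
    obtain i where "i \<in> I" "F i j \<kappa> \<noteq> 0" using j(3) by (rule rs_sum_nonzeroD)
    then show False using j j0 by blast
  qed
  finally show "rs_sum I (\<lambda>i. rs_sum J (F i)) \<kappa> = rs_sum J (\<lambda>j. rs_sum I (\<lambda>i. F i j)) \<kappa>" .
qed

lemma rs_sum_add:
  assumes "locally_finite I F" "locally_finite I G"
  shows "rs_sum I (\<lambda>i. rs_add (F i) (G i)) = rs_add (rs_sum I F) (rs_sum I G)"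
proof
  fix \<kappa>
  let ?J = "{i \<in> I. F i \<kappa> \<noteq> 0} \<union> {i \<in> I. G i \<kappa> \<noteq> 0}"
  have fin: "finite ?J" using assms by (simp add: locally_finite_def)
  have "rs_sum I (\<lambda>i. rs_add (F i) (G i)) \<kappa> = (\<Sum>i\<in>?J. F i \<kappa> + G i \<kappa>)"
    using rs_sum_eq[OF fin, of I "\<lambda>i. rs_add (F i) (G i)" \<kappa>] by (auto simp: rs_add_def)
  moreover have "rs_sum I F \<kappa> = (\<Sum>i\<in>?J. F i \<kappa>)" "rs_sum I G \<kappa> = (\<Sum>i\<in>?J. G i \<kappa>)"
    by (rule rs_sum_eq[OF fin], auto)+
  ultimately show "rs_sum I (\<lambda>i. rs_add (F i) (G i)) \<kappa> = rs_add (rs_sum I F) (rs_sum I G) \<kappa>"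
    by (simp add: rs_add_def sum.distrib)
qed

lemma rs_sum_finite_sum:
  assumes "finite K" "\<And>k. k \<in> K \<Longrightarrow> locally_finite I (F k)"
  shows "rs_sum I (\<lambda>i \<kappa>. \<Sum>k\<in>K. F k i \<kappa>) = (\<lambda>\<kappa>. \<Sum>k\<in>K. rs_sum I (F k) \<kappa>)"
proof -
  have "rs_sum I (\<lambda>i. rs_sum K (\<lambda>k. F k i)) = rs_sum K (\<lambda>k. rs_sum I (\<lambda>i. F k i))"
  proof (rule rs_sum_swap)
    fix \<kappa>
    show "finite {(i, k). i \<in> I \<and> k \<in> K \<and> F k i \<kappa> \<noteq> 0}"
      by (rule finite_subset[of _ "(\<lambda>(k, i). (i, k)) ` (SIGMA k:K. {i \<in> I. F k i \<kappa> \<noteq> 0})"])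
        (use assms in \<open>auto simp: locally_finite_def\<close>)
  qed
  then show ?thesis by (simp add: rs_sum_finite[OF assms(1)])
qed


section \<open>Series with support bounded below\<close>

text \<open>
  \<open>tame g C d f\<close>: only \<open>\<rho>\<^sub>1, \<dots>, \<rho>\<^sub>g\<close> occur in \<open>f\<close>, with exponents at least \<open>-C/2\<close> each and
  of total degree at least \<open>d/2\<close>.
\<close>

definition tame :: "nat \<Rightarrow> int \<Rightarrow> int \<Rightarrow> rho_series \<Rightarrow> bool" where
  "tame g C d f \<longleftrightarrow> (\<forall>\<kappa>. f \<kappa> \<noteq> 0 \<longrightarrow>
     (\<forall>i\<in>{1..g}. - C \<le> \<kappa> i) \<and> (\<forall>i. i \<notin> {1..g} \<longrightarrow> \<kappa> i = 0) \<and> d \<le> (\<Sum>i = 1..g. \<kappa> i))"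

lemma tameI:
  assumes "\<And>\<kappa> i. f \<kappa> \<noteq> 0 \<Longrightarrow> i \<in> {1..g} \<Longrightarrow> - C \<le> \<kappa> i" "\<And>\<kappa> i. f \<kappa> \<noteq> 0 \<Longrightarrow> i \<notin> {1..g} \<Longrightarrow> \<kappa> i = 0"
    "\<And>\<kappa>. f \<kappa> \<noteq> 0 \<Longrightarrow> d \<le> (\<Sum>i = 1..g. \<kappa> i)"
  shows "tame g C d f"
  using assms unfolding tame_def by blast

lemma tameD:
  assumes "tame g C d f" "f \<kappa> \<noteq> 0"
  shows "i \<in> {1..g} \<Longrightarrow> - C \<le> \<kappa> i" "i \<notin> {1..g} \<Longrightarrow> \<kappa> i = 0" "d \<le> (\<Sum>i = 1..g. \<kappa> i)"
  using assms unfolding tame_def by blast+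

lemma tame_weaken: "tame g C d f \<Longrightarrow> C \<le> C' \<Longrightarrow> d' \<le> d \<Longrightarrow> tame g C' d' f"
  unfolding tame_def by fastforce

lemma tame_mult:
  assumes f: "tame g C d f" and h: "tame g C' d' h"
  shows "tame g (C + C') (d + d') (rs_mult f h)"
proof -
  have *: "(i \<in> {1..g} \<longrightarrow> - (C + C') \<le> \<kappa> i) \<and> (i \<notin> {1..g} \<longrightarrow> \<kappa> i = 0) \<and> d + d' \<le> (\<Sum>i = 1..g. \<kappa> i)"
    if nz: "rs_mult f h \<kappa> \<noteq> 0" for \<kappa> i
  proof -
    obtain \<mu> where \<mu>: "f \<mu> \<noteq> 0" "h (\<lambda>i. \<kappa> i - \<mu> i) \<noteq> 0" using nz by (rule rs_mult_nonzeroD)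
    show ?thesis
      using tameD(1)[OF f \<mu>(1), of i] tameD(2)[OF f \<mu>(1), of i] tameD(3)[OF f \<mu>(1)]
        tameD(1)[OF h \<mu>(2), of i] tameD(2)[OF h \<mu>(2), of i] tameD(3)[OF h \<mu>(2)]
      by (auto simp: sum_subtractf)
  qed
  show ?thesis by (rule tameI) (use * in blast)+
qed

lemma tame_rs_sum:
  assumes "\<And>i. i \<in> I \<Longrightarrow> tame g C d (F i)"
  shows "tame g C d (rs_sum I F)"
  unfolding tame_def by (metis assms rs_sum_nonzeroD tame_def)

lemma tame_add: "tame g C d f \<Longrightarrow> tame g C d h \<Longrightarrow> tame g C d (rs_add f h)"
proof -
  assume f: "tame g C d f" and h: "tame g C d h"
  have "f \<kappa> \<noteq> 0 \<or> h \<kappa> \<noteq> 0" if "rs_add f h \<kappa> \<noteq> 0" for \<kappa>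
    using that by (auto simp: rs_add_def)
  then show ?thesis using f h unfolding tame_def by blast
qed

lemma tame_finite_sum:
  assumes "\<And>k. k \<in> K \<Longrightarrow> tame g C d (F k)"
  shows "tame g C d (\<lambda>\<kappa>. \<Sum>k\<in>K. F k \<kappa>)"
proof -
  have "\<exists>k\<in>K. F k \<kappa> \<noteq> 0" if "(\<Sum>k\<in>K. F k \<kappa>) \<noteq> 0" for \<kappa>
    using that by (meson sum.neutral)
  then show ?thesis using assms unfolding tame_def by blast
qed

lemma tame_mono:
  assumes "\<And>i. i \<in> {1..g} \<Longrightarrow> - C \<le> \<mu> i" "\<And>i. i \<notin> {1..g} \<Longrightarrow> \<mu> i = 0" "d \<le> (\<Sum>i = 1..g. \<mu> i)"
  shows "tame g C d (rs_mono c \<mu>)"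
  using assms by (auto simp: tame_def rs_mono_def split: if_splits)

text \<open>
  A finite set of exponents containing all terms of the coefficient \<open>\<kappa>\<close> of a product of two tame series.
\<close>

definition exponent_box :: "nat \<Rightarrow> int \<Rightarrow> int \<Rightarrow> (nat \<Rightarrow> int) \<Rightarrow> (nat \<Rightarrow> int) set" where
  "exponent_box g C C' \<kappa> = {\<mu>. \<forall>i. (i \<in> {1..g} \<longrightarrow> \<mu> i \<in> {- C..(\<Sum>i = 1..g. \<bar>\<kappa> i\<bar>) + C'}) \<and> (i \<notin> {1..g} \<longrightarrow> \<mu> i = 0)}"

lemma finite_exponent_box: "finite (exponent_box g C C' \<kappa>)"
  unfolding exponent_box_def by (rule finite_set_of_finite_funs) auto

lemma exponent_box_superset:
  assumes "tame g C d f" "tame g C' d' h" "f \<mu> \<noteq> 0" "h (\<lambda>i. \<kappa> i - \<mu> i) \<noteq> 0"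
  shows "\<mu> \<in> exponent_box g C C' \<kappa>"
proof -
  have "\<kappa> i \<le> (\<Sum>i = 1..g. \<bar>\<kappa> i\<bar>)" if "i \<in> {1..g}" for i
    using member_le_sum[of i "{1..g}" "\<lambda>i. \<bar>\<kappa> i\<bar>"] that by force
  then show ?thesis
    using tameD[OF assms(1,3)] tameD[OF assms(2,4)] by (fastforce simp: exponent_box_def)
qed

lemma rs_mult_box:
  assumes "tame g C d f" "tame g C' d' h"
  shows "rs_mult f h \<kappa> = (\<Sum>\<mu>\<in>exponent_box g C C' \<kappa>. f \<mu> * h (\<lambda>i. \<kappa> i - \<mu> i))"
  unfolding rs_mult_def
  by (rule Sum_any.expand_superset[OF finite_exponent_box])
    (use exponent_box_superset[OF assms] in auto)

lemma rs_mult_add_right: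
  assumes "tame g C d f" "tame g C' d' h" "tame g C' d' k"
  shows "rs_mult f (rs_add h k) = rs_add (rs_mult f h) (rs_mult f k)"
proof
  fix \<kappa>
  show "rs_mult f (rs_add h k) \<kappa> = rs_add (rs_mult f h) (rs_mult f k) \<kappa>"
    unfolding rs_mult_box[OF assms(1) tame_add[OF assms(2,3)]]
    by (simp add: rs_add_def rs_mult_box[OF assms(1,2)] rs_mult_box[OF assms(1,3)] sum.distrib distrib_left)
qed

lemma rs_mult_add_left:
  assumes "tame g C d f" "tame g C' d' h" "tame g C' d' k"
  shows "rs_mult (rs_add h k) f = rs_add (rs_mult h f) (rs_mult k f)"
  using rs_mult_add_right[OF assms] by (simp add: rs_mult_commute[of _ f])

lemma rs_mult_finite_sum_right:
  assumes "tame g C d f" "\<And>k. k \<in> K \<Longrightarrow> tame g C' d' (F k)"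
  shows "rs_mult f (\<lambda>\<kappa>. \<Sum>k\<in>K. F k \<kappa>) = (\<lambda>\<kappa>. \<Sum>k\<in>K. rs_mult f (F k) \<kappa>)"
proof
  fix \<kappa>
  have "rs_mult f (\<lambda>\<kappa>. \<Sum>k\<in>K. F k \<kappa>) \<kappa>
      = (\<Sum>\<mu>\<in>exponent_box g C C' \<kappa>. \<Sum>k\<in>K. f \<mu> * F k (\<lambda>i. \<kappa> i - \<mu> i))"
    by (simp add: rs_mult_box[OF assms(1) tame_finite_sum[OF assms(2)]] sum_distrib_left)
  also have "\<dots> = (\<Sum>k\<in>K. rs_mult f (F k) \<kappa>)"
    by (subst sum.swap) (simp add: rs_mult_box[OF assms(1) assms(2)])
  finally show "rs_mult f (\<lambda>\<kappa>. \<Sum>k\<in>K. F k \<kappa>) \<kappa> = (\<Sum>k\<in>K. rs_mult f (F k) \<kappa>)" .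
qed

text \<open>
  For tame series each coefficient of the product is a sum over one fixed finite box of exponents, in which
  only finitely many members of the family occur.
\<close>

lemma rs_mult_rs_sum_right:
  assumes f: "tame g C d f" and F: "\<And>i. i \<in> I \<Longrightarrow> tame g C' d' (F i)" and lf: "locally_finite I F"
  shows "rs_mult f (rs_sum I F) = rs_sum I (\<lambda>i. rs_mult f (F i))"
proof
  fix \<kappa>
  let ?K = "exponent_box g C C' \<kappa>"
  define J where "J = (\<Union>\<mu>\<in>?K. {i \<in> I. F i (\<lambda>j. \<kappa> j - \<mu> j) \<noteq> 0})"
  have fin: "finite J" unfolding J_def using lf finite_exponent_box by (auto simp: locally_finite_def)
  have sub: "J \<subseteq> I" by (auto simp: J_def)
  have "rs_mult f (rs_sum I F) \<kappa> = (\<Sum>\<mu>\<in>?K. f \<mu> * rs_sum I F (\<lambda>j. \<kappa> j - \<mu> j))"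
    by (rule rs_mult_box[OF f tame_rs_sum[OF F]])
  also have "\<dots> = (\<Sum>\<mu>\<in>?K. f \<mu> * (\<Sum>i\<in>J. F i (\<lambda>j. \<kappa> j - \<mu> j)))"
    by (intro sum.cong refl arg_cong2[where f = "(*)"] rs_sum_eq[OF fin sub]) (auto simp: J_def)
  also have "\<dots> = (\<Sum>i\<in>J. \<Sum>\<mu>\<in>?K. f \<mu> * F i (\<lambda>j. \<kappa> j - \<mu> j))"
    by (subst sum.swap) (simp add: sum_distrib_left)
  also have "\<dots> = (\<Sum>i\<in>J. rs_mult f (F i) \<kappa>)"
    by (intro sum.cong refl) (use sub in \<open>auto simp: rs_mult_box[OF f F]\<close>)
  also have "\<dots> = rs_sum I (\<lambda>i. rs_mult f (F i)) \<kappa>"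
  proof (rule rs_sum_eq[OF fin sub, symmetric])
    fix i assume i: "i \<in> I" "i \<notin> J"
    then have "F i (\<lambda>j. \<kappa> j - \<mu> j) = 0" if "\<mu> \<in> ?K" for \<mu> using that by (auto simp: J_def)
    then show "rs_mult f (F i) \<kappa> = 0" by (simp add: rs_mult_box[OF f F[OF i(1)]])
  qed
  finally show "rs_mult f (rs_sum I F) \<kappa> = rs_sum I (\<lambda>i. rs_mult f (F i)) \<kappa>" .
qed

lemma rs_mult_rs_sum_left:
  assumes "tame g C d f" "\<And>i. i \<in> I \<Longrightarrow> tame g C' d' (F i)" "locally_finite I F"
  shows "rs_mult (rs_sum I F) f = rs_sum I (\<lambda>i. rs_mult (F i) f)"
  using rs_mult_rs_sum_right[OF assms] by (simp add: rs_mult_commute[of _ f])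

text \<open>Only members of degree at most that of \<open>\<kappa>\<close> can contribute to the coefficient \<open>\<kappa>\<close>.\<close>

lemma locally_finite_degree:
  assumes "\<And>i. i \<in> I \<Longrightarrow> tame g C (\<phi> i) (F i)" "\<And>k. finite {i \<in> I. \<phi> i \<le> k}"
  shows "locally_finite I F"
  unfolding locally_finite_def
proof
  fix \<kappa> :: "nat \<Rightarrow> int"
  show "finite {i \<in> I. F i \<kappa> \<noteq> 0}"
    by (rule finite_subset[OF _ assms(2)[of "\<Sum>i = 1..g. \<kappa> i"]]) (use tameD(3) assms(1) in blast)
qed

lemma finite_handles: "finite (handles g)"
  by (simp add: handles_def)

lemma uminus_handles: "a \<in> handles g \<Longrightarrow> - a \<in> handles g"
  by (auto simp: handles_def)

lemma finite_index_le: "finite {r \<in> handles g \<times> UNIV. int (snd r) + c \<le> k}"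
  by (rule finite_subset[of _ "handles g \<times> {..nat (k - c)}"]) (auto simp: finite_handles)

lemma locally_finite_index:
  assumes "\<And>a m. a \<in> handles g \<Longrightarrow> tame h C (int m + c) (F (a, m))"
  shows "locally_finite (handles g \<times> UNIV) F"
  by (rule locally_finite_degree[where \<phi> = "\<lambda>r. int (snd r) + c"]) (use assms finite_index_le in auto)

lemma finite_index_pairs:
  assumes "\<And>a m b n. a \<in> handles g \<Longrightarrow> b \<in> handles g \<Longrightarrow> tame h C (int m + int n + c) (F (a, m) (b, n))"
  shows "finite {(r, q). r \<in> handles g \<times> UNIV \<and> q \<in> handles g \<times> UNIV \<and> F r q \<kappa> \<noteq> 0}"
proof (rule finite_subset)
  let ?k = "\<Sum>i = 1..h. \<kappa> i"
  show "finite ((handles g \<times> {..nat (?k - c)}) \<times> (handles g \<times> {..nat (?k - c)}))"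
    by (simp add: finite_handles)
  show "{(r, q). r \<in> handles g \<times> UNIV \<and> q \<in> handles g \<times> UNIV \<and> F r q \<kappa> \<noteq> 0}
      \<subseteq> (handles g \<times> {..nat (?k - c)}) \<times> (handles g \<times> {..nat (?k - c)})"
  proof
    fix z assume "z \<in> {(r, q). r \<in> handles g \<times> UNIV \<and> q \<in> handles g \<times> UNIV \<and> F r q \<kappa> \<noteq> 0}"
    then obtain a m b n where z: "z = ((a, m), (b, n))" and ab: "a \<in> handles g" "b \<in> handles g"
      and nz: "F (a, m) (b, n) \<kappa> \<noteq> 0" by auto
    have "int m + int n + c \<le> ?k" by (rule tameD(3)[OF assms[OF ab] nz])
    then show "z \<in> (handles g \<times> {..nat (?k - c)}) \<times> (handles g \<times> {..nat (?k - c)})"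
      using z ab by auto
  qed
qed

section \<open>Monomial entries of vectors and matrices\<close>

definition is_monomial :: "rho_series \<Rightarrow> bool" where
  "is_monomial f \<longleftrightarrow> (\<exists>c \<mu>. f = rs_mono c \<mu>)"

lemma rs_mult_assoc_middle: "is_monomial m \<Longrightarrow> rs_mult (rs_mult f m) h = rs_mult f (rs_mult m h)"
  by (auto simp: is_monomial_def rs_mult_mono_assoc)

lemma rs_mult_assoc_left: "is_monomial m \<Longrightarrow> rs_mult (rs_mult m f) h = rs_mult m (rs_mult f h)"
  by (auto simp: is_monomial_def rs_mono_mult_assoc)

lemma rs_mult_rs_sum_monomial_left:
  "is_monomial m \<Longrightarrow> rs_mult m (rs_sum I F) = rs_sum I (\<lambda>i. rs_mult m (F i))"
  by (auto simp: is_monomial_def rs_sum_mono_mult)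

lemma rs_mult_rs_sum_monomial_right:
  "is_monomial m \<Longrightarrow> rs_mult (rs_sum I F) m = rs_sum I (\<lambda>i. rs_mult (F i) m)"
  by (auto simp: is_monomial_def rs_sum_mult_mono)

lemma rs_mono_mult_mono: "rs_mult (rs_mono c \<mu>) (rs_mono d \<nu>) = rs_mono (c * d) (\<lambda>i. \<mu> i + \<nu> i)"
  unfolding rs_mult_mono_left by (auto simp: rs_mono_def fun_eq_iff algebra_simps)

text \<open>
  The exponent vector of \<open>\<rho>\<^sub>a^(k/2)\<close>; the variables \<open>\<rho>\<^sub>a\<close> and \<open>\<rho>\<^sub>-\<^sub>a\<close> coincide.
\<close>

definition half_exponent :: "int \<Rightarrow> int \<Rightarrow> nat \<Rightarrow> int" where
  "half_exponent a k = (\<lambda>i. if i = nat \<bar>a\<bar> then k else 0)"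

lemma rho_half_mono: "rho_half a k = rs_mono 1 (half_exponent a k)"
  by (simp add: rho_half_def half_exponent_def)

lemma Lvec_mono: "Lvec N w A x (b, n) = rs_mono (sderiv2 0 n (piN N A) x (w b)) (half_exponent b (int n))"
  by (simp add: Lvec_def rho_half_mono rs_const_def rs_mono_mult_mono)

lemma handle_index: "a \<in> handles g \<Longrightarrow> nat \<bar>a\<bar> \<in> {1..g}"
  by (auto simp: handles_def)

lemma sum_half_exponent: "c \<in> handles g \<Longrightarrow> (\<Sum>i = 1..g. half_exponent c k i) = k"
  unfolding half_exponent_def using handle_index[of c g] by simp

lemma tame_half_exponent:
  assumes "a \<in> handles g" "k \<ge> 0"
  shows "tame g 0 k (rs_mono c (half_exponent a k))"
proof (rule tame_mono)
  have "(\<Sum>i = 1..g. half_exponent a k i) = k"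
    unfolding half_exponent_def using handle_index[OF assms(1)] by simp
  then show "k \<le> (\<Sum>i = 1..g. half_exponent a k i)" by simp
qed (use assms handle_index[OF assms(1)] in \<open>auto simp: half_exponent_def\<close>)

lemma tame_rs_const: "tame g 0 0 (rs_const c)"
  unfolding rs_const_def by (rule tame_mono) auto

lemma tame_rho_half: "a \<in> handles g \<Longrightarrow> k \<ge> 0 \<Longrightarrow> tame g 0 k (rho_half a k)"
  by (simp add: rho_half_mono tame_half_exponent)

lemma is_monomial_mult: "is_monomial f \<Longrightarrow> is_monomial h \<Longrightarrow> is_monomial (rs_mult f h)"
  unfolding is_monomial_def using rs_mono_mult_mono by metis

lemma is_monomial_rho_half: "is_monomial (rho_half a k)"
  and is_monomial_rs_const: "is_monomial (rs_const c)"
  by (auto simp: is_monomial_def rho_half_mono rs_const_def)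

lemma is_monomial_Lvec: "is_monomial (Lvec N w A x p)"
  by (cases p) (simp add: Lvec_def is_monomial_mult is_monomial_rho_half is_monomial_rs_const)

lemma is_monomial_Amat: "is_monomial (Amat N w A p q)"
  by (cases p; cases q) (simp add: Amat_def is_monomial_mult is_monomial_rho_half is_monomial_rs_const)

lemma tame_Lvec: "b \<in> handles g \<Longrightarrow> tame g 0 (int n) (Lvec N w A x (b, n))"
  using tame_mult[OF tame_rho_half[of b g "int n"] tame_rs_const] by (simp add: Lvec_def)

lemma tame_Amat:
  "a \<in> handles g \<Longrightarrow> b \<in> handles g \<Longrightarrow> tame g 0 (int m + int n + 1) (Amat N w A (a, m) (b, n))"
  using tame_mult[OF tame_mult[OF tame_rho_half[of a g "int m + 1"] tame_rho_half[of b g "int n"]] tame_rs_const]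
  by (simp add: Amat_def add_ac)

lemma rs_sum_single:
  assumes "p \<in> I" "\<And>r. r \<in> I \<Longrightarrow> r \<noteq> p \<Longrightarrow> F r = (\<lambda>_. 0)"
  shows "rs_sum I F = F p"
proof
  fix \<kappa>
  have "rs_sum I F \<kappa> = (\<Sum>r\<in>{p}. F r \<kappa>)" by (rule rs_sum_eq) (use assms in auto)
  then show "rs_sum I F \<kappa> = F p \<kappa>" by simp
qed

lemma vec_mat_Delta:
  assumes "a \<in> handles g"
  shows "vec_mat g X (Delta N) (a, n) = X (a, n + 2 * N - 1)"
proof -
  have "vec_mat g X (Delta N) (a, n) = rs_mult (X (a, n + 2 * N - 1)) (Delta N (a, n + 2 * N - 1) (a, n))"
    unfolding vec_mat_def
    by (rule rs_sum_single) (use assms in \<open>auto simp: Delta_def rs_mult_const_right\<close>)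
  then show ?thesis by (simp add: Delta_def rs_mult_const_right)
qed

lemma Ltilde_eq: "b \<in> handles g \<Longrightarrow> Ltilde N g w A x (b, n) = Lvec N w A x (b, n + 2 * N - 1)"
  by (simp add: Ltilde_def vec_mat_Delta)

lemma Atilde_eq: "b \<in> handles g \<Longrightarrow> Atilde N g w A p (b, n) = Amat N w A p (b, n + 2 * N - 1)"
  by (simp add: Atilde_def mat_mult_def vec_mat_Delta)

text \<open>
  \<open>Delta\<close> shifts the mode number by \<open>2N - 1\<close>; the modes below the shift are those of \<open>\<Theta>\<^sub>N\<^sub>,\<^sub>a\<^sup>l\<close>.
\<close>

lemma rs_sum_split_low:
  fixes F :: "int \<times> nat \<Rightarrow> rho_series"
  assumes "locally_finite (handles g \<times> UNIV) F" "N \<ge> 1"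
  shows "rs_sum (handles g \<times> UNIV) F =
    (\<lambda>\<kappa>. (\<Sum>p\<in>handles g \<times> {..2 * N - 2}. F p \<kappa>)
       + rs_sum (handles g \<times> UNIV) (\<lambda>(a, n). F (a, n + 2 * N - 1)) \<kappa>)"
proof
  fix \<kappa>
  let ?I = "handles g \<times> (UNIV :: nat set)"
  let ?low = "handles g \<times> {..2 * N - 2}"
  let ?sh = "\<lambda>(a :: int, n). (a, n + 2 * N - 1)"
  define J where "J = {p \<in> ?I. F p \<kappa> \<noteq> 0}"
  have fin: "finite J" using assms(1) by (simp add: J_def locally_finite_def)
  have inj: "inj_on ?sh X" for X using assms(2) by (auto simp: inj_on_def)
  have img: "?sh ` {q \<in> ?I. F (?sh q) \<kappa> \<noteq> 0} = J - ?low"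
  proof
    show "?sh ` {q \<in> ?I. F (?sh q) \<kappa> \<noteq> 0} \<subseteq> J - ?low" using assms(2) by (auto simp: J_def)
    show "J - ?low \<subseteq> ?sh ` {q \<in> ?I. F (?sh q) \<kappa> \<noteq> 0}"
    proof
      fix p assume p: "p \<in> J - ?low"
      obtain a n where an: "p = (a, n)" by (cases p)
      have "p = ?sh (a, n - (2 * N - 1))" "(a, n - (2 * N - 1)) \<in> {q \<in> ?I. F (?sh q) \<kappa> \<noteq> 0}"
        using p assms(2) by (auto simp: an J_def)
      then show "p \<in> ?sh ` {q \<in> ?I. F (?sh q) \<kappa> \<noteq> 0}" by (rule image_eqI)
    qed
  qed
  have "rs_sum ?I F \<kappa> = (\<Sum>p\<in>J. F p \<kappa>)" by (simp add: rs_sum_def J_def)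
  also have "\<dots> = (\<Sum>p\<in>J \<inter> ?low. F p \<kappa>) + (\<Sum>p\<in>J - ?low. F p \<kappa>)"
    by (subst sum.Int_Diff[OF fin, of _ ?low]) simp
  also have "(\<Sum>p\<in>J \<inter> ?low. F p \<kappa>) = (\<Sum>p\<in>?low. F p \<kappa>)"
    by (rule sum.mono_neutral_left) (auto simp: J_def finite_handles)
  also have "(\<Sum>p\<in>J - ?low. F p \<kappa>) = (\<Sum>q\<in>{q \<in> ?I. F (?sh q) \<kappa> \<noteq> 0}. F (?sh q) \<kappa>)"
    unfolding img[symmetric] by (subst sum.reindex[OF inj]) simp
  also have "\<dots> = rs_sum ?I (\<lambda>(a, n). F (a, n + 2 * N - 1)) \<kappa>"
    by (simp add: rs_sum_def case_prod_unfold)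
  finally show "rs_sum ?I F \<kappa> = (\<Sum>p\<in>?low. F p \<kappa>) + rs_sum ?I (\<lambda>(a, n). F (a, n + 2 * N - 1)) \<kappa>" .
qed

section \<open>The resolvent of the moment matrix\<close>

context
  fixes N g :: nat and w :: "int \<Rightarrow> complex" and A :: "nat \<Rightarrow> complex"
  assumes N: "N \<ge> 1"
begin

abbreviation "idx \<equiv> handles g \<times> (UNIV :: nat set)"
abbreviation "At \<equiv> Atilde N g w A"
abbreviation "Apow k \<equiv> (mat_mult g At ^^ k) mat_one"
abbreviation "Ginv \<equiv> geometric_inverse g At"

lemma is_monomial_Atilde: "q \<in> idx \<Longrightarrow> is_monomial (At p q)"
  by (cases q) (auto simp: Atilde_eq is_monomial_Amat)

text \<open>
  The entry has degree \<open>(m + n + 2N)/2\<close> in \<open>\<rho>\<close>.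
\<close>

lemma tame_Atilde:
  assumes "a \<in> handles g" "b \<in> handles g"
  shows "tame g 0 (int m + int n + 2) (At (a, m) (b, n))"
  unfolding Atilde_eq[OF assms(2)]
  by (rule tame_weaken[OF tame_Amat[OF assms]]) (use N in auto)

lemma tame_Atilde_column: "a \<in> handles g \<Longrightarrow> q \<in> idx \<Longrightarrow> tame g 0 (int m + 2) (At (a, m) q)"
  by (cases q) (auto intro: tame_weaken[OF tame_Atilde])

lemma tame_Atilde_row: "p \<in> idx \<Longrightarrow> b \<in> handles g \<Longrightarrow> tame g 0 (int n + 2) (At p (b, n))"
  by (cases p) (auto intro: tame_weaken[OF tame_Atilde])

lemma Apow_Suc: "Apow (Suc k) p q = rs_sum idx (\<lambda>r. rs_mult (At p r) (Apow k r q))"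
  by (simp add: mat_mult_def vec_mat_def)

lemma tame_Apow: "p \<in> idx \<Longrightarrow> tame g 0 (2 * int k) (Apow k p q)"
proof (induction k arbitrary: p)
  case 0
  then show ?case by (simp add: mat_one_def tame_rs_const)
next
  case (Suc k)
  show ?case
    unfolding Apow_Suc
  proof (rule tame_rs_sum)
    fix r assume r: "r \<in> idx"
    obtain a m where p: "p = (a, m)" "a \<in> handles g" using Suc.prems by auto
    show "tame g 0 (2 * int (Suc k)) (rs_mult (At p r) (Apow k r q))"
      using tame_mult[OF tame_Atilde_column[OF p(2) r] Suc.IH[OF r]] unfolding p
      by (rule tame_weaken) auto
  qed
qed

lemma rs_sum_mat_one_right: "q \<in> idx \<Longrightarrow> rs_sum idx (\<lambda>r. rs_mult (X r) (mat_one r q)) = X q"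
  by (subst rs_sum_single[of q]) (auto simp: mat_one_def rs_mult_const_right)

lemma rs_sum_mat_one_left: "p \<in> idx \<Longrightarrow> rs_sum idx (\<lambda>r. rs_mult (mat_one p r) (X r)) = X p"
  by (subst rs_sum_single[of p]) (auto simp: mat_one_def rs_mult_const_left)

text \<open>
  The powers are defined by multiplication on the left.  Multiplication on the right gives the same, as the
  sums over intermediate indices may be exchanged by the growth of the degrees.
\<close>

lemma Apow_Suc_right:
  assumes "p \<in> idx" "q \<in> idx"
  shows "Apow (Suc k) p q = rs_sum idx (\<lambda>r. rs_mult (Apow k p r) (At r q))"
  using assms
proof (induction k arbitrary: p)
  case 0
  then show ?case
    by (simp only: Apow_Suc funpow_0 rs_sum_mat_one_right rs_sum_mat_one_left)
next
  case (Suc k)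
  have "Apow (Suc (Suc k)) p q = rs_sum idx (\<lambda>r. rs_mult (At p r) (Apow (Suc k) r q))"
    by (rule Apow_Suc)
  also have "\<dots> = rs_sum idx (\<lambda>r. rs_sum idx (\<lambda>s. rs_mult (At p r) (rs_mult (Apow k r s) (At s q))))"
    by (rule rs_sum_cong) (simp only: Suc.IH Suc.prems rs_mult_rs_sum_monomial_left is_monomial_Atilde)
  also have "\<dots> = rs_sum idx (\<lambda>s. rs_sum idx (\<lambda>r. rs_mult (At p r) (rs_mult (Apow k r s) (At s q))))"
  proof (rule rs_sum_swap, rule finite_index_pairs[where C = 0 and c = 0])
    fix a m b n assume ab: "a \<in> handles g" "b \<in> handles g"
    have "tame g (0 + (0 + 0)) (int m + 2 + (2 * int k + (int n + 2)))
        (rs_mult (At p (a, m)) (rs_mult (Apow k (a, m) (b, n)) (At (b, n) q)))"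
      by (intro tame_mult tame_Atilde_row tame_Atilde_column tame_Apow Suc.prems ab) (use ab in auto)
    then show "tame g 0 (int m + int n + 0) (rs_mult (At p (a, m)) (rs_mult (Apow k (a, m) (b, n)) (At (b, n) q)))"
      by (rule tame_weaken) auto
  qed
  also have "\<dots> = rs_sum idx (\<lambda>s. rs_mult (Apow (Suc k) p s) (At s q))"
    unfolding Apow_Suc
    by (rule rs_sum_cong)
      (simp only: rs_mult_rs_sum_monomial_right is_monomial_Atilde Suc.prems rs_mult_assoc_middle,
        rule rs_sum_cong, simp only: rs_mult_assoc_left is_monomial_Atilde)
  finally show ?case .
qed

lemma locally_finite_Apow: "p \<in> idx \<Longrightarrow> locally_finite UNIV (\<lambda>k. Apow k p q)"
proof (rule locally_finite_degree)
  show "finite {i \<in> UNIV. 2 * int i \<le> k}" for k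
    by (rule finite_subset[of _ "{..nat k}"]) auto
qed (rule tame_Apow)

lemma tame_Ginv: "p \<in> idx \<Longrightarrow> tame g 0 0 (Ginv p q)"
  unfolding geometric_inverse_def
  by (rule tame_rs_sum, rule tame_weaken[OF tame_Apow]) auto

lemma rs_sum_nat_split:
  assumes "locally_finite UNIV (F :: nat \<Rightarrow> rho_series)"
  shows "rs_sum UNIV F = rs_add (F 0) (rs_sum UNIV (\<lambda>k. F (Suc k)))"
proof
  fix \<kappa>
  have "finite {k. F k \<kappa> \<noteq> 0}" using assms by (simp add: locally_finite_def)
  then obtain K where K: "\<And>k. F k \<kappa> \<noteq> 0 \<Longrightarrow> k < K"
    unfolding finite_nat_set_iff_bounded by blast
  have "rs_sum UNIV F \<kappa> = (\<Sum>k<Suc K. F k \<kappa>)"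
    by (rule rs_sum_eq) (use K less_SucI in blast)+
  also have "\<dots> = F 0 \<kappa> + (\<Sum>k<K. F (Suc k) \<kappa>)" by (rule sum.lessThan_Suc_shift)
  also have "(\<Sum>k<K. F (Suc k) \<kappa>) = rs_sum UNIV (\<lambda>k. F (Suc k)) \<kappa>"
    by (rule rs_sum_eq[symmetric]) (use K Suc_lessD in blast)+
  finally show "rs_sum UNIV F \<kappa> = rs_add (F 0) (rs_sum UNIV (\<lambda>k. F (Suc k))) \<kappa>"
    by (simp add: rs_add_def)
qed

lemma Ginv_rec:
  assumes p: "p \<in> idx" and q: "q \<in> idx"
  shows "Ginv p q = rs_add (mat_one p q) (rs_sum idx (\<lambda>s. rs_mult (Ginv p s) (At s q)))"
proof -
  have "Ginv p q = rs_add (mat_one p q) (rs_sum UNIV (\<lambda>k. Apow (Suc k) p q))"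
    unfolding geometric_inverse_def
    by (subst rs_sum_nat_split[OF locally_finite_Apow[OF p]]) simp
  also have "rs_sum UNIV (\<lambda>k. Apow (Suc k) p q)
      = rs_sum UNIV (\<lambda>k. rs_sum idx (\<lambda>s. rs_mult (Apow k p s) (At s q)))"
    by (rule rs_sum_cong) (rule Apow_Suc_right[OF p q])
  also have "\<dots> = rs_sum idx (\<lambda>s. rs_sum UNIV (\<lambda>k. rs_mult (Apow k p s) (At s q)))"
  proof (rule rs_sum_swap)
    fix \<kappa> :: "nat \<Rightarrow> int"
    let ?d = "\<Sum>i = 1..g. \<kappa> i"
    show "finite {(k, s). k \<in> UNIV \<and> s \<in> idx \<and> rs_mult (Apow k p s) (At s q) \<kappa> \<noteq> 0}"
    proof (rule finite_subset)
      show "finite ({..nat ?d} \<times> (handles g \<times> {..nat ?d}))" by (simp add: finite_handles)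
      show "{(k, s). k \<in> UNIV \<and> s \<in> idx \<and> rs_mult (Apow k p s) (At s q) \<kappa> \<noteq> 0} \<subseteq> {..nat ?d} \<times> (handles g \<times> {..nat ?d})"
      proof
        fix z assume "z \<in> {(k, s). k \<in> UNIV \<and> s \<in> idx \<and> rs_mult (Apow k p s) (At s q) \<kappa> \<noteq> 0}"
        then obtain k a n where z: "z = (k, (a, n))" "a \<in> handles g"
          "rs_mult (Apow k p (a, n)) (At (a, n) q) \<kappa> \<noteq> 0" by auto
        have "tame g (0 + 0) (2 * int k + (int n + 2)) (rs_mult (Apow k p (a, n)) (At (a, n) q))"
          by (intro tame_mult tame_Apow tame_Atilde_column p q z)
        from tameD(3)[OF this z(3)] show "z \<in> {..nat ?d} \<times> (handles g \<times> {..nat ?d})"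
          using z by auto
      qed
    qed
  qed
  also have "\<dots> = rs_sum idx (\<lambda>s. rs_mult (Ginv p s) (At s q))"
    unfolding geometric_inverse_def
    by (rule rs_sum_cong) (simp only: rs_mult_rs_sum_monomial_right is_monomial_Atilde q)
  finally show ?thesis .
qed

context
  fixes x :: complex
begin

abbreviation "Lt \<equiv> Ltilde N g w A x"
abbreviation "LInv \<equiv> LtildeInv N g w A x"

lemma is_monomial_Ltilde: "q \<in> idx \<Longrightarrow> is_monomial (Lt q)"
  by (cases q) (auto simp: Ltilde_eq is_monomial_Lvec)

lemma tame_Ltilde: "b \<in> handles g \<Longrightarrow> tame g 0 (int n) (Lt (b, n))"
  unfolding Ltilde_eq by (rule tame_weaken[OF tame_Lvec]) (use N in auto)

lemma LInv_eq: "LInv q = rs_sum idx (\<lambda>r. rs_mult (Lt r) (Ginv r q))"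
  by (simp add: LtildeInv_def vec_mat_def)

lemma tame_LInv: "tame g 0 0 (LInv q)"
  unfolding LInv_eq
proof (rule tame_rs_sum)
  fix r assume r: "r \<in> idx"
  then obtain b n where bn: "r = (b, n)" "b \<in> handles g" by auto
  show "tame g 0 0 (rs_mult (Lt r) (Ginv r q))"
    using tame_mult[OF tame_Ltilde[OF bn(2), of n] tame_Ginv[OF r, of q]] unfolding bn
    by (rule tame_weaken) auto
qed

text \<open>
  Multiply the recursion \<open>Ginv_rec\<close> by \<open>\<tilde>L\<close> from the left.  This one-sided identity is the only property
  of \<open>(I - \<tilde>A)\<^sup>-\<^sup>1\<close> that enters the solution of the linear system.
\<close>

lemma LInv_rec:
  assumes q: "q \<in> idx"
  shows "LInv q = rs_add (Lt q) (rs_sum idx (\<lambda>s. rs_mult (LInv s) (At s q)))"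
proof -
  let ?S = "\<lambda>r. rs_sum idx (\<lambda>s. rs_mult (Ginv r s) (At s q))"
  have tS: "tame g 0 0 (?S r)" if "r \<in> idx" for r
  proof (rule tame_rs_sum)
    fix s assume "s \<in> idx"
    then obtain b n where s: "s = (b, n)" "b \<in> handles g" by auto
    show "tame g 0 0 (rs_mult (Ginv r s) (At s q))"
      using tame_mult[OF tame_Ginv[OF that, of s] tame_Atilde_column[OF s(2) q, of n]] unfolding s
      by (rule tame_weaken) auto
  qed
  have tone: "tame g 0 0 (mat_one r q)" for r by (simp add: mat_one_def tame_rs_const)
  have lf: "locally_finite idx (\<lambda>r. rs_mult (Lt r) (X r))" if "\<And>r. r \<in> idx \<Longrightarrow> tame g 0 0 (X r)" for X
    by (rule locally_finite_index[where h = g and c = 0]) (rule tame_mult[OF tame_Ltilde that], auto)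
  have "LInv q = rs_sum idx (\<lambda>r. rs_add (rs_mult (Lt r) (mat_one r q)) (rs_mult (Lt r) (?S r)))"
    unfolding LInv_eq
  proof (rule rs_sum_cong)
    fix r assume r: "r \<in> idx"
    then obtain b n where bn: "r = (b, n)" "b \<in> handles g" by auto
    show "rs_mult (Lt r) (Ginv r q) = rs_add (rs_mult (Lt r) (mat_one r q)) (rs_mult (Lt r) (?S r))"
      unfolding Ginv_rec[OF r q]
      by (rule rs_mult_add_right[OF _ tone tS[OF r]]) (use tame_Ltilde[OF bn(2), of n] bn in simp)
  qed
  also have "\<dots> = rs_add (rs_sum idx (\<lambda>r. rs_mult (Lt r) (mat_one r q))) (rs_sum idx (\<lambda>r. rs_mult (Lt r) (?S r)))"
    by (intro rs_sum_add lf tone tS)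
  also have "rs_sum idx (\<lambda>r. rs_mult (Lt r) (mat_one r q)) = Lt q"
    by (rule rs_sum_mat_one_right[OF q])
  also have "rs_sum idx (\<lambda>r. rs_mult (Lt r) (?S r))
      = rs_sum idx (\<lambda>r. rs_sum idx (\<lambda>s. rs_mult (rs_mult (Lt r) (Ginv r s)) (At s q)))"
    by (rule rs_sum_cong)
      (simp only: rs_mult_rs_sum_monomial_left is_monomial_Ltilde rs_mult_assoc_left)
  also have "\<dots> = rs_sum idx (\<lambda>s. rs_sum idx (\<lambda>r. rs_mult (rs_mult (Lt r) (Ginv r s)) (At s q)))"
  proof (rule rs_sum_swap, rule finite_index_pairs[where C = 0 and c = 0])
    fix a m b n assume ab: "a \<in> handles g" "b \<in> handles g"
    have "tame g (0 + 0 + 0) (int m + 0 + (int n + 2)) (rs_mult (rs_mult (Lt (a, m)) (Ginv (a, m) (b, n))) (At (b, n) q))"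
      by (intro tame_mult tame_Ltilde tame_Ginv tame_Atilde_column ab q) (use ab in auto)
    then show "tame g 0 (int m + int n + 0) (rs_mult (rs_mult (Lt (a, m)) (Ginv (a, m) (b, n))) (At (b, n) q))"
      by (rule tame_weaken) auto
  qed
  also have "\<dots> = rs_sum idx (\<lambda>s. rs_mult (LInv s) (At s q))"
    unfolding LInv_eq
    by (rule rs_sum_cong) (simp only: rs_mult_rs_sum_monomial_right is_monomial_Atilde q)
  finally show ?thesis .
qed

text \<open>
  Write \<open>M = \<tilde>L (I - \<tilde>A)\<^sup>-\<^sup>1\<close>.  Then \<open>M Y = \<tilde>L Y + M \<tilde>A Y\<close> by \<open>LInv_rec\<close>, while \<open>Y = H + \<tilde>A Y\<close> gives
  \<open>M Y = M H + M \<tilde>A Y\<close>.  The number \<open>C\<close> bounds the negative exponents that the unknowns may have.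
\<close>

lemma resolvent_solution:
  assumes Y: "\<And>a n. a \<in> handles g \<Longrightarrow> tame g C (int n - C) (Y (a, n))"
    and H: "\<And>a n. a \<in> handles g \<Longrightarrow> tame g C (int n - C) (H (a, n))"
    and eq: "\<And>q. q \<in> idx \<Longrightarrow> Y q = rs_add (H q) (rs_sum idx (\<lambda>r. rs_mult (At q r) (Y r)))"
    and C: "C \<ge> 0"
  shows "rs_sum idx (\<lambda>q. rs_mult (Lt q) (Y q)) = rs_sum idx (\<lambda>q. rs_mult (LInv q) (H q))"
proof -
  let ?AY = "\<lambda>q. rs_sum idx (\<lambda>r. rs_mult (At q r) (Y r))"
  let ?LA = "\<lambda>q. rs_sum idx (\<lambda>s. rs_mult (LInv s) (At s q))"
  have tY: "tame g C (- C) (Y q)" if "q \<in> idx" for q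
    using that tame_weaken[OF Y, of "fst q" C "- C" "snd q"] by auto
  have tAY1: "tame g C (int m + int n - C) (rs_mult (At (a, m) (b, n)) (Y (b, n)))"
    if "a \<in> handles g" "b \<in> handles g" for a b m n
    using tame_mult[OF tame_Atilde[OF that, of m n] Y[OF that(2), of n]]
    by (rule tame_weaken) auto
  have tAY: "tame g C (int m - C) (?AY (a, m))" if a: "a \<in> handles g" for a m
  proof (rule tame_rs_sum)
    fix r assume "r \<in> idx"
    then obtain b n where r: "r = (b, n)" "b \<in> handles g" by auto
    show "tame g C (int m - C) (rs_mult (At (a, m) r) (Y r))"
      unfolding r(1) by (rule tame_weaken[OF tAY1[OF a r(2), of m n]]) auto
  qed
  have tLA1: "tame g 0 (int m + int n) (rs_mult (LInv (a, m)) (At (a, m) (b, n)))"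
    if "a \<in> handles g" "b \<in> handles g" for a b m n
    using tame_mult[OF tame_LInv[of "(a, m)"] tame_Atilde[OF that, of m n]]
    by (rule tame_weaken) auto
  have tLA: "tame g 0 (int n) (?LA (b, n))" if b: "b \<in> handles g" for b n
  proof (rule tame_rs_sum)
    fix r assume "r \<in> idx"
    then obtain a m where r: "r = (a, m)" "a \<in> handles g" by auto
    show "tame g 0 (int n) (rs_mult (LInv r) (At r (b, n)))"
      unfolding r(1) by (rule tame_weaken[OF tLA1[OF r(2) b, of m n]]) auto
  qed
  have lfLtY: "locally_finite idx (\<lambda>q. rs_mult (Lt q) (Y q))"
  proof (rule locally_finite_index[where h = g and C = C and c = "- C"])
    fix b n assume b: "b \<in> handles g"
    show "tame g C (int n + - C) (rs_mult (Lt (b, n)) (Y (b, n)))"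
      using tame_mult[OF tame_Ltilde[OF b, of n] Y[OF b, of n]] by (rule tame_weaken) auto
  qed
  have lfLAY: "locally_finite idx (\<lambda>q. rs_mult (?LA q) (Y q))"
  proof (rule locally_finite_index[where h = g and C = C and c = "- C"])
    fix b n assume b: "b \<in> handles g"
    show "tame g C (int n + - C) (rs_mult (?LA (b, n)) (Y (b, n)))"
      using tame_mult[OF tLA[OF b, of n] Y[OF b, of n]] by (rule tame_weaken) auto
  qed
  have lfLInv: "locally_finite idx (\<lambda>q. rs_mult (LInv q) (Z q))"
    if "\<And>a n. a \<in> handles g \<Longrightarrow> tame g C (int n - C) (Z (a, n))" for Z
  proof (rule locally_finite_index[where h = g and C = C and c = "- C"])
    fix b n assume b: "b \<in> handles g"
    show "tame g C (int n + - C) (rs_mult (LInv (b, n)) (Z (b, n)))"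
      using tame_mult[OF tame_LInv[of "(b, n)"] that[OF b, of n]] by (rule tame_weaken) auto
  qed
  have "rs_sum idx (\<lambda>q. rs_mult (LInv q) (Y q))
      = rs_sum idx (\<lambda>q. rs_add (rs_mult (Lt q) (Y q)) (rs_mult (?LA q) (Y q)))"
  proof (rule rs_sum_cong)
    fix q assume q: "q \<in> idx"
    then obtain b n where bn: "q = (b, n)" "b \<in> handles g" by auto
    show "rs_mult (LInv q) (Y q) = rs_add (rs_mult (Lt q) (Y q)) (rs_mult (?LA q) (Y q))"
      unfolding LInv_rec[OF q]
      by (rule rs_mult_add_left[OF tY[OF q]])
        (use tame_Ltilde[OF bn(2), of n] tLA[OF bn(2), of n] bn in simp_all)
  qed
  also have "\<dots> = rs_add (rs_sum idx (\<lambda>q. rs_mult (Lt q) (Y q))) (rs_sum idx (\<lambda>q. rs_mult (?LA q) (Y q)))"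
    by (rule rs_sum_add[OF lfLtY lfLAY])
  also have "rs_sum idx (\<lambda>q. rs_mult (?LA q) (Y q))
      = rs_sum idx (\<lambda>q. rs_sum idx (\<lambda>s. rs_mult (LInv s) (rs_mult (At s q) (Y q))))"
  proof (rule rs_sum_cong)
    fix q assume q: "q \<in> idx"
    then obtain b n where bn: "q = (b, n)" "b \<in> handles g" by auto
    have "rs_mult (?LA q) (Y q) = rs_sum idx (\<lambda>s. rs_mult (rs_mult (LInv s) (At s q)) (Y q))"
    proof (rule rs_mult_rs_sum_left[OF tY[OF q]])
      show "tame g 0 0 (rs_mult (LInv s) (At s q))" if "s \<in> idx" for s
        using that tame_weaken[OF tLA1[of "fst s" b "snd s" n]] bn by auto
      show "locally_finite idx (\<lambda>s. rs_mult (LInv s) (At s q))"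
        by (rule locally_finite_index[where h = g and C = 0 and c = 0])
          (use bn tame_weaken[OF tLA1] in auto)
    qed
    also have "\<dots> = rs_sum idx (\<lambda>s. rs_mult (LInv s) (rs_mult (At s q) (Y q)))"
      by (rule rs_sum_cong) (simp only: rs_mult_assoc_middle is_monomial_Atilde q)
    finally show "rs_mult (?LA q) (Y q) = rs_sum idx (\<lambda>s. rs_mult (LInv s) (rs_mult (At s q) (Y q)))" .
  qed
  also have "\<dots> = rs_sum idx (\<lambda>s. rs_sum idx (\<lambda>q. rs_mult (LInv s) (rs_mult (At s q) (Y q))))"
  proof (rule rs_sum_swap, rule finite_index_pairs[where C = C and c = "- C"])
    fix a m b n assume ab: "a \<in> handles g" "b \<in> handles g"
    show "tame g C (int m + int n + - C) (rs_mult (LInv (b, n)) (rs_mult (At (b, n) (a, m)) (Y (a, m))))"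
      using tame_mult[OF tame_LInv[of "(b, n)"] tAY1[OF ab(2,1), of n m]] by (rule tame_weaken) auto
  qed
  also have "\<dots> = rs_sum idx (\<lambda>s. rs_mult (LInv s) (?AY s))"
  proof (rule rs_sum_cong)
    fix s assume s: "s \<in> idx"
    then obtain b n where bn: "s = (b, n)" "b \<in> handles g" by auto
    show "rs_sum idx (\<lambda>q. rs_mult (LInv s) (rs_mult (At s q) (Y q))) = rs_mult (LInv s) (?AY s)"
    proof (rule rs_mult_rs_sum_right[OF tame_LInv, symmetric])
      show "tame g C (- C) (rs_mult (At s q) (Y q))" if "q \<in> idx" for q
        using that tame_weaken[OF tAY1[of b "fst q" n "snd q"]] bn by auto
      show "locally_finite idx (\<lambda>q. rs_mult (At s q) (Y q))"
        by (rule locally_finite_index[where h = g and C = C and c = "- C"])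
          (use bn tame_weaken[OF tAY1] in auto)
    qed
  qed
  finally have 1: "rs_sum idx (\<lambda>q. rs_mult (LInv q) (Y q))
     = rs_add (rs_sum idx (\<lambda>q. rs_mult (Lt q) (Y q))) (rs_sum idx (\<lambda>s. rs_mult (LInv s) (?AY s)))" .
  have "rs_sum idx (\<lambda>q. rs_mult (LInv q) (Y q))
      = rs_sum idx (\<lambda>q. rs_add (rs_mult (LInv q) (H q)) (rs_mult (LInv q) (?AY q)))"
  proof (rule rs_sum_cong)
    fix q assume q: "q \<in> idx"
    then obtain b n where bn: "q = (b, n)" "b \<in> handles g" by auto
    show "rs_mult (LInv q) (Y q) = rs_add (rs_mult (LInv q) (H q)) (rs_mult (LInv q) (?AY q))"
      by (subst eq[OF q], rule rs_mult_add_right[OF tame_LInv])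
        (use H[OF bn(2), of n] tAY[OF bn(2), of n] bn in simp_all)
  qed
  also have "\<dots> = rs_add (rs_sum idx (\<lambda>q. rs_mult (LInv q) (H q))) (rs_sum idx (\<lambda>q. rs_mult (LInv q) (?AY q)))"
    by (intro rs_sum_add lfLInv H tAY)
  finally show ?thesis using 1 by (simp add: rs_add_def fun_eq_iff)
qed

text \<open>
  The hypothesis expresses the \<open>X\<^sub>a\<^sup>j\<close> with \<open>j \<ge> 2N - 1\<close> by the \<open>D\<^sub>i\<close> and all the \<open>X\<^sub>a\<^sup>j\<close>.  Splitting off the
  \<open>X\<^sub>a\<^sup>l\<close> with \<open>l \<le> 2N - 2\<close> brings it to the form \<open>Y = H + \<tilde>A Y\<close> with \<open>Y\<^sub>a\<^sup>n = X\<^sub>a^(n+2N-1)\<close>, and \<open>L X\<close> splits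
  in the same way into a part with small \<open>l\<close> and \<open>\<tilde>L Y\<close>.
\<close>

theorem formal_solution:
  assumes X: "\<And>a j. a \<in> handles g \<Longrightarrow> tame g C (int j - C) (X (a, j))" and C: "C \<ge> 0"
    and K: "finite K"
    and R: "\<And>i q. i \<in> K \<Longrightarrow> is_monomial (R i q)"
      "\<And>i a m. i \<in> K \<Longrightarrow> a \<in> handles g \<Longrightarrow> tame g 0 (int m) (R i (a, m))"
    and D: "\<And>i. i \<in> K \<Longrightarrow> tame g C (- C) (D i)"
    and eq: "\<And>a n. a \<in> handles g \<Longrightarrow> X (a, n + 2 * N - 1) =
        rs_add (\<lambda>\<kappa>. \<Sum>i\<in>K. rs_mult (R i (a, n)) (D i) \<kappa>)
          (rs_sum idx (\<lambda>p. rs_mult (Amat N w A (a, n) p) (X p)))"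
  shows "rs_sum idx (\<lambda>p. rs_mult (Lvec N w A x p) (X p)) = (\<lambda>\<kappa>.
      (\<Sum>i\<in>K. rs_mult (vec_dot g LInv (R i)) (D i) \<kappa>)
    + (\<Sum>p\<in>handles g \<times> {..2 * N - 2}.
         rs_mult (rs_add (Lvec N w A x p) (vec_mat g LInv (Amat N w A) p)) (X p) \<kappa>))"
proof -
  let ?low = "handles g \<times> {..2 * N - 2}"
  let ?AX = "\<lambda>q p. rs_mult (Amat N w A q p) (X p)"
  define Y where "Y = (\<lambda>(a, n). X (a, n + 2 * N - 1))"
  define H1 where "H1 q = (\<lambda>\<kappa>. \<Sum>i\<in>K. rs_mult (R i q) (D i) \<kappa>)" for q
  define H2 where "H2 q = (\<lambda>\<kappa>. \<Sum>p\<in>?low. ?AX q p \<kappa>)" for q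
  have finlow: "finite ?low" by (simp add: finite_handles)
  have tX: "tame g C (- C) (X p)" if "p \<in> idx" for p
    using that tame_weaken[OF X, of "fst p" C "- C" "snd p"] by auto
  have tY: "tame g C (int n - C) (Y (a, n))" if "a \<in> handles g" for a n
    unfolding Y_def prod.case by (rule tame_weaken[OF X[OF that]]) (use N in auto)
  have tAX: "tame g C (int m + int n - C) (?AX (a, m) (b, n))" if "a \<in> handles g" "b \<in> handles g" for a b m n
  proof -
    have "tame g (0 + C) ((int m + int n + 1) + - C) (?AX (a, m) (b, n))"
      by (intro tame_mult tame_Amat tX that) (use that in auto)
    then show ?thesis by (rule tame_weaken) auto
  qed
  have tRD: "tame g C (int m - C) (rs_mult (R i (a, m)) (D i))" if "i \<in> K" "a \<in> handles g" for i a m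
    using tame_mult[OF R(2)[OF that, of m] D[OF that(1)]] by (rule tame_weaken) auto
  have tH1: "tame g C (int m - C) (H1 (a, m))" if "a \<in> handles g" for a m
    unfolding H1_def by (rule tame_finite_sum) (rule tRD[OF _ that])
  have tH2: "tame g C (int m - C) (H2 (a, m))" if a: "a \<in> handles g" for a m
    unfolding H2_def
  proof (rule tame_finite_sum)
    fix p assume "p \<in> ?low"
    then obtain b n where p: "p = (b, n)" "b \<in> handles g" by auto
    show "tame g C (int m - C) (?AX (a, m) p)"
      unfolding p(1) by (rule tame_weaken[OF tAX[OF a p(2), of m n]]) auto
  qed
  have lfAX: "locally_finite idx (?AX (a, m))" if "a \<in> handles g" for a m
    by (rule locally_finite_index[where h = g and C = C and c = "- C"])
      (use that tame_weaken[OF tAX] in auto)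
  have lfLX: "locally_finite idx (\<lambda>p. rs_mult (Lvec N w A x p) (X p))"
  proof (rule locally_finite_index[where h = g and C = C and c = "- C"])
    fix b n assume b: "b \<in> handles g"
    have "tame g C (- C) (X (b, n))" by (rule tX) (use b in simp)
    from tame_mult[OF tame_Lvec[OF b, of n] this]
    show "tame g C (int n + - C) (rs_mult (Lvec N w A x (b, n)) (X (b, n)))" by simp
  qed
  have Yeq: "Y q = rs_add (rs_add (H1 q) (H2 q)) (rs_sum idx (\<lambda>r. rs_mult (At q r) (Y r)))" if q: "q \<in> idx" for q
  proof -
    obtain a n where an: "q = (a, n)" "a \<in> handles g" using q by auto
    have "Y q = rs_add (H1 q) (rs_sum idx (?AX q))"
      using eq[OF an(2), of n] by (simp add: Y_def H1_def an)
    also have "rs_sum idx (?AX q) = rs_add (H2 q) (rs_sum idx (\<lambda>(a, n). ?AX q (a, n + 2 * N - 1)))"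
      unfolding an(1) by (subst rs_sum_split_low[OF lfAX[OF an(2)] N]) (simp add: H2_def rs_add_def)
    also have "rs_sum idx (\<lambda>(a, n). ?AX q (a, n + 2 * N - 1)) = rs_sum idx (\<lambda>r. rs_mult (At q r) (Y r))"
      by (rule rs_sum_cong) (auto simp: Atilde_eq Y_def)
    finally show ?thesis by (simp add: rs_add_def add.assoc)
  qed
  have lfLInv: "locally_finite idx (\<lambda>q. rs_mult (LInv q) (Z q))"
    if "\<And>a n. a \<in> handles g \<Longrightarrow> tame g C (int n - C) (Z (a, n))" for Z
  proof (rule locally_finite_index[where h = g and C = C and c = "- C"])
    fix b n assume b: "b \<in> handles g"
    show "tame g C (int n + - C) (rs_mult (LInv (b, n)) (Z (b, n)))"
      using tame_mult[OF tame_LInv[of "(b, n)"] that[OF b, of n]] by (rule tame_weaken) auto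
  qed
  have sum1: "rs_sum idx (\<lambda>q. rs_mult (LInv q) (H1 q)) = (\<lambda>\<kappa>. \<Sum>i\<in>K. rs_mult (vec_dot g LInv (R i)) (D i) \<kappa>)"
  proof -
    have "rs_sum idx (\<lambda>q. rs_mult (LInv q) (H1 q))
        = rs_sum idx (\<lambda>q \<kappa>. \<Sum>i\<in>K. rs_mult (LInv q) (rs_mult (R i q) (D i)) \<kappa>)"
    proof (rule rs_sum_cong)
      fix q assume "q \<in> idx"
      then obtain a m where q: "q = (a, m)" "a \<in> handles g" by auto
      show "rs_mult (LInv q) (H1 q) = (\<lambda>\<kappa>. \<Sum>i\<in>K. rs_mult (LInv q) (rs_mult (R i q) (D i)) \<kappa>)"
        unfolding H1_def q(1) by (rule rs_mult_finite_sum_right[OF tame_LInv]) (rule tRD[OF _ q(2)])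
    qed
    also have "\<dots> = (\<lambda>\<kappa>. \<Sum>i\<in>K. rs_sum idx (\<lambda>q. rs_mult (LInv q) (rs_mult (R i q) (D i))) \<kappa>)"
      by (rule rs_sum_finite_sum[OF K]) (rule lfLInv, rule tRD)
    also have "\<dots> = (\<lambda>\<kappa>. \<Sum>i\<in>K. rs_mult (vec_dot g LInv (R i)) (D i) \<kappa>)"
    proof (intro ext sum.cong refl)
      fix \<kappa> i assume i: "i \<in> K"
      have tLR: "tame g 0 (int m) (rs_mult (LInv (a, m)) (R i (a, m)))" if "a \<in> handles g" for a m
        using tame_mult[OF tame_LInv[of "(a, m)"] R(2)[OF i that, of m]] by (rule tame_weaken) auto
      have "rs_mult (vec_dot g LInv (R i)) (D i) = rs_sum idx (\<lambda>q. rs_mult (rs_mult (LInv q) (R i q)) (D i))"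
        unfolding vec_dot_def
      proof (rule rs_mult_rs_sum_left[OF D[OF i]])
        show "tame g 0 0 (rs_mult (LInv q) (R i q))" if "q \<in> idx" for q
          using that tame_weaken[OF tLR[of "fst q" "snd q"]] by auto
        show "locally_finite idx (\<lambda>q. rs_mult (LInv q) (R i q))"
          by (rule locally_finite_index[where h = g and C = 0 and c = 0]) (use tLR in auto)
      qed
      then show "rs_sum idx (\<lambda>q. rs_mult (LInv q) (rs_mult (R i q) (D i))) \<kappa> = rs_mult (vec_dot g LInv (R i)) (D i) \<kappa>"
        by (simp only: rs_mult_assoc_middle[OF R(1)[OF i]])
    qed
    finally show ?thesis .
  qed
  have tLA: "tame g 0 (int m) (rs_mult (LInv (a, m)) (Amat N w A (a, m) p))" if "a \<in> handles g" "p \<in> idx" for a m p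
  proof -
    obtain b n where p: "p = (b, n)" "b \<in> handles g" using \<open>p \<in> idx\<close> by auto
    show ?thesis unfolding p(1)
      using tame_mult[OF tame_LInv[of "(a, m)"] tame_Amat[OF that(1) p(2), of m n]] by (rule tame_weaken) auto
  qed
  have sum2: "rs_sum idx (\<lambda>q. rs_mult (LInv q) (H2 q)) = (\<lambda>\<kappa>. \<Sum>p\<in>?low. rs_mult (vec_mat g LInv (Amat N w A) p) (X p) \<kappa>)"
  proof -
    have tAX': "tame g C (int m - C) (?AX (a, m) p)" if "a \<in> handles g" "p \<in> ?low" for a m p
    proof -
      obtain b n where p: "p = (b, n)" "b \<in> handles g" using \<open>p \<in> ?low\<close> by auto
      show ?thesis unfolding p(1) by (rule tame_weaken[OF tAX[OF that(1) p(2), of m n]]) auto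
    qed
    have "rs_sum idx (\<lambda>q. rs_mult (LInv q) (H2 q))
        = rs_sum idx (\<lambda>q \<kappa>. \<Sum>p\<in>?low. rs_mult (LInv q) (?AX q p) \<kappa>)"
    proof (rule rs_sum_cong)
      fix q assume "q \<in> idx"
      then obtain a m where q: "q = (a, m)" "a \<in> handles g" by auto
      show "rs_mult (LInv q) (H2 q) = (\<lambda>\<kappa>. \<Sum>p\<in>?low. rs_mult (LInv q) (?AX q p) \<kappa>)"
        unfolding H2_def q(1) by (rule rs_mult_finite_sum_right[OF tame_LInv]) (rule tAX'[OF q(2)])
    qed
    also have "\<dots> = (\<lambda>\<kappa>. \<Sum>p\<in>?low. rs_sum idx (\<lambda>q. rs_mult (LInv q) (?AX q p)) \<kappa>)"
      by (rule rs_sum_finite_sum[OF finlow]) (rule lfLInv, rule tAX')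
    also have "\<dots> = (\<lambda>\<kappa>. \<Sum>p\<in>?low. rs_mult (vec_mat g LInv (Amat N w A) p) (X p) \<kappa>)"
    proof (intro ext sum.cong refl)
      fix \<kappa> p assume "p \<in> ?low"
      then have p: "p \<in> idx" by auto
      have "rs_mult (vec_mat g LInv (Amat N w A) p) (X p)
          = rs_sum idx (\<lambda>q. rs_mult (rs_mult (LInv q) (Amat N w A q p)) (X p))"
        unfolding vec_mat_def
      proof (rule rs_mult_rs_sum_left[OF tX[OF p]])
        show "tame g 0 0 (rs_mult (LInv q) (Amat N w A q p))" if "q \<in> idx" for q
          using that tame_weaken[OF tLA[of "fst q" p "snd q"]] p by auto
        show "locally_finite idx (\<lambda>q. rs_mult (LInv q) (Amat N w A q p))"
          by (rule locally_finite_index[where h = g and C = 0 and c = 0]) (use tLA p in auto)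
      qed
      then show "rs_sum idx (\<lambda>q. rs_mult (LInv q) (?AX q p)) \<kappa> = rs_mult (vec_mat g LInv (Amat N w A) p) (X p) \<kappa>"
        by (simp only: rs_mult_assoc_middle[OF is_monomial_Amat])
    qed
    finally show ?thesis .
  qed
  have tH: "tame g C (int n - C) (rs_add (H1 (a, n)) (H2 (a, n)))" if "a \<in> handles g" for a n
    by (intro tame_add tH1 tH2 that)
  have "rs_sum idx (\<lambda>q. rs_mult (Lt q) (Y q)) = rs_sum idx (\<lambda>q. rs_mult (LInv q) (rs_add (H1 q) (H2 q)))"
    by (rule resolvent_solution[where H = "\<lambda>q. rs_add (H1 q) (H2 q)", OF tY tH Yeq C])
  also have "\<dots> = rs_sum idx (\<lambda>q. rs_add (rs_mult (LInv q) (H1 q)) (rs_mult (LInv q) (H2 q)))"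
  proof (rule rs_sum_cong)
    fix q assume "q \<in> idx"
    then obtain a m where q: "q = (a, m)" "a \<in> handles g" by auto
    show "rs_mult (LInv q) (rs_add (H1 q) (H2 q)) = rs_add (rs_mult (LInv q) (H1 q)) (rs_mult (LInv q) (H2 q))"
      unfolding q(1) by (rule rs_mult_add_right[OF tame_LInv tH1[OF q(2)] tH2[OF q(2)]])
  qed
  also have "\<dots> = rs_add (rs_sum idx (\<lambda>q. rs_mult (LInv q) (H1 q))) (rs_sum idx (\<lambda>q. rs_mult (LInv q) (H2 q)))"
    by (intro rs_sum_add lfLInv tH1 tH2)
  finally have LtY: "rs_sum idx (\<lambda>q. rs_mult (Lt q) (Y q)) = (\<lambda>\<kappa>.
      (\<Sum>i\<in>K. rs_mult (vec_dot g LInv (R i)) (D i) \<kappa>)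
      + (\<Sum>p\<in>?low. rs_mult (vec_mat g LInv (Amat N w A) p) (X p) \<kappa>))"
    by (simp add: sum1 sum2 rs_add_def)
  have high: "rs_sum idx (\<lambda>(a, n). rs_mult (Lvec N w A x (a, n + 2 * N - 1)) (X (a, n + 2 * N - 1)))
      = rs_sum idx (\<lambda>q. rs_mult (Lt q) (Y q))"
    by (rule rs_sum_cong) (auto simp: Ltilde_eq Y_def)
  have low: "rs_mult (rs_add (Lvec N w A x p) (vec_mat g LInv (Amat N w A) p)) (X p)
      = rs_add (rs_mult (Lvec N w A x p) (X p)) (rs_mult (vec_mat g LInv (Amat N w A) p) (X p))" if "p \<in> ?low" for p
  proof (rule rs_mult_add_left)
    show "tame g C (- C) (X p)" using that by (intro tX) auto
    obtain b n where p: "p = (b, n)" "b \<in> handles g" using \<open>p \<in> ?low\<close> by auto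
    show "tame g 0 0 (Lvec N w A x p)" unfolding p(1) by (rule tame_weaken[OF tame_Lvec[OF p(2)]]) auto
    show "tame g 0 0 (vec_mat g LInv (Amat N w A) p)"
      unfolding vec_mat_def
    proof (rule tame_rs_sum)
      fix r assume "r \<in> idx"
      then obtain a m where r: "r = (a, m)" "a \<in> handles g" by auto
      show "tame g 0 0 (rs_mult (LInv r) (Amat N w A r p))"
        unfolding r(1) by (rule tame_weaken[OF tLA[OF r(2), of p m]]) (use p in auto)
    qed
  qed
  have "(\<Sum>p\<in>?low. rs_mult (rs_add (Lvec N w A x p) (vec_mat g LInv (Amat N w A) p)) (X p) \<kappa>)
      = (\<Sum>p\<in>?low. rs_mult (Lvec N w A x p) (X p) \<kappa>)
        + (\<Sum>p\<in>?low. rs_mult (vec_mat g LInv (Amat N w A) p) (X p) \<kappa>)" for \<kappa>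
    unfolding sum.distrib[symmetric] by (rule sum.cong[OF refl]) (simp only: low, simp only: rs_add_def)
  then show ?thesis
    unfolding rs_sum_split_low[OF lfLX N] high LtY by (simp add: add_ac)
qed

end

end

section \<open>Lists of handle insertions\<close>

text \<open>
  The entries \<open>f 1, f (-1), \<dots>, f g, f (-g)\<close>; \<open>handle_pos c\<close> is the position of \<open>f c\<close>.
\<close>

definition handle_list :: "nat \<Rightarrow> (int \<Rightarrow> 'a) \<Rightarrow> 'a list" where
  "handle_list g f = concat (map (\<lambda>a. [f (int a), f (- int a)]) [1..<Suc g])"

definition handle_pos :: "int \<Rightarrow> nat" where
  "handle_pos c = 2 * (nat \<bar>c\<bar> - 1) + (if c < 0 then 1 else 0)"

lemma handle_list_Suc: "handle_list (Suc g) f = handle_list g f @ [f (int (Suc g)), f (- int (Suc g))]"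
  by (simp add: handle_list_def)

lemma length_handle_list [simp]: "length (handle_list g f) = 2 * g"
proof (induction g)
  case 0 show ?case by (simp add: handle_list_def)
next
  case (Suc g) then show ?case by (simp add: handle_list_Suc)
qed

lemma handle_pos_less: "c \<in> handles g \<Longrightarrow> handle_pos c < 2 * g"
  by (auto simp: handles_def handle_pos_def)

lemma nth_handle_list: "c \<in> handles g \<Longrightarrow> handle_list g f ! handle_pos c = f c"
proof (induction g)
  case 0
  then show ?case by (auto simp: handles_def)
next
  case (Suc g)
  show ?case
  proof (cases "c \<in> handles g")
    case True
    then show ?thesis using Suc.IH handle_pos_less[OF True] by (simp add: handle_list_Suc nth_append)
  next
    case False
    then have "c = int (Suc g) \<or> c = - int (Suc g)" using Suc.prems by (auto simp: handles_def)
    then show ?thesis by (auto simp: handle_list_Suc nth_append handle_pos_def)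
  qed
qed

lemma bij_betw_handle_pos: "bij_betw handle_pos (handles g) {..<2 * g}"
proof (rule bij_betw_byWitness[of _ "\<lambda>k. if even k then int (k div 2) + 1 else - (int (k div 2) + 1)"])
  show "\<forall>c\<in>handles g. (if even (handle_pos c) then int (handle_pos c div 2) + 1 else - (int (handle_pos c div 2) + 1)) = c"
    by (auto simp: handles_def handle_pos_def)
  show "\<forall>k\<in>{..<2 * g}. handle_pos (if even k then int (k div 2) + 1 else - (int (k div 2) + 1)) = k"
  proof
    fix k assume "k \<in> {..<2 * g}"
    have "nat (int (k div 2) + 1) - 1 = k div 2" by simp
    then show "handle_pos (if even k then int (k div 2) + 1 else - (int (k div 2) + 1)) = k"
      by (auto simp: handle_pos_def nat_add_distrib abs_if)
  qed
  show "handle_pos ` handles g \<subseteq> {..<2 * g}" using handle_pos_less by auto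
  show "(\<lambda>k. if even k then int (k div 2) + 1 else - (int (k div 2) + 1)) ` {..<2 * g} \<subseteq> handles g"
    by (auto simp: handles_def)
qed

lemma handle_pos_cases:
  assumes "k < 2 * g"
  obtains c where "c \<in> handles g" "k = handle_pos c"
  using bij_betw_handle_pos[of g] assms unfolding bij_betw_def by (metis imageE lessThan_iff)

lemma handle_pos_eq_iff: "c \<in> handles g \<Longrightarrow> c' \<in> handles g \<Longrightarrow> handle_pos c = handle_pos c' \<longleftrightarrow> c = c'"
  using bij_betw_handle_pos[of g] unfolding bij_betw_def inj_on_def by blast

lemma handle_list_update:
  assumes "c \<in> handles g"
  shows "(handle_list g f)[handle_pos c := v] = handle_list g (f(c := v))"
proof (rule nth_equalityI)
  fix k assume "k < length ((handle_list g f)[handle_pos c := v])"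
  then obtain c' where c': "c' \<in> handles g" "k = handle_pos c'" using handle_pos_cases[of k g] by auto
  show "(handle_list g f)[handle_pos c := v] ! k = handle_list g (f(c := v)) ! k"
    using handle_pos_less[OF assms] handle_pos_less[OF c'(1)] handle_pos_eq_iff[OF assms c'(1)]
    by (auto simp: c'(2) nth_list_update nth_handle_list[OF c'(1)])
qed simp

lemma set_handle_list: "set (handle_list g f) = f ` handles g"
proof
  show "set (handle_list g f) \<subseteq> f ` handles g"
    by (auto simp: handle_list_def handles_def)
  show "f ` handles g \<subseteq> set (handle_list g f)"
  proof
    fix y assume "y \<in> f ` handles g"
    then obtain c where c: "c \<in> handles g" "y = f c" by blast
    have "handle_list g f ! handle_pos c \<in> set (handle_list g f)"
      using handle_pos_less[OF c(1)] by (intro nth_mem) simp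
    then show "y \<in> set (handle_list g f)" by (simp add: nth_handle_list c)
  qed
qed

lemma distinct_handle_list: "inj_on w (handles g) \<Longrightarrow> distinct (handle_list g w)"
proof (subst distinct_conv_nth, intro allI impI)
  fix i j assume w: "inj_on w (handles g)" and ij: "i < length (handle_list g w)" "j < length (handle_list g w)" "i \<noteq> j"
  obtain c where c: "c \<in> handles g" "i = handle_pos c" using handle_pos_cases[of i g] ij by auto
  obtain d where d: "d \<in> handles g" "j = handle_pos d" using handle_pos_cases[of j g] ij by auto
  have "c \<noteq> d" using ij c d by auto
  then show "handle_list g w ! i \<noteq> handle_list g w ! j"
    using w c d by (auto simp: nth_handle_list inj_on_def)
qed

lemma sum_split_handles:
  "(\<Sum>p<n + 2 * g. F p) = (\<Sum>k<n. F k) + (\<Sum>c\<in>handles g. F (n + handle_pos c))"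
proof -
  have "(\<Sum>p<n + 2 * g. F p) = (\<Sum>k<n. F k) + (\<Sum>p\<in>{n..<n + 2 * g}. F p)"
    by (simp add: sum.atLeastLessThan_concat atLeast0LessThan[symmetric])
  also have "(\<Sum>p\<in>{n..<n + 2 * g}. F p) = (\<Sum>p\<in>{..<2 * g}. F (n + p))"
    by (rule sum.reindex_bij_witness[of _ "\<lambda>p. n + p" "\<lambda>p. p - n"]) auto
  also have "\<dots> = (\<Sum>c\<in>handles g. F (n + handle_pos c))"
    by (rule sum.reindex_bij_betw[OF bij_betw_handle_pos, symmetric])
  finally show ?thesis .
qed

section \<open>Correlation functions traced over the handles\<close>

locale genus_g_correlations = voa_invariant_form V B for V :: "('v::ab_group_add) voa" and B +
  fixes N g :: nat and u :: 'v and w :: "int \<Rightarrow> complex" and A :: "nat \<Rightarrow> complex"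
    and bas :: "nat \<Rightarrow> 'v set" and vs :: "'v list" and ys :: "complex list"
  assumes u: "quasiprimary V N u" and N: "N \<ge> 1"
    and bas: "\<And>a. a \<in> {1..g} \<Longrightarrow> homogeneous_basis V (bas a)"
    and len: "length ys = length vs"
    and ys: "distinct ys" and w: "inj_on w (handles g)" and ysw: "set ys \<inter> w ` handles g = {}"
    and A: "inj_on A {..2 * N - 2}" and Aw: "\<And>c. c \<in> handles g \<Longrightarrow> w c \<notin> A ` {..2 * N - 2}"
begin

abbreviation "P \<equiv> ys @ handle_list g w"

lemma u_weight: "u \<in> wtspace V N"
  using u by (simp add: quasiprimary_def)

lemma distinct_P: "distinct P"
  using ys distinct_handle_list[OF w] ysw by (simp add: set_handle_list)

text \<open>
  The vector at \<open>w\<^sub>c\<close> without its power of \<open>\<rho>\<close>, for which \<open>handle_exponent\<close> accounts.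
\<close>

definition handle_vectors :: "(nat \<Rightarrow> 'v) \<Rightarrow> int \<Rightarrow> 'v" where
  "handle_vectors b c = (if c > 0 then b (nat c) else dual_vec B (bas (nat (- c))) (b (nat (- c))))"

text \<open>
  The exponent vector of \<open>\<Prod>\<^sub>a \<rho>\<^sub>a^(wt b\<^sub>a)\<close>; the factor \<open>2\<close> is there because series are indexed by the powers of
  \<open>\<rho>\<^sub>a^(1/2)\<close>.
\<close>

definition handle_exponent :: "(nat \<Rightarrow> 'v) \<Rightarrow> nat \<Rightarrow> int" where
  "handle_exponent b = (\<lambda>a. if a \<in> {1..g} then 2 * int (wt V (b a)) else 0)"

definition contributing :: "(nat \<Rightarrow> int) \<Rightarrow> (nat \<Rightarrow> 'v) set" where
  "contributing \<kappa> = {b \<in> \<Pi>\<^sub>E a\<in>{1..g}. bas a. handle_exponent b = \<kappa>}"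

definition handle_trace :: "((nat \<Rightarrow> 'v) \<Rightarrow> complex) \<Rightarrow> rho_series" where
  "handle_trace \<phi> = (\<lambda>\<kappa>. \<Sum>b\<in>contributing \<kappa>. \<phi> b)"

lemma contributing_eq:
  "contributing \<kappa> = (if \<forall>i. i \<notin> {1..g} \<longrightarrow> \<kappa> i = 0
     then \<Pi>\<^sub>E a\<in>{1..g}. {s \<in> bas a. 2 * int (wt V s) = \<kappa> a} else {})"
proof (cases "\<forall>i. i \<notin> {1..g} \<longrightarrow> \<kappa> i = 0")
  case True
  have eqv: "handle_exponent b = \<kappa> \<longleftrightarrow> (\<forall>a\<in>{1..g}. 2 * int (wt V (b a)) = \<kappa> a)" for b
  proof
    assume e: "handle_exponent b = \<kappa>"
    show "\<forall>a\<in>{1..g}. 2 * int (wt V (b a)) = \<kappa> a"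
      unfolding e[symmetric] handle_exponent_def by simp
  next
    assume h: "\<forall>a\<in>{1..g}. 2 * int (wt V (b a)) = \<kappa> a"
    show "handle_exponent b = \<kappa>"
    proof
      fix i show "handle_exponent b i = \<kappa> i"
      proof (cases "i \<in> {1..g}")
        case i: True
        show ?thesis unfolding handle_exponent_def if_P[OF i] using h i by blast
      next
        case i: False
        show ?thesis unfolding handle_exponent_def if_not_P[OF i] using True i by metis
      qed
    qed
  qed
  have "contributing \<kappa> = {b \<in> \<Pi>\<^sub>E a\<in>{1..g}. bas a. \<forall>a\<in>{1..g}. 2 * int (wt V (b a)) = \<kappa> a}"
    by (simp only: contributing_def eqv)
  also have "\<dots> = (\<Pi>\<^sub>E a\<in>{1..g}. {s \<in> bas a. 2 * int (wt V s) = \<kappa> a})"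
    unfolding PiE_iff set_eq_iff by blast
  finally show ?thesis unfolding if_P[OF True] .
next
  case False
  then obtain i where "i \<notin> {1..g}" "\<kappa> i \<noteq> 0" by blast
  then have "handle_exponent b \<noteq> \<kappa>" for b by (auto simp: handle_exponent_def)
  then show ?thesis unfolding if_not_P[OF False] contributing_def by blast
qed

lemma finite_contributing: "finite (contributing \<kappa>)"
proof -
  have "finite {s \<in> bas a. 2 * int (wt V s) = \<kappa> a}" if "a \<in> {1..g}" for a
    by (rule finite_subset[OF _ finite_basis_of_weight[OF bas[OF that], of "\<kappa> a div 2"]]) auto
  then show ?thesis unfolding contributing_eq by (auto intro!: finite_PiE)
qed

lemma handle_vectors_weight:
  assumes "b \<in> contributing \<kappa>" "c \<in> handles g"
  shows "\<exists>n. handle_vectors b c \<in> wtspace V n \<and> 2 * int n = \<kappa> (nat \<bar>c\<bar>)"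
proof -
  have a: "nat \<bar>c\<bar> \<in> {1..g}" by (rule handle_index[OF assms(2)])
  have b: "b (nat \<bar>c\<bar>) \<in> bas (nat \<bar>c\<bar>)" "2 * int (wt V (b (nat \<bar>c\<bar>))) = \<kappa> (nat \<bar>c\<bar>)"
    using assms(1) a by (auto simp: contributing_eq PiE_iff split: if_splits)
  have "handle_vectors b c \<in> wtspace V (wt V (b (nat \<bar>c\<bar>)))"
  proof (cases "c > 0")
    case True
    then show ?thesis using basis_wtspace[OF bas[OF a] b(1)] by (simp add: handle_vectors_def)
  next
    case False
    then show ?thesis using dual_vec_props(1)[OF bas[OF a] b(1)] by (simp add: handle_vectors_def)
  qed
  then show ?thesis using b(2) by blast
qed

lemma ZV_eq_trace:
  "ZV V B g w bas vs' ys' = handle_trace (\<lambda>b. Z0 V B (vs' @ handle_list g (handle_vectors b)) (ys' @ handle_list g w))"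
proof -
  have L: "concat (map (\<lambda>a. [b a, dual_vec B (bas a) (b a)]) [1..<Suc g]) = handle_list g (handle_vectors b)" for b
    unfolding handle_list_def
    by (intro arg_cong[of _ _ concat] map_cong refl) (auto simp: handle_vectors_def)
  show ?thesis
  proof
    fix \<kappa>
    show "ZV V B g w bas vs' ys' \<kappa> = handle_trace (\<lambda>b. Z0 V B (vs' @ handle_list g (handle_vectors b)) (ys' @ handle_list g w)) \<kappa>"
      unfolding ZV_def L handle_list_def[of g w, symmetric] handle_exponent_def[symmetric] handle_trace_def
      by (subst rs_sum_eq[OF finite_contributing[of \<kappa>]])
        (auto simp: contributing_def rs_mono_def intro!: sum.cong)
  qed
qed

lemma handle_trace_nonneg:
  assumes "handle_trace \<phi> \<kappa> \<noteq> 0"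
  shows "\<kappa> i \<ge> 0" "i \<notin> {1..g} \<Longrightarrow> \<kappa> i = 0"
proof -
  obtain b where "b \<in> contributing \<kappa>" using assms unfolding handle_trace_def by (metis sum.empty ex_in_conv)
  then have "\<kappa> = handle_exponent b" by (simp add: contributing_def)
  then show "\<kappa> i \<ge> 0" "i \<notin> {1..g} \<Longrightarrow> \<kappa> i = 0" by (auto simp: handle_exponent_def)
qed

lemma tame_handle_trace: "tame g 0 0 (handle_trace \<phi>)"
  by (rule tameI) (use handle_trace_nonneg in \<open>auto intro!: sum_nonneg\<close>)

text \<open>
  The series \<open>X\<^sub>c\<^sup>j\<close>.  For \<open>j = l \<ge> 0\<close> it is the residue at \<open>w\<^sub>c\<close> with the factor \<open>(x - w\<^sub>c)^l\<close>, see \<open>handle_residue\<close>;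
  negative \<open>j\<close> arise when \<open>u\<close> is moved across a handle.
\<close>

definition handle_insertion :: "int \<Rightarrow> int \<Rightarrow> rho_series" where
  "handle_insertion c j = handle_trace (\<lambda>b. Z0 V B
     (vs @ handle_list g ((handle_vectors b)(c := vmode V u j (handle_vectors b c)))) P)"

definition point_insertion :: "nat \<Rightarrow> int \<Rightarrow> rho_series" where
  "point_insertion k j = handle_trace (\<lambda>b. Z0 V B
     (vs[k := vmode V u j (vs ! k)] @ handle_list g (handle_vectors b)) P)"

lemma Z0_handle_zero:
  assumes "c \<in> handles g"
  shows "Z0 V B (vs @ handle_list g (f(c := 0))) P = 0"
proof -
  have "Z0 V B ((vs @ handle_list g f)[length vs + handle_pos c := 0]) P = 0"
    using handle_pos_less[OF assms] distinct_P len by (intro Z0_slot_zero) auto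
  then show ?thesis by (simp add: list_update_append handle_list_update[OF assms])
qed

lemma handle_insertion_nonzero:
  assumes "handle_insertion c j \<kappa> \<noteq> 0" and c: "c \<in> handles g"
  shows "\<kappa> (nat \<bar>c\<bar>) \<ge> 2 * (j + 1 - int N)"
proof -
  obtain b where b: "b \<in> contributing \<kappa>"
    "Z0 V B (vs @ handle_list g ((handle_vectors b)(c := vmode V u j (handle_vectors b c)))) P \<noteq> 0"
    using assms(1) unfolding handle_insertion_def handle_trace_def by (meson sum.neutral)
  then have nz: "vmode V u j (handle_vectors b c) \<noteq> 0" using Z0_handle_zero[OF c] by auto
  obtain n where n: "handle_vectors b c \<in> wtspace V n" "2 * int n = \<kappa> (nat \<bar>c\<bar>)"
    using handle_vectors_weight[OF b(1) c] by blast
  have "\<not> int N + int n - j - 1 < 0" using nz mode_eq_0[OF u_weight n(1)] by blast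
  then have "2 * (j + 1 - int N) \<le> 2 * int n" by simp
  then show ?thesis unfolding n(2) .
qed

lemma handle_insertion_eq_0:
  assumes c: "c \<in> handles g" and j: "int N + (\<Sum>i = 1..g. \<bar>\<kappa> i\<bar>) \<le> j"
  shows "handle_insertion c j \<kappa> = 0"
proof (rule ccontr)
  assume nz: "handle_insertion c j \<kappa> \<noteq> 0"
  have "2 * (j + 1 - int N) \<le> \<kappa> (nat \<bar>c\<bar>)" by (rule handle_insertion_nonzero[OF nz c])
  also have "\<dots> \<le> \<bar>\<kappa> (nat \<bar>c\<bar>)\<bar>" by simp
  also have "\<dots> \<le> (\<Sum>i = 1..g. \<bar>\<kappa> i\<bar>)"
    by (rule member_le_sum[of _ _ "\<lambda>i. \<bar>\<kappa> i\<bar>"]) (use handle_index[OF c] in auto)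
  finally have "2 * j + 2 - 2 * int N \<le> (\<Sum>i = 1..g. \<bar>\<kappa> i\<bar>)" by (simp add: distrib_left)
  moreover have "0 \<le> (\<Sum>i = 1..g. \<bar>\<kappa> i\<bar>)" by (rule sum_nonneg) simp
  ultimately show False using j by linarith
qed

text \<open>
  The vectors \<open>b\<^sub>c\<close> contributing to the coefficient \<open>\<kappa>\<close> have weight \<open>\<kappa>\<^sub>|\<^sub>c\<^sub>| / 2\<close>, and \<open>u(j)\<close> lowers the
  weight by \<open>j + 1 - N\<close>.
\<close>

lemma mode_bound:
  assumes J0: "\<And>k j. k < length vs \<Longrightarrow> j \<ge> J0 \<Longrightarrow> vmode V u (int j) (vs ! k) = 0"
    and b: "b \<in> contributing \<kappa>" and J: "J \<ge> J0" "int J \<ge> int N + (\<Sum>i = 1..g. \<bar>\<kappa> i\<bar>)"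
    and p: "p < length (vs @ handle_list g (handle_vectors b))" "j \<ge> J"
  shows "vmode V u (int j) ((vs @ handle_list g (handle_vectors b)) ! p) = 0"
proof (cases "p < length vs")
  case True
  then show ?thesis using J0[OF True, of j] J p by (simp add: nth_append)
next
  case False
  then have "p - length vs < 2 * g" using p(1) by auto
  then obtain c where c: "c \<in> handles g" "p - length vs = handle_pos c"
    by (rule handle_pos_cases)
  obtain n where n: "handle_vectors b c \<in> wtspace V n" "2 * int n = \<kappa> (nat \<bar>c\<bar>)"
    using handle_vectors_weight[OF b c(1)] by blast
  have "\<bar>\<kappa> (nat \<bar>c\<bar>)\<bar> \<le> (\<Sum>i = 1..g. \<bar>\<kappa> i\<bar>)"
    by (rule member_le_sum[of _ _ "\<lambda>i. \<bar>\<kappa> i\<bar>"]) (use handle_index[OF c(1)] in auto)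
  then have "vmode V u (int j) (handle_vectors b c) = 0"
    using n(2) J(2) p(2) by (intro mode_eq_0[OF u_weight n(1)]) linarith
  then show ?thesis using False c by (simp add: nth_append nth_handle_list)
qed

lemma exists_mode_bound:
  "\<exists>J0. \<forall>k<length vs. \<forall>j\<ge>J0. vmode V u (int j) (vs ! k) = 0"
  using mode_trunc_list[of vs u] by (metis nth_mem)

text \<open>
  The coefficients \<open>C\<close> do not depend on the basis vectors, so that the sum over the bases can be taken
  term by term.
\<close>

lemma trace_expansion:
  assumes J0: "\<And>k j. k < length vs \<Longrightarrow> j \<ge> J0 \<Longrightarrow> vmode V u (int j) (vs ! k) = 0"
    and J: "J \<ge> J0" "int J \<ge> int N + (\<Sum>i = 1..g. \<bar>\<kappa> i\<bar>)"
    and \<phi>: "\<And>b. b \<in> contributing \<kappa> \<Longrightarrow> \<phi> b = (\<Sum>p<length vs + 2 * g. \<Sum>j<J. C p j *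
        Z0 V B ((vs @ handle_list g (handle_vectors b))[p := vmode V u (int j) ((vs @ handle_list g (handle_vectors b)) ! p)]) P)"
  shows "handle_trace \<phi> \<kappa> = (\<Sum>k<length vs. \<Sum>j<J0. C k j * point_insertion k (int j) \<kappa>)
      + (\<Sum>c\<in>handles g. \<Sum>j<J. C (length vs + handle_pos c) j * handle_insertion c (int j) \<kappa>)"
proof -
  let ?n = "length vs"
  let ?W = "\<lambda>b. vs @ handle_list g (handle_vectors b)"
  let ?Z = "\<lambda>b p j. Z0 V B ((?W b)[p := vmode V u (int j) (?W b ! p)]) P"
  have pt: "(\<Sum>b\<in>contributing \<kappa>. ?Z b k j) = point_insertion k (int j) \<kappa>" if "k < ?n" for k j
    unfolding point_insertion_def handle_trace_def
    by (rule sum.cong[OF refl]) (use that in \<open>simp add: list_update_append nth_append\<close>)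
  have hd: "(\<Sum>b\<in>contributing \<kappa>. ?Z b (?n + handle_pos c) j) = handle_insertion c (int j) \<kappa>" if c: "c \<in> handles g" for c j
    unfolding handle_insertion_def handle_trace_def
    by (rule sum.cong[OF refl])
      (simp add: list_update_append nth_append nth_handle_list[OF c] handle_list_update[OF c])
  have pt0: "point_insertion k (int j) \<kappa> = 0" if "k < ?n" "j \<ge> J0" for k j
    unfolding pt[OF that(1), symmetric]
  proof (rule sum.neutral, rule ballI)
    fix b assume "b \<in> contributing \<kappa>"
    have 0: "vmode V u (int j) (?W b ! k) = 0" using J0[OF that] that(1) by (simp add: nth_append)
    show "?Z b k j = 0"
      unfolding 0 using that(1) distinct_P len by (intro Z0_slot_zero) auto
  qed
  have "handle_trace \<phi> \<kappa> = (\<Sum>b\<in>contributing \<kappa>. \<Sum>p<?n + 2 * g. \<Sum>j<J. C p j * ?Z b p j)"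
    unfolding handle_trace_def by (rule sum.cong[OF refl]) (rule \<phi>)
  also have "\<dots> = (\<Sum>p<?n + 2 * g. \<Sum>b\<in>contributing \<kappa>. \<Sum>j<J. C p j * ?Z b p j)" by (rule sum.swap)
  also have "\<dots> = (\<Sum>p<?n + 2 * g. \<Sum>j<J. C p j * (\<Sum>b\<in>contributing \<kappa>. ?Z b p j))"
    by (rule sum.cong[OF refl], subst sum.swap) (simp add: sum_distrib_left)
  also have "\<dots> = (\<Sum>k<?n. \<Sum>j<J. C k j * point_insertion k (int j) \<kappa>)
      + (\<Sum>c\<in>handles g. \<Sum>j<J. C (?n + handle_pos c) j * handle_insertion c (int j) \<kappa>)"
    unfolding sum_split_handles
    by (intro arg_cong2[where f = "(+)"] sum.cong refl) (simp_all only: lessThan_iff pt hd)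
  also have "(\<Sum>k<?n. \<Sum>j<J. C k j * point_insertion k (int j) \<kappa>)
      = (\<Sum>k<?n. \<Sum>j<J0. C k j * point_insertion k (int j) \<kappa>)"
    by (rule sum.cong[OF refl], rule sum.mono_neutral_right) (use J(1) pt0 in auto)
  finally show ?thesis .
qed

lemma nth_P_point: "k < length vs \<Longrightarrow> P ! k = ys ! k"
  using len by (simp add: nth_append)

lemma nth_P_handle: "c \<in> handles g \<Longrightarrow> P ! (length vs + handle_pos c) = w c"
  using len by (simp add: nth_append nth_handle_list)

text \<open>
  The genus zero recursion is summed over the bases; the bound \<open>J\<close> on the modes of \<open>u\<close> is common to
  all basis vectors that contribute to the coefficient \<open>\<kappa>\<close>.
\<close>

lemma insertion_expansion:
  assumes J0: "\<And>k j. k < length vs \<Longrightarrow> j \<ge> J0 \<Longrightarrow> vmode V u (int j) (vs ! k) = 0"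
    and J: "J \<ge> J0" "int J \<ge> int N + (\<Sum>i = 1..g. \<bar>\<kappa> i\<bar>)"
    and x: "x \<notin> set ys" "x \<notin> w ` handles g" "x \<notin> A ` {..2 * N - 2}"
  shows "ZV V B g w bas (u # vs) (x # ys) \<kappa> =
      (\<Sum>k<length vs. \<Sum>j<J0. sderiv2 0 j (piN N A) x (ys ! k) * point_insertion k (int j) \<kappa>)
    + (\<Sum>c\<in>handles g. \<Sum>j<J. sderiv2 0 j (piN N A) x (w c) * handle_insertion c (int j) \<kappa>)"
proof -
  have "ZV V B g w bas (u # vs) (x # ys) \<kappa> =
      (\<Sum>k<length vs. \<Sum>j<J0. sderiv2 0 j (piN N A) x (P ! k) * point_insertion k (int j) \<kappa>)
    + (\<Sum>c\<in>handles g. \<Sum>j<J. sderiv2 0 j (piN N A) x (P ! (length vs + handle_pos c)) * handle_insertion c (int j) \<kappa>)"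
    unfolding ZV_eq_trace
  proof (rule trace_expansion[OF J0 J, where C = "\<lambda>p j. sderiv2 0 j (piN N A) x (P ! p)"])
    fix b assume b: "b \<in> contributing \<kappa>"
    let ?W = "vs @ handle_list g (handle_vectors b)"
    have "Z0 V B (u # ?W) (x # P) = (\<Sum>p<length ?W. \<Sum>j<J. sderiv2 0 j (piN N A) x (P ! p) *
        Z0 V B (?W[p := vmode V u (int j) (?W ! p)]) P)"
    proof (rule Z0_Cons_piN[OF u N _ _ _ A x(3)])
      show "vmode V u (int j) (?W ! p) = 0" if "p < length ?W" "J \<le> j" for p j
        by (rule mode_bound[OF J0 b J that])
      show "distinct (x # P)" using distinct_P x(1,2) by (simp add: set_handle_list)
    qed (simp add: len)
    then show "Z0 V B ((u # vs) @ handle_list g (handle_vectors b)) ((x # ys) @ handle_list g w) =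
        (\<Sum>p<length vs + 2 * g. \<Sum>j<J. sderiv2 0 j (piN N A) x (P ! p) * Z0 V B (?W[p := vmode V u (int j) (?W ! p)]) P)"
      by simp
  qed
  then show ?thesis by (simp add: nth_P_point nth_P_handle)
qed

text \<open>
  The coefficients are the entries of the moment matrix \<open>A\<close> in the row of \<open>-c\<close>, up to signs and powers
  of \<open>\<rho>\<close>.
\<close>

lemma creation_expansion:
  assumes J0: "\<And>k j. k < length vs \<Longrightarrow> j \<ge> J0 \<Longrightarrow> vmode V u (int j) (vs ! k) = 0"
    and J: "J \<ge> J0" "int J \<ge> int N + (\<Sum>i = 1..g. \<bar>\<kappa> i\<bar>)"
    and c: "c \<in> handles g"
  shows "handle_insertion c (- 1 - int m) \<kappa> =
      (\<Sum>k<length vs. \<Sum>j<J0. sderiv2 m j (piN N A) (w c) (ys ! k) * point_insertion k (int j) \<kappa>)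
    + (\<Sum>d\<in>handles g. \<Sum>j<J. (if d = c
          then \<Sum>l\<le>2 * N - 2. of_nat (l choose j) * sderiv m (fN N A l) (w c) * w c ^ (l - j)
          else sderiv2 m j (piN N A) (w c) (w d)) * handle_insertion d (int j) \<kappa>)"
proof -
  let ?k = "length vs + handle_pos c"
  let ?C = "\<lambda>p j. if p = ?k
          then \<Sum>l\<le>2 * N - 2. of_nat (l choose j) * sderiv m (fN N A l) (P ! ?k) * (P ! ?k) ^ (l - j)
          else sderiv2 m j (piN N A) (P ! ?k) (P ! p)"
  have "handle_insertion c (- 1 - int m) \<kappa> =
      (\<Sum>k<length vs. \<Sum>j<J0. ?C k j * point_insertion k (int j) \<kappa>)
    + (\<Sum>d\<in>handles g. \<Sum>j<J. ?C (length vs + handle_pos d) j * handle_insertion d (int j) \<kappa>)"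
    unfolding handle_insertion_def[of c "- 1 - int m"]
  proof (rule trace_expansion[OF J0 J, where C = ?C])
    fix b assume b: "b \<in> contributing \<kappa>"
    let ?W = "vs @ handle_list g (handle_vectors b)"
    have Wk: "?W ! ?k = handle_vectors b c" by (simp add: nth_append nth_handle_list[OF c])
    have "Z0 V B (?W[?k := vmode V u (- 1 - int m) (?W ! ?k)]) P = (\<Sum>p<length ?W. \<Sum>j<J. ?C p j *
        Z0 V B (?W[p := vmode V u (int j) (?W ! p)]) P)"
    proof (rule Z0_creation_mode_piN[OF u N _ _ _ distinct_P A])
      show "vmode V u (int j) (?W ! p) = 0" if "p < length ?W" "J \<le> j" for p j
        by (rule mode_bound[OF J0 b J that])
      show "P ! ?k \<notin> A ` {..2 * N - 2}" unfolding nth_P_handle[OF c] by (rule Aw[OF c])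
    qed (use len handle_pos_less[OF c] in simp_all)
    then show "Z0 V B (vs @ handle_list g ((handle_vectors b)(c := vmode V u (- 1 - int m) (handle_vectors b c)))) P =
        (\<Sum>p<length vs + 2 * g. \<Sum>j<J. ?C p j * Z0 V B (?W[p := vmode V u (int j) (?W ! p)]) P)"
      unfolding Wk by (simp add: list_update_append handle_list_update[OF c])
  qed
  also have "(\<Sum>k<length vs. \<Sum>j<J0. ?C k j * point_insertion k (int j) \<kappa>)
      = (\<Sum>k<length vs. \<Sum>j<J0. sderiv2 m j (piN N A) (w c) (ys ! k) * point_insertion k (int j) \<kappa>)"
    by (intro sum.cong refl) (simp add: nth_P_handle[OF c] nth_P_point)
  also have "(\<Sum>d\<in>handles g. \<Sum>j<J. ?C (length vs + handle_pos d) j * handle_insertion d (int j) \<kappa>)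
      = (\<Sum>d\<in>handles g. \<Sum>j<J. (if d = c
          then \<Sum>l\<le>2 * N - 2. of_nat (l choose j) * sderiv m (fN N A l) (w c) * w c ^ (l - j)
          else sderiv2 m j (piN N A) (w c) (w d)) * handle_insertion d (int j) \<kappa>)"
    by (intro sum.cong refl) (simp only: add_left_cancel handle_pos_eq_iff[OF _ c] nth_P_handle[OF c] nth_P_handle)
  finally show ?thesis .
qed


section \<open>Moving \<open>u\<close> across a handle\<close>

lemma handle_vectors_upd:
  assumes "a \<ge> 1"
  shows "handle_vectors (h(a := s)) = (handle_vectors h)(int a := s, - int a := dual_vec B (bas a) s)"
  using assms by (auto simp: handle_vectors_def fun_eq_iff)

lemma sum_contributing_split:
  assumes a: "a \<in> {1..g}" and \<kappa>: "\<And>i. i \<notin> {1..g} \<Longrightarrow> \<kappa> i = 0"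
  shows "(\<Sum>b\<in>contributing \<kappa>. \<phi> b) =
    (\<Sum>h\<in>(\<Pi>\<^sub>E i\<in>{1..g} - {a}. {s \<in> bas i. 2 * int (wt V s) = \<kappa> i}).
      \<Sum>s | s \<in> bas a \<and> 2 * int (wt V s) = \<kappa> a. \<phi> (h(a := s)))"
proof -
  let ?T = "\<lambda>i. {s \<in> bas i. 2 * int (wt V s) = \<kappa> i}"
  let ?R = "{1..g} - {a}"
  have ins: "{1..g} = insert a ?R" using a by auto
  have "contributing \<kappa> = PiE (insert a ?R) ?T"
    using \<kappa> ins by (simp add: contributing_eq)
  also have "\<dots> = (\<lambda>(s, h). h(a := s)) ` (?T a \<times> PiE ?R ?T)" by (rule PiE_insert_eq)
  finally have c: "contributing \<kappa> = (\<lambda>(s, h). h(a := s)) ` (?T a \<times> PiE ?R ?T)" .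
  have "(\<Sum>b\<in>contributing \<kappa>. \<phi> b) = (\<Sum>(s, h)\<in>?T a \<times> PiE ?R ?T. \<phi> (h(a := s)))"
    unfolding c by (subst sum.reindex[OF inj_combinator]) (auto simp: case_prod_unfold)
  also have "\<dots> = (\<Sum>s\<in>?T a. \<Sum>h\<in>PiE ?R ?T. \<phi> (h(a := s)))" by (rule sum.cartesian_product[symmetric])
  also have "\<dots> = (\<Sum>h\<in>PiE ?R ?T. \<Sum>s\<in>?T a. \<phi> (h(a := s)))" by (rule sum.swap)
  finally show ?thesis by simp
qed

lemma Z0_handle_linear:
  assumes c: "c \<in> handles g"
  shows "Z0 V B (vs @ handle_list g (f(c := \<Sum>i\<in>I. t i \<odot> v i))) P
       = (\<Sum>i\<in>I. t i * Z0 V B (vs @ handle_list g (f(c := v i))) P)"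
proof -
  let ?W = "vs @ handle_list g f" and ?k = "length vs + handle_pos c"
  have k: "?k < length ?W" "length P = length ?W" using handle_pos_less[OF c] len by auto
  have upd: "?W[?k := z] = vs @ handle_list g (f(c := z))" for z
    by (simp add: list_update_append handle_list_update[OF c])
  have scale: "Z0 V B (vs @ handle_list g (f(c := r \<odot> z))) P = r * Z0 V B (vs @ handle_list g (f(c := z))) P" for r z
    using Z0_slot_scale[OF k distinct_P, of r z] by (simp only: upd)
  show ?thesis
    using Z0_slot_sum[OF k distinct_P, of "\<lambda>i. t i \<odot> v i" I]
    by (simp only: upd scale)
qed

text \<open>
  Fix the basis vectors of the other handles.  The correlation function is then bilinear in the vectors at
  \<open>w\<^sub>a\<close> and \<open>w\<^sub>-\<^sub>a\<close>, and \<open>dual_basis_adjoint\<close> applies.  Since \<open>u(j)\<close> changes the weight by \<open>N - 1 - j\<close>, the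
  power of \<open>\<rho>\<^sub>a\<close> changes too.
\<close>

lemma handle_flip_pos:
  assumes a: "a \<in> {1..g}"
  shows "handle_insertion (int a) j \<kappa> =
     (-1) ^ N * handle_insertion (- int a) (2 * int N - 2 - j) (\<lambda>i. \<kappa> i - half_exponent (int a) (2 * (j + 1 - int N)) i)"
proof (cases "\<forall>i. i \<notin> {1..g} \<longrightarrow> \<kappa> i = 0")
  case False
  then obtain i where i: "i \<notin> {1..g}" "\<kappa> i \<noteq> 0" by blast
  then have "i \<noteq> a" using a by auto
  then have "handle_trace \<phi> (\<lambda>i. \<kappa> i - half_exponent (int a) (2 * (j + 1 - int N)) i) = 0" for \<phi>
    using handle_trace_nonneg(2)[of \<phi> "\<lambda>i. \<kappa> i - half_exponent (int a) (2 * (j + 1 - int N)) i" i] i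
    by (auto simp: half_exponent_def)
  moreover have "handle_trace \<phi> \<kappa> = 0" for \<phi>
    using handle_trace_nonneg(2)[of \<phi> \<kappa> i] i by auto
  ultimately show ?thesis by (simp add: handle_insertion_def)
next
  case True
  let ?j = "2 * int N - 2 - j"
  define \<kappa>' where "\<kappa>' = (\<lambda>i. \<kappa> i - half_exponent (int a) (2 * (j + 1 - int N)) i)"
  have \<kappa>'a: "\<kappa>' a = \<kappa> a + 2 * (int N - 1 - j)" by (simp add: \<kappa>'_def half_exponent_def)
  have \<kappa>'_other: "\<kappa>' i = \<kappa> i" if "i \<noteq> a" for i using that by (simp add: \<kappa>'_def half_exponent_def)
  have c: "int a \<in> handles g" "- int a \<in> handles g" "int a \<noteq> - int a" "a \<ge> 1" using a by (auto simp: handles_def)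
  have True': "\<kappa>' i = 0" if "i \<notin> {1..g}" for i using True that a \<kappa>'_other[of i] by auto
  let ?R = "\<Pi>\<^sub>E i\<in>{1..g} - {a}. {s \<in> bas i. 2 * int (wt V s) = \<kappa> i}"
  have R': "(\<Pi>\<^sub>E i\<in>{1..g} - {a}. {s \<in> bas i. 2 * int (wt V s) = \<kappa>' i}) = ?R"
    by (rule PiE_cong) (simp add: \<kappa>'_other)
  define \<beta> where "\<beta> h s t = Z0 V B (vs @ handle_list g ((handle_vectors h)(int a := s, - int a := t))) P" for h s t
  have "handle_insertion (int a) j \<kappa> = (\<Sum>h\<in>?R. \<Sum>s | s \<in> bas a \<and> 2 * int (wt V s) = \<kappa> a.
      \<beta> h (vmode V u j s) (dual_vec B (bas a) s))"
    unfolding handle_insertion_def handle_trace_def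
    by (subst sum_contributing_split[OF a]) (use True c in \<open>auto simp: \<beta>_def handle_vectors_upd fun_upd_twist intro!: sum.cong\<close>)
  also have "\<dots> = (\<Sum>h\<in>?R. (-1) ^ N * (\<Sum>s | s \<in> bas a \<and> 2 * int (wt V s) = \<kappa>' a.
      \<beta> h s (vmode V u ?j (dual_vec B (bas a) s))))"
  proof (rule sum.cong[OF refl])
    fix h
    have lin1: "\<beta> h (\<Sum>i\<in>I. t i \<odot> f i) z = (\<Sum>i\<in>I. t i * \<beta> h (f i) z)" for I :: "'v set" and t f z
      using Z0_handle_linear[OF c(1), of "(handle_vectors h)(- int a := z)" t f I] c(3)
      by (simp add: \<beta>_def fun_upd_twist)
    have lin2: "\<beta> h z (\<Sum>i\<in>I. t i \<odot> f i) = (\<Sum>i\<in>I. t i * \<beta> h z (f i))" for I :: "'v set" and t f z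
      using Z0_handle_linear[OF c(2), of "(handle_vectors h)(int a := z)" t f I] by (simp add: \<beta>_def)
    show "(\<Sum>s | s \<in> bas a \<and> 2 * int (wt V s) = \<kappa> a. \<beta> h (vmode V u j s) (dual_vec B (bas a) s))
      = (-1) ^ N * (\<Sum>s | s \<in> bas a \<and> 2 * int (wt V s) = \<kappa>' a. \<beta> h s (vmode V u ?j (dual_vec B (bas a) s)))"
    proof (cases "even (\<kappa> a)")
      case True
      then obtain k where k: "\<kappa> a = 2 * k" by (elim evenE)
      have 1: "{s. s \<in> bas a \<and> 2 * int (wt V s) = \<kappa> a} = {s. s \<in> bas a \<and> int (wt V s) = k}" by (auto simp: k)
      have 2: "{s. s \<in> bas a \<and> 2 * int (wt V s) = \<kappa>' a} = {s. s \<in> bas a \<and> int (wt V s) = k + int N - 1 - j}"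
        by (auto simp: k \<kappa>'a)
      show ?thesis unfolding 1 2 by (rule dual_basis_adjoint[OF bas[OF a] u lin1 lin2])
    next
      \<comment> \<open>Both sums are empty, as only integral powers of \<open>\<rho>\<^sub>a\<close> occur.\<close>
      case False
      have odd1: "2 * int n \<noteq> \<kappa> a" for n using False by (metis dvd_triv_left)
      have odd2: "2 * int n \<noteq> \<kappa>' a" for n
      proof
        assume "2 * int n = \<kappa>' a"
        then have "\<kappa> a = 2 * (int n - (int N - 1 - j))" by (simp add: \<kappa>'a)
        then show False using False by (metis dvd_triv_left)
      qed
      show ?thesis by (simp add: odd1 odd2)
    qed
  qed
  also have "\<dots> = (-1) ^ N * handle_insertion (- int a) ?j \<kappa>'"
    unfolding handle_insertion_def handle_trace_def
    by (subst sum_contributing_split[OF a True'], assumption, unfold R' sum_distrib_left[symmetric])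
      (use c in \<open>auto simp: \<beta>_def handle_vectors_upd intro!: sum.cong\<close>)
  finally show ?thesis unfolding \<kappa>'_def .
qed

theorem handle_flip:
  assumes c: "c \<in> handles g"
  shows "handle_insertion c j = (\<lambda>\<kappa>. (-1) ^ N *
     handle_insertion (- c) (2 * int N - 2 - j) (\<lambda>i. \<kappa> i - half_exponent c (2 * (j + 1 - int N)) i))"
proof
  fix \<kappa>
  show "handle_insertion c j \<kappa> = (-1) ^ N *
     handle_insertion (- c) (2 * int N - 2 - j) (\<lambda>i. \<kappa> i - half_exponent c (2 * (j + 1 - int N)) i)"
  proof (cases "c > 0")
    case True
    then have "nat c \<in> {1..g}" "int (nat c) = c" using c by (auto simp: handles_def)
    then show ?thesis using handle_flip_pos[of "nat c" j \<kappa>] by (simp only:)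
  next
    case False
    define a where "a = nat (- c)"
    have a: "a \<in> {1..g}" "c = - int a" using False c by (auto simp: handles_def a_def)
    let ?\<kappa> = "\<lambda>i. \<kappa> i - half_exponent c (2 * (j + 1 - int N)) i"
    have "handle_insertion (int a) (2 * int N - 2 - j) ?\<kappa> = (-1) ^ N * handle_insertion (- int a) (2 * int N - 2 - (2 * int N - 2 - j))
        (\<lambda>i. ?\<kappa> i - half_exponent (int a) (2 * (2 * int N - 2 - j + 1 - int N)) i)"
      by (rule handle_flip_pos[OF a(1)])
    also have "(\<lambda>i. ?\<kappa> i - half_exponent (int a) (2 * (2 * int N - 2 - j + 1 - int N)) i) = \<kappa>"
      by (auto simp: half_exponent_def a(2) fun_eq_iff)
    finally have "handle_insertion (int a) (2 * int N - 2 - j) ?\<kappa> = (-1) ^ N * handle_insertion c j \<kappa>"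
      by (simp add: a(2))
    moreover have "(-1) ^ N * (-1) ^ N = (1::complex)" by (simp flip: power_mult_distrib)
    ultimately show ?thesis by (simp add: a(2) flip: mult.assoc)
  qed
qed

end

section \<open>Residues at the handles\<close>

text \<open>
  Multiplication by \<open>(x - z)^l\<close> turns the pole of order \<open>l + 1\<close> into a simple one; the others become
  holomorphic or keep a pole of order at least \<open>2\<close>.
\<close>

lemma residue_principal_part:
  fixes h :: "nat \<Rightarrow> complex"
  assumes S: "open S" "z \<in> S" and R: "R holomorphic_on S"
  shows "residue (\<lambda>x. (x - z) ^ l * (R x + (\<Sum>j<J. h j / (x - z) ^ (j + 1)))) z = (if l < J then h l else 0)"
proof (induction J)
  case 0
  have "(\<lambda>x. (x - z) ^ l * R x) holomorphic_on S" by (intro holomorphic_intros R)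
  then show ?case using residue_holo[OF S] by simp
next
  case (Suc J)
  let ?f = "\<lambda>x. (x - z) ^ l * (R x + (\<Sum>j<J. h j / (x - z) ^ (j + 1)))"
  let ?g = "\<lambda>x. (h J * (x - z) ^ l) / (x - z) ^ Suc J"
  have "(\<lambda>x. (x - z) ^ l * (R x + (\<Sum>j<Suc J. h j / (x - z) ^ (j + 1)))) = (\<lambda>x. ?f x + ?g x)"
    by (simp add: algebra_simps)
  moreover have "residue (\<lambda>x. ?f x + ?g x) z = residue ?f z + residue ?g z"
  proof (rule residue_add[OF S])
    show "?f holomorphic_on S - {z}"
      by (intro holomorphic_intros holomorphic_on_subset[OF R]) auto
    show "?g holomorphic_on S - {z}" by (intro holomorphic_intros) auto
  qed
  moreover have "residue ?g z = (if J = l then h J else 0)"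
  proof -
    have "residue ?g z = sderiv J (\<lambda>x. h J * (x - z) ^ l) z"
      unfolding sderiv_def
      by (rule residue_holomorphic_over_power[of UNIV]) (auto intro!: holomorphic_intros)
    also have "\<dots> = (\<lambda>m x. h J * (of_nat (l choose m) * (x - z) ^ (l - m))) J z"
    proof (rule sderiv_family[of UNIV, where G = "\<lambda>m x. h J * (of_nat (l choose m) * (x - z) ^ (l - m))"])
      fix m x
      have e: "of_nat (l choose m) * of_nat (l - m) = (of_nat (Suc m) * of_nat (l choose Suc m) :: complex)"
      proof -
        have "(l choose m) * (l - m) = Suc m * (l choose Suc m)"
          using binomial_absorb_comp[of l m] binomial_absorption[of m l] by (metis mult.commute)
        then show ?thesis by (metis of_nat_mult)
      qed
      have "((\<lambda>x. h J * (of_nat (l choose m) * (x - z) ^ (l - m))) has_field_derivative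
          h J * ((of_nat (l choose m) * of_nat (l - m)) * (x - z) ^ (l - Suc m))) (at x)"
        by (auto intro!: derivative_eq_intros)
      then show "((\<lambda>x. h J * (of_nat (l choose m) * (x - z) ^ (l - m))) has_field_derivative
          of_nat (Suc m) * (h J * (of_nat (l choose Suc m) * (x - z) ^ (l - Suc m)))) (at x)"
        unfolding e by (simp only: mult_ac)
    qed auto
    also have "\<dots> = (if J = l then h J else 0)" by (auto simp: power_0_left binomial_eq_0)
    finally show ?thesis .
  qed
  ultimately show ?case using Suc.IH by auto
qed

lemma rho_half_mult_const: "rs_mult (rho_half a k) (rs_const c) = rs_mono c (half_exponent a k)"
  by (simp only: rho_half_mono rs_const_def rs_mono_mult_mono mult_1 add_0_right)

lemma Amat_mono:
  "Amat N w A (a, m) (b, n) = rs_mono ((-1) ^ N *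
     (if b = - a then \<Sum>l\<le>2 * N - 2. of_nat (l choose n) * sderiv m (fN N A l) (w (- a)) * w (- a) ^ (l - n)
      else sderiv2 m n (piN N A) (w (- a)) (w b))) (\<lambda>i. half_exponent a (int m + 1) i + half_exponent b (int n) i)"
proof -
  have "a \<noteq> - b \<longleftrightarrow> b \<noteq> - a" by auto
  then show ?thesis
    by (simp only: Amat_def prod.case rho_half_mono rs_const_def rs_mono_mult_mono mult_1 add_0_right if_not_P if_P
        split: if_split) simp
qed

context genus_g_correlations
begin

text \<open>
  In the recursion with the kernel \<open>1/(x - y)\<close> the function is holomorphic at \<open>w\<^sub>a\<close> up to the poles
  \<open>(x - w\<^sub>a)^(-j-1)\<close> with the coefficients \<open>X\<^sub>a\<^sup>j\<close>.
\<close>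

lemma handle_residue:
  assumes a: "a \<in> handles g"
  shows "residue (\<lambda>x. (x - w a) ^ l * ZV V B g w bas (u # vs) (x # ys) \<kappa>) (w a) = handle_insertion a (int l) \<kappa>"
proof -
  obtain J0 where J0: "\<And>k j. k < length vs \<Longrightarrow> j \<ge> J0 \<Longrightarrow> vmode V u (int j) (vs ! k) = 0"
    using exists_mode_bound by blast
  define J where "J = max (Suc l) (max J0 (N + nat (\<Sum>i = 1..g. \<bar>\<kappa> i\<bar>)))"
  have J: "J \<ge> J0" "int J \<ge> int N + (\<Sum>i = 1..g. \<bar>\<kappa> i\<bar>)" "l < J"
    by (auto simp: J_def)
  define R where "R x = (\<Sum>k<length vs. \<Sum>j<J0. 1 / (x - ys ! k) ^ (j + 1) * point_insertion k (int j) \<kappa>)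
     + (\<Sum>c\<in>handles g - {a}. \<Sum>j<J. 1 / (x - w c) ^ (j + 1) * handle_insertion c (int j) \<kappa>)" for x
  define S where "S = - (set ys \<union> w ` (handles g - {a}))"
  have S: "open S" "w a \<in> S"
    using a ysw w by (auto simp: S_def inj_on_def finite_handles intro!: open_Compl finite_imp_closed)
  have expand: "ZV V B g w bas (u # vs) (x # ys) \<kappa>
      = R x + (\<Sum>j<J. handle_insertion a (int j) \<kappa> / (x - w a) ^ (j + 1))" if x: "x \<in> S" "x \<noteq> w a" for x
  proof -
    have xP: "distinct (x # P)" using distinct_P x by (auto simp: set_handle_list S_def)
    have "ZV V B g w bas (u # vs) (x # ys) \<kappa> =
        (\<Sum>k<length vs. \<Sum>j<J0. 1 / (x - P ! k) ^ (j + 1) * point_insertion k (int j) \<kappa>)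
      + (\<Sum>c\<in>handles g. \<Sum>j<J. 1 / (x - P ! (length vs + handle_pos c)) ^ (j + 1) * handle_insertion c (int j) \<kappa>)"
      unfolding ZV_eq_trace
    proof (rule trace_expansion[OF J0 J(1,2), where C = "\<lambda>p j. 1 / (x - P ! p) ^ (j + 1)"])
      fix b assume b: "b \<in> contributing \<kappa>"
      let ?W = "vs @ handle_list g (handle_vectors b)"
      have "Z0 V B (u # ?W) (x # P) = (\<Sum>p<length ?W. \<Sum>j<J. 1 / (x - P ! p) ^ (j + 1) *
          Z0 V B (?W[p := vmode V u (int j) (?W ! p)]) P)"
      proof (rule Z0_Cons[OF u_weight N _ _ xP])
        show "vmode V u (int j) (?W ! p) = 0" if "p < length ?W" "J \<le> j" for p j
          by (rule mode_bound[OF J0 b J(1,2) that])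
      qed (simp add: len)
      then show "Z0 V B ((u # vs) @ handle_list g (handle_vectors b)) ((x # ys) @ handle_list g w) =
          (\<Sum>p<length vs + 2 * g. \<Sum>j<J. 1 / (x - P ! p) ^ (j + 1) * Z0 V B (?W[p := vmode V u (int j) (?W ! p)]) P)"
        by simp
    qed
    also have "(\<Sum>k<length vs. \<Sum>j<J0. 1 / (x - P ! k) ^ (j + 1) * point_insertion k (int j) \<kappa>)
        = (\<Sum>k<length vs. \<Sum>j<J0. 1 / (x - ys ! k) ^ (j + 1) * point_insertion k (int j) \<kappa>)"
      by (intro sum.cong refl) (simp add: nth_P_point)
    also have "(\<Sum>c\<in>handles g. \<Sum>j<J. 1 / (x - P ! (length vs + handle_pos c)) ^ (j + 1) * handle_insertion c (int j) \<kappa>)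
        = (\<Sum>c\<in>handles g. \<Sum>j<J. 1 / (x - w c) ^ (j + 1) * handle_insertion c (int j) \<kappa>)"
      by (intro sum.cong refl) (simp only: nth_P_handle)
    also have "\<dots> = (\<Sum>j<J. 1 / (x - w a) ^ (j + 1) * handle_insertion a (int j) \<kappa>)
        + (\<Sum>c\<in>handles g - {a}. \<Sum>j<J. 1 / (x - w c) ^ (j + 1) * handle_insertion c (int j) \<kappa>)"
      by (rule sum.remove[OF finite_handles a])
    finally show ?thesis by (simp add: R_def)
  qed
  have "R holomorphic_on S"
    unfolding R_def
  proof (intro holomorphic_intros)
    fix k j x assume "k \<in> {..<length vs}" "x \<in> S"
    then show "(x - ys ! k) ^ (j + 1) \<noteq> 0" using len nth_mem[of k ys] by (auto simp: S_def)
  next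
    fix c j x assume "c \<in> handles g - {a}" "x \<in> S"
    then show "(x - w c) ^ (j + 1) \<noteq> 0" by (auto simp: S_def)
  qed
  note res = residue_principal_part[OF S this, where l = l and J = J and h = "\<lambda>j. handle_insertion a (int j) \<kappa>"]
  have "eventually (\<lambda>x. x \<in> S \<and> x \<noteq> w a) (at (w a))"
    using eventually_at_topological S by blast
  then have "eventually (\<lambda>x. (x - w a) ^ l * ZV V B g w bas (u # vs) (x # ys) \<kappa>
      = (x - w a) ^ l * (R x + (\<Sum>j<J. handle_insertion a (int j) \<kappa> / (x - w a) ^ (j + 1)))) (at (w a))"
    by eventually_elim (simp add: expand)
  from residue_cong[OF this refl] show ?thesis using res J(3) by simp
qed

section \<open>The linear system of the handle insertions\<close>

text \<open>
  \<open>X\<^sub>c\<^sup>j\<close> with the factor \<open>\<rho>\<^sub>c^(-j/2)\<close> compensating the powers of \<open>\<rho>\<close> in the entries of \<open>L\<close> and \<open>A\<close>.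
\<close>

definition handle_unknown :: "int \<times> nat \<Rightarrow> rho_series" where
  "handle_unknown = (\<lambda>(c, j). rs_mult (rho_half c (- int j)) (handle_insertion c (int j)))"

lemma handle_unknown_eq: "handle_unknown (c, j) = (\<lambda>\<kappa>. handle_insertion c (int j) (\<lambda>i. \<kappa> i + half_exponent c (int j) i))"
  by (simp add: handle_unknown_def rho_half_mono rs_mult_mono_left half_exponent_def fun_eq_iff if_distrib cong: if_cong)

text \<open>
  A contributing vector \<open>b\<^sub>c\<close> has weight at least \<open>j + 1 - N\<close>, as otherwise \<open>u(j)b\<^sub>c = 0\<close>.  So the factor
  \<open>\<rho>\<^sub>c^(-j/2)\<close> costs only half of the available power of \<open>\<rho>\<^sub>c\<close>, and the degree still grows with \<open>j\<close>.
\<close>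

lemma tame_handle_unknown:
  assumes c: "c \<in> handles g"
  shows "tame g (2 * int N) (int j - 2 * int N) (handle_unknown (c, j))"
proof (rule tameI)
  fix \<kappa> assume nz: "handle_unknown (c, j) \<kappa> \<noteq> 0"
  let ?\<kappa> = "\<lambda>i. \<kappa> i + half_exponent c (int j) i"
  have nz': "handle_insertion c (int j) ?\<kappa> \<noteq> 0" using nz by (simp add: handle_unknown_eq)
  have nn: "?\<kappa> i \<ge> 0" and out: "i \<notin> {1..g} \<Longrightarrow> ?\<kappa> i = 0" for i
    using handle_trace_nonneg[of _ ?\<kappa> i] nz' unfolding handle_insertion_def by blast+
  have hi: "?\<kappa> (nat \<bar>c\<bar>) \<ge> 2 * (int j + 1 - int N)" by (rule handle_insertion_nonzero[OF nz' c])
  show "- (2 * int N) \<le> \<kappa> i" for i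
    using nn[of i] hi by (cases "i = nat \<bar>c\<bar>") (auto simp: half_exponent_def)
  show "\<kappa> i = 0" if "i \<notin> {1..g}" for i
    using out[OF that] handle_index[OF c] that by (auto simp: half_exponent_def split: if_splits)
  have "?\<kappa> (nat \<bar>c\<bar>) \<le> (\<Sum>i = 1..g. ?\<kappa> i)"
    by (rule member_le_sum[of _ _ ?\<kappa>]) (use handle_index[OF c] nn in auto)
  also have "\<dots> = (\<Sum>i = 1..g. \<kappa> i) + int j" using sum_half_exponent[OF c, of "int j"] by (simp add: sum.distrib)
  finally have "2 * (int j + 1 - int N) \<le> (\<Sum>i = 1..g. \<kappa> i) + int j" using hi by (rule order_trans[rotated])
  then show "int j - 2 * int N \<le> (\<Sum>i = 1..g. \<kappa> i)" by (simp add: distrib_left)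
qed

lemma Lvec_handle_unknown:
  "rs_mult (Lvec N w A x (c, j)) (handle_unknown (c, j)) = (\<lambda>\<kappa>. sderiv2 0 j (piN N A) x (w c) * handle_insertion c (int j) \<kappa>)"
  by (simp add: Lvec_mono rs_mult_mono_left handle_unknown_eq)

text \<open>
  The entry \<open>R\<^sub>a\<^sup>m(y\<^sub>k)\<close>, differentiated \<open>j\<close> times in \<open>y\<^sub>k\<close>.
\<close>

definition point_kernel :: "nat \<times> nat \<Rightarrow> int \<times> nat \<Rightarrow> rho_series" where
  "point_kernel = (\<lambda>(k, j) (a, m). rs_mult (rho_half a (int m + 1))
     (rs_const ((-1) ^ N * sderiv2 m j (piN N A) (w (- a)) (ys ! k))))"

text \<open>
  The flip turns \<open>u(n+2N-1)\<close> at \<open>w\<^sub>a\<close> into \<open>u(-1-n)\<close> at \<open>w\<^sub>-\<^sub>a\<close>, to which the genus zero recursion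
  applies.
\<close>

lemma handle_unknown_system:
  assumes J0: "\<And>k j. k < length vs \<Longrightarrow> j \<ge> J0 \<Longrightarrow> vmode V u (int j) (vs ! k) = 0"
    and a: "a \<in> handles g"
  shows "handle_unknown (a, n + 2 * N - 1) =
     rs_add (\<lambda>\<kappa>. \<Sum>i\<in>{..<length vs} \<times> {..<J0}. rs_mult (point_kernel i (a, n)) (point_insertion (fst i) (int (snd i))) \<kappa>)
       (rs_sum (handles g \<times> UNIV) (\<lambda>p. rs_mult (Amat N w A (a, n) p) (handle_unknown p)))"
proof
  fix \<kappa>
  let ?\<mu> = "\<lambda>i. \<kappa> i - half_exponent a (int n + 1) i"
  define J where "J = max J0 (N + nat (\<Sum>i = 1..g. \<bar>?\<mu> i\<bar>))"
  have J: "J \<ge> J0" "int J \<ge> int N + (\<Sum>i = 1..g. \<bar>?\<mu> i\<bar>)" by (auto simp: J_def)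
  have na: "- a \<in> handles g" by (rule uminus_handles[OF a])
  have n_eq: "int (n + 2 * N - 1) = int n + 2 * int N - 1" using N by simp
  have e: "(\<lambda>i. \<kappa> i + half_exponent a (int n + 2 * int N - 1) i - half_exponent a (2 * (int n + 2 * int N - 1 + 1 - int N)) i) = ?\<mu>"
    by (auto simp: half_exponent_def fun_eq_iff)
  have e2: "2 * int N - 2 - (int n + 2 * int N - 1) = - 1 - int n" by simp
  have "handle_unknown (a, n + 2 * N - 1) \<kappa> = (-1) ^ N * handle_insertion (- a) (- 1 - int n) ?\<mu>"
    unfolding handle_unknown_eq n_eq by (subst handle_flip[OF a]) (simp only: e e2)
  also have "\<dots> = (-1) ^ N * ((\<Sum>k<length vs. \<Sum>j<J0. sderiv2 n j (piN N A) (w (- a)) (ys ! k) * point_insertion k (int j) ?\<mu>)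
    + (\<Sum>d\<in>handles g. \<Sum>j<J. (if d = - a
          then \<Sum>l\<le>2 * N - 2. of_nat (l choose j) * sderiv n (fN N A l) (w (- a)) * w (- a) ^ (l - j)
          else sderiv2 n j (piN N A) (w (- a)) (w d)) * handle_insertion d (int j) ?\<mu>))"
    by (simp only: creation_expansion[OF J0 J na])
  also have "\<dots> = (\<Sum>i\<in>{..<length vs} \<times> {..<J0}. rs_mult (point_kernel i (a, n)) (point_insertion (fst i) (int (snd i))) \<kappa>)
     + (\<Sum>p\<in>handles g \<times> {..<J}. rs_mult (Amat N w A (a, n) p) (handle_unknown p) \<kappa>)"
  proof -
    have pk: "rs_mult (point_kernel (k, j) (a, n)) f \<kappa> = (-1) ^ N * (sderiv2 n j (piN N A) (w (- a)) (ys ! k) * f ?\<mu>)" for k j f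
      by (simp add: point_kernel_def rho_half_mult_const rs_mult_mono_left)
    have am: "rs_mult (Amat N w A (a, n) (d, j)) (handle_unknown (d, j)) \<kappa> = (-1) ^ N * ((if d = - a
          then \<Sum>l\<le>2 * N - 2. of_nat (l choose j) * sderiv n (fN N A l) (w (- a)) * w (- a) ^ (l - j)
          else sderiv2 n j (piN N A) (w (- a)) (w d)) * handle_insertion d (int j) ?\<mu>)" for d j
      by (auto simp: Amat_mono rs_mult_mono_left handle_unknown_eq algebra_simps)
    show ?thesis
      unfolding distrib_left sum_distrib_left sum.cartesian_product
      by (intro arg_cong2[where f = "(+)"] sum.cong refl) (auto simp: pk am)
  qed
  also have "(\<Sum>p\<in>handles g \<times> {..<J}. rs_mult (Amat N w A (a, n) p) (handle_unknown p) \<kappa>)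
      = rs_sum (handles g \<times> UNIV) (\<lambda>p. rs_mult (Amat N w A (a, n) p) (handle_unknown p)) \<kappa>"
  proof (rule rs_sum_eq[symmetric])
    fix p assume p: "p \<in> handles g \<times> UNIV" "p \<notin> handles g \<times> {..<J}"
    then obtain d j where dj: "p = (d, j)" "d \<in> handles g" "j \<ge> J"
      by (cases p) (auto simp: not_less)
    have "handle_insertion d (int j) ?\<mu> = 0"
      by (rule handle_insertion_eq_0[OF dj(2)]) (use J(2) dj(3) in linarith)
    then show "rs_mult (Amat N w A (a, n) p) (handle_unknown p) \<kappa> = 0"
      unfolding dj(1)
      by (auto simp: Amat_mono rs_mult_mono_left handle_unknown_eq algebra_simps)
  qed (auto simp: finite_handles)
  finally show "handle_unknown (a, n + 2 * N - 1) \<kappa> =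
     rs_add (\<lambda>\<kappa>. \<Sum>i\<in>{..<length vs} \<times> {..<J0}. rs_mult (point_kernel i (a, n)) (point_insertion (fst i) (int (snd i))) \<kappa>)
       (rs_sum (handles g \<times> UNIV) (\<lambda>p. rs_mult (Amat N w A (a, n) p) (handle_unknown p))) \<kappa>"
    by (simp only: rs_add_def)
qed

lemma insertion_as_rs_sum:
  assumes J0: "\<And>k j. k < length vs \<Longrightarrow> j \<ge> J0 \<Longrightarrow> vmode V u (int j) (vs ! k) = 0"
    and x: "x \<notin> set ys" "x \<notin> w ` handles g" "x \<notin> A ` {..2 * N - 2}"
  shows "ZV V B g w bas (u # vs) (x # ys) = (\<lambda>\<kappa>.
      (\<Sum>i\<in>{..<length vs} \<times> {..<J0}. sderiv2 0 (snd i) (piN N A) x (ys ! fst i) * point_insertion (fst i) (int (snd i)) \<kappa>)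
    + rs_sum (handles g \<times> UNIV) (\<lambda>p. rs_mult (Lvec N w A x p) (handle_unknown p)) \<kappa>)"
proof
  fix \<kappa>
  define J where "J = max J0 (N + nat (\<Sum>i = 1..g. \<bar>\<kappa> i\<bar>))"
  have J: "J \<ge> J0" "int J \<ge> int N + (\<Sum>i = 1..g. \<bar>\<kappa> i\<bar>)" by (auto simp: J_def)
  have "rs_sum (handles g \<times> UNIV) (\<lambda>p. rs_mult (Lvec N w A x p) (handle_unknown p)) \<kappa>
      = (\<Sum>p\<in>handles g \<times> {..<J}. rs_mult (Lvec N w A x p) (handle_unknown p) \<kappa>)"
  proof (rule rs_sum_eq)
    fix p assume p: "p \<in> handles g \<times> UNIV" "p \<notin> handles g \<times> {..<J}"
    then obtain d j where dj: "p = (d, j)" "d \<in> handles g" "j \<ge> J"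
      by (cases p) (auto simp: not_less)
    have "handle_insertion d (int j) \<kappa> = 0"
      by (rule handle_insertion_eq_0[OF dj(2)]) (use J(2) dj(3) in linarith)
    then show "rs_mult (Lvec N w A x p) (handle_unknown p) \<kappa> = 0"
      unfolding dj(1) Lvec_handle_unknown by simp
  qed (auto simp: finite_handles)
  also have "\<dots> = (\<Sum>c\<in>handles g. \<Sum>j<J. sderiv2 0 j (piN N A) x (w c) * handle_insertion c (int j) \<kappa>)"
    unfolding sum.cartesian_product by (intro sum.cong refl) (auto simp: Lvec_handle_unknown)
  finally show "ZV V B g w bas (u # vs) (x # ys) \<kappa> =
      (\<Sum>i\<in>{..<length vs} \<times> {..<J0}. sderiv2 0 (snd i) (piN N A) x (ys ! fst i) * point_insertion (fst i) (int (snd i)) \<kappa>)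
    + rs_sum (handles g \<times> UNIV) (\<lambda>p. rs_mult (Lvec N w A x p) (handle_unknown p)) \<kappa>"
    by (simp add: insertion_expansion[OF J0 J x] sum.cartesian_product case_prod_unfold)
qed

text \<open>Each coefficient of \<open>\<Psi>\<^sub>N(x,y)\<close> is a finite sum, and can be differentiated termwise in \<open>y\<close>.\<close>

lemma psi_derivative:
  assumes x: "x \<notin> set ys" "x \<notin> w ` handles g" "x \<notin> A ` {..2 * N - 2}" and k: "k < length vs"
  shows "(\<lambda>\<kappa>. sderiv j (\<lambda>y. psi N g w A x y \<kappa>) (ys ! k)) =
    rs_add (rs_const (sderiv2 0 j (piN N A) x (ys ! k))) (vec_dot g (LtildeInv N g w A x) (point_kernel (k, j)))"
proof
  fix \<kappa>
  let ?y = "ys ! k"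
  let ?LI = "LtildeInv N g w A x"
  have yk: "?y \<in> set ys" using k len by simp
  have yw: "?y \<notin> w ` handles g" using yk ysw by blast
  \<comment> \<open>The entries with index \<open>m > M\<close> have a degree exceeding that of \<open>\<kappa>\<close>.\<close>
  define M where "M = nat (\<Sum>i = 1..g. \<kappa> i)"
  let ?I = "handles g \<times> {..M}"
  let ?S = "- ({x} \<union> w ` handles g)"
  have S: "open ?S" by (intro open_Compl finite_imp_closed) (simp add: finite_handles)
  have yS: "?y \<in> ?S" using yk x(1) ysw by auto
  define cf where "cf = (\<lambda>(a, m). (-1) ^ N * ?LI (a, m) (\<lambda>i. \<kappa> i - half_exponent a (int m + 1) i))"
  have dot: "vec_dot g ?LI Q \<kappa> = (\<Sum>(a, m)\<in>?I. cf (a, m) * q a m)"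
    if Q: "\<And>a m. Q (a, m) = rs_mult (rho_half a (int m + 1)) (rs_const ((-1) ^ N * q a m))" for Q q
  proof -
    have mono: "Q (a, m) = rs_mono ((-1) ^ N * q a m) (half_exponent a (int m + 1))" for a m
      by (simp add: Q rho_half_mult_const)
    have "vec_dot g ?LI Q \<kappa> = (\<Sum>r\<in>?I. rs_mult (?LI r) (Q r) \<kappa>)"
      unfolding vec_dot_def
    proof (rule rs_sum_eq)
      fix r assume r: "r \<in> handles g \<times> UNIV" "r \<notin> ?I"
      then obtain a m where am: "r = (a, m)" "a \<in> handles g" "m > M"
        by (cases r) (auto simp: not_le)
      have t: "tame g (0 + 0) (0 + (int m + 1)) (rs_mult (?LI r) (Q r))"
        unfolding am(1) mono by (intro tame_mult tame_LInv[OF N] tame_half_exponent am(2)) simp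
      show "rs_mult (?LI r) (Q r) \<kappa> = 0"
      proof (rule ccontr)
        assume "rs_mult (?LI r) (Q r) \<kappa> \<noteq> 0"
        from tameD(3)[OF t this] show False using am(3) by (simp add: M_def)
      qed
    qed (auto simp: finite_handles)
    also have "\<dots> = (\<Sum>(a, m)\<in>?I. cf (a, m) * q a m)"
      by (intro sum.cong refl) (auto simp: mono rs_mult_mono_right cf_def)
    finally show ?thesis .
  qed
  define d0 where "d0 = (if \<kappa> = (\<lambda>_. 0) then 1 else 0 :: complex)"
  have Aw': "w (- a) \<notin> A ` {..2 * N - 2}" if "a \<in> handles g" for a
    by (rule Aw[OF uminus_handles[OF that]])
  have psi: "psi N g w A x y \<kappa> = d0 * piN N A x y + (\<Sum>(a, m)\<in>?I. cf (a, m) * sderiv2 m 0 (piN N A) (w (- a)) y)" for y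
  proof -
    have "vec_dot g ?LI (Rvec N w A y) \<kappa> = (\<Sum>(a, m)\<in>?I. cf (a, m) * sderiv2 m 0 (piN N A) (w (- a)) y)"
      by (rule dot) (simp add: Rvec_def)
    then show ?thesis by (simp add: psi_def rs_add_def rs_const_def rs_mono_def d0_def)
  qed
  have "sderiv j (\<lambda>y. psi N g w A x y \<kappa>) ?y =
      d0 * piN_deriv N A 0 j x ?y + (\<Sum>(a, m)\<in>?I. cf (a, m) * piN_deriv N A m j (w (- a)) ?y)"
  proof (rule sderiv_family[OF S, where G = "\<lambda>j y. d0 * piN_deriv N A 0 j x y + (\<Sum>(a, m)\<in>?I. cf (a, m) * piN_deriv N A m j (w (- a)) y)"])
    fix i y assume y: "y \<in> ?S"
    have "((\<lambda>y. d0 * piN_deriv N A 0 i x y + (\<Sum>p\<in>?I. cf p * piN_deriv N A (snd p) i (w (- fst p)) y)) has_field_derivative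
        d0 * (of_nat (Suc i) * piN_deriv N A 0 (Suc i) x y)
          + (\<Sum>p\<in>?I. cf p * (of_nat (Suc i) * piN_deriv N A (snd p) (Suc i) (w (- fst p)) y))) (at y)"
    proof (intro DERIV_add DERIV_cmult DERIV_sum piN_deriv_has_derivative_y)
      show "x \<noteq> y" using y by auto
      fix p assume "p \<in> ?I"
      then have "- fst p \<in> handles g" using uminus_handles by auto
      then show "w (- fst p) \<noteq> y" using y by auto
    qed
    moreover have "d0 * (of_nat (Suc i) * piN_deriv N A 0 (Suc i) x y)
          + (\<Sum>p\<in>?I. cf p * (of_nat (Suc i) * piN_deriv N A (snd p) (Suc i) (w (- fst p)) y))
        = of_nat (Suc i) * (d0 * piN_deriv N A 0 (Suc i) x y + (\<Sum>p\<in>?I. cf p * piN_deriv N A (snd p) (Suc i) (w (- fst p)) y))"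
      by (simp only: distrib_left sum_distrib_left mult.left_commute)
    ultimately show "((\<lambda>y. d0 * piN_deriv N A 0 i x y + (\<Sum>(a, m)\<in>?I. cf (a, m) * piN_deriv N A m i (w (- a)) y)) has_field_derivative
        of_nat (Suc i) * (d0 * piN_deriv N A 0 (Suc i) x y + (\<Sum>(a, m)\<in>?I. cf (a, m) * piN_deriv N A m (Suc i) (w (- a)) y))) (at y)"
      by (simp only: case_prod_unfold prod.collapse)
  next
    fix y assume y: "y \<in> ?S"
    have "piN N A x y = piN_deriv N A 0 0 x y"
      using sderiv_piN_y[OF N A x(3), of y 0] y by (auto simp: sderiv_def)
    moreover have "sderiv2 m 0 (piN N A) (w (- a)) y = piN_deriv N A m 0 (w (- a)) y" if "a \<in> handles g" for a m
      by (rule sderiv2_piN[OF N A Aw'[OF that]]) (use y uminus_handles[OF that] in auto)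
    ultimately show "psi N g w A x y \<kappa> = d0 * piN_deriv N A 0 0 x y + (\<Sum>(a, m)\<in>?I. cf (a, m) * piN_deriv N A m 0 (w (- a)) y)"
      unfolding psi by (intro arg_cong2[where f = "(+)"] sum.cong refl) auto
  qed (rule yS)
  also have "piN_deriv N A 0 j x ?y = sderiv2 0 j (piN N A) x ?y"
    by (rule sderiv2_piN[OF N A x(3), symmetric]) (use yk x(1) in auto)
  also have "(\<Sum>(a, m)\<in>?I. cf (a, m) * piN_deriv N A m j (w (- a)) ?y)
      = (\<Sum>(a, m)\<in>?I. cf (a, m) * sderiv2 m j (piN N A) (w (- a)) ?y)"
  proof (intro sum.cong refl)
    fix p assume "p \<in> ?I"
    then obtain a m where p: "p = (a, m)" "a \<in> handles g" by auto
    have "sderiv2 m j (piN N A) (w (- a)) ?y = piN_deriv N A m j (w (- a)) ?y"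
      by (rule sderiv2_piN[OF N A Aw'[OF p(2)]]) (metis yw imageI uminus_handles p(2))
    then show "(case p of (a, m) \<Rightarrow> cf (a, m) * piN_deriv N A m j (w (- a)) ?y)
        = (case p of (a, m) \<Rightarrow> cf (a, m) * sderiv2 m j (piN N A) (w (- a)) ?y)" by (simp add: p)
  qed
  also have "\<dots> = vec_dot g ?LI (point_kernel (k, j)) \<kappa>"
    by (rule dot[symmetric]) (simp add: point_kernel_def)
  finally show "sderiv j (\<lambda>y. psi N g w A x y \<kappa>) ?y =
    rs_add (rs_const (sderiv2 0 j (piN N A) x ?y)) (vec_dot g ?LI (point_kernel (k, j))) \<kappa>"
    by (simp add: rs_add_def rs_const_def rs_mono_def d0_def)
qed

end

section \<open>The genus \<open>g\<close> recursion\<close>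

lemma tame_half_exponent_any:
  assumes a: "a \<in> handles g"
  shows "tame g \<bar>k\<bar> k (rs_mono c (half_exponent a k))"
proof (rule tame_mono)
  show "k \<le> (\<Sum>i = 1..g. half_exponent a k i)" by (simp only: sum_half_exponent[OF a])
qed (use handle_index[OF a] in \<open>auto simp: half_exponent_def\<close>)

lemma half_exponent_uminus: "half_exponent (- a) k = half_exponent a k"
  by (simp add: half_exponent_def)

lemma handles_eq_Un: "handles g = int ` {1..g} \<union> (\<lambda>a. - int a) ` {1..g}"
proof
  show "handles g \<subseteq> int ` {1..g} \<union> (\<lambda>a. - int a) ` {1..g}"
  proof
    fix c assume c: "c \<in> handles g"
    have "c = int (nat \<bar>c\<bar>) \<or> c = - int (nat \<bar>c\<bar>)" by auto
    then show "c \<in> int ` {1..g} \<union> (\<lambda>a. - int a) ` {1..g}" using handle_index[OF c] by blast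
  qed
qed (auto simp: handles_def)

lemma sum_handles: "(\<Sum>c\<in>handles g. F c) = (\<Sum>a = 1..g. F (int a) + F (- int a))"
proof -
  have "(\<Sum>c\<in>handles g. F c) = (\<Sum>c\<in>int ` {1..g}. F c) + (\<Sum>c\<in>(\<lambda>a. - int a) ` {1..g}. F c)"
    unfolding handles_eq_Un by (rule sum.union_disjoint) auto
  also have "\<dots> = (\<Sum>a = 1..g. F (int a)) + (\<Sum>a = 1..g. F (- int a))"
    by (subst (1 2) sum.reindex) (auto simp: inj_on_def)
  finally show ?thesis by (simp add: sum.distrib)
qed

context genus_g_correlations
begin

text \<open>
  The flip exchanges the range \<open>0 \<le> l \<le> 2N - 2\<close> with itself.
\<close>

lemma handle_flip_low:
  assumes a: "a \<in> handles g" and l: "l \<le> 2 * N - 2"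
  shows "handle_insertion (- a) (int (2 * N - 2 - l)) =
     rs_mult (rs_const ((-1) ^ N)) (rs_mult (rho_half a (2 * (int N - 1 - int l))) (handle_insertion a (int l)))"
proof -
  have e: "int (2 * N - 2 - l) = 2 * int N - 2 - int l" using l N by (simp add: of_nat_diff)
  have e2: "2 * int N - 2 - (2 * int N - 2 - int l) = int l" "2 * int N - 2 - int l + 1 - int N = int N - 1 - int l" by simp_all
  show ?thesis
    unfolding e
    by (subst handle_flip[OF uminus_handles[OF a]])
      (simp only: e2 half_exponent_uminus minus_minus rho_half_mono rs_mult_mono_left rs_mult_const_left mult_1)
qed

text \<open>
  The solution of the linear system is sorted by insertions: the direct term of \<open>\<pi>\<^sub>N\<close> and the correction through
  \<open>R\<close> add up to \<open>\<Psi>\<^sub>N\<close>, and the terms \<open>T\<^sub>c\<^sup>l\<close> for \<open>c = a\<close> and \<open>c = -a\<close> are joined by the flip.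
\<close>

theorem ZV_recursion:
  assumes J0: "\<And>k j. k < length vs \<Longrightarrow> j \<ge> J0 \<Longrightarrow> vmode V u (int j) (vs ! k) = 0"
    and x: "x \<notin> set ys" "x \<notin> w ` handles g" "x \<notin> A ` {..2 * N - 2}"
  shows "ZV V B g w bas (u # vs) (x # ys) = (\<lambda>\<kappa>.
      (\<Sum>a = 1..g. \<Sum>l = 0..2 * N - 2. rs_mult (theta N g w A (int a) l x) (handle_insertion (int a) (int l)) \<kappa>)
    + (\<Sum>k<length vs. \<Sum>j<J0. rs_mult (\<lambda>\<kappa>. sderiv j (\<lambda>y. psi N g w A x y \<kappa>) (ys ! k)) (point_insertion k (int j)) \<kappa>))"
proof -
  let ?K = "{..<length vs} \<times> {..<J0}"
  let ?low = "handles g \<times> {..2 * N - 2}"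
  let ?LI = "LtildeInv N g w A x"
  define D where "D = (\<lambda>i. point_insertion (fst i) (int (snd i)))"
  define T where "T p = rs_add (Lvec N w A x p) (vec_mat g ?LI (Amat N w A) p)" for p
  have tD: "tame g 0 0 (D i)" for i unfolding D_def point_insertion_def by (rule tame_handle_trace)
  have thi: "tame g 0 0 (handle_insertion c j)" for c j unfolding handle_insertion_def by (rule tame_handle_trace)
  have pk: "point_kernel i (a, m) = rs_mono ((-1) ^ N * sderiv2 m (snd i) (piN N A) (w (- a)) (ys ! fst i)) (half_exponent a (int m + 1))" for i a m
    by (cases i) (simp add: point_kernel_def rho_half_mult_const)
  have tpk: "tame g 0 (int m) (point_kernel i (a, m))" if "a \<in> handles g" for i a m
    unfolding pk by (rule tame_weaken[OF tame_half_exponent[OF that]]) auto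
  have mpk: "is_monomial (point_kernel i q)" for i q
    by (cases q) (auto simp: pk is_monomial_def)
  have ins: "ZV V B g w bas (u # vs) (x # ys) = (\<lambda>\<kappa>.
      (\<Sum>i\<in>?K. sderiv2 0 (snd i) (piN N A) x (ys ! fst i) * D i \<kappa>)
    + rs_sum (handles g \<times> UNIV) (\<lambda>p. rs_mult (Lvec N w A x p) (handle_unknown p)) \<kappa>)"
    unfolding D_def by (rule insertion_as_rs_sum[OF _ x]) (rule J0)
  have sol: "rs_sum (handles g \<times> UNIV) (\<lambda>p. rs_mult (Lvec N w A x p) (handle_unknown p)) = (\<lambda>\<kappa>.
      (\<Sum>i\<in>?K. rs_mult (vec_dot g ?LI (point_kernel i)) (D i) \<kappa>) + (\<Sum>p\<in>?low. rs_mult (T p) (handle_unknown p) \<kappa>))"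
    unfolding T_def
    \<comment> \<open>\<open>2N\<close> is the bound on the negative exponents from \<open>tame_handle_unknown\<close>.\<close>
  proof (rule formal_solution[OF N, where C = "2 * int N" and K = ?K and R = point_kernel])
    show "tame g (2 * int N) (int j - 2 * int N) (handle_unknown (a, j))" if "a \<in> handles g" for a j
      by (rule tame_handle_unknown[OF that])
    show "tame g (2 * int N) (- (2 * int N)) (D i)" for i
      by (rule tame_weaken[OF tD]) auto
    show "handle_unknown (a, n + 2 * N - 1) = rs_add (\<lambda>\<kappa>. \<Sum>i\<in>?K. rs_mult (point_kernel i (a, n)) (D i) \<kappa>)
         (rs_sum (handles g \<times> UNIV) (\<lambda>p. rs_mult (Amat N w A (a, n) p) (handle_unknown p)))" if "a \<in> handles g" for a n
      unfolding D_def by (rule handle_unknown_system[OF J0 that])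
  qed (auto simp: mpk tpk)
  have tdot: "tame g 0 0 (vec_dot g ?LI (point_kernel i))" for i
    unfolding vec_dot_def
  proof (rule tame_rs_sum)
    fix r :: "int \<times> nat" assume "r \<in> handles g \<times> UNIV"
    then obtain a m where r: "r = (a, m)" "a \<in> handles g" by auto
    show "tame g 0 0 (rs_mult (?LI r) (point_kernel i r))"
      unfolding r(1) using tame_mult[OF tame_LInv[OF N, where q = "(a, m)"] tpk[OF r(2), of m i]]
      by (rule tame_weaken) auto
  qed
  have points: "sderiv2 0 (snd i) (piN N A) x (ys ! fst i) * D i \<kappa> + rs_mult (vec_dot g ?LI (point_kernel i)) (D i) \<kappa>
      = rs_mult (\<lambda>\<kappa>. sderiv (snd i) (\<lambda>y. psi N g w A x y \<kappa>) (ys ! fst i)) (D i) \<kappa>" if "i \<in> ?K" for i \<kappa>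
  proof -
    have k: "fst i < length vs" using that by auto
    have "rs_mult (rs_add (rs_const (sderiv2 0 (snd i) (piN N A) x (ys ! fst i))) (vec_dot g ?LI (point_kernel i))) (D i)
        = rs_add (rs_mult (rs_const (sderiv2 0 (snd i) (piN N A) x (ys ! fst i))) (D i)) (rs_mult (vec_dot g ?LI (point_kernel i)) (D i))"
      by (rule rs_mult_add_left[OF tD tame_rs_const tdot])
    then show ?thesis
      unfolding psi_derivative[OF x k] by (simp add: rs_mult_const_left rs_add_def)
  qed
  have tT: "tame g 0 0 (T p)" if "p \<in> ?low" for p
    unfolding T_def
  proof (rule tame_add)
    obtain b n where p: "p = (b, n)" "b \<in> handles g" using \<open>p \<in> ?low\<close> by auto
    show "tame g 0 0 (Lvec N w A x p)" unfolding p(1) by (rule tame_weaken[OF tame_Lvec[OF p(2)]]) auto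
    show "tame g 0 0 (vec_mat g ?LI (Amat N w A) p)"
      unfolding vec_mat_def
    proof (rule tame_rs_sum)
      fix r :: "int \<times> nat" assume "r \<in> handles g \<times> UNIV"
      then obtain a m where r: "r = (a, m)" "a \<in> handles g" by auto
      show "tame g 0 0 (rs_mult (?LI r) (Amat N w A r p))"
        unfolding r(1) p(1)
        using tame_mult[OF tame_LInv[OF N, where q = "(a, m)"] tame_Amat[OF r(2) p(2), of m n]]
        by (rule tame_weaken) auto
    qed
  qed
  have Tc: "Tcoeff N g w A c l x = rs_mult (rho_half c (- int l)) (T (c, l))" for c l
    by (simp add: Tcoeff_def T_def)
  have unknown: "rs_mult (T (c, l)) (handle_unknown (c, l)) = rs_mult (Tcoeff N g w A c l x) (handle_insertion c (int l))" for c l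
    unfolding Tc handle_unknown_def prod.case
    by (simp only: rs_mult_commute[of "rho_half c (- int l)" "T (c, l)"] rs_mult_assoc_middle[OF is_monomial_rho_half])
  have handle: "rs_mult (Tcoeff N g w A (int a) l x) (handle_insertion (int a) (int l)) \<kappa>
      + rs_mult (Tcoeff N g w A (- int a) (2 * N - 2 - l) x) (handle_insertion (- int a) (int (2 * N - 2 - l))) \<kappa>
      = rs_mult (theta N g w A (int a) l x) (handle_insertion (int a) (int l)) \<kappa>" if a: "a \<in> {1..g}" and l: "l \<le> 2 * N - 2" for a l \<kappa>
  proof -
    have ha: "int a \<in> handles g" using a by (auto simp: handles_def)
    let ?T1 = "Tcoeff N g w A (int a) l x"
    let ?T2 = "Tcoeff N g w A (- int a) (2 * N - 2 - l) x"
    let ?\<rho> = "rho_half (int a) (2 * (int N - 1 - int l))"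
    let ?c = "rs_const ((-1) ^ N)"
    \<comment> \<open>A common bound for the two series, generous enough for both powers of \<open>\<rho>\<^sub>a\<close>.\<close>
    let ?M = "8 * int N"
    have t1: "tame g ?M (- ?M) ?T1"
      unfolding Tc rho_half_mono
      by (rule tame_weaken[OF tame_mult[OF tame_half_exponent_any[OF ha] tT]]) (use ha l N in auto)
    have t2': "tame g (\<bar>- int (2 * N - 2 - l)\<bar> + 0) (- int (2 * N - 2 - l) + 0) ?T2"
      unfolding Tc rho_half_mono
      by (rule tame_mult[OF tame_half_exponent_any[OF uminus_handles[OF ha]] tT]) (use uminus_handles[OF ha] l in auto)
    have tr: "tame g \<bar>k\<bar> k (rho_half (int a) k)" for k
      unfolding rho_half_mono by (rule tame_half_exponent_any[OF ha])
    have t2: "tame g ?M (- ?M) (rs_mult ?c (rs_mult ?\<rho> ?T2))"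
      by (rule tame_weaken[OF tame_mult[OF tame_rs_const tame_mult[OF tr t2']]]) (use l N in auto)
    have "rs_mult ?T2 (handle_insertion (- int a) (int (2 * N - 2 - l)))
        = rs_mult ?T2 (rs_mult ?c (rs_mult ?\<rho> (handle_insertion (int a) (int l))))"
      by (simp only: handle_flip_low[OF ha l])
    also have "\<dots> = rs_mult (rs_mult (rs_mult ?T2 ?c) ?\<rho>) (handle_insertion (int a) (int l))"
      by (rule trans[OF rs_mult_assoc_middle[OF is_monomial_rs_const, symmetric] rs_mult_assoc_middle[OF is_monomial_rho_half, symmetric]])
    also have "rs_mult (rs_mult ?T2 ?c) ?\<rho> = rs_mult ?c (rs_mult ?\<rho> ?T2)"
      unfolding rs_mult_commute[of ?T2 ?c] rs_mult_commute[of ?\<rho> ?T2] by (rule rs_mult_assoc_left[OF is_monomial_rs_const])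
    finally have 2: "rs_mult ?T2 (handle_insertion (- int a) (int (2 * N - 2 - l)))
        = rs_mult (rs_mult ?c (rs_mult ?\<rho> ?T2)) (handle_insertion (int a) (int l))" .
    show ?thesis
      unfolding theta_def rs_mult_add_left[OF thi t1 t2] 2 by (simp only: rs_add_def)
  qed
  show ?thesis
  proof
    fix \<kappa>
    have rev: "(\<Sum>l\<le>M. F l) = (\<Sum>l\<le>M. F (M - l))" for M and F :: "nat \<Rightarrow> complex"
      by (rule sum.reindex_bij_witness[of _ "\<lambda>l. M - l" "\<lambda>l. M - l"]) auto
    let ?g = "\<lambda>c l. rs_mult (Tcoeff N g w A c l x) (handle_insertion c (int l)) \<kappa>"
    have "(\<Sum>p\<in>?low. rs_mult (T p) (handle_unknown p) \<kappa>) = (\<Sum>c\<in>handles g. \<Sum>l\<le>2 * N - 2. ?g c l)"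
      unfolding sum.cartesian_product by (intro sum.cong refl) (auto simp: unknown)
    also have "\<dots> = (\<Sum>a = 1..g. (\<Sum>l\<le>2 * N - 2. ?g (int a) l) + (\<Sum>l\<le>2 * N - 2. ?g (- int a) l))"
      by (rule sum_handles)
    also have "\<dots> = (\<Sum>a = 1..g. \<Sum>l = 0..2 * N - 2. rs_mult (theta N g w A (int a) l x) (handle_insertion (int a) (int l)) \<kappa>)"
    proof (rule sum.cong[OF refl])
      fix a assume a: "a \<in> {1..g}"
      have "(\<Sum>l\<le>2 * N - 2. ?g (- int a) l) = (\<Sum>l\<le>2 * N - 2. ?g (- int a) (2 * N - 2 - l))"
        by (rule rev)
      then have "(\<Sum>l\<le>2 * N - 2. ?g (int a) l) + (\<Sum>l\<le>2 * N - 2. ?g (- int a) l)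
          = (\<Sum>l\<le>2 * N - 2. ?g (int a) l + ?g (- int a) (2 * N - 2 - l))" by (simp add: sum.distrib)
      also have "\<dots> = (\<Sum>l\<le>2 * N - 2. rs_mult (theta N g w A (int a) l x) (handle_insertion (int a) (int l)) \<kappa>)"
        by (rule sum.cong[OF refl]) (rule handle[OF a], simp)
      finally show "(\<Sum>l\<le>2 * N - 2. ?g (int a) l) + (\<Sum>l\<le>2 * N - 2. ?g (- int a) l)
          = (\<Sum>l = 0..2 * N - 2. rs_mult (theta N g w A (int a) l x) (handle_insertion (int a) (int l)) \<kappa>)"
        by (simp add: atLeast0AtMost)
    qed
    finally have low: "(\<Sum>p\<in>?low. rs_mult (T p) (handle_unknown p) \<kappa>)
      = (\<Sum>a = 1..g. \<Sum>l = 0..2 * N - 2. rs_mult (theta N g w A (int a) l x) (handle_insertion (int a) (int l)) \<kappa>)" .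
    have "(\<Sum>i\<in>?K. sderiv2 0 (snd i) (piN N A) x (ys ! fst i) * D i \<kappa>)
        + (\<Sum>i\<in>?K. rs_mult (vec_dot g ?LI (point_kernel i)) (D i) \<kappa>)
      = (\<Sum>i\<in>?K. rs_mult (\<lambda>\<kappa>. sderiv (snd i) (\<lambda>y. psi N g w A x y \<kappa>) (ys ! fst i)) (D i) \<kappa>)"
      unfolding sum.distrib[symmetric] by (rule sum.cong[OF refl]) (rule points)
    also have "\<dots> = (\<Sum>k<length vs. \<Sum>j<J0. rs_mult (\<lambda>\<kappa>. sderiv j (\<lambda>y. psi N g w A x y \<kappa>) (ys ! k)) (point_insertion k (int j)) \<kappa>)"
      by (simp add: sum.cartesian_product case_prod_unfold D_def)
    finally show "ZV V B g w bas (u # vs) (x # ys) \<kappa> =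
        (\<Sum>a = 1..g. \<Sum>l = 0..2 * N - 2. rs_mult (theta N g w A (int a) l x) (handle_insertion (int a) (int l)) \<kappa>)
      + (\<Sum>k<length vs. \<Sum>j<J0. rs_mult (\<lambda>\<kappa>. sderiv j (\<lambda>y. psi N g w A x y \<kappa>) (ys ! k)) (point_insertion k (int j)) \<kappa>)"
      unfolding ins sol low[symmetric] by (simp add: D_def add_ac)
  qed
qed

lemma ZV_Cons_scale:
  assumes "x \<notin> set ys" "x \<notin> w ` handles g"
  shows "ZV V B g w bas ((c \<odot> u) # vs) (x # ys) = (\<lambda>\<kappa>. c * ZV V B g w bas (u # vs) (x # ys) \<kappa>)"
proof -
  have "distinct (x # P)" using distinct_P assms by (simp add: set_handle_list)
  then have "Z0 V B ((c \<odot> u) # vs @ handle_list g f) (x # P) = c * Z0 V B (u # vs @ handle_list g f) (x # P)" for f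
    using Z0_slot_scale[of 0 "u # vs @ handle_list g f" "x # P" c u] len by simp
  then show ?thesis by (simp add: ZV_eq_trace handle_trace_def sum_distrib_left)
qed

lemma ZV_point_scale:
  assumes k: "k < length vs"
  shows "ZV V B g w bas (vs[k := c \<odot> vmode V u j (vs ! k)]) ys = (\<lambda>\<kappa>. c * point_insertion k j \<kappa>)"
proof -
  have upd: "(vs @ handle_list g f)[k := z] = vs[k := z] @ handle_list g f" for f z
    using k by (simp add: list_update_append)
  have "Z0 V B (vs[k := c \<odot> vmode V u j (vs ! k)] @ handle_list g f) P = c * Z0 V B (vs[k := vmode V u j (vs ! k)] @ handle_list g f) P" for f
    unfolding upd[symmetric] using k distinct_P len by (intro Z0_slot_scale) auto
  then show ?thesis by (simp add: ZV_eq_trace point_insertion_def handle_trace_def sum_distrib_left)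
qed

lemma point_insertion_zero:
  assumes k: "k < length vs" and 0: "vmode V u j (vs ! k) = 0"
  shows "point_insertion k j = (\<lambda>_. 0)"
  using ZV_point_scale[OF k, of 0 j] ZV_point_scale[OF k, of 1 j] by (simp add: 0)

end

theorem theorem4p2:
  fixes V :: "('v::ab_group_add) voa" and B :: "'v \<Rightarrow> 'v \<Rightarrow> complex"
    and N g n :: nat and u :: 'v and vs :: "'v list"
    and x dx :: complex and ys dys :: "complex list"
    and w :: "int \<Rightarrow> complex" and A :: "nat \<Rightarrow> complex" and bas :: "nat \<Rightarrow> 'v set"
  assumes "is_voa V" and "simple_voa V" and "strong_cft_type V" and "self_contragredient V"
    and "normalized_invariant_form V B"
    and "N \<ge> 1" and "g \<ge> 1" and "N \<ge> 2 \<longrightarrow> g \<ge> 2"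
    and "\<forall>a\<in>{1..g}. homogeneous_basis V (bas a)"
    and "quasiprimary V N u"
    and "length vs = n" and "length ys = n" and "length dys = n" and "0 \<notin> set dys"
    and "distinct (x # ys @ map w ([- int g..-1] @ [1..int g]))"
    and "inj_on A {..2 * N - 2}"
    and "\<forall>l\<le>2 * N - 2. A l \<noteq> x \<and> A l \<notin> w ` handles g"
  shows "FV V B g w bas (u # vs) (x # ys) (dx # dys) =
    (\<lambda>\<kappa>. (\<Sum>a = 1..g. \<Sum>l = 0..2 * N - 2.
            rs_mult (Theta_form N g w A (int a) l x dx)
                    (Res_FV V B g w bas (int a) l u vs ys dys) \<kappa>)
       + (\<Sum>k<n. Sum_any (\<lambda>j::nat.
            rs_mult (Psi_form_deriv N g w A j x dx (ys ! k) (dys ! k))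
                    (FV V B g w bas (vs[k := vmode V u (int j) (vs ! k)]) ys dys) \<kappa>
            * (dys ! k) ^ j)))"
proof -
  note prems = assms
  let ?vs = "map2 (form_weight V) dys vs"
  have set_hd: "set ([- int g..-1] @ [1..int g]) = handles g" by (auto simp: handles_def)
  have dist: "x \<notin> set ys" "x \<notin> w ` handles g" "distinct ys" "set ys \<inter> w ` handles g = {}"
    "inj_on w (handles g)"
  proof -
    have d: "distinct (map w ([- int g..-1] @ [1..int g]))" "x \<notin> set ys" "distinct ys"
        "x \<notin> set (map w ([- int g..-1] @ [1..int g]))" "set ys \<inter> set (map w ([- int g..-1] @ [1..int g])) = {}"
      using prems(15) by (simp_all only: distinct.simps distinct_append set_append Un_iff de_Morgan_disj simp_thms)
    from d show "x \<notin> set ys" "x \<notin> w ` handles g" "distinct ys" "set ys \<inter> w ` handles g = {}" "inj_on w (handles g)"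
      by (simp_all only: set_map set_hd distinct_map simp_thms)
  qed
  have xA: "x \<notin> A ` {..2 * N - 2}" using prems(17) by auto
  interpret F: voa_invariant_form V B
    by unfold_locales (use prems in auto)
  interpret G: genus_g_correlations V B N g u w A bas ?vs ys
  proof unfold_locales
    show "quasiprimary V N u" "N \<ge> 1" by (fact prems)+
    show "homogeneous_basis V (bas a)" if "a \<in> {1..g}" for a using prems(9) that by blast
    show "length ys = length ?vs" using prems(11-13) by simp
    show "distinct ys" "inj_on w (handles g)" "set ys \<inter> w ` handles g = {}" by (fact dist)+
    show "inj_on A {..2 * N - 2}" by (fact prems)
    show "w c \<notin> A ` {..2 * N - 2}" if "c \<in> handles g" for c
      using prems(17) that by (metis atMost_iff imageE imageI)
  qed
  have uw: "u \<in> wtspace V N" using prems(10) by (simp add: quasiprimary_def)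
  have len: "length ?vs = n" using prems by simp
  have LHS: "FV V B g w bas (u # vs) (x # ys) (d # dys) = (\<lambda>\<kappa>. d ^ N * ZV V B g w bas (u # ?vs) (x # ys) \<kappa>)" for d
    using G.ZV_Cons_scale[OF dist(1,2)] by (simp add: FV_def F.form_weight_homogeneous[OF uw])
  have Res: "Res_FV V B g w bas (int a) l u vs ys dys = G.handle_insertion (int a) (int l)" if "a \<in> {1..g}" for a l
  proof
    fix \<kappa>
    have "int a \<in> handles g" using that by (auto simp: handles_def)
    from G.handle_residue[OF this]
    show "Res_FV V B g w bas (int a) l u vs ys dys \<kappa> = G.handle_insertion (int a) (int l) \<kappa>"
      using F.form_weight_one by (simp add: Res_FV_def FV_def)
  qed
  have pt: "FV V B g w bas (vs[k := vmode V u (int j) (vs ! k)]) ys dys =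
      (\<lambda>\<kappa>. (dys ! k) powi (int N - int j - 1) * G.point_insertion k (int j) \<kappa>)" if k: "k < n" for k j
  proof -
    have d: "dys ! k \<noteq> 0" using prems(13,14) k nth_mem by metis
    have kl: "k < length ?vs" using k len by simp
    have "map2 (form_weight V) dys (vs[k := vmode V u (int j) (vs ! k)])
        = ?vs[k := form_weight V (dys ! k) (vmode V u (int j) (vs ! k))]"
      by (rule nth_equalityI) (use prems k in \<open>auto simp: nth_list_update\<close>)
    also have "form_weight V (dys ! k) (vmode V u (int j) (vs ! k))
        = vscale V ((dys ! k) powi (int N - int j - 1)) (vmode V u (int j) (?vs ! k))"
      using F.form_weight_mode[OF uw d, of "int j" "vs ! k"] k prems by simp
    finally have "map2 (form_weight V) dys (vs[k := vmode V u (int j) (vs ! k)])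
        = ?vs[k := vscale V ((dys ! k) powi (int N - int j - 1)) (vmode V u (int j) (?vs ! k))]" .
    then show ?thesis
      unfolding FV_def by (simp only: G.ZV_point_scale[OF kl])
  qed
  obtain J where J: "\<And>k j. k < length ?vs \<Longrightarrow> j \<ge> J \<Longrightarrow> vmode V u (int j) (?vs ! k) = 0"
    using G.exists_mode_bound by blast
  have rec: "ZV V B g w bas (u # ?vs) (x # ys) = (\<lambda>\<kappa>.
      (\<Sum>a = 1..g. \<Sum>l = 0..2 * N - 2. rs_mult (theta N g w A (int a) l x) (G.handle_insertion (int a) (int l)) \<kappa>)
    + (\<Sum>k<length ?vs. \<Sum>j<J. rs_mult (\<lambda>\<kappa>. sderiv j (\<lambda>y. psi N g w A x y \<kappa>) (ys ! k)) (G.point_insertion k (int j)) \<kappa>))"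
    by (rule G.ZV_recursion[OF _ dist(1,2) xA]) (rule J)
  have scale: "rs_mult (rs_mult (rs_const c) f) h \<kappa> = c * rs_mult f h \<kappa>" for c f h \<kappa>
    unfolding rs_mult_assoc_left[OF is_monomial_rs_const] by (simp only: rs_mult_const_left)
  have scale': "rs_mult f (\<lambda>\<kappa>. c * h \<kappa>) \<kappa> = c * rs_mult f h \<kappa>" for c f h \<kappa>
    using scale[of c h f \<kappa>] unfolding rs_mult_const_left rs_mult_commute[of f] .
  show ?thesis
  proof
    fix \<kappa>
    have point: "Sum_any (\<lambda>j::nat. rs_mult (Psi_form_deriv N g w A j x dx (ys ! k) (dys ! k))
                    (FV V B g w bas (vs[k := vmode V u (int j) (vs ! k)]) ys dys) \<kappa> * (dys ! k) ^ j)
      = dx ^ N * (\<Sum>j<J. rs_mult (\<lambda>\<kappa>. sderiv j (\<lambda>y. psi N g w A x y \<kappa>) (ys ! k)) (G.point_insertion k (int j)) \<kappa>)"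
      if k: "k < n" for k
    proof -
      have d: "dys ! k \<noteq> 0" using prems(13,14) k nth_mem by metis
      let ?t = "\<lambda>j. dx ^ N * rs_mult (\<lambda>\<kappa>. sderiv j (\<lambda>y. psi N g w A x y \<kappa>) (ys ! k)) (G.point_insertion k (int j)) \<kappa>"
      have t: "rs_mult (Psi_form_deriv N g w A j x dx (ys ! k) (dys ! k))
                    (FV V B g w bas (vs[k := vmode V u (int j) (vs ! k)]) ys dys) \<kappa> * (dys ! k) ^ j = ?t j" for j
      proof -
        have "dys ! k powi (1 - int N) * dys ! k powi (int N - int j - 1) * (dys ! k) ^ j = 1"
        proof -
          have "dys ! k powi (1 - int N) * dys ! k powi (int N - int j - 1) * dys ! k powi (int j)
              = dys ! k powi ((1 - int N) + (int N - int j - 1) + int j)"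
            by (simp only: power_int_add[OF disjI1[OF d]])
          then show ?thesis by simp
        qed
        then show ?thesis
          unfolding pt[OF k] Psi_form_deriv_def scale scale' by (simp add: mult_ac)
      qed
      have "Sum_any ?t = (\<Sum>j<J. ?t j)"
      proof (rule Sum_any.expand_superset)
        show "{j. ?t j \<noteq> 0} \<subseteq> {..<J}"
        proof (rule subsetI, rule ccontr)
          fix j assume j: "j \<in> {j. ?t j \<noteq> 0}" "j \<notin> {..<J}"
          then have "G.point_insertion k (int j) = (\<lambda>_. 0)"
            using k len by (intro G.point_insertion_zero J) auto
          then show False using j by simp
        qed
      qed simp
      then show ?thesis by (simp only: t sum_distrib_left)
    qed
    have theta: "rs_mult (Theta_form N g w A (int a) l x dx) (Res_FV V B g w bas (int a) l u vs ys dys) \<kappa>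
        = dx ^ N * rs_mult (theta N g w A (int a) l x) (G.handle_insertion (int a) (int l)) \<kappa>" if "a \<in> {1..g}" for a l
      unfolding Theta_form_def Res[OF that] by (rule scale)
    have "FV V B g w bas (u # vs) (x # ys) (dx # dys) \<kappa> =
        dx ^ N * ((\<Sum>a = 1..g. \<Sum>l = 0..2 * N - 2. rs_mult (theta N g w A (int a) l x) (G.handle_insertion (int a) (int l)) \<kappa>)
      + (\<Sum>k<length ?vs. \<Sum>j<J. rs_mult (\<lambda>\<kappa>. sderiv j (\<lambda>y. psi N g w A x y \<kappa>) (ys ! k)) (G.point_insertion k (int j)) \<kappa>))"
      unfolding LHS rec ..
    also have "\<dots> = (\<Sum>a = 1..g. \<Sum>l = 0..2 * N - 2.
            rs_mult (Theta_form N g w A (int a) l x dx) (Res_FV V B g w bas (int a) l u vs ys dys) \<kappa>)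
       + (\<Sum>k<n. Sum_any (\<lambda>j::nat.
            rs_mult (Psi_form_deriv N g w A j x dx (ys ! k) (dys ! k))
                    (FV V B g w bas (vs[k := vmode V u (int j) (vs ! k)]) ys dys) \<kappa>
            * (dys ! k) ^ j))"
      unfolding distrib_left sum_distrib_left[of "dx ^ N"] len
      by (intro arg_cong2[where f = "(+)"] sum.cong refl)
        (simp_all only: theta point sum_distrib_left lessThan_iff)
    finally show "FV V B g w bas (u # vs) (x # ys) (dx # dys) \<kappa> = (\<Sum>a = 1..g. \<Sum>l = 0..2 * N - 2.
            rs_mult (Theta_form N g w A (int a) l x dx) (Res_FV V B g w bas (int a) l u vs ys dys) \<kappa>)
       + (\<Sum>k<n. Sum_any (\<lambda>j::nat.
            rs_mult (Psi_form_deriv N g w A j x dx (ys ! k) (dys ! k))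
                    (FV V B g w bas (vs[k := vmode V u (int j) (vs ! k)]) ys dys) \<kappa>
            * (dys ! k) ^ j))" .
  qed
qed


end
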